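(* Let $n\ge1$ and let $\mathcal C$ be an $n$-Frobenius category. The operator $\circ$ is distributive over $+$ on both sides: for $K,L,M,N\in\mathcal C$ with fixed unit conflations $\delta_N\in\operatorname{Ext}^n(N,\Omega^nN)$, $\delta_K\in\operatorname{Ext}^n(K,\Omega^nK)$, and for all $\bar\alpha\in\operatorname{Ext}^n(M,\Omega^nN)/\mathcal P$, $\bar\beta,\bar\beta'\in\operatorname{Ext}^n(N,\Omega^nK)/\mathcal P$ and $\bar\gamma\in\operatorname{Ext}^n(K,\Omega^nL)/\mathcal P$, $$(\bar\beta+\bar\beta')\circ\bar\alpha=\bar\beta\circ\bar\alpha+\bar\beta'\circ\bar\alpha\quad\text{and}\quad\bar\gamma\circ(\bar\beta+\bar\beta')=\bar\gamma\circ\bar\beta+\bar\gamma\circ\bar\beta'.$$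
   Context: Let $\mathcal A$ be an abelian category and $\mathcal C$ a full additive extension-closed subcategory with the inherited exact structure: conflations are short exact sequences of $\mathcal A$ with all terms in $\mathcal C$ (first map an inflation, second a deflation). $\operatorname{Ext}^t(A,B)=\operatorname{Ext}^t_{\mathcal C}(A,B)$ ($t\ge1$) is the abelian group (Baer sum) of equivalence classes of exact sequences $B\to X_{t-1}\to\cdots\to X_0\to A$ spliced from $t$ conflations. $g\gamma$, $\gamma h$ denote push-out along $g$ and pull-back along $h$. $P\in\mathcal C$ is $n$-projective (resp. $n$-injective) if $\operatorname{Ext}^i(P,Y)=0$ (resp. $\operatorname{Ext}^i(Y,P)=0$) for all $i>n$, $Y\in\mathcal C$. $\mathcal C$ is $n$-Frobenius if every object has a deflation from an $n$-projective and an inflation into an $n$-injective, and $n$-projectives and $n$-injectives coincide. $\mathcal P(X,Y)\subseteq\operatorname{Ext}^n(X,Y)$ is the subgroup of elements $\eta h$ with $h:X\to P$, $P$ $n$-projective, $\eta\in\operatorname{Ext}^n(P,Y)$; bars denote classes modulo $\mathcal P$, and $\bar\gamma+\bar\gamma':=\overline{\gamma+\gamma'}$ (Baer sum). A unit conflation of length $n$ is of the form $B\to P_{n-1}\to\cdots\to P_0\to A$ with all $P_i$ $n$-projective; $B$ is then an $n$-th syzygy $\Omega^nA$ of $A$; $\mathcal U^n(B)$ denotes the class of unit conflations of length $n$ beginning with $B$. A right unit factorization of $\gamma\in\operatorname{Ext}^n(M,\Omega^nN)$ is an equality $\gamma=\delta f$ with $\delta\in\mathcal U^n(\Omega^nN)$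 and $f$ a morphism; these always exist. $\Sigma$ is the class of quasi-invertible morphisms: those $f:A\to B$ such that $\operatorname{Ext}^{n+1}(X,A)\to\operatorname{Ext}^{n+1}(X,B)$, $\gamma\mapsto f\gamma$, is an isomorphism for all $X\in\mathcal C$ (equivalently, the analogous condition with pull-backs). For $\delta,\delta'\in\mathcal U^n(B)$, a co-angled pair $[\delta a,\delta'b]$ consists of deflations $a,b\in\Sigma$ from a common object to the right end terms of $\delta,\delta'$ respectively, such that $\delta a=\delta'b$ is again in $\mathcal U^n(B)$; such pairs always exist. For $b:X\to X'$ in $\Sigma$ and $\gamma\in\operatorname{Ext}^n(X,Y)$, $\gamma b^{-1}$ denotes an element $\gamma'\in\operatorname{Ext}^n(X',Y)$ with $\gamma-\gamma'b\in\mathcal P$; it exists and is unique modulo $\mathcal P$. Composition: with a fixed unit conflation $\delta_N\in\operatorname{Ext}^n(N,\Omega^nN)$, for $\beta\in\operatorname{Ext}^n(N,\Omega^nK)$ and $\gamma\in\operatorname{Ext}^n(M,\Omega^nN)$ put $\bar\beta\circ\bar\gamma:=\overline{((\beta a_1)b_1^{-1})f}\in\operatorname{Ext}^n(M,\Omega^nK)/\mathcal P$, where $\gamma=\delta f$ is a right unit factorization and $[\delta_Na_1,\delta b_1]$ is a co-angled pair; this is well-defined. *)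

theory Defs
  imports "HOL-Algebra.Coset"
begin

text \<open>
  A category is given by a set of objects and a set of arrows inside arbitrary types; composition
  is written in the order of function composition. The fields \<^term>\<open>plus_mor\<close> and
  \<^term>\<open>zero_mor\<close> hold the group structure of the Hom-sets.
\<close>

record ('o, 'm) addcat =
  Obj :: "'o set"
  Arr :: "'m set"
  src :: "'m \<Rightarrow> 'o"
  tgt :: "'m \<Rightarrow> 'o"
  idm :: "'o \<Rightarrow> 'm"
  cmp :: "'m \<Rightarrow> 'm \<Rightarrow> 'm" (infixl "\<cdot>\<index>" 70)
  plus_mor :: "'m \<Rightarrow> 'm \<Rightarrow> 'm" (infixl "\<boxplus>\<index>" 65)
  zero_mor :: "'o \<Rightarrow> 'o \<Rightarrow> 'm"

definition Hom :: "('o, 'm) addcat \<Rightarrow> 'o \<Rightarrow> 'o \<Rightarrow> 'm set" where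
  "Hom \<A> X Y = {f \<in> Arr \<A>. src \<A> f = X \<and> tgt \<A> f = Y}"

definition Hom_group :: "('o, 'm) addcat \<Rightarrow> 'o \<Rightarrow> 'o \<Rightarrow> 'm monoid" where
  "Hom_group \<A> X Y = \<lparr>carrier = Hom \<A> X Y, monoid.mult = plus_mor \<A>, one = zero_mor \<A> X Y\<rparr>"

context
  fixes \<A> :: "('o, 'm) addcat" (structure)
begin

definition zero_object :: "'o \<Rightarrow> bool" where
  "zero_object Z \<longleftrightarrow> Z \<in> Obj \<A> \<and>
     (\<forall>X \<in> Obj \<A>. (\<exists>!f. f \<in> Hom \<A> Z X) \<and> (\<exists>!f. f \<in> Hom \<A> X Z))"

definition biproduct :: "'o \<Rightarrow> 'o \<Rightarrow> 'o \<times> 'm \<times> 'm \<times> 'm \<times> 'm \<Rightarrow> bool" where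
  "biproduct X Y = (\<lambda>(S, i1, i2, p1, p2).
     S \<in> Obj \<A> \<and>
     i1 \<in> Hom \<A> X S \<and> i2 \<in> Hom \<A> Y S \<and> p1 \<in> Hom \<A> S X \<and> p2 \<in> Hom \<A> S Y \<and>
     p1 \<cdot> i1 = idm \<A> X \<and> p2 \<cdot> i2 = idm \<A> Y \<and>
     p1 \<cdot> i2 = zero_mor \<A> Y X \<and> p2 \<cdot> i1 = zero_mor \<A> X Y \<and>
     (i1 \<cdot> p1) \<boxplus> (i2 \<cdot> p2) = idm \<A> S)"

definition monic :: "'m \<Rightarrow> bool" where
  "monic f \<longleftrightarrow> f \<in> Arr \<A> \<and>
     (\<forall>u \<in> Arr \<A>. \<forall>v \<in> Arr \<A>. src \<A> u = src \<A> v \<and> tgt \<A> u = src \<A> f \<and> tgt \<A> v = src \<A> f \<and>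
        f \<cdot> u = f \<cdot> v \<longrightarrow> u = v)"

definition epic :: "'m \<Rightarrow> bool" where
  "epic f \<longleftrightarrow> f \<in> Arr \<A> \<and>
     (\<forall>u \<in> Arr \<A>. \<forall>v \<in> Arr \<A>. tgt \<A> u = tgt \<A> v \<and> src \<A> u = tgt \<A> f \<and> src \<A> v = tgt \<A> f \<and>
        u \<cdot> f = v \<cdot> f \<longrightarrow> u = v)"

definition is_kernel :: "'m \<Rightarrow> 'm \<Rightarrow> bool" where
  "is_kernel k f \<longleftrightarrow> k \<in> Arr \<A> \<and> f \<in> Arr \<A> \<and> tgt \<A> k = src \<A> f \<and>
     f \<cdot> k = zero_mor \<A> (src \<A> k) (tgt \<A> f) \<and>
     (\<forall>u \<in> Arr \<A>. tgt \<A> u = src \<A> f \<and> f \<cdot> u = zero_mor \<A> (src \<A> u) (tgt \<A> f) \<longrightarrow>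
        (\<exists>!w. w \<in> Hom \<A> (src \<A> u) (src \<A> k) \<and> k \<cdot> w = u))"

definition is_cokernel :: "'m \<Rightarrow> 'm \<Rightarrow> bool" where
  "is_cokernel c f \<longleftrightarrow> c \<in> Arr \<A> \<and> f \<in> Arr \<A> \<and> src \<A> c = tgt \<A> f \<and>
     c \<cdot> f = zero_mor \<A> (src \<A> f) (tgt \<A> c) \<and>
     (\<forall>u \<in> Arr \<A>. src \<A> u = tgt \<A> f \<and> u \<cdot> f = zero_mor \<A> (src \<A> f) (tgt \<A> u) \<longrightarrow>
        (\<exists>!w. w \<in> Hom \<A> (tgt \<A> c) (tgt \<A> u) \<and> w \<cdot> c = u))"

text \<open>\<open>f'\<close> is the push-out of \<open>f\<close> along \<open>g\<close>, with \<open>x\<close> the other leg of the cocone.\<close>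

definition is_pushout :: "'m \<Rightarrow> 'm \<Rightarrow> 'm \<Rightarrow> 'm \<Rightarrow> bool" where
  "is_pushout f g f' x \<longleftrightarrow>
     f \<in> Arr \<A> \<and> g \<in> Arr \<A> \<and> f' \<in> Arr \<A> \<and> x \<in> Arr \<A> \<and>
     src \<A> f = src \<A> g \<and> src \<A> f' = tgt \<A> g \<and> src \<A> x = tgt \<A> f \<and> tgt \<A> f' = tgt \<A> x \<and>
     f' \<cdot> g = x \<cdot> f \<and>
     (\<forall>u \<in> Arr \<A>. \<forall>v \<in> Arr \<A>.
        src \<A> u = tgt \<A> g \<and> src \<A> v = tgt \<A> f \<and> tgt \<A> u = tgt \<A> v \<and> u \<cdot> g = v \<cdot> f \<longrightarrow>
        (\<exists>!w. w \<in> Hom \<A> (tgt \<A> f') (tgt \<A> u) \<and> w \<cdot> f' = u \<and> w \<cdot> x = v))"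

text \<open>\<open>f'\<close> is the pull-back of \<open>f\<close> along \<open>h\<close>, with \<open>x\<close> the other leg of the cone.\<close>

definition is_pullback :: "'m \<Rightarrow> 'm \<Rightarrow> 'm \<Rightarrow> 'm \<Rightarrow> bool" where
  "is_pullback f h f' x \<longleftrightarrow>
     f \<in> Arr \<A> \<and> h \<in> Arr \<A> \<and> f' \<in> Arr \<A> \<and> x \<in> Arr \<A> \<and>
     tgt \<A> f = tgt \<A> h \<and> tgt \<A> f' = src \<A> h \<and> tgt \<A> x = src \<A> f \<and> src \<A> f' = src \<A> x \<and>
     h \<cdot> f' = f \<cdot> x \<and>
     (\<forall>u \<in> Arr \<A>. \<forall>v \<in> Arr \<A>.
        tgt \<A> u = src \<A> h \<and> tgt \<A> v = src \<A> f \<and> src \<A> u = src \<A> v \<and> h \<cdot> u = f \<cdot> v \<longrightarrow>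
        (\<exists>!w. w \<in> Hom \<A> (src \<A> u) (src \<A> f') \<and> f' \<cdot> w = u \<and> x \<cdot> w = v))"

definition short_exact :: "'m \<Rightarrow> 'm \<Rightarrow> bool" where
  "short_exact i p \<longleftrightarrow> is_kernel i p \<and> is_cokernel p i"

end

locale preadditive_category =
  fixes \<A> :: "('o, 'm) addcat" (structure)
  assumes src_in_Obj: "f \<in> Arr \<A> \<Longrightarrow> src \<A> f \<in> Obj \<A>"
    and tgt_in_Obj: "f \<in> Arr \<A> \<Longrightarrow> tgt \<A> f \<in> Obj \<A>"
    and idm_in_Hom: "X \<in> Obj \<A> \<Longrightarrow> idm \<A> X \<in> Hom \<A> X X"
    and cmp_in_Hom: "f \<in> Hom \<A> X Y \<Longrightarrow> g \<in> Hom \<A> Y Z \<Longrightarrow> g \<cdot> f \<in> Hom \<A> X Z"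
    and cmp_idm: "f \<in> Hom \<A> X Y \<Longrightarrow> f \<cdot> idm \<A> X = f"
    and idm_cmp: "f \<in> Hom \<A> X Y \<Longrightarrow> idm \<A> Y \<cdot> f = f"
    and cmp_assoc: "f \<in> Hom \<A> W X \<Longrightarrow> g \<in> Hom \<A> X Y \<Longrightarrow> h \<in> Hom \<A> Y Z \<Longrightarrow>
           (h \<cdot> g) \<cdot> f = h \<cdot> (g \<cdot> f)"
    and Hom_comm_group: "X \<in> Obj \<A> \<Longrightarrow> Y \<in> Obj \<A> \<Longrightarrow> comm_group (Hom_group \<A> X Y)"
    and cmp_plus: "f \<in> Hom \<A> X Y \<Longrightarrow> g \<in> Hom \<A> Y Z \<Longrightarrow> g' \<in> Hom \<A> Y Z \<Longrightarrow>
           (g \<boxplus> g') \<cdot> f = (g \<cdot> f) \<boxplus> (g' \<cdot> f)"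
    and plus_cmp: "f \<in> Hom \<A> X Y \<Longrightarrow> f' \<in> Hom \<A> X Y \<Longrightarrow> g \<in> Hom \<A> Y Z \<Longrightarrow>
           g \<cdot> (f \<boxplus> f') = (g \<cdot> f) \<boxplus> (g \<cdot> f')"

locale abelian_category = preadditive_category +
  assumes ex_zero_object: "\<exists>Z. zero_object \<A> Z"
    and ex_biproduct: "X \<in> Obj \<A> \<Longrightarrow> Y \<in> Obj \<A> \<Longrightarrow> \<exists>b. biproduct \<A> X Y b"
    and ex_kernel: "f \<in> Arr \<A> \<Longrightarrow> \<exists>k. is_kernel \<A> k f"
    and ex_cokernel: "f \<in> Arr \<A> \<Longrightarrow> \<exists>c. is_cokernel \<A> c f"
    and monic_normal: "monic \<A> f \<Longrightarrow> \<exists>g. is_kernel \<A> f g"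
    and epic_normal: "epic \<A> f \<Longrightarrow> \<exists>g. is_cokernel \<A> f g"

text \<open>A full subcategory is given by its set of objects.\<close>

locale extension_closed_subcategory = abelian_category \<A>
  for \<A> :: "('o, 'm) addcat" (structure) +
  fixes \<C> :: "'o set"
  assumes sub_Obj: "\<C> \<subseteq> Obj \<A>"
    and sub_zero: "\<exists>Z \<in> \<C>. zero_object \<A> Z"
    and sub_biproduct: "X \<in> \<C> \<Longrightarrow> Y \<in> \<C> \<Longrightarrow> \<exists>S \<in> \<C>. \<exists>ms. biproduct \<A> X Y (S, ms)"
    and extension_closed: "short_exact \<A> i p \<Longrightarrow> src \<A> i \<in> \<C> \<Longrightarrow> tgt \<A> p \<in> \<C> \<Longrightarrow> tgt \<A> i \<in> \<C>"

context
  fixes \<A> :: "('o, 'm) addcat" (structure)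
begin

text \<open>A fixed choice of biproducts; the Baer sum does not depend on it.\<close>

definition biprod :: "'o \<Rightarrow> 'o \<Rightarrow> 'o \<times> 'm \<times> 'm \<times> 'm \<times> 'm" where
  "biprod X Y = (SOME b. biproduct \<A> X Y b)"

definition dsum :: "'m \<Rightarrow> 'm \<Rightarrow> 'm" where
  "dsum f g = (case biprod (src \<A> f) (src \<A> g) of (_, _, _, p1, p2) \<Rightarrow>
               case biprod (tgt \<A> f) (tgt \<A> g) of (_, i1, i2, _, _) \<Rightarrow>
                 ((i1 \<cdot> f) \<cdot> p1) \<boxplus> ((i2 \<cdot> g) \<cdot> p2))"

definition diag :: "'o \<Rightarrow> 'm" where
  "diag X = (case biprod X X of (_, i1, i2, _, _) \<Rightarrow> i1 \<boxplus> i2)"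

definition codiag :: "'o \<Rightarrow> 'm" where
  "codiag X = (case biprod X X of (_, _, _, p1, p2) \<Rightarrow> p1 \<boxplus> p2)"

text \<open>
  A sequence \<open>B \<rightarrow> X\<^bsub>t-1\<^esub> \<rightarrow> \<dots> \<rightarrow> X\<^bsub>0\<^esub> \<rightarrow> A\<close> is the list of its \<open>t + 1\<close> arrows, from left to
  right. Push-out along \<open>g\<close> changes only the two arrows at the left end, pull-back along \<open>h\<close> only
  the two at the right end: the new outer arrow is the push-out (pull-back) of the old one, and
  the new inner arrow is the one induced by the old inner arrow and zero.
\<close>

definition seq_pushout :: "'m \<Rightarrow> 'm list \<Rightarrow> 'm list \<Rightarrow> bool" where
  "seq_pushout g E E' \<longleftrightarrow> (\<exists>d e ds d' e' x. E = d # e # ds \<and> E' = d' # e' # ds \<and>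
     is_pushout \<A> d g d' x \<and> e' \<in> Hom \<A> (tgt \<A> d') (tgt \<A> e) \<and>
     e' \<cdot> x = e \<and> e' \<cdot> d' = zero_mor \<A> (tgt \<A> g) (tgt \<A> e))"

definition seq_pullback :: "'m \<Rightarrow> 'm list \<Rightarrow> 'm list \<Rightarrow> bool" where
  "seq_pullback h E E' \<longleftrightarrow> (\<exists>ds e d e' d' x. E = ds @ [e, d] \<and> E' = ds @ [e', d'] \<and>
     is_pullback \<A> d h d' x \<and> e' \<in> Hom \<A> (src \<A> e) (src \<A> d') \<and>
     x \<cdot> e' = e \<and> d' \<cdot> e' = zero_mor \<A> (src \<A> e) (src \<A> h))"

text \<open>Existence of a morphism of sequences (with vertical arrows \<open>vs\<close>) that is the identity on
  the common end terms \<open>B\<close> (left) and \<open>A\<close> (right).\<close>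

definition seq_map :: "'o \<Rightarrow> 'o \<Rightarrow> 'm list \<Rightarrow> 'm list \<Rightarrow> bool" where
  "seq_map A B E E' \<longleftrightarrow> length E' = length E \<and>
     (\<exists>vs. length vs = Suc (length E) \<and> hd vs = idm \<A> B \<and> last vs = idm \<A> A \<and>
        (\<forall>k < length E. vs ! k \<in> Hom \<A> (src \<A> (E ! k)) (src \<A> (E' ! k)) \<and>
           (E' ! k) \<cdot> (vs ! k) = (vs ! Suc k) \<cdot> (E ! k)))"

end

context
  fixes \<A> :: "('o, 'm) addcat" (structure) and \<C> :: "'o set"
begin

definition conflation :: "'m \<Rightarrow> 'm \<Rightarrow> bool" where
  "conflation i p \<longleftrightarrow> short_exact \<A> i p \<and> src \<A> i \<in> \<C> \<and> tgt \<A> i \<in> \<C> \<and> tgt \<A> p \<in> \<C>"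

definition inflation :: "'m \<Rightarrow> bool" where
  "inflation i \<longleftrightarrow> (\<exists>p. conflation i p)"

definition deflation :: "'m \<Rightarrow> bool" where
  "deflation p \<longleftrightarrow> (\<exists>i. conflation i p)"

text \<open>\<open>ext_seq t A B E\<close>: \<open>E\<close> is an exact sequence from \<open>B\<close> to \<open>A\<close> spliced from \<open>t\<close> conflations.\<close>

inductive ext_seq :: "nat \<Rightarrow> 'o \<Rightarrow> 'o \<Rightarrow> 'm list \<Rightarrow> bool" where
  single: "conflation i p \<Longrightarrow> ext_seq 1 (tgt \<A> p) (src \<A> i) [i, p]"
| splice: "conflation i p \<Longrightarrow> ext_seq t A (tgt \<A> p) (d # ds) \<Longrightarrow>
             ext_seq (Suc t) A (src \<A> i) (i # (d \<cdot> p) # ds)"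

definition ext_step :: "('m list \<times> 'm list) set" where
  "ext_step = {(E, E'). \<exists>t A B. ext_seq t A B E \<and> ext_seq t A B E' \<and> seq_map \<A> A B E E'}"

text \<open>The equivalence relation generated by the morphisms of sequences with fixed ends.\<close>

definition ext_equiv :: "('m list \<times> 'm list) set" where
  "ext_equiv = (ext_step \<union> ext_step\<inverse>)\<^sup>*"

definition ext_class :: "'m list \<Rightarrow> 'm list set" where
  "ext_class E = ext_equiv `` {E}"

text \<open>
  Operations on equivalence classes: as usual for quotients, the result is the union of the classes
  obtained from all representatives (and all choices of push-outs, pull-backs), these being equal.
\<close>

definition push :: "'m \<Rightarrow> 'm list set \<Rightarrow> 'm list set" where
  "push g \<gamma> = \<Union> {ext_class E' | E E'. E \<in> \<gamma> \<and> seq_pushout \<A> g E E'}"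

definition pull :: "'m list set \<Rightarrow> 'm \<Rightarrow> 'm list set" where
  "pull \<gamma> h = \<Union> {ext_class E' | E E'. E \<in> \<gamma> \<and> seq_pullback \<A> h E E'}"

definition ext_dsum :: "'m list set \<Rightarrow> 'm list set \<Rightarrow> 'm list set" where
  "ext_dsum \<gamma> \<gamma>' = \<Union> {ext_class (map2 (dsum \<A>) E E') | E E'. E \<in> \<gamma> \<and> E' \<in> \<gamma>'}"

definition baer_sum :: "'o \<Rightarrow> 'o \<Rightarrow> 'm list set \<Rightarrow> 'm list set \<Rightarrow> 'm list set" where
  "baer_sum A B \<gamma> \<gamma>' = push (codiag \<A> B) (pull (ext_dsum \<gamma> \<gamma>') (diag \<A> A))"

definition ext_carrier :: "nat \<Rightarrow> 'o \<Rightarrow> 'o \<Rightarrow> 'm list set set" where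
  "ext_carrier t A B = {E. ext_seq t A B E} // ext_equiv"

text \<open>The group \<open>Ext\<^sup>t(A,B)\<close> under the Baer sum (written multiplicatively, as all groups of the
  library), for \<open>t \<ge> 1\<close>.\<close>

definition Ext :: "nat \<Rightarrow> 'o \<Rightarrow> 'o \<Rightarrow> 'm list set monoid" where
  "Ext t A B = \<lparr>carrier = ext_carrier t A B, monoid.mult = baer_sum A B,
     one = (THE z. z \<in> ext_carrier t A B \<and> (\<forall>\<gamma> \<in> ext_carrier t A B. baer_sum A B z \<gamma> = \<gamma>))\<rparr>"

context
  fixes n :: nat
begin

definition n_projective :: "'o \<Rightarrow> bool" where
  "n_projective P \<longleftrightarrow> P \<in> \<C> \<and> (\<forall>i > n. \<forall>Y \<in> \<C>. carrier (Ext i P Y) = {\<one>\<^bsub>Ext i P Y\<^esub>})"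

definition n_injective :: "'o \<Rightarrow> bool" where
  "n_injective P \<longleftrightarrow> P \<in> \<C> \<and> (\<forall>i > n. \<forall>Y \<in> \<C>. carrier (Ext i Y P) = {\<one>\<^bsub>Ext i Y P\<^esub>})"

definition n_Frobenius :: bool where
  "n_Frobenius \<longleftrightarrow>
     (\<forall>X \<in> \<C>. \<exists>p. deflation p \<and> n_projective (src \<A> p) \<and> tgt \<A> p = X) \<and>
     (\<forall>X \<in> \<C>. \<exists>i. inflation i \<and> src \<A> i = X \<and> n_injective (tgt \<A> i)) \<and>
     (\<forall>P \<in> \<C>. n_projective P \<longleftrightarrow> n_injective P)"

text \<open>The subgroup \<open>\<P>(X,Y)\<close> of \<open>Ext\<^sup>n(X,Y)\<close>, and the quotient \<open>Ext\<^sup>n(X,Y)/\<P>\<close>.\<close>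

definition proj_ext :: "'o \<Rightarrow> 'o \<Rightarrow> 'm list set set" where
  "proj_ext X Y =
     {pull \<eta> h | \<eta> h P. n_projective P \<and> h \<in> Hom \<A> X P \<and> \<eta> \<in> carrier (Ext n P Y)}"

definition stable_Ext :: "'o \<Rightarrow> 'o \<Rightarrow> 'm list set set monoid" where
  "stable_Ext X Y = Ext n X Y Mod proj_ext X Y"

definition unit_conflation :: "'o \<Rightarrow> 'o \<Rightarrow> 'm list \<Rightarrow> bool" where
  "unit_conflation A B E \<longleftrightarrow> ext_seq n A B E \<and> (\<forall>d \<in> set (butlast E). n_projective (tgt \<A> d))"

text \<open>\<open>B\<close> is an \<open>n\<close>-th syzygy of \<open>A\<close>.\<close>

definition syzygy :: "'o \<Rightarrow> 'o \<Rightarrow> bool" where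
  "syzygy A B \<longleftrightarrow> (\<exists>E. unit_conflation A B E)"

text \<open>The members of \<open>\<U>\<^sup>n(B)\<close> with right end term \<open>A\<close>, as elements of \<open>Ext\<^sup>n(A,B)\<close>.\<close>

definition unit_ext :: "'o \<Rightarrow> 'o \<Rightarrow> 'm list set set" where
  "unit_ext A B = {\<delta> \<in> carrier (Ext n A B). \<exists>E \<in> \<delta>. unit_conflation A B E}"

definition quasi_invertible :: "'m \<Rightarrow> bool" where
  "quasi_invertible f \<longleftrightarrow> f \<in> Arr \<A> \<and> src \<A> f \<in> \<C> \<and> tgt \<A> f \<in> \<C> \<and>
     (\<forall>X \<in> \<C>. push f \<in> iso (Ext (n + 1) X (src \<A> f)) (Ext (n + 1) X (tgt \<A> f)))"

text \<open>\<open>[\<delta>a, \<delta>'b]\<close> is a co-angled pair, where \<open>\<delta>\<close>, \<open>\<delta>'\<close> have right end terms \<open>A\<close>, \<open>A'\<close>.\<close>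

definition co_angled_pair ::
    "'o \<Rightarrow> 'o \<Rightarrow> 'o \<Rightarrow> 'm list set \<Rightarrow> 'm \<Rightarrow> 'm list set \<Rightarrow> 'm \<Rightarrow> bool" where
  "co_angled_pair A A' B \<delta> a \<delta>' b \<longleftrightarrow>
     \<delta> \<in> unit_ext A B \<and> \<delta>' \<in> unit_ext A' B \<and>
     src \<A> a = src \<A> b \<and> tgt \<A> a = A \<and> tgt \<A> b = A' \<and>
     deflation a \<and> quasi_invertible a \<and> deflation b \<and> quasi_invertible b \<and>
     pull \<delta> a = pull \<delta>' b \<and> pull \<delta> a \<in> unit_ext (src \<A> a) B"

text \<open>\<open>\<gamma>'\<close> is a possible value of \<open>\<gamma>b\<inverse>\<close>, for \<open>\<gamma> \<in> Ext\<^sup>n(X,Y)\<close> and a quasi-invertible \<open>b : X \<rightarrow> X'\<close>.\<close>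

definition pull_inv :: "'o \<Rightarrow> 'm list set \<Rightarrow> 'm \<Rightarrow> 'm list set \<Rightarrow> bool" where
  "pull_inv Y \<gamma> b \<gamma>' \<longleftrightarrow> \<gamma>' \<in> carrier (Ext n (tgt \<A> b) Y) \<and>
     (let G = Ext n (src \<A> b) Y in \<gamma> \<otimes>\<^bsub>G\<^esub> inv\<^bsub>G\<^esub> (pull \<gamma>' b) \<in> proj_ext (src \<A> b) Y)"

text \<open>
  The composition of \<open>y \<in> Ext\<^sup>n(N,K')/\<P>\<close> and \<open>x \<in> Ext\<^sup>n(M,N')/\<P>\<close>, where \<open>N' = \<Omega>\<^sup>nN\<close>,
  \<open>K' = \<Omega>\<^sup>nK\<close>, relative to \<open>\<delta>\<^sub>N \<in> Ext\<^sup>n(N,N')\<close>. As above, the union runs over all representatives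
  \<open>\<beta>\<close>, \<open>\<gamma>\<close> and all auxiliary choices: a right unit factorization \<open>\<gamma> = \<delta>f\<close>, a co-angled pair
  \<open>[\<delta>\<^sub>Na, \<delta>b]\<close> and a value \<open>\<epsilon>\<close> of \<open>(\<beta>a)b\<inverse>\<close>.
\<close>

definition stable_comp ::
    "'o \<Rightarrow> 'o \<Rightarrow> 'o \<Rightarrow> 'o \<Rightarrow> 'm list set \<Rightarrow> 'm list set set \<Rightarrow> 'm list set set \<Rightarrow> 'm list set set" where
  "stable_comp M N N' K' \<delta>\<^sub>N y x =
     \<Union> {proj_ext M K' #>\<^bsub>Ext n M K'\<^esub> pull \<epsilon> f | \<beta> \<gamma> Z \<delta> f a b \<epsilon>.
           \<beta> \<in> y \<and> \<gamma> \<in> x \<and>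
           \<delta> \<in> unit_ext Z N' \<and> f \<in> Hom \<A> M Z \<and> \<gamma> = pull \<delta> f \<and>
           co_angled_pair N Z N' \<delta>\<^sub>N a \<delta> b \<and>
           pull_inv K' (pull \<beta> a) b \<epsilon>}"

end

end

end

theory Submission
  imports Defs
begin

text \<open>
  Let \<open>\<kappa>\<close> be a unit of length \<open>n + 1\<close> with right end term \<open>\<Omega>\<^sup>nK\<close>. Dimension shifting along units shows
  that \<open>\<P>\<close> is the kernel of the Yoneda product with \<open>\<kappa>\<close>, and that \<open>\<kappa>\<beta> = \<beta>\<^sup>*\<delta>\<^sub>N\<close> for a unique \<open>\<beta>\<^sup>*\<close>. If
  \<open>\<gamma> = \<delta>f\<close>, \<open>\<delta>\<^sub>Na = \<delta>b\<close> and \<open>\<epsilon>b - \<beta>a \<in> \<P>\<close>, write \<open>\<kappa>\<epsilon> = \<xi>\<delta>\<close>; then \<open>\<xi>\<delta>b = \<beta>\<^sup>*\<delta>b\<close>, and since \<open>\<delta>b\<close> is a unit,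
  \<open>\<xi> = \<beta>\<^sup>*\<close>. Hence \<open>\<kappa>(\<beta> \<circ> \<gamma>) = \<beta>\<^sup>*\<gamma>\<close> whatever the choices, and distributivity is the bilinearity of the
  Yoneda product.

  The long exact sequences behind the shifts follow from the fact that two Yoneda products \<open>\<epsilon>\<^sub>1\<rho>\<^sub>1 = \<epsilon>\<^sub>2\<rho>\<^sub>2\<close> with \<open>\<epsilon>\<^sub>i\<close> of length \<open>1\<close> are
  always linked by a single roof \<open>\<rho>\<^sub>i = c\<^sub>i\<rho>\<close>, \<open>\<epsilon>\<^sub>1c\<^sub>1 = \<epsilon>\<^sub>2c\<^sub>2\<close>, which is proved by induction on the length
  together with a Mayer--Vietoris property of pull-backs.
\<close>

section \<open>Preadditive categories and their opposites\<close>

text \<open>The length n + 1 of kappa balances two needs. Multiplication by a unit is onto from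
  degree n upwards, but injective only above n. With this length, kappa beta lies in degree 2n + 1 =
  (n + 1) + n. Dividing by kappa on the left lands in degree n, where quotients exist but are
  determined only modulo P; dividing by a unit of length n on the right lands in degree n + 1, where
  the quotient is unique. So the indeterminacy sits in the coset alone.

  Ext-classes are generated by morphisms of sequences in both directions, and no projective
  resolutions are at hand, so exactness has to be extracted from zigzags. A step against the
  direction of a roof creates a cospan, and turning cospans into spans is what requires
  Mayer-Vietoris.

  \<open>stable_comp\<close> is a union over choices and would be empty if there were none; hence
  the existence of right unit factorizations, co-angled pairs and values of the inverse is part of
  the argument. Most statements on right ends are those on left ends, read backwards in
  \<open>opcat\<close>.\<close>

lemma Hom_iff: "f \<in> Hom \<A> X Y \<longleftrightarrow> f \<in> Arr \<A> \<and> src \<A> f = X \<and> tgt \<A> f = Y"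
  by (auto simp: Hom_def)

text \<open>An involution that keeps the types and the sets of objects and arrows, so that a locale
  theorem about \<open>opcat \<A>\<close> rewrites to its dual about \<open>\<A>\<close>. Since
  \<open>zero_mor\<close> takes source and target as arguments, these are exchanged too.\<close>

definition opcat :: "('o, 'm) addcat \<Rightarrow> ('o, 'm) addcat" where
  "opcat \<A> = \<lparr>Obj = Obj \<A>, Arr = Arr \<A>, src = tgt \<A>, tgt = src \<A>, idm = idm \<A>,
     cmp = (\<lambda>g f. cmp \<A> f g), plus_mor = plus_mor \<A>, zero_mor = (\<lambda>X Y. zero_mor \<A> Y X)\<rparr>"

lemma opcat_simps [simp]:
  "Obj (opcat \<A>) = Obj \<A>" "Arr (opcat \<A>) = Arr \<A>" "src (opcat \<A>) = tgt \<A>"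
  "tgt (opcat \<A>) = src \<A>" "idm (opcat \<A>) = idm \<A>" "cmp (opcat \<A>) g f = cmp \<A> f g"
  "plus_mor (opcat \<A>) = plus_mor \<A>" "zero_mor (opcat \<A>) X Y = zero_mor \<A> Y X"
  "opcat (opcat \<A>) = \<A>"
  by (simp_all add: opcat_def)

lemma Hom_opcat [simp]: "Hom (opcat \<A>) X Y = Hom \<A> Y X"
  by (auto simp: Hom_def)

context preadditive_category
begin

abbreviation dom where "dom \<equiv> src \<A>"
abbreviation cod where "cod \<equiv> tgt \<A>"
abbreviation ide where "ide \<equiv> idm \<A>"
abbreviation zm where "zm \<equiv> zero_mor \<A>"

declare src_in_Obj [simp] tgt_in_Obj [simp]

lemma idm_simps [simp]:
  assumes "X \<in> Obj \<A>"
  shows "ide X \<in> Arr \<A>" "dom (ide X) = X" "cod (ide X) = X"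
  using idm_in_Hom[OF assms] by (auto simp: Hom_iff)

lemma cmp_simps [simp]:
  assumes "f \<in> Arr \<A>" "g \<in> Arr \<A>" "cod f = dom g"
  shows "g \<cdot> f \<in> Arr \<A>" "dom (g \<cdot> f) = dom f" "cod (g \<cdot> f) = cod g"
  using cmp_in_Hom[of f "dom f" "dom g" g "cod g"] assms by (auto simp: Hom_iff)

lemma cmp_idm' [simp]: "f \<in> Arr \<A> \<Longrightarrow> dom f = X \<Longrightarrow> f \<cdot> ide X = f"
  using cmp_idm by (auto simp: Hom_iff)

lemma idm_cmp' [simp]: "f \<in> Arr \<A> \<Longrightarrow> cod f = Y \<Longrightarrow> ide Y \<cdot> f = f"
  using idm_cmp by (auto simp: Hom_iff)

lemma assoc [simp]:
  assumes "f \<in> Arr \<A>" "g \<in> Arr \<A>" "h \<in> Arr \<A>" "cod f = dom g" "cod g = dom h"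
  shows "(h \<cdot> g) \<cdot> f = h \<cdot> (g \<cdot> f)"
  using cmp_assoc[of f "dom f" "dom g" g "dom h" h "cod h"] assms by (auto simp: Hom_iff)

text \<open>Products are normalised to right-nested form by \<open>assoc\<close>, where a known
  equation for g f is hidden inside g (f u). Throughout, such an equation is supplied in this form
  for the particular u.\<close>

lemma reassoc:
  assumes "g \<cdot> f = k" "f \<in> Arr \<A>" "g \<in> Arr \<A>" "cod f = dom g"
    "u \<in> Arr \<A>" "cod u = dom f"
  shows "g \<cdot> (f \<cdot> u) = k \<cdot> u"
  using assms(1) assoc[OF assms(5,2,3,6,4)] by simp

lemma Hom_group_simps [simp]:
  "carrier (Hom_group \<A> X Y) = Hom \<A> X Y" "f \<otimes>\<^bsub>Hom_group \<A> X Y\<^esub> g = f \<boxplus> g"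
  "\<one>\<^bsub>Hom_group \<A> X Y\<^esub> = zm X Y"
  by (auto simp: Hom_group_def)

lemma zero_simps [simp]:
  assumes "X \<in> Obj \<A>" "Y \<in> Obj \<A>"
  shows "zm X Y \<in> Arr \<A>" "dom (zm X Y) = X" "cod (zm X Y) = Y"
proof -
  interpret comm_group "Hom_group \<A> X Y" by (rule Hom_comm_group[OF assms])
  show "zm X Y \<in> Arr \<A>" "dom (zm X Y) = X" "cod (zm X Y) = Y"
    using one_closed by (simp_all add: Hom_iff)
qed

definition neg :: "'m \<Rightarrow> 'm" where
  "neg f = inv\<^bsub>Hom_group \<A> (dom f) (cod f)\<^esub> f"

lemma plus_simps [simp]:
  assumes "f \<in> Arr \<A>" "g \<in> Arr \<A>" "dom f = dom g" "cod f = cod g"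
  shows "f \<boxplus> g \<in> Arr \<A>" "dom (f \<boxplus> g) = dom g" "cod (f \<boxplus> g) = cod g"
proof -
  interpret comm_group "Hom_group \<A> (dom g) (cod g)" using assms by (simp add: Hom_comm_group)
  show "f \<boxplus> g \<in> Arr \<A>" "dom (f \<boxplus> g) = dom g" "cod (f \<boxplus> g) = cod g"
    using m_closed[of f g] assms by (simp_all add: Hom_iff)
qed

lemma plus_zero [simp]:
  assumes "f \<in> Arr \<A>" "dom f = X" "cod f = Y"
  shows "f \<boxplus> zm X Y = f" "zm X Y \<boxplus> f = f"
proof -
  interpret comm_group "Hom_group \<A> (dom f) (cod f)" using assms by (intro Hom_comm_group) auto
  show "f \<boxplus> zm X Y = f" "zm X Y \<boxplus> f = f"
    using r_one[of f] l_one[of f] assms by (simp_all add: Hom_iff)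
qed

lemma plus_comm:
  assumes "f \<in> Arr \<A>" "g \<in> Arr \<A>" "dom f = dom g" "cod f = cod g"
  shows "f \<boxplus> g = g \<boxplus> f"
proof -
  interpret comm_group "Hom_group \<A> (dom g) (cod g)" using assms by (simp add: Hom_comm_group)
  show ?thesis using m_comm[of f g] assms by (simp_all add: Hom_iff)
qed

lemma plus_assoc:
  assumes "f \<in> Arr \<A>" "g \<in> Arr \<A>" "h \<in> Arr \<A>" "dom f = dom g" "cod f = cod g"
    "dom g = dom h" "cod g = cod h"
  shows "(f \<boxplus> g) \<boxplus> h = f \<boxplus> (g \<boxplus> h)"
proof -
  interpret comm_group "Hom_group \<A> (dom g) (cod g)" using assms by (simp add: Hom_comm_group)
  show ?thesis using m_assoc[of f g h] assms by (simp_all add: Hom_iff)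
qed

lemma plus_cancel:
  assumes "f \<boxplus> g = f \<boxplus> h"
    "f \<in> Arr \<A>" "g \<in> Arr \<A>" "h \<in> Arr \<A>" "dom f = dom g" "cod f = cod g"
    "dom g = dom h" "cod g = cod h"
  shows "g = h"
proof -
  interpret comm_group "Hom_group \<A> (dom g) (cod g)" using assms by (simp add: Hom_comm_group)
  show ?thesis using Units_l_cancel[of f g h] assms unfolding Units_eq by (simp add: Hom_iff)
qed

lemma neg_simps [simp]:
  assumes "f \<in> Arr \<A>"
  shows "neg f \<in> Arr \<A>" "dom (neg f) = dom f" "cod (neg f) = cod f"
    "f \<boxplus> neg f = zm (dom f) (cod f)" "neg f \<boxplus> f = zm (dom f) (cod f)"
proof -
  interpret comm_group "Hom_group \<A> (dom f) (cod f)" using assms by (simp add: Hom_comm_group)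
  have f: "f \<in> carrier (Hom_group \<A> (dom f) (cod f))" using assms by (simp add: Hom_iff)
  show "neg f \<in> Arr \<A>" "dom (neg f) = dom f" "cod (neg f) = cod f"
    "f \<boxplus> neg f = zm (dom f) (cod f)" "neg f \<boxplus> f = zm (dom f) (cod f)"
    using inv_closed[OF f] r_inv[OF f] l_inv[OF f] unfolding neg_def by (simp_all add: Hom_iff)
qed

lemma neg_unique:
  assumes "f \<boxplus> g = zm (dom f) (cod f)"
    "f \<in> Arr \<A>" "g \<in> Arr \<A>" "dom f = dom g" "cod f = cod g"
  shows "g = neg f"
  by (rule plus_cancel[of f]) (use assms in auto)

lemma neg_neg [simp]: "f \<in> Arr \<A> \<Longrightarrow> neg (neg f) = f"
  by (rule neg_unique[symmetric]) auto

lemma plus_neg_eq_zero: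
  assumes "f \<boxplus> neg g = zm (dom f) (cod f)"
    "f \<in> Arr \<A>" "g \<in> Arr \<A>" "dom f = dom g" "cod f = cod g"
  shows "f = g"
  using neg_unique[OF assms(1)] assms(2-) by (metis neg_neg neg_simps(1,2,3))

lemma dist_r [simp]:
  assumes "f \<in> Arr \<A>" "g \<in> Arr \<A>" "g' \<in> Arr \<A>" "cod f = dom g" "dom g' = dom g" "cod g' = cod g"
  shows "(g \<boxplus> g') \<cdot> f = (g \<cdot> f) \<boxplus> (g' \<cdot> f)"
  using cmp_plus[of f "dom f" "dom g" g "cod g" g'] assms by (auto simp: Hom_iff)

lemma dist_l [simp]:
  assumes "f \<in> Arr \<A>" "f' \<in> Arr \<A>" "g \<in> Arr \<A>" "cod f = dom g" "dom f' = dom f" "cod f' = cod f"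
  shows "g \<cdot> (f \<boxplus> f') = (g \<cdot> f) \<boxplus> (g \<cdot> f')"
  using plus_cmp[of f "dom f" "dom g" f' g "cod g"] assms by (auto simp: Hom_iff)

lemma zero_cmp [simp]:
  assumes "f \<in> Arr \<A>" "cod f = X" "Y \<in> Obj \<A>"
  shows "zm X Y \<cdot> f = zm (dom f) Y"
proof -
  have X: "X \<in> Obj \<A>" using assms by auto
  have "(zm X Y \<boxplus> zm X Y) \<cdot> f = zm X Y \<cdot> f" using assms X by (subst plus_zero) auto
  hence "(zm X Y \<cdot> f) \<boxplus> (zm X Y \<cdot> f) = (zm X Y \<cdot> f) \<boxplus> zm (dom f) Y"
    using assms X by (subst (asm) dist_r) auto
  thus ?thesis by (rule plus_cancel) (use assms X in auto)
qed

lemma cmp_zero [simp]: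
  assumes "f \<in> Arr \<A>" "dom f = Y" "X \<in> Obj \<A>"
  shows "f \<cdot> zm X Y = zm X (cod f)"
proof -
  have Y: "Y \<in> Obj \<A>" using assms by auto
  have "f \<cdot> (zm X Y \<boxplus> zm X Y) = f \<cdot> zm X Y" using assms Y by (subst plus_zero) auto
  hence "(f \<cdot> zm X Y) \<boxplus> (f \<cdot> zm X Y) = (f \<cdot> zm X Y) \<boxplus> zm X (cod f)"
    using assms Y by (subst (asm) dist_l) auto
  thus ?thesis by (rule plus_cancel) (use assms Y in auto)
qed

lemma neg_cmp [simp]:
  assumes "f \<in> Arr \<A>" "g \<in> Arr \<A>" "cod f = dom g"
  shows "neg g \<cdot> f = neg (g \<cdot> f)"
  by (rule neg_unique) (use assms dist_r[of f g "neg g"] in auto)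

lemma cmp_neg [simp]:
  assumes "f \<in> Arr \<A>" "g \<in> Arr \<A>" "cod f = dom g"
  shows "g \<cdot> neg f = neg (g \<cdot> f)"
  by (rule neg_unique) (use assms dist_l[of f "neg f" g] in auto)

lemma neg_zero [simp]: "X \<in> Obj \<A> \<Longrightarrow> Y \<in> Obj \<A> \<Longrightarrow> neg (zm X Y) = zm X Y"
  by (rule neg_unique[symmetric]) auto

lemma opcat_preadditive: "preadditive_category (opcat \<A>)"
proof (rule preadditive_category.intro)
  fix X Y assume "X \<in> Obj (opcat \<A>)" "Y \<in> Obj (opcat \<A>)"
  thus "comm_group (Hom_group (opcat \<A>) X Y)"
    using Hom_comm_group[of Y X] by (simp add: Hom_group_def)
qed (auto simp: Hom_iff)

end

lemma zero_object_opcat [simp]: "zero_object (opcat \<A>) Z = zero_object \<A> Z"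
  by (auto simp: zero_object_def)

lemma biproduct_opcat:
  "biproduct (opcat \<A>) X Y (S, i1, i2, p1, p2) = biproduct \<A> X Y (S, p1, p2, i1, i2)"
  by (auto simp: biproduct_def)

lemma monic_opcat [simp]: "monic (opcat \<A>) f = epic \<A> f"
  and epic_opcat [simp]: "epic (opcat \<A>) f = monic \<A> f"
  by (auto simp: monic_def epic_def)

lemma is_kernel_opcat [simp]: "is_kernel (opcat \<A>) k f = is_cokernel \<A> k f"
  and is_cokernel_opcat [simp]: "is_cokernel (opcat \<A>) k f = is_kernel \<A> k f"
  by (auto simp: is_kernel_def is_cokernel_def)

lemma short_exact_opcat [simp]: "short_exact (opcat \<A>) i p = short_exact \<A> p i"
  by (auto simp: short_exact_def)

lemma is_pushout_opcat [simp]: "is_pushout (opcat \<A>) f g f' x = is_pullback \<A> f g f' x"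
  and is_pullback_opcat [simp]: "is_pullback (opcat \<A>) f g f' x = is_pushout \<A> f g f' x"
  by (auto simp: is_pushout_def is_pullback_def)

lemma (in abelian_category) opcat_abelian: "abelian_category (opcat \<A>)"
proof -
  interpret op: preadditive_category "opcat \<A>" by (rule opcat_preadditive)
  show ?thesis
  proof
    fix X Y assume "X \<in> Obj (opcat \<A>)" "Y \<in> Obj (opcat \<A>)"
    then obtain b where b: "biproduct \<A> X Y b" using ex_biproduct unfolding opcat_simps by blast
    obtain S i1 i2 p1 p2 where [simp]: "b = (S, i1, i2, p1, p2)" by (cases b) auto
    have "biproduct (opcat \<A>) X Y (S, p1, p2, i1, i2)" using b by (simp add: biproduct_opcat)
    thus "\<exists>b. biproduct (opcat \<A>) X Y b" by blast
  qed (use ex_zero_object ex_kernel ex_cokernel monic_normal epic_normal in auto)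
qed

lemma (in extension_closed_subcategory) opcat_ecs: "extension_closed_subcategory (opcat \<A>) \<C>"
proof -
  interpret op: abelian_category "opcat \<A>" by (rule opcat_abelian)
  show ?thesis
  proof
    fix X Y assume "X \<in> \<C>" "Y \<in> \<C>"
    then obtain S ms where S: "S \<in> \<C>" and b: "biproduct \<A> X Y (S, ms)" using sub_biproduct by blast
    obtain i1 i2 p1 p2 where [simp]: "ms = (i1, i2, p1, p2)" by (cases ms) auto
    have "biproduct (opcat \<A>) X Y (S, p1, p2, i1, i2)" using b by (simp add: biproduct_opcat)
    thus "\<exists>S\<in>\<C>. \<exists>ms. biproduct (opcat \<A>) X Y (S, ms)" using S by blast
  next
    fix i p assume "short_exact (opcat \<A>) i p" "src (opcat \<A>) i \<in> \<C>" "tgt (opcat \<A>) p \<in> \<C>"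
    moreover from this(1) have "dom i = cod p" unfolding short_exact_opcat short_exact_def is_kernel_def opcat_simps by blast
    ultimately show "tgt (opcat \<A>) i \<in> \<C>" using extension_closed[of p i] by simp
  qed (use sub_Obj sub_zero in auto)
qed

section \<open>Push-outs and short exact sequences\<close>

text \<open>Instantiating a lemma at \<open>opcat \<A>\<close> and unfolding with this list yields
  its dual; the \<open>lemmas\<close> below that cite \<open>opcat_preadditive\<close> or
  \<open>opcat_abelian\<close> arise in this way.\<close>

lemmas op_simps = opcat_simps Hom_opcat zero_object_opcat monic_opcat epic_opcat is_kernel_opcat
  is_cokernel_opcat short_exact_opcat is_pushout_opcat is_pullback_opcat

context preadditive_category
begin

section \<open>Kernels and cokernels, monic and epic arrows\<close>

lemma is_kernelD:
  assumes "is_kernel \<A> k f"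
  shows "k \<in> Arr \<A>" "f \<in> Arr \<A>" "cod k = dom f" "f \<cdot> k = zm (dom k) (cod f)"
  using assms unfolding is_kernel_def by blast+

lemma is_kernel_lift:
  assumes "is_kernel \<A> k f" "u \<in> Arr \<A>" "cod u = dom f" "f \<cdot> u = zm (dom u) (cod f)"
  obtains w where "w \<in> Arr \<A>" "dom w = dom u" "cod w = dom k" "k \<cdot> w = u"
  using assms unfolding is_kernel_def Hom_iff by blast

lemma monicD:
  assumes "monic \<A> f" "f \<cdot> u = f \<cdot> v" "u \<in> Arr \<A>" "v \<in> Arr \<A>" "dom u = dom v"
    "cod u = dom f" "cod v = dom f"
  shows "u = v"
  using assms unfolding monic_def by blast

lemma monic_arr: "monic \<A> f \<Longrightarrow> f \<in> Arr \<A>"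
  unfolding monic_def by blast

lemma epic_arr: "epic \<A> f \<Longrightarrow> f \<in> Arr \<A>"
  unfolding epic_def by blast

lemma monic_zeroD:
  assumes "monic \<A> f" "f \<cdot> u = zm (dom u) (cod f)" "u \<in> Arr \<A>" "cod u = dom f"
  shows "u = zm (dom u) (dom f)"
  by (rule monicD[OF assms(1)]) (use assms monic_arr[OF assms(1)] in auto)

text \<open>By bilinearity f u = f v amounts to f (u - v) = 0, so cancellation need only be tested
  on arrows sent to zero.\<close>

lemma monicI:
  assumes "f \<in> Arr \<A>" "\<And>u. u \<in> Arr \<A> \<Longrightarrow> cod u = dom f \<Longrightarrow>
    f \<cdot> u = zm (dom u) (cod f) \<Longrightarrow> u = zm (dom u) (dom f)"
  shows "monic \<A> f"
  unfolding monic_def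
proof (intro conjI ballI impI assms(1))
  fix u v assume uv: "u \<in> Arr \<A>" "v \<in> Arr \<A>"
    and e: "dom u = dom v \<and> cod u = dom f \<and> cod v = dom f \<and> f \<cdot> u = f \<cdot> v"
  have s: "dom (u \<boxplus> neg v) = dom v" using uv e by simp
  have "u \<boxplus> neg v = zm (dom (u \<boxplus> neg v)) (dom f)"
    by (rule assms(2)) (use uv e assms(1) in simp_all)
  from this[unfolded s] show "u = v" using uv e by (rule_tac plus_neg_eq_zero) auto
qed

lemma is_kernel_monic: "is_kernel \<A> k f \<Longrightarrow> monic \<A> k"
proof (rule monicI)
  fix u assume k: "is_kernel \<A> k f" and u: "u \<in> Arr \<A>" "cod u = dom k"
    and z: "k \<cdot> u = zm (dom u) (cod k)"
  note K = is_kernelD[OF k]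
  have "\<exists>!w. w \<in> Hom \<A> (dom (k \<cdot> u)) (dom k) \<and> k \<cdot> w = k \<cdot> u"
  proof -
    have "k \<cdot> u \<in> Arr \<A>" "cod (k \<cdot> u) = dom f" "f \<cdot> (k \<cdot> u) = zm (dom (k \<cdot> u)) (cod f)"
      using K u by (simp_all add: z)
    thus ?thesis using k unfolding is_kernel_def by blast
  qed
  moreover have "u \<in> Hom \<A> (dom (k \<cdot> u)) (dom k)" using u K by (simp add: Hom_iff)
  moreover have "zm (dom u) (dom k) \<in> Hom \<A> (dom (k \<cdot> u)) (dom k) \<and>
     k \<cdot> zm (dom u) (dom k) = k \<cdot> u" using u K z by (simp add: Hom_iff)
  ultimately show "u = zm (dom u) (dom k)" by blast
qed (rule is_kernelD)

lemma is_kernelI: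
  assumes "monic \<A> k" "f \<in> Arr \<A>" "cod k = dom f" "f \<cdot> k = zm (dom k) (cod f)"
    "\<And>u. u \<in> Arr \<A> \<Longrightarrow> cod u = dom f \<Longrightarrow> f \<cdot> u = zm (dom u) (cod f) \<Longrightarrow>
      \<exists>w. w \<in> Arr \<A> \<and> dom w = dom u \<and> cod w = dom k \<and> k \<cdot> w = u"
  shows "is_kernel \<A> k f"
  unfolding is_kernel_def
proof (intro conjI ballI impI assms(2-4) monic_arr[OF assms(1)])
  fix u assume "u \<in> Arr \<A>" "cod u = dom f \<and> f \<cdot> u = zm (dom u) (cod f)"
  then obtain w where w: "w \<in> Arr \<A>" "dom w = dom u" "cod w = dom k" "k \<cdot> w = u"
    using assms(5) by blast
  show "\<exists>!w. w \<in> Hom \<A> (dom u) (dom k) \<and> k \<cdot> w = u"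
    by (rule ex1I[of _ w]) (use w in \<open>auto simp: Hom_iff intro: monicD[OF assms(1)]\<close>)
qed

lemmas is_cokernelD = preadditive_category.is_kernelD[OF opcat_preadditive, unfolded op_simps]
lemmas is_cokernel_lift = preadditive_category.is_kernel_lift[OF opcat_preadditive, unfolded op_simps]
lemmas epicD = preadditive_category.monicD[OF opcat_preadditive, unfolded op_simps]
lemmas is_cokernel_epic = preadditive_category.is_kernel_monic[OF opcat_preadditive, unfolded op_simps]
lemmas epicI = preadditive_category.monicI[OF opcat_preadditive, unfolded op_simps]
lemmas epic_zeroD = preadditive_category.monic_zeroD[OF opcat_preadditive, unfolded op_simps]
lemmas is_cokernelI = preadditive_category.is_kernelI[OF opcat_preadditive, unfolded op_simps]

lemma short_exactD:
  assumes "short_exact \<A> i p"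
  shows "is_kernel \<A> i p" "is_cokernel \<A> p i" "monic \<A> i" "epic \<A> p" "i \<in> Arr \<A>" "p \<in> Arr \<A>" "cod i = dom p"
    "p \<cdot> i = zm (dom i) (cod p)"
  using assms is_kernelD is_kernel_monic is_cokernel_epic unfolding short_exact_def by blast+

end

context abelian_category
begin

text \<open>A monic f is the kernel of some g. As g f = 0, g factors through the cokernel c; hence c
  u = 0 implies g u = 0, and u lifts through f.\<close>

lemma short_exactI_monic:
  assumes "monic \<A> f" "is_cokernel \<A> c f"
  shows "short_exact \<A> f c"
proof -
  obtain g where g: "is_kernel \<A> f g" using monic_normal assms(1) by blast
  note G = is_kernelD[OF g] and C = is_cokernelD[OF assms(2)]
  obtain w where w: "w \<in> Arr \<A>" "cod w = cod g" "dom w = cod c" "w \<cdot> c = g"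
    by (rule is_cokernel_lift[OF assms(2), of g]) (use G in auto)
  have "is_kernel \<A> f c"
  proof (rule is_kernelI[OF assms(1)])
    fix u assume u: "u \<in> Arr \<A>" "cod u = dom c" "c \<cdot> u = zm (dom u) (cod c)"
    have "g \<cdot> u = w \<cdot> (c \<cdot> u)" using u C w(1-3) by (simp flip: w(4))
    hence "g \<cdot> u = zm (dom u) (cod g)" using u w by simp
    with u C G show "\<exists>w. w \<in> Arr \<A> \<and> dom w = dom u \<and> cod w = dom f \<and> f \<cdot> w = u"
      using is_kernel_lift[OF g, of u] by metis
  qed (use C in auto)
  thus ?thesis using assms(2) by (simp add: short_exact_def)
qed

lemma short_exactI_epic:
  assumes "epic \<A> p" "is_kernel \<A> i p"
  shows "short_exact \<A> i p"
  using abelian_category.short_exactI_monic[OF opcat_abelian, of p i] assms by simp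

section \<open>Biproducts\<close>

definition bs :: "'a \<Rightarrow> 'a \<Rightarrow> 'a" where "bs X Y = fst (biprod \<A> X Y)"
definition in1 :: "'a \<Rightarrow> 'a \<Rightarrow> 'b" where "in1 X Y = fst (snd (biprod \<A> X Y))"
definition in2 :: "'a \<Rightarrow> 'a \<Rightarrow> 'b" where "in2 X Y = fst (snd (snd (biprod \<A> X Y)))"
definition pr1 :: "'a \<Rightarrow> 'a \<Rightarrow> 'b" where "pr1 X Y = fst (snd (snd (snd (biprod \<A> X Y))))"
definition pr2 :: "'a \<Rightarrow> 'a \<Rightarrow> 'b" where "pr2 X Y = snd (snd (snd (snd (biprod \<A> X Y))))"

lemma biprod_eq: "biprod \<A> X Y = (bs X Y, in1 X Y, in2 X Y, pr1 X Y, pr2 X Y)"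
  by (simp add: bs_def in1_def in2_def pr1_def pr2_def)

lemma biprod_simps [simp]:
  assumes "X \<in> Obj \<A>" "Y \<in> Obj \<A>"
  shows "bs X Y \<in> Obj \<A>" "in1 X Y \<in> Arr \<A>" "dom (in1 X Y) = X" "cod (in1 X Y) = bs X Y"
    "in2 X Y \<in> Arr \<A>" "dom (in2 X Y) = Y" "cod (in2 X Y) = bs X Y"
    "pr1 X Y \<in> Arr \<A>" "dom (pr1 X Y) = bs X Y" "cod (pr1 X Y) = X"
    "pr2 X Y \<in> Arr \<A>" "dom (pr2 X Y) = bs X Y" "cod (pr2 X Y) = Y"
    "pr1 X Y \<cdot> in1 X Y = ide X" "pr2 X Y \<cdot> in2 X Y = ide Y"
    "pr1 X Y \<cdot> in2 X Y = zm Y X" "pr2 X Y \<cdot> in1 X Y = zm X Y"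
    "(in1 X Y \<cdot> pr1 X Y) \<boxplus> (in2 X Y \<cdot> pr2 X Y) = ide (bs X Y)"
proof -
  have "biproduct \<A> X Y (biprod \<A> X Y)"
    unfolding biprod_def using ex_biproduct[OF assms] by (rule someI_ex)
  thus "bs X Y \<in> Obj \<A>" "in1 X Y \<in> Arr \<A>" "dom (in1 X Y) = X" "cod (in1 X Y) = bs X Y"
    "in2 X Y \<in> Arr \<A>" "dom (in2 X Y) = Y" "cod (in2 X Y) = bs X Y"
    "pr1 X Y \<in> Arr \<A>" "dom (pr1 X Y) = bs X Y" "cod (pr1 X Y) = X"
    "pr2 X Y \<in> Arr \<A>" "dom (pr2 X Y) = bs X Y" "cod (pr2 X Y) = Y"
    "pr1 X Y \<cdot> in1 X Y = ide X" "pr2 X Y \<cdot> in2 X Y = ide Y"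
    "pr1 X Y \<cdot> in2 X Y = zm Y X" "pr2 X Y \<cdot> in1 X Y = zm X Y"
    "(in1 X Y \<cdot> pr1 X Y) \<boxplus> (in2 X Y \<cdot> pr2 X Y) = ide (bs X Y)"
    by (auto simp: biprod_eq biproduct_def Hom_iff)
qed

lemma biprod_reassoc [simp]:
  assumes "X \<in> Obj \<A>" "Y \<in> Obj \<A>" "u \<in> Arr \<A>"
  shows "cod u = X \<Longrightarrow> pr1 X Y \<cdot> (in1 X Y \<cdot> u) = u" "cod u = Y \<Longrightarrow> pr2 X Y \<cdot> (in2 X Y \<cdot> u) = u"
    "cod u = Y \<Longrightarrow> pr1 X Y \<cdot> (in2 X Y \<cdot> u) = zm (dom u) X"
    "cod u = X \<Longrightarrow> pr2 X Y \<cdot> (in1 X Y \<cdot> u) = zm (dom u) Y"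
  using assms by (simp_all flip: assoc)

lemma biprod_split:
  assumes "u \<in> Arr \<A>" "cod u = bs X Y" "X \<in> Obj \<A>" "Y \<in> Obj \<A>"
  shows "(in1 X Y \<cdot> (pr1 X Y \<cdot> u)) \<boxplus> (in2 X Y \<cdot> (pr2 X Y \<cdot> u)) = u"
proof -
  have "((in1 X Y \<cdot> pr1 X Y) \<boxplus> (in2 X Y \<cdot> pr2 X Y)) \<cdot> u = u" using assms by (subst biprod_simps) auto
  thus ?thesis using assms by (subst (asm) dist_r) auto
qed

lemma biprod_cosplit:
  assumes "u \<in> Arr \<A>" "dom u = bs X Y" "X \<in> Obj \<A>" "Y \<in> Obj \<A>"
  shows "(u \<cdot> (in1 X Y \<cdot> pr1 X Y)) \<boxplus> (u \<cdot> (in2 X Y \<cdot> pr2 X Y)) = u"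
proof -
  have "u \<cdot> ((in1 X Y \<cdot> pr1 X Y) \<boxplus> (in2 X Y \<cdot> pr2 X Y)) = u" using assms by (subst biprod_simps) auto
  thus ?thesis using assms by (subst (asm) dist_l) auto
qed

lemma biprod_ext:
  assumes "pr1 X Y \<cdot> u = pr1 X Y \<cdot> v" "pr2 X Y \<cdot> u = pr2 X Y \<cdot> v" "u \<in> Arr \<A>" "cod u = bs X Y"
    "v \<in> Arr \<A>" "cod v = bs X Y" "X \<in> Obj \<A>" "Y \<in> Obj \<A>"
  shows "u = v"
  using biprod_split[OF assms(3,4,7,8)] biprod_split[OF assms(5,6,7,8)] unfolding assms(1,2) by metis

lemma biprod_coext:
  assumes "u \<cdot> in1 X Y = v \<cdot> in1 X Y" "u \<cdot> in2 X Y = v \<cdot> in2 X Y" "u \<in> Arr \<A>" "dom u = bs X Y"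
    "v \<in> Arr \<A>" "dom v = bs X Y" "X \<in> Obj \<A>" "Y \<in> Obj \<A>"
  shows "u = v"
proof -
  have "u \<cdot> (in1 X Y \<cdot> pr1 X Y) = v \<cdot> (in1 X Y \<cdot> pr1 X Y)" "u \<cdot> (in2 X Y \<cdot> pr2 X Y) = v \<cdot> (in2 X Y \<cdot> pr2 X Y)"
    using assms by (simp_all flip: assoc)
  thus ?thesis using biprod_cosplit[OF assms(3,4,7,8)] biprod_cosplit[OF assms(5,6,7,8)] by metis
qed

definition pair :: "'b \<Rightarrow> 'b \<Rightarrow> 'b" where
  "pair f g = (in1 (cod f) (cod g) \<cdot> f) \<boxplus> (in2 (cod f) (cod g) \<cdot> g)"

definition copair :: "'b \<Rightarrow> 'b \<Rightarrow> 'b" where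
  "copair f g = (f \<cdot> pr1 (dom f) (dom g)) \<boxplus> (g \<cdot> pr2 (dom f) (dom g))"

lemma pair_simps [simp]:
  assumes "f \<in> Arr \<A>" "g \<in> Arr \<A>" "dom f = dom g"
  shows "pair f g \<in> Arr \<A>" "dom (pair f g) = dom g" "cod (pair f g) = bs (cod f) (cod g)"
    "X = cod f \<Longrightarrow> Y = cod g \<Longrightarrow> pr1 X Y \<cdot> pair f g = f" "X = cod f \<Longrightarrow> Y = cod g \<Longrightarrow> pr2 X Y \<cdot> pair f g = g"
  using assms by (simp_all add: pair_def)

lemma copair_simps [simp]:
  assumes "f \<in> Arr \<A>" "g \<in> Arr \<A>" "cod f = cod g"
  shows "copair f g \<in> Arr \<A>" "cod (copair f g) = cod g" "dom (copair f g) = bs (dom f) (dom g)"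
    "X = dom f \<Longrightarrow> Y = dom g \<Longrightarrow> copair f g \<cdot> in1 X Y = f" "X = dom f \<Longrightarrow> Y = dom g \<Longrightarrow> copair f g \<cdot> in2 X Y = g"
  using assms by (simp_all add: copair_def)

lemma copair_pair:
  assumes "f \<in> Arr \<A>" "g \<in> Arr \<A>" "cod f = cod g" "u \<in> Arr \<A>" "v \<in> Arr \<A>" "dom u = dom v"
    "cod u = dom f" "cod v = dom g"
  shows "copair f g \<cdot> pair u v = (f \<cdot> u) \<boxplus> (g \<cdot> v)"
  using assms by (simp add: pair_def flip: assoc)

lemma copair_cmp:
  assumes "f \<in> Arr \<A>" "g \<in> Arr \<A>" "cod f = cod g" "u \<in> Arr \<A>" "cod u = bs (dom f) (dom g)"
  shows "copair f g \<cdot> u = (f \<cdot> (pr1 (dom f) (dom g) \<cdot> u)) \<boxplus> (g \<cdot> (pr2 (dom f) (dom g) \<cdot> u))"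
  using assms by (simp add: copair_def)

end

context preadditive_category
begin

section \<open>Push-outs and, by duality, pull-backs\<close>

lemma is_pushoutD:
  assumes "is_pushout \<A> f g f' x"
  shows "f \<in> Arr \<A>" "g \<in> Arr \<A>" "f' \<in> Arr \<A>" "x \<in> Arr \<A>"
     "dom f = dom g" "dom f' = cod g" "dom x = cod f" "cod f' = cod x" "f' \<cdot> g = x \<cdot> f"
  using assms unfolding is_pushout_def by blast+

lemma is_pushout_lift:
  assumes "is_pushout \<A> f g f' x" "u \<in> Arr \<A>" "v \<in> Arr \<A>" "dom u = cod g" "dom v = cod f"
    "cod u = cod v" "u \<cdot> g = v \<cdot> f"
  obtains w where "w \<in> Arr \<A>" "dom w = cod f'" "cod w = cod u" "w \<cdot> f' = u" "w \<cdot> x = v"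
  using assms unfolding is_pushout_def Hom_iff by blast

lemma is_pushout_ext:
  assumes "is_pushout \<A> f g f' x" "w \<cdot> f' = w' \<cdot> f'" "w \<cdot> x = w' \<cdot> x" "w \<in> Arr \<A>" "w' \<in> Arr \<A>"
    "dom w = cod f'" "dom w' = cod f'" "cod w = cod w'"
  shows "w = w'"
proof -
  note P = is_pushoutD[OF assms(1)]
  have "(w \<cdot> f') \<cdot> g = (w \<cdot> x) \<cdot> f" using P assms(2-) by simp
  hence "\<exists>!v. v \<in> Hom \<A> (cod f') (cod (w \<cdot> f')) \<and> v \<cdot> f' = w \<cdot> f' \<and> v \<cdot> x = w \<cdot> x"
  proof -
    have "w \<cdot> f' \<in> Arr \<A>" "w \<cdot> x \<in> Arr \<A>" "dom (w \<cdot> f') = cod g" "dom (w \<cdot> x) = cod f"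
      "cod (w \<cdot> f') = cod (w \<cdot> x)" using P assms(4-) by simp_all
    with \<open>(w \<cdot> f') \<cdot> g = (w \<cdot> x) \<cdot> f\<close> show ?thesis using assms(1) unfolding is_pushout_def by blast
  qed
  moreover have "w \<in> Hom \<A> (cod f') (cod (w \<cdot> f'))" "w' \<in> Hom \<A> (cod f') (cod (w \<cdot> f'))"
    using P assms(4-) by (simp_all add: Hom_iff)
  ultimately show ?thesis using assms(2,3) by metis
qed

lemma is_pushoutI:
  assumes "f \<in> Arr \<A>" "g \<in> Arr \<A>" "f' \<in> Arr \<A>" "x \<in> Arr \<A>"
     "dom f = dom g" "dom f' = cod g" "dom x = cod f" "cod f' = cod x" "f' \<cdot> g = x \<cdot> f"
    "\<And>u v. u \<in> Arr \<A> \<Longrightarrow> v \<in> Arr \<A> \<Longrightarrow> dom u = cod g \<Longrightarrow> dom v = cod f \<Longrightarrow>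
      cod u = cod v \<Longrightarrow> u \<cdot> g = v \<cdot> f \<Longrightarrow>
      \<exists>w. w \<in> Arr \<A> \<and> dom w = cod f' \<and> cod w = cod u \<and> w \<cdot> f' = u \<and> w \<cdot> x = v"
    "\<And>w w'. w \<in> Arr \<A> \<Longrightarrow> w' \<in> Arr \<A> \<Longrightarrow> dom w = cod f' \<Longrightarrow> dom w' = cod f' \<Longrightarrow>
      cod w = cod w' \<Longrightarrow> w \<cdot> f' = w' \<cdot> f' \<Longrightarrow> w \<cdot> x = w' \<cdot> x \<Longrightarrow> w = w'"
  shows "is_pushout \<A> f g f' x"
  unfolding is_pushout_def
proof (intro conjI ballI impI assms(1-9))
  fix u v assume "u \<in> Arr \<A>" "v \<in> Arr \<A>"
    "dom u = cod g \<and> dom v = cod f \<and> cod u = cod v \<and> u \<cdot> g = v \<cdot> f"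
  then obtain w where "w \<in> Arr \<A>" "dom w = cod f'" "cod w = cod u" "w \<cdot> f' = u" "w \<cdot> x = v"
    using assms(10) by blast
  thus "\<exists>!w. w \<in> Hom \<A> (cod f') (cod u) \<and> w \<cdot> f' = u \<and> w \<cdot> x = v"
    unfolding Hom_iff by (intro ex1I[of _ w]) (auto intro: assms(11))
qed

lemma is_pushout_sym:
  assumes po: "is_pushout \<A> f g f' x"
  shows "is_pushout \<A> g f x f'"
proof -
  note P = is_pushoutD[OF po]
  show ?thesis
  proof (rule is_pushoutI)
    fix u v assume "u \<in> Arr \<A>" "v \<in> Arr \<A>" "dom u = cod f" "dom v = cod g" "cod u = cod v" "u \<cdot> f = v \<cdot> g"
    then obtain w where "w \<in> Arr \<A>" "dom w = cod f'" "cod w = cod v" "w \<cdot> f' = v" "w \<cdot> x = u"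
      using is_pushout_lift[OF po, of v u] by metis
    with \<open>cod u = cod v\<close> P(8)
    show "\<exists>w. w \<in> Arr \<A> \<and> dom w = cod x \<and> cod w = cod u \<and> w \<cdot> x = u \<and> w \<cdot> f' = v" by metis
  next
    fix w w' assume "w \<in> Arr \<A>" "w' \<in> Arr \<A>" "dom w = cod x" "dom w' = cod x"
      "cod w = cod w'" "w \<cdot> x = w' \<cdot> x" "w \<cdot> f' = w' \<cdot> f'"
    thus "w = w'" using is_pushout_ext[OF po] P(8) by metis
  qed (use P in auto)
qed

lemmas is_pullbackD = preadditive_category.is_pushoutD[OF opcat_preadditive, unfolded op_simps]
lemmas is_pullback_sym = preadditive_category.is_pushout_sym[OF opcat_preadditive, unfolded op_simps]
lemmas is_pullback_lift = preadditive_category.is_pushout_lift[OF opcat_preadditive, unfolded op_simps]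
lemmas is_pullback_ext = preadditive_category.is_pushout_ext[OF opcat_preadditive, unfolded op_simps]

lemmas is_pullbackI = preadditive_category.is_pushoutI[OF opcat_preadditive, unfolded op_simps]

end

context abelian_category
begin

text \<open>The push-out is the cokernel of the arrow with components f and -g into the biproduct of
  the targets; its legs are the restrictions of this cokernel to the two summands.\<close>

lemma ex_pushout:
  assumes "f \<in> Arr \<A>" "g \<in> Arr \<A>" "dom f = dom g"
  obtains f' x where "is_pushout \<A> f g f' x"
proof -
  let ?X = "cod f" and ?Y = "cod g"
  define m where "m = pair f (neg g)"
  have m: "m \<in> Arr \<A>" "dom m = dom g" "cod m = bs ?X ?Y" "pr1 ?X ?Y \<cdot> m = f" "pr2 ?X ?Y \<cdot> m = neg g"
    using assms by (simp_all add: m_def)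
  obtain c where c: "is_cokernel \<A> c m" using ex_cokernel m by blast
  note C = is_cokernelD[OF c]
  have "(c \<cdot> in1 ?X ?Y) \<cdot> f \<boxplus> neg ((c \<cdot> in2 ?X ?Y) \<cdot> g) = c \<cdot> m"
    using assms C m by (simp add: m_def pair_def)
  hence e: "(c \<cdot> in1 ?X ?Y) \<cdot> f = (c \<cdot> in2 ?X ?Y) \<cdot> g"
    by (rule_tac plus_neg_eq_zero) (use assms C m in auto)
  have "is_pushout \<A> f g (c \<cdot> in2 ?X ?Y) (c \<cdot> in1 ?X ?Y)"
  proof (rule is_pushoutI)
    fix u v assume uv: "u \<in> Arr \<A>" "v \<in> Arr \<A>" "dom u = ?Y" "dom v = ?X" "cod u = cod v" "u \<cdot> g = v \<cdot> f"
    have "copair v u \<cdot> m = zm (dom m) (cod u)" unfolding m_def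
      using uv assms by (subst copair_pair) auto
    then obtain w where w: "w \<in> Arr \<A>" "cod w = cod u" "dom w = cod c" "w \<cdot> c = copair v u"
      using is_cokernel_lift[OF c, of "copair v u"] uv m by auto
    have "w \<cdot> (c \<cdot> in1 ?X ?Y) = (w \<cdot> c) \<cdot> in1 ?X ?Y" "w \<cdot> (c \<cdot> in2 ?X ?Y) = (w \<cdot> c) \<cdot> in2 ?X ?Y"
      using w(1-3) C m assms by simp_all
    hence "w \<cdot> (c \<cdot> in1 ?X ?Y) = v" "w \<cdot> (c \<cdot> in2 ?X ?Y) = u" using uv by (simp_all add: w(4))
    thus "\<exists>w. w \<in> Arr \<A> \<and> dom w = cod (c \<cdot> in2 ?X ?Y) \<and> cod w = cod u \<and>
            w \<cdot> (c \<cdot> in2 ?X ?Y) = u \<and> w \<cdot> (c \<cdot> in1 ?X ?Y) = v"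
      using w C m assms by (intro exI[of _ w]) auto
  next
    fix w w' assume w: "w \<in> Arr \<A>" "w' \<in> Arr \<A>" "dom w = cod (c \<cdot> in2 ?X ?Y)" "dom w' = cod (c \<cdot> in2 ?X ?Y)"
      "cod w = cod w'" "w \<cdot> (c \<cdot> in2 ?X ?Y) = w' \<cdot> (c \<cdot> in2 ?X ?Y)" "w \<cdot> (c \<cdot> in1 ?X ?Y) = w' \<cdot> (c \<cdot> in1 ?X ?Y)"
    have s: "dom w = cod c" "dom w' = cod c" using w(3,4) C m assms by auto
    have "w \<cdot> c = w' \<cdot> c"
      by (rule biprod_coext[where X = ?X and Y = ?Y]) (use w(1,2,5-) s C m assms in auto)
    thus "w = w'" using epicD[OF is_cokernel_epic[OF c]] w s by blast
  qed (use assms C m e in auto)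
  thus ?thesis by (rule that)
qed

text \<open>With m = (f, -g), the universal property makes the induced arrow c on the biproduct a
  cokernel of m. As f is monic, so is m, and then m is also the kernel of c. If f' u = 0, then (0,
  u) is killed by c and equals m w; its first component gives f w = 0, so w = 0 and u = 0.\<close>

lemma pushout_monic:
  assumes po: "is_pushout \<A> f g f' x" and f: "monic \<A> f"
  shows "monic \<A> f'"
proof -
  note P = is_pushoutD[OF po]
  let ?X = "cod f" and ?Y = "cod g"
  define m where "m = pair f (neg g)"
  have m: "m \<in> Arr \<A>" "dom m = dom g" "cod m = bs ?X ?Y" "pr1 ?X ?Y \<cdot> m = f" "pr2 ?X ?Y \<cdot> m = neg g"
    using P by (simp_all add: m_def)
  define c where "c = copair x f'"
  have c: "c \<in> Arr \<A>" "dom c = bs ?X ?Y" "cod c = cod x" "c \<cdot> in1 ?X ?Y = x" "c \<cdot> in2 ?X ?Y = f'"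
    using P by (simp_all add: c_def)
  have mm: "monic \<A> m"
  proof (rule monicI[OF m(1)])
    fix u assume u: "u \<in> Arr \<A>" "cod u = dom m" "m \<cdot> u = zm (dom u) (cod m)"
    have "f \<cdot> u = pr1 ?X ?Y \<cdot> (m \<cdot> u)" using m P u(1,2) by (simp flip: assoc)
    thus "u = zm (dom u) (dom m)" using monic_zeroD[OF f, of u] u m P by simp
  qed
  have cm: "is_cokernel \<A> c m"
  proof (rule is_cokernelI)
    show "epic \<A> c"
    proof (rule epicI[OF c(1)])
      fix u assume u: "u \<in> Arr \<A>" "dom u = cod c" "u \<cdot> c = zm (dom c) (cod u)"
      have "u \<cdot> x = (u \<cdot> c) \<cdot> in1 ?X ?Y" "u \<cdot> f' = (u \<cdot> c) \<cdot> in2 ?X ?Y" using u(1,2) c P by simp_all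
      thus "u = zm (cod c) (cod u)"
        by (rule_tac is_pushout_ext[OF po]) (use u c P in auto)
    qed
    show "c \<cdot> m = zm (dom m) (cod c)" unfolding c_def m_def using P by (subst copair_pair) auto
    fix u assume u: "u \<in> Arr \<A>" "dom u = cod m" "u \<cdot> m = zm (dom m) (cod u)"
    have "(u \<cdot> in1 ?X ?Y) \<cdot> f \<boxplus> neg ((u \<cdot> in2 ?X ?Y) \<cdot> g) = u \<cdot> m"
      using P u(1,2) m by (simp add: m_def pair_def)
    hence "(u \<cdot> in1 ?X ?Y) \<cdot> f = (u \<cdot> in2 ?X ?Y) \<cdot> g"
      by (rule_tac plus_neg_eq_zero) (use P u m in auto)
    then obtain w where w: "w \<in> Arr \<A>" "dom w = cod f'" "cod w = cod u" "w \<cdot> f' = u \<cdot> in2 ?X ?Y" "w \<cdot> x = u \<cdot> in1 ?X ?Y"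
      using is_pushout_lift[OF po, of "u \<cdot> in2 ?X ?Y" "u \<cdot> in1 ?X ?Y"] u m P by auto
    have "w \<cdot> c = u"
      by (rule biprod_coext[where X = ?X and Y = ?Y]) (use w u c m P in auto)
    thus "\<exists>w. w \<in> Arr \<A> \<and> cod w = cod u \<and> dom w = cod c \<and> w \<cdot> c = u"
      using w c P by (intro exI[of _ w]) auto
  qed (use m c in auto)
  have k: "is_kernel \<A> m c" using short_exactI_monic[OF mm cm] short_exactD by blast
  show ?thesis
  proof (rule monicI)
    fix u assume u: "u \<in> Arr \<A>" "cod u = dom f'" "f' \<cdot> u = zm (dom u) (cod f')"
    have "c \<cdot> (in2 ?X ?Y \<cdot> u) = f' \<cdot> u" using u(1,2) c P by (simp flip: assoc)
    then obtain w where w: "w \<in> Arr \<A>" "dom w = dom u" "cod w = dom m" "m \<cdot> w = in2 ?X ?Y \<cdot> u"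
      using is_kernel_lift[OF k, of "in2 ?X ?Y \<cdot> u"] u c P by auto
    have "f \<cdot> w = pr1 ?X ?Y \<cdot> (m \<cdot> w)" using w(1-3) m P by (simp flip: assoc)
    hence "f \<cdot> w = zm (dom u) ?X" unfolding w(4) using u P by simp
    hence "w = zm (dom u) (dom f)" using monic_zeroD[OF f, of w] w m P by simp
    hence "in2 ?X ?Y \<cdot> u = zm (dom u) (bs ?X ?Y)" using w(4) m u P by simp
    moreover have "u = pr2 ?X ?Y \<cdot> (in2 ?X ?Y \<cdot> u)" using u P by simp
    ultimately show "u = zm (dom u) (dom f')" using u P by simp
  qed (use P in auto)
qed

text \<open>The cokernel does not change under push-out: by the universal property, arrows vanishing
  on i' correspond to arrows vanishing on i.\<close>

lemma pushout_short_exact: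
  assumes se: "short_exact \<A> i p" and po: "is_pushout \<A> i g i' x"
    and e: "e \<in> Arr \<A>" "dom e = cod i'" "cod e = cod p" "e \<cdot> x = p" "e \<cdot> i' = zm (dom i') (cod e)"
  shows "short_exact \<A> i' e"
proof (rule short_exactI_monic)
  note S = short_exactD[OF se] and P = is_pushoutD[OF po]
  show "monic \<A> i'" using pushout_monic[OF po] S by blast
  show "is_cokernel \<A> e i'"
  proof (rule is_cokernelI)
    show "epic \<A> e"
    proof (rule epicI[OF e(1)])
      fix u assume u: "u \<in> Arr \<A>" "dom u = cod e" "u \<cdot> e = zm (dom e) (cod u)"
      have "u \<cdot> p = (u \<cdot> e) \<cdot> x" using u(1,2) e P by simp
      thus "u = zm (cod e) (cod u)" using epic_zeroD[OF S(4), of u] u e P S by simp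
    qed
    fix u assume u: "u \<in> Arr \<A>" "dom u = cod i'" "u \<cdot> i' = zm (dom i') (cod u)"
    have "(u \<cdot> x) \<cdot> i = (u \<cdot> i') \<cdot> g" using u(1,2) P by simp
    hence "(u \<cdot> x) \<cdot> i = zm (dom i) (cod u)" using u P by simp
    then obtain w where w: "w \<in> Arr \<A>" "cod w = cod u" "dom w = cod p" "w \<cdot> p = u \<cdot> x"
      using is_cokernel_lift[OF S(2), of "u \<cdot> x"] u P S by auto
    have "w \<cdot> e = u"
      by (rule is_pushout_ext[OF po]) (use w u e P in auto)
    thus "\<exists>w. w \<in> Arr \<A> \<and> cod w = cod u \<and> dom w = cod e \<and> w \<cdot> e = u"
      using w e by (intro exI[of _ w]) auto
  qed (use e P in auto)
qed

lemmas ex_pullback = abelian_category.ex_pushout[OF opcat_abelian, unfolded op_simps]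
lemmas pullback_epic = abelian_category.pushout_monic[OF opcat_abelian, unfolded op_simps]
lemmas pullback_short_exact = abelian_category.pushout_short_exact[OF opcat_abelian, unfolded op_simps]

end

section \<open>Maps of short exact sequences\<close>

definition ses_map :: "('o, 'm) addcat \<Rightarrow> 'm \<Rightarrow> 'm \<Rightarrow> 'm \<Rightarrow> 'm \<Rightarrow> 'm \<Rightarrow> 'm \<Rightarrow> 'm \<Rightarrow> bool" where
  "ses_map \<A> g x c i p i' p' \<longleftrightarrow> g \<in> Hom \<A> (src \<A> i) (src \<A> i') \<and> x \<in> Hom \<A> (tgt \<A> i) (tgt \<A> i') \<and>
     c \<in> Hom \<A> (tgt \<A> p) (tgt \<A> p') \<and> cmp \<A> i' g = cmp \<A> x i \<and> cmp \<A> p' x = cmp \<A> c p"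

context abelian_category
begin

lemma ses_mapD:
  assumes "ses_map \<A> g x c i p i' p'"
  shows "g \<in> Arr \<A>" "dom g = dom i" "cod g = dom i'"
    "x \<in> Arr \<A>" "dom x = cod i" "cod x = cod i'"
    "c \<in> Arr \<A>" "dom c = cod p" "cod c = cod p'"
    "i' \<cdot> g = x \<cdot> i" "p' \<cdot> x = c \<cdot> p"
  using assms by (auto simp: ses_map_def Hom_iff)

lemma ses_map_id:
  assumes "short_exact \<A> i p"
  shows "ses_map \<A> (ide (dom i)) (ide (cod i)) (ide (cod p)) i p i p"
  using short_exactD[OF assms] by (simp add: ses_map_def Hom_iff)

lemma ses_map_cmp:
  assumes "ses_map \<A> g x c i p i' p'" "ses_map \<A> g' x' c' i' p' i'' p''"
    "short_exact \<A> i p" "short_exact \<A> i' p'" "short_exact \<A> i'' p''"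
  shows "ses_map \<A> (g' \<cdot> g) (x' \<cdot> x) (c' \<cdot> c) i p i'' p''"
proof -
  note S = ses_mapD[OF assms(1)] ses_mapD[OF assms(2)] 
    short_exactD(5-7)[OF assms(3)] short_exactD(5-7)[OF assms(4)] short_exactD(5-7)[OF assms(5)]
  have "i'' \<cdot> (g' \<cdot> g) = x' \<cdot> (x \<cdot> i)" using S reassoc[of i'' g' "x' \<cdot> i'" g] by simp
  moreover have "p'' \<cdot> (x' \<cdot> x) = c' \<cdot> (c \<cdot> p)" using S reassoc[of p'' x' "c' \<cdot> p'" x] by simp
  ultimately show ?thesis unfolding ses_map_def Hom_iff using S by simp
qed

lemma ses_map_opcat:
  "short_exact \<A> i p \<Longrightarrow> short_exact \<A> i' p' \<Longrightarrow>
     ses_map (opcat \<A>) c x g p' i' p i \<longleftrightarrow> ses_map \<A> g x c i p i' p'"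
  using short_exactD(7)[of i p] short_exactD(7)[of i' p'] by (auto simp: ses_map_def)

text \<open>Being epic, f is a cokernel of some h. Then f h = 0 forces h = 0 because f is monic, so
  the identity of the source kills h and factors through f.\<close>

lemma monic_epic_iso:
  assumes "monic \<A> f" "epic \<A> f"
  obtains g where "g \<in> Arr \<A>" "dom g = cod f" "cod g = dom f"
    "g \<cdot> f = ide (dom f)" "f \<cdot> g = ide (cod f)"
proof -
  obtain h where h: "is_cokernel \<A> f h" using epic_normal assms(2) by blast
  note C = is_cokernelD[OF h]
  have "h = zm (dom h) (dom f)" by (rule monic_zeroD[OF assms(1)]) (use C in auto)
  hence "ide (dom f) \<cdot> h = zm (dom h) (dom f)" using C by (metis idm_cmp')
  then obtain g where g: "g \<in> Arr \<A>" "cod g = dom f" "dom g = cod f" "g \<cdot> f = ide (dom f)"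
    using is_cokernel_lift[OF h, of "ide (dom f)"] C by auto
  have "f \<cdot> g = ide (cod f)"
    by (rule epicD[OF assms(2)]) (use g C in auto)
  thus ?thesis using that g by blast
qed

text \<open>Tested against zero, the middle component is monic and epic, hence invertible by
  \<open>monic_epic_iso\<close>. Its inverse again has identity ends, which is why morphisms between
  extensions of length one can be reversed.\<close>

lemma short_five:
  assumes m: "ses_map \<A> (ide B) x (ide A) i p i' p'" and se: "short_exact \<A> i p" "short_exact \<A> i' p'"
    and BA: "dom i = B" "cod p = A"
  obtains y where "ses_map \<A> (ide B) y (ide A) i' p' i p" "y \<cdot> x = ide (cod i)" "x \<cdot> y = ide (cod i')"
proof -
  note M = ses_mapD[OF m] and S = short_exactD[OF se(1)] and S' = short_exactD[OF se(2)]
  have B: "B \<in> Obj \<A>" "A \<in> Obj \<A>" using BA S by auto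
  have B': "dom i' = B" "cod p' = A" using M(3,9) B by auto
  have e: "x \<cdot> i = i'" "p' \<cdot> x = p" using M(10,11) S(5,6) S'(5) B' BA by simp_all
  have mon: "monic \<A> x"
  proof (rule monicI[OF M(4)])
    fix u assume u: "u \<in> Arr \<A>" "cod u = dom x" "x \<cdot> u = zm (dom u) (cod x)"
    have "p \<cdot> u = p' \<cdot> (x \<cdot> u)" using reassoc[OF e(2), of u] M S S' u(1,2) by simp
    hence "p \<cdot> u = zm (dom u) (cod p)" using u M S' B' BA by simp
    then obtain w where w: "w \<in> Arr \<A>" "dom w = dom u" "cod w = dom i" "i \<cdot> w = u"
      using is_kernel_lift[OF S(1), of u] u M S by auto
    have "i' \<cdot> w = x \<cdot> u" using reassoc[OF e(1), of w] w M(1-9) S by simp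
    hence "i' \<cdot> w = zm (dom w) (cod i')" using u w M by simp
    hence "w = zm (dom u) B"
      using monic_zeroD[OF S'(3), of w] w B' BA by simp
    hence "i \<cdot> w = zm (dom u) (dom x)" using S u M BA by simp
    thus "u = zm (dom u) (dom x)" unfolding w(4) .
  qed
  have epi: "epic \<A> x"
  proof (rule epicI[OF M(4)])
    fix u assume u: "u \<in> Arr \<A>" "dom u = cod x" "u \<cdot> x = zm (dom x) (cod u)"
    have "u \<cdot> i' = (u \<cdot> x) \<cdot> i" using e(1) M S S' u(1,2) by simp
    hence "u \<cdot> i' = zm (dom i') (cod u)" using u M S B' BA by simp
    then obtain w where w: "w \<in> Arr \<A>" "cod w = cod u" "dom w = cod p'" "w \<cdot> p' = u"
      using is_cokernel_lift[OF S'(2), of u] u M S' by auto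
    have "w \<cdot> p = u \<cdot> x" using reassoc[OF w(4), of x] w M S S' e(2) by simp
    hence "w \<cdot> p = zm (dom p) (cod w)" using u w M S by simp
    hence "w = zm A (cod u)"
      using epic_zeroD[OF S(4), of w] w B' BA by simp
    hence "w \<cdot> p' = zm (cod x) (cod u)" using S' u M B' by simp
    thus "u = zm (cod x) (cod u)" unfolding w(4) .
  qed
  obtain y where y: "y \<in> Arr \<A>" "dom y = cod x" "cod y = dom x"
    "y \<cdot> x = ide (dom x)" "x \<cdot> y = ide (cod x)"
    by (rule monic_epic_iso[OF mon epi])
  have "y \<cdot> i' = i" using reassoc[OF y(4), of i] e(1) y M S by simp
  moreover have "p \<cdot> y = p'" using reassoc[OF e(2), of y] y M S S' by simp
  ultimately have "ses_map \<A> (ide B) y (ide A) i' p' i p"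
    unfolding ses_map_def Hom_iff using y M B B' BA S S' by simp
  thus ?thesis using that y M by simp
qed

lemma epic_cmp:
  assumes "epic \<A> f" "epic \<A> g" "cod f = dom g"
  shows "epic \<A> (g \<cdot> f)"
proof (rule epicI)
  note F = epic_arr[OF assms(1)] epic_arr[OF assms(2)]
  show "g \<cdot> f \<in> Arr \<A>" using F assms by simp
  fix u assume u: "u \<in> Arr \<A>" "dom u = cod (g \<cdot> f)" "u \<cdot> (g \<cdot> f) = zm (dom (g \<cdot> f)) (cod u)"
  have "(u \<cdot> g) \<cdot> f = zm (dom f) (cod u)" using u F assms by simp
  hence "u \<cdot> g = zm (cod f) (cod (u \<cdot> g))"
    by (intro epic_zeroD[OF assms(1)]) (use u F assms in auto)
  hence "u = zm (cod g) (cod u)"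
    by (intro epic_zeroD[OF assms(2)]) (use u F assms in auto)
  thus "u = zm (cod (g \<cdot> f)) (cod u)" using F assms by simp
qed

lemma ses_map_pullback:
  assumes se: "short_exact \<A> i p" and c: "c \<in> Arr \<A>" "cod c = cod p"
  obtains i' p' y where "short_exact \<A> i' p'" "ses_map \<A> (ide (dom i)) y c i' p' i p"
    "dom i' = dom i" "cod p' = dom c" "is_pullback \<A> p c p' y"
proof -
  note S = short_exactD[OF se]
  obtain p' y where pb: "is_pullback \<A> p c p' y" using ex_pullback[of p c] S c by metis
  note P = is_pullbackD[OF pb]
  obtain i' where i': "i' \<in> Arr \<A>" "cod i' = dom p'" "dom i' = dom i" "p' \<cdot> i' = zm (dom i) (dom c)" "y \<cdot> i' = i"
    using is_pullback_lift[OF pb, of "zm (dom i) (dom c)" i] P S by auto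
  have "short_exact \<A> i' p'"
    by (rule pullback_short_exact[OF se pb]) (use i' P S in auto)
  moreover have "ses_map \<A> (ide (dom i)) y c i' p' i p"
    unfolding ses_map_def Hom_iff using i' P S by auto
  ultimately show ?thesis using that i' P pb by metis
qed

text \<open>The arrow w compares the given sequence with an actual pull-back along c and is the
  identity on both ends. By \<open>short_five\<close> it is invertible, and the universal property
  is carried over along its inverse v.\<close>

lemma ses_map_is_pullback:
  assumes m: "ses_map \<A> (ide B) x c i p i' p'" and se: "short_exact \<A> i p" "short_exact \<A> i' p'"
    and B: "dom i = B"
  shows "is_pullback \<A> p' c p x"
proof -
  note M = ses_mapD[OF m] and S = short_exactD[OF se(1)] and S' = short_exactD[OF se(2)]
  have BO: "B \<in> Obj \<A>" using B S by auto
  have B': "dom i' = B" using M(3) BO by simp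
  obtain i'' d y where s2: "short_exact \<A> i'' d" and m2: "ses_map \<A> (ide (dom i')) y c i'' d i' p'"
    and ii: "dom i'' = dom i'" "cod d = dom c" and pb: "is_pullback \<A> p' c d y"
    by (rule ses_map_pullback[OF se(2), of c]) (use M in auto)
  note M2 = ses_mapD[OF m2] and S2 = short_exactD[OF s2] and P = is_pullbackD[OF pb]
  obtain w where w: "w \<in> Arr \<A>" "cod w = dom d" "dom w = dom p" "d \<cdot> w = p" "y \<cdot> w = x"
    by (rule is_pullback_lift[OF pb, of p x]) (use P M S S' in auto)
  have e1: "y \<cdot> i'' = i'" "x \<cdot> i = i'" using M(10) M2(10) S'(5) B' by simp_all
  have "w \<cdot> i = i''"
  proof (rule is_pullback_ext[OF pb])
    show "d \<cdot> (w \<cdot> i) = d \<cdot> i''" using reassoc[OF w(4), of i] w S S2 P ii M B B' by simp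
    show "y \<cdot> (w \<cdot> i) = y \<cdot> i''" using reassoc[OF w(5), of i] w S S2 P ii M e1 by simp
  qed (use w S S2 P ii B B' in auto)
  hence "ses_map \<A> (ide B) w (ide (cod p)) i p i'' d"
    unfolding ses_map_def Hom_iff using w S S2 M ii B B' BO by auto
  from short_five[OF this se(1) s2 B refl] obtain v where
    v: "ses_map \<A> (ide B) v (ide (cod p)) i'' d i p" "v \<cdot> w = ide (cod i)" "w \<cdot> v = ide (cod i'')" .
  note V = ses_mapD[OF v(1)]
  have pv: "p \<cdot> v = d" using V S2 S ii M by simp
  have xv: "x \<cdot> v = y" using reassoc[OF w(5), of v] v(3) w(1-3) V(4-6) S2(5-7) P(3,4,7,8) S(7) by simp
  show ?thesis
  proof (rule is_pullbackI)
    fix u u' assume u: "u \<in> Arr \<A>" "u' \<in> Arr \<A>" "cod u = dom c" "cod u' = dom p'"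
      "dom u = dom u'" "c \<cdot> u = p' \<cdot> u'"
    obtain z where z: "z \<in> Arr \<A>" "cod z = dom d" "dom z = dom u" "d \<cdot> z = u" "y \<cdot> z = u'"
      by (rule is_pullback_lift[OF pb, of u u']) (use u in auto)
    show "\<exists>w. w \<in> Arr \<A> \<and> cod w = dom p \<and> dom w = dom u \<and> p \<cdot> w = u \<and> x \<cdot> w = u'"
      using reassoc[OF pv, of z] reassoc[OF xv, of z] z V S S2 M by (intro exI[of _ "v \<cdot> z"]) auto
  next
    fix u u' assume u: "u \<in> Arr \<A>" "u' \<in> Arr \<A>" "cod u = dom p" "cod u' = dom p"
      "dom u = dom u'" "p \<cdot> u = p \<cdot> u'" "x \<cdot> u = x \<cdot> u'"
    have "w \<cdot> u = w \<cdot> u'"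
    proof (rule is_pullback_ext[OF pb])
      show "d \<cdot> (w \<cdot> u) = d \<cdot> (w \<cdot> u')" using reassoc[OF w(4), of u] reassoc[OF w(4), of u'] u w P by simp
      show "y \<cdot> (w \<cdot> u) = y \<cdot> (w \<cdot> u')" using reassoc[OF w(5), of u] reassoc[OF w(5), of u'] u w P by simp
    qed (use u w in auto)
    hence "v \<cdot> (w \<cdot> u) = v \<cdot> (w \<cdot> u')" by simp
    thus "u = u'" using reassoc[OF v(2), of u] reassoc[OF v(2), of u'] u w V S S2 by simp
  qed (use M S S' in auto)
qed

text \<open>All three sequences end in A. The middle term of the new one is the pull-back of the two
  middle arrows y1 and y2, its left term the pull-back of h and k. That h is epic makes y1 epic, so
  that the projection from the new middle term to A stays epic.\<close>

lemma short_exact_pullback_middle: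
  assumes se1: "short_exact \<A> i1 p1" and se2: "short_exact \<A> i2 p2" and se: "short_exact \<A> i p"
    and m1: "ses_map \<A> h y1 (ide A) i1 p1 i p" and m2: "ses_map \<A> k y2 (ide A) i2 p2 i p"
    and A: "cod p = A" and pb: "is_pullback \<A> h k q2 q1" and ep: "epic \<A> h"
  obtains i3 p3 r1 r2 where "short_exact \<A> i3 p3" "dom i3 = dom q1" "cod p3 = A"
    "ses_map \<A> q1 r1 (ide A) i3 p3 i1 p1" "ses_map \<A> q2 r2 (ide A) i3 p3 i2 p2"
proof -
  note M1 = ses_mapD(1-9)[OF m1] and M2 = ses_mapD(1-9)[OF m2]
    and N1 = ses_mapD(10,11)[OF m1] and N2 = ses_mapD(10,11)[OF m2] and S1 = short_exactD[OF se1] and S2 = short_exactD[OF se2]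
    and S = short_exactD[OF se] and Q = is_pullbackD[OF pb]
  have AO: "A \<in> Obj \<A>" using A S by auto
  have A': "cod p1 = A" "cod p2 = A" using M1(8) M2(8) AO by auto
  have py: "p \<cdot> y1 = p1" "p \<cdot> y2 = p2" using N1 N2 A' S1 S2 by simp_all
  obtain r2 r1 where pb2: "is_pullback \<A> y1 y2 r2 r1" using ex_pullback[of y1 y2] M1 M2 by metis
  note R = is_pullbackD[OF pb2]
  have "y2 \<cdot> (i2 \<cdot> q2) = y1 \<cdot> (i1 \<cdot> q1)"
    using reassoc[OF N1(1)[symmetric], of q1] reassoc[OF N2(1)[symmetric], of q2] Q(9) M1 M2 S1 S2 S Q by simp
  then obtain i3 where i3: "i3 \<in> Arr \<A>" "cod i3 = dom r2" "dom i3 = dom q2" "r2 \<cdot> i3 = i2 \<cdot> q2" "r1 \<cdot> i3 = i1 \<cdot> q1"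
    using is_pullback_lift[OF pb2, of "i2 \<cdot> q2" "i1 \<cdot> q1"] M1 M2 S1 S2 S Q by auto
  define p3 where "p3 = p2 \<cdot> r2"
  have p3: "p3 \<in> Arr \<A>" "dom p3 = dom r2" "cod p3 = A" using R S2 M2 A' by (auto simp: p3_def)
  have p3': "p3 = p1 \<cdot> r1"
    unfolding p3_def using reassoc[OF py(1), of r1] reassoc[OF py(2), of r2] R M1 M2 S by simp
  have ey: "epic \<A> y1"
  proof (rule epicI[OF M1(4)])
    fix u assume u: "u \<in> Arr \<A>" "dom u = cod y1" "u \<cdot> y1 = zm (dom y1) (cod u)"
    have "(u \<cdot> i) \<cdot> h = (u \<cdot> y1) \<cdot> i1" using u(1,2) M1 N1 S S1 by simp
    hence "(u \<cdot> i) \<cdot> h = zm (dom h) (cod (u \<cdot> i))" using u M1 S S1 by simp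
    hence "u \<cdot> i = zm (cod h) (cod (u \<cdot> i))"
      by (intro epic_zeroD[OF ep]) (use u M1 S in auto)
    hence "u \<cdot> i = zm (dom i) (cod u)" using u M1 S by simp
    then obtain w where w: "w \<in> Arr \<A>" "cod w = cod u" "dom w = cod p" "w \<cdot> p = u"
      using is_cokernel_lift[OF S(2), of u] u M1 S by auto
    have "w \<cdot> p1 = u \<cdot> y1" using reassoc[OF w(4), of y1] w M1 S py by simp
    hence "w \<cdot> p1 = zm (dom p1) (cod w)" using u w M1 S1 by simp
    hence "w = zm A (cod u)"
      using epic_zeroD[OF S1(4), of w] w A A' by simp
    hence "w \<cdot> p = zm (cod y1) (cod u)" using S u M1 A by simp
    thus "u = zm (cod y1) (cod u)" unfolding w(4) .
  qed
  have "epic \<A> r2" by (rule pullback_epic[OF pb2 ey])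
  hence e3: "epic \<A> p3" unfolding p3_def by (rule epic_cmp) (use S2 R M2 in auto)
  have z3: "p3 \<cdot> i3 = zm (dom i3) A"
    unfolding p3_def using i3 R S2 M2 Q A' AO reassoc[OF S2(8), of q2] by simp
  have "is_kernel \<A> i3 p3"
  proof (rule is_kernelI)
    show "monic \<A> i3"
    proof (rule monicI[OF i3(1)])
      fix u assume u: "u \<in> Arr \<A>" "cod u = dom i3" "i3 \<cdot> u = zm (dom u) (cod i3)"
      have "i1 \<cdot> (q1 \<cdot> u) = r1 \<cdot> (i3 \<cdot> u)" "i2 \<cdot> (q2 \<cdot> u) = r2 \<cdot> (i3 \<cdot> u)"
        using reassoc[OF i3(5), of u] reassoc[OF i3(4), of u] i3 u(1,2) R Q M1 M2 S1 S2 by auto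
      hence e: "i1 \<cdot> (q1 \<cdot> u) = zm (dom (q1 \<cdot> u)) (cod i1)" "i2 \<cdot> (q2 \<cdot> u) = zm (dom (q2 \<cdot> u)) (cod i2)"
        using u i3 R Q M1 M2 S1 S2 by auto
      have "q1 \<cdot> u = zm (dom (q1 \<cdot> u)) (dom i1)" "q2 \<cdot> u = zm (dom (q2 \<cdot> u)) (dom i2)"
        using monic_zeroD[OF S1(3) e(1)] monic_zeroD[OF S2(3) e(2)] u(1,2) i3(1-3) Q(1-8) M1 M2 S1(5-7) S2(5-7) by simp_all
      thus "u = zm (dom u) (dom i3)"
        by (rule_tac is_pullback_ext[OF pb]) (use u i3 Q M1 M2 in auto)
    qed
    show "p3 \<cdot> i3 = zm (dom i3) (cod p3)" using z3 p3 by simp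
    fix u assume u: "u \<in> Arr \<A>" "cod u = dom p3" "p3 \<cdot> u = zm (dom u) (cod p3)"
    have pr: "p1 \<cdot> (r1 \<cdot> u) = zm (dom (r1 \<cdot> u)) (cod p1)" "p2 \<cdot> (r2 \<cdot> u) = zm (dom (r2 \<cdot> u)) (cod p2)"
      using u p3 reassoc[OF p3'[symmetric], of u] reassoc[OF p3_def[symmetric], of u] R M1 M2 S1 S2 A' by auto
    obtain w1 where w1: "w1 \<in> Arr \<A>" "dom w1 = dom u" "cod w1 = dom i1" "i1 \<cdot> w1 = r1 \<cdot> u"
      by (rule is_kernel_lift[OF S1(1), of "r1 \<cdot> u"]) (use u(1,2) pr p3 R(1-8) M1 S1(5-7) in auto)
    obtain w2 where w2: "w2 \<in> Arr \<A>" "dom w2 = dom u" "cod w2 = dom i2" "i2 \<cdot> w2 = r2 \<cdot> u"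
      by (rule is_kernel_lift[OF S2(1), of "r2 \<cdot> u"]) (use u(1,2) pr p3 R(1-8) M2 S2(5-7) in auto)
    have "i \<cdot> (h \<cdot> w1) = y1 \<cdot> (r1 \<cdot> u)" "i \<cdot> (k \<cdot> w2) = y2 \<cdot> (r2 \<cdot> u)"
      using reassoc[OF N1(1), of w1] reassoc[OF N2(1), of w2] w1 w2 S S1 S2 M1 M2 by auto
    moreover have "y1 \<cdot> (r1 \<cdot> u) = y2 \<cdot> (r2 \<cdot> u)" using reassoc[OF R(9), of u] R M1 M2 u p3 by simp
    ultimately have "i \<cdot> (h \<cdot> w1) = i \<cdot> (k \<cdot> w2)" by simp
    hence "h \<cdot> w1 = k \<cdot> w2"
      by (rule monicD[OF S(3)]) (use w1 w2 M1 M2 in auto)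
    then obtain w where w: "w \<in> Arr \<A>" "cod w = dom q2" "dom w = dom w2" "q2 \<cdot> w = w2" "q1 \<cdot> w = w1"
      using is_pullback_lift[OF pb, of w2 w1] w1 w2 M1 M2 by auto
    have "i3 \<cdot> w = u"
    proof (rule is_pullback_ext[OF pb2])
      show "r2 \<cdot> (i3 \<cdot> w) = r2 \<cdot> u" using reassoc[OF i3(4), of w] w w2 i3 R S2 M2 Q by simp
      show "r1 \<cdot> (i3 \<cdot> w) = r1 \<cdot> u" using reassoc[OF i3(5), of w] w w1 i3 R S1 M1 Q by simp
    qed (use w u w2 i3 p3 in auto)
    thus "\<exists>w. w \<in> Arr \<A> \<and> dom w = dom u \<and> cod w = dom i3 \<and> i3 \<cdot> w = u"
      using w w2 i3 by (intro exI[of _ w]) auto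
  qed (use p3 i3 in auto)
  hence "short_exact \<A> i3 p3" using short_exactI_epic e3 by blast
  moreover have "ses_map \<A> q1 r1 (ide A) i3 p3 i1 p1" "ses_map \<A> q2 r2 (ide A) i3 p3 i2 p2"
    unfolding ses_map_def Hom_iff using i3 p3 R(1-8) Q(1-8) M1 M2 A' AO S1(5-7) S2(5-7) by (simp_all add: p3'[symmetric] p3_def[symmetric])
  ultimately show ?thesis using that i3 p3 Q by metis
qed

text \<open>The arrow 1 - s p is killed by p, so it factors through i; the factor is a retraction
  because i is monic.\<close>

lemma section_retraction:
  assumes se: "short_exact \<A> i p" and s: "s \<in> Arr \<A>" "dom s = cod p" "cod s = cod i" "p \<cdot> s = ide (cod p)"
  obtains r where "r \<in> Arr \<A>" "dom r = cod i" "cod r = dom i" "r \<cdot> i = ide (dom i)"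
proof -
  note S = short_exactD[OF se]
  let ?e = "ide (cod i) \<boxplus> neg (s \<cdot> p)"
  have "p \<cdot> ?e = zm (dom ?e) (cod p)" using S s reassoc[OF s(4), of p] by simp
  then obtain r where r: "r \<in> Arr \<A>" "dom r = cod i" "cod r = dom i" "i \<cdot> r = ?e"
    using is_kernel_lift[OF S(1), of ?e] S s by auto
  have "r \<cdot> i = ide (dom i)"
    by (rule monicD[OF S(3)]) (use r S s reassoc[OF r(4), of i] in auto)
  thus ?thesis using that r by blast
qed

text \<open>An arrow with components u and v into the biproduct is killed by [f, d] exactly if f u =
  d (-v), that is, if u and -v form a cone over f and d. The sign in the kernel comes from there.
  That d is epic already makes [f, d] epic.\<close>

lemma copair_kernel:
  assumes d: "epic \<A> d" and f: "f \<in> Arr \<A>" "cod f = cod d" and pb: "is_pullback \<A> d f t1 t2"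
  shows "short_exact \<A> (pair t1 (neg t2)) (copair f d)"
proof (rule short_exactI_epic)
  note P = is_pullbackD[OF pb] and D = epic_arr[OF d]
  let ?X = "dom f" and ?Y = "dom d"
  have c: "copair f d \<in> Arr \<A>" "dom (copair f d) = bs ?X ?Y" "cod (copair f d) = cod d"
    "copair f d \<cdot> in2 ?X ?Y = d" using f D by auto
  have k: "pair t1 (neg t2) \<in> Arr \<A>" "dom (pair t1 (neg t2)) = dom t2" "cod (pair t1 (neg t2)) = bs ?X ?Y"
    "pr1 ?X ?Y \<cdot> pair t1 (neg t2) = t1" "pr2 ?X ?Y \<cdot> pair t1 (neg t2) = neg t2" using P by auto
  show "epic \<A> (copair f d)"
  proof (rule epicI[OF c(1)])
    fix u assume u: "u \<in> Arr \<A>" "dom u = cod (copair f d)" "u \<cdot> copair f d = zm (dom (copair f d)) (cod u)"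
    have "u \<cdot> d = (u \<cdot> copair f d) \<cdot> in2 ?X ?Y" using u(1,2) c f D by simp
    hence "u \<cdot> d = zm (dom d) (cod u)" using u c f D by simp
    thus "u = zm (cod (copair f d)) (cod u)" using epic_zeroD[OF d, of u] u c by simp
  qed
  show "is_kernel \<A> (pair t1 (neg t2)) (copair f d)"
  proof (rule is_kernelI)
    show "monic \<A> (pair t1 (neg t2))"
    proof (rule monicI[OF k(1)])
      fix u assume u: "u \<in> Arr \<A>" "cod u = dom (pair t1 (neg t2))"
        "pair t1 (neg t2) \<cdot> u = zm (dom u) (cod (pair t1 (neg t2)))"
      have "t1 \<cdot> u = pr1 ?X ?Y \<cdot> (pair t1 (neg t2) \<cdot> u)" "neg t2 \<cdot> u = pr2 ?X ?Y \<cdot> (pair t1 (neg t2) \<cdot> u)"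
        using reassoc[OF k(4), of u] reassoc[OF k(5), of u] k(1-3) u(1,2) P by auto
      hence "t1 \<cdot> u = zm (dom u) ?X" "neg (t2 \<cdot> u) = zm (dom u) ?Y"
        using u k P f D by auto
      moreover from this(2) have "t2 \<cdot> u = zm (dom u) ?Y" using u k P D
        by (metis neg_neg neg_zero cmp_simps(1) src_in_Obj)
      ultimately show "u = zm (dom u) (dom (pair t1 (neg t2)))"
        by (rule_tac is_pullback_ext[OF pb]) (use u k P in auto)
    qed
    show "copair f d \<cdot> pair t1 (neg t2) = zm (dom (pair t1 (neg t2))) (cod (copair f d))"
      using P f D by (subst copair_pair) auto
    fix u assume u: "u \<in> Arr \<A>" "cod u = dom (copair f d)" "copair f d \<cdot> u = zm (dom u) (cod (copair f d))"
    have "(f \<cdot> (pr1 ?X ?Y \<cdot> u)) \<boxplus> neg (d \<cdot> neg (pr2 ?X ?Y \<cdot> u)) = zm (dom u) (cod d)"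
      using copair_cmp[of f d u] u c f D by simp
    hence "f \<cdot> (pr1 ?X ?Y \<cdot> u) = d \<cdot> neg (pr2 ?X ?Y \<cdot> u)"
      by (rule_tac plus_neg_eq_zero) (use u c f D in auto)
    then obtain w where w: "w \<in> Arr \<A>" "cod w = dom t1" "dom w = dom u" "t1 \<cdot> w = pr1 ?X ?Y \<cdot> u" "t2 \<cdot> w = neg (pr2 ?X ?Y \<cdot> u)"
      using is_pullback_lift[OF pb, of "pr1 ?X ?Y \<cdot> u" "neg (pr2 ?X ?Y \<cdot> u)"] u c f D by auto
    have "pair t1 (neg t2) \<cdot> w = u"
    proof (rule biprod_ext[where X = ?X and Y = ?Y])
      show "pr1 ?X ?Y \<cdot> (pair t1 (neg t2) \<cdot> w) = pr1 ?X ?Y \<cdot> u" using reassoc[OF k(4), of w] w k P D f by simp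
      show "pr2 ?X ?Y \<cdot> (pair t1 (neg t2) \<cdot> w) = pr2 ?X ?Y \<cdot> u" using reassoc[OF k(5), of w] w k P D f u c by simp
    qed (use w(1-3) u(1,2) k(1-3) c(1-3) P(3,4,6-8) f D in simp_all)
    thus "\<exists>w. w \<in> Arr \<A> \<and> dom w = dom u \<and> cod w = dom (pair t1 (neg t2)) \<and> pair t1 (neg t2) \<cdot> w = u"
      using w k P by (intro exI[of _ w]) auto
  qed (use k c in auto)
qed

section \<open>Direct sums of arrows, diagonals and codiagonals\<close>

lemma dsum_eq: "dsum \<A> f g = ((in1 (cod f) (cod g) \<cdot> f) \<cdot> pr1 (dom f) (dom g)) \<boxplus>
    ((in2 (cod f) (cod g) \<cdot> g) \<cdot> pr2 (dom f) (dom g))"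
  by (simp add: dsum_def biprod_eq)

lemma dsum_simps [simp]:
  assumes "f \<in> Arr \<A>" "g \<in> Arr \<A>"
  shows "dsum \<A> f g \<in> Arr \<A>" "dom (dsum \<A> f g) = bs (dom f) (dom g)" "cod (dsum \<A> f g) = bs (cod f) (cod g)"
    "X = dom f \<Longrightarrow> Y = dom g \<Longrightarrow> dsum \<A> f g \<cdot> in1 X Y = in1 (cod f) (cod g) \<cdot> f"
    "X = dom f \<Longrightarrow> Y = dom g \<Longrightarrow> dsum \<A> f g \<cdot> in2 X Y = in2 (cod f) (cod g) \<cdot> g"
    "X = cod f \<Longrightarrow> Y = cod g \<Longrightarrow> pr1 X Y \<cdot> dsum \<A> f g = f \<cdot> pr1 (dom f) (dom g)"
    "X = cod f \<Longrightarrow> Y = cod g \<Longrightarrow> pr2 X Y \<cdot> dsum \<A> f g = g \<cdot> pr2 (dom f) (dom g)"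
  using assms by (simp_all add: dsum_eq)

lemma dsum_cmp:
  assumes "f \<in> Arr \<A>" "g \<in> Arr \<A>" "f' \<in> Arr \<A>" "g' \<in> Arr \<A>" "cod f = dom f'" "cod g = dom g'"
  shows "dsum \<A> (f' \<cdot> f) (g' \<cdot> g) = dsum \<A> f' g' \<cdot> dsum \<A> f g"
proof (rule biprod_ext[where X = "cod f'" and Y = "cod g'"])
  show "pr1 (cod f') (cod g') \<cdot> dsum \<A> (f' \<cdot> f) (g' \<cdot> g) = pr1 (cod f') (cod g') \<cdot> (dsum \<A> f' g' \<cdot> dsum \<A> f g)"
    using assms reassoc[OF dsum_simps(6)[OF assms(3,4) refl refl], of "dsum \<A> f g"] by simp
  show "pr2 (cod f') (cod g') \<cdot> dsum \<A> (f' \<cdot> f) (g' \<cdot> g) = pr2 (cod f') (cod g') \<cdot> (dsum \<A> f' g' \<cdot> dsum \<A> f g)"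
    using assms reassoc[OF dsum_simps(7)[OF assms(3,4) refl refl], of "dsum \<A> f g"] by simp
qed (use assms in auto)

lemma dsum_id:
  assumes "X \<in> Obj \<A>" "Y \<in> Obj \<A>"
  shows "dsum \<A> (ide X) (ide Y) = ide (bs X Y)"
  by (rule biprod_ext[where X = X and Y = Y]) (use assms in auto)

lemma dsum_zero:
  assumes "X \<in> Obj \<A>" "Y \<in> Obj \<A>" "X' \<in> Obj \<A>" "Y' \<in> Obj \<A>"
  shows "dsum \<A> (zm X Y) (zm X' Y') = zm (bs X X') (bs Y Y')"
  by (rule biprod_ext[where X = Y and Y = Y']) (use assms in auto)

lemma diag_eq: "diag \<A> X = in1 X X \<boxplus> in2 X X"
  by (simp add: diag_def biprod_eq)

lemma codiag_eq: "codiag \<A> X = pr1 X X \<boxplus> pr2 X X"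
  by (simp add: codiag_def biprod_eq)

lemma diag_simps [simp]:
  assumes "X \<in> Obj \<A>"
  shows "diag \<A> X \<in> Arr \<A>" "dom (diag \<A> X) = X" "cod (diag \<A> X) = bs X X"
    "pr1 X X \<cdot> diag \<A> X = ide X" "pr2 X X \<cdot> diag \<A> X = ide X"
    "codiag \<A> X \<in> Arr \<A>" "dom (codiag \<A> X) = bs X X" "cod (codiag \<A> X) = X"
    "codiag \<A> X \<cdot> in1 X X = ide X" "codiag \<A> X \<cdot> in2 X X = ide X"
  using assms by (simp_all add: diag_eq codiag_eq)

lemma dsum_diag:
  assumes "f \<in> Arr \<A>"
  shows "dsum \<A> f f \<cdot> diag \<A> (dom f) = diag \<A> (cod f) \<cdot> f"
  using assms by (simp add: diag_eq)

lemma dsum_codiag: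
  assumes "f \<in> Arr \<A>"
  shows "codiag \<A> (cod f) \<cdot> dsum \<A> f f = f \<cdot> codiag \<A> (dom f)"
  using assms by (simp add: codiag_eq)

text \<open>Addition of arrows is brought into the shape of the Baer sum: diagonal, direct sum,
  codiagonal. This links the two additions in \<open>push_plus\<close> and
  \<open>pull_plus\<close>.\<close>

lemma codiag_dsum_diag:
  assumes "f \<in> Arr \<A>" "g \<in> Arr \<A>" "dom f = dom g" "cod f = cod g"
  shows "codiag \<A> (cod g) \<cdot> (dsum \<A> f g \<cdot> diag \<A> (dom g)) = f \<boxplus> g"
  using assms by (simp add: codiag_eq diag_eq)

lemma dsum_short_exact:
  assumes se: "short_exact \<A> i p" "short_exact \<A> i' p'"
  shows "short_exact \<A> (dsum \<A> i i') (dsum \<A> p p')"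
proof (rule short_exactI_epic)
  note S = short_exactD[OF se(1)] and S' = short_exactD[OF se(2)]
  let ?X = "dom p" and ?Y = "dom p'" and ?A = "cod p" and ?A' = "cod p'" and ?B = "dom i" and ?B' = "dom i'"
  note T = S(5-7) S'(5-7)
  have O: "?X \<in> Obj \<A>" "?Y \<in> Obj \<A>" "?A \<in> Obj \<A>" "?A' \<in> Obj \<A>" "?B \<in> Obj \<A>" "?B' \<in> Obj \<A>" using T by auto
  show "epic \<A> (dsum \<A> p p')"
  proof (rule epicI)
    fix u assume u: "u \<in> Arr \<A>" "dom u = cod (dsum \<A> p p')" "u \<cdot> dsum \<A> p p' = zm (dom (dsum \<A> p p')) (cod u)"
    have "(u \<cdot> in1 ?A ?A') \<cdot> p = (u \<cdot> dsum \<A> p p') \<cdot> in1 ?X ?Y" "(u \<cdot> in2 ?A ?A') \<cdot> p' = (u \<cdot> dsum \<A> p p') \<cdot> in2 ?X ?Y"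
      using u(1,2) T O by auto
    hence "(u \<cdot> in1 ?A ?A') \<cdot> p = zm (dom p) (cod (u \<cdot> in1 ?A ?A'))"
      "(u \<cdot> in2 ?A ?A') \<cdot> p' = zm (dom p') (cod (u \<cdot> in2 ?A ?A'))" using u T O by auto
    hence "u \<cdot> in1 ?A ?A' = zm ?A (cod u)" "u \<cdot> in2 ?A ?A' = zm ?A' (cod u)"
      using epic_zeroD[OF S(4), of "u \<cdot> in1 ?A ?A'"] epic_zeroD[OF S'(4), of "u \<cdot> in2 ?A ?A'"] u T O by auto
    thus "u = zm (cod (dsum \<A> p p')) (cod u)"
      by (rule_tac biprod_coext[where X = ?A and Y = ?A']) (use u T O in auto)
  qed (use T in auto)
  show "is_kernel \<A> (dsum \<A> i i') (dsum \<A> p p')"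
  proof (rule is_kernelI)
    show "monic \<A> (dsum \<A> i i')"
    proof (rule monicI)
      fix u assume u: "u \<in> Arr \<A>" "cod u = dom (dsum \<A> i i')" "dsum \<A> i i' \<cdot> u = zm (dom u) (cod (dsum \<A> i i'))"
      have "i \<cdot> (pr1 ?B ?B' \<cdot> u) = pr1 ?X ?Y \<cdot> (dsum \<A> i i' \<cdot> u)" "i' \<cdot> (pr2 ?B ?B' \<cdot> u) = pr2 ?X ?Y \<cdot> (dsum \<A> i i' \<cdot> u)"
        using u(1,2) T O reassoc[OF dsum_simps(6)[of i i' ?X ?Y], of u] reassoc[OF dsum_simps(7)[of i i' ?X ?Y], of u] by auto
      hence "i \<cdot> (pr1 ?B ?B' \<cdot> u) = zm (dom (pr1 ?B ?B' \<cdot> u)) (cod i)"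
        "i' \<cdot> (pr2 ?B ?B' \<cdot> u) = zm (dom (pr2 ?B ?B' \<cdot> u)) (cod i')" using u T O by auto
      hence "pr1 ?B ?B' \<cdot> u = zm (dom u) ?B" "pr2 ?B ?B' \<cdot> u = zm (dom u) ?B'"
        using monic_zeroD[OF S(3), of "pr1 ?B ?B' \<cdot> u"] monic_zeroD[OF S'(3), of "pr2 ?B ?B' \<cdot> u"] u T O by auto
      thus "u = zm (dom u) (dom (dsum \<A> i i'))"
        by (rule_tac biprod_ext[where X = ?B and Y = ?B']) (use u T O in auto)
    qed (use T in auto)
    show "dsum \<A> p p' \<cdot> dsum \<A> i i' = zm (dom (dsum \<A> i i')) (cod (dsum \<A> p p'))"
      using dsum_cmp[of i i' p p'] T O by (simp add: S(8) S'(8) dsum_zero)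
    fix u assume u: "u \<in> Arr \<A>" "cod u = dom (dsum \<A> p p')" "dsum \<A> p p' \<cdot> u = zm (dom u) (cod (dsum \<A> p p'))"
    have "p \<cdot> (pr1 ?X ?Y \<cdot> u) = pr1 ?A ?A' \<cdot> (dsum \<A> p p' \<cdot> u)" "p' \<cdot> (pr2 ?X ?Y \<cdot> u) = pr2 ?A ?A' \<cdot> (dsum \<A> p p' \<cdot> u)"
      using u(1,2) T O reassoc[OF dsum_simps(6)[of p p' ?A ?A'], of u] reassoc[OF dsum_simps(7)[of p p' ?A ?A'], of u] by auto
    hence z: "p \<cdot> (pr1 ?X ?Y \<cdot> u) = zm (dom (pr1 ?X ?Y \<cdot> u)) (cod p)"
        "p' \<cdot> (pr2 ?X ?Y \<cdot> u) = zm (dom (pr2 ?X ?Y \<cdot> u)) (cod p')" using u T O by auto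
    obtain w where w: "w \<in> Arr \<A>" "dom w = dom u" "cod w = ?B" "i \<cdot> w = pr1 ?X ?Y \<cdot> u"
      by (rule is_kernel_lift[OF S(1), of "pr1 ?X ?Y \<cdot> u"]) (use u(1,2) z T O in auto)
    obtain w' where w': "w' \<in> Arr \<A>" "dom w' = dom u" "cod w' = ?B'" "i' \<cdot> w' = pr2 ?X ?Y \<cdot> u"
      by (rule is_kernel_lift[OF S'(1), of "pr2 ?X ?Y \<cdot> u"]) (use u(1,2) z T O in auto)
    note w = w w'
    have "dsum \<A> i i' \<cdot> pair w w' = u"
    proof (rule biprod_ext[where X = ?X and Y = ?Y])
      show "pr1 ?X ?Y \<cdot> (dsum \<A> i i' \<cdot> pair w w') = pr1 ?X ?Y \<cdot> u"
        using reassoc[OF dsum_simps(6)[of i i' ?X ?Y], of "pair w w'"] w T O by simp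
      show "pr2 ?X ?Y \<cdot> (dsum \<A> i i' \<cdot> pair w w') = pr2 ?X ?Y \<cdot> u"
        using reassoc[OF dsum_simps(7)[of i i' ?X ?Y], of "pair w w'"] w T O by simp
    qed (use u(1,2) w(1-3,5-7) T O in simp_all)
    thus "\<exists>w. w \<in> Arr \<A> \<and> dom w = dom u \<and> cod w = dom (dsum \<A> i i') \<and> dsum \<A> i i' \<cdot> w = u"
      using w T by (intro exI[of _ "pair w w'"]) auto
  qed (use T in auto)
qed

end

section \<open>Push-out and pull-back of extension classes\<close>

text \<open>\<open>emor \<A> g h E E'\<close>: there is a morphism of sequences \<open>E \<rightarrow> E'\<close> with outer components \<open>g\<close> and \<open>h\<close>. Only the
  sources of the components are recorded; the targets are forced by \<open>path\<close>.\<close>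

fun emor :: "('o, 'm) addcat \<Rightarrow> 'm \<Rightarrow> 'm \<Rightarrow> 'm list \<Rightarrow> 'm list \<Rightarrow> bool" where
  "emor \<A> g h [] [] \<longleftrightarrow> g = h"
| "emor \<A> g h (d # ds) (d' # ds') \<longleftrightarrow> g \<in> Hom \<A> (src \<A> d) (src \<A> d') \<and>
     (\<exists>x. cmp \<A> d' g = cmp \<A> x d \<and> emor \<A> x h ds ds')"
| "emor \<A> g h _ _ \<longleftrightarrow> False"

fun path :: "('o, 'm) addcat \<Rightarrow> 'o \<Rightarrow> 'm list \<Rightarrow> 'o \<Rightarrow> bool" where
  "path \<A> B [] A \<longleftrightarrow> B = A"
| "path \<A> B (d # ds) A \<longleftrightarrow> d \<in> Arr \<A> \<and> src \<A> d = B \<and> path \<A> (tgt \<A> d) ds A"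

text \<open>The splice behind the Yoneda product: the deflation that ends E, followed by the
  inflation that starts F, becomes one arrow.\<close>

definition yo :: "('o, 'm) addcat \<Rightarrow> 'm list \<Rightarrow> 'm list \<Rightarrow> 'm list" where
  "yo \<A> E F = butlast E @ cmp \<A> (hd F) (last E) # tl F"

lemma emor_length: "emor \<A> g h E E' \<Longrightarrow> length E' = length E"
  by (induction \<A> g h E E' rule: emor.induct) auto

lemma seq_map_iff_emor: "seq_map \<A> A B E E' \<longleftrightarrow> emor \<A> (idm \<A> B) (idm \<A> A) E E'"
proof -
  \<comment> \<open>Arbitrary outer components are needed: peeling off one square replaces the left
    component by the next vertical arrow.\<close>
  have "(length E' = length E \<and> (\<exists>vs. length vs = Suc (length E) \<and> hd vs = g \<and> last vs = h \<and>
        (\<forall>k < length E. vs ! k \<in> Hom \<A> (src \<A> (E ! k)) (src \<A> (E' ! k)) \<and>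
           cmp \<A> (E' ! k) (vs ! k) = cmp \<A> (vs ! Suc k) (E ! k)))) \<longleftrightarrow> emor \<A> g h E E'" (is "?L g E E' \<longleftrightarrow> _") for g h
  proof (induction \<A> g h E E' rule: emor.induct)
    case (1 \<A> g h)
    have "\<exists>vs. length vs = Suc 0 \<and> hd vs = g \<and> last vs = h" if "g = h"
      using that by (intro exI[of _ "[g]"]) auto
    moreover have "g = h" if "length vs = Suc 0" "hd vs = g" "last vs = h" for vs
      using that by (cases vs) auto
    ultimately show ?case by auto
  next
    case (2 \<A> g h d ds d' ds')
    show ?case (is "?L \<longleftrightarrow> ?R")
    proof
      assume ?L
      then obtain vs where vs: "length ds' = length ds" "length vs = Suc (Suc (length ds))" "hd vs = g" "last vs = h"
        and st: "\<And>k. k < Suc (length ds) \<Longrightarrow> vs ! k \<in> Hom \<A> (src \<A> ((d # ds) ! k)) (src \<A> ((d' # ds') ! k)) \<and>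
           cmp \<A> ((d' # ds') ! k) (vs ! k) = cmp \<A> (vs ! Suc k) ((d # ds) ! k)" by auto
      obtain x ws where w: "vs = g # x # ws" using vs by (cases vs; cases "tl vs") auto
      have "emor \<A> x h ds ds'"
        unfolding 2[of x, symmetric]
        using vs w st[of "Suc k" for k] by (intro conjI exI[of _ "x # ws"]) (auto split: if_splits)
      thus ?R using st[of 0] w by auto
    next
      assume ?R
      then obtain x where x: "g \<in> Hom \<A> (src \<A> d) (src \<A> d')" "cmp \<A> d' g = cmp \<A> x d" "emor \<A> x h ds ds'" by auto
      from x(3) obtain vs where vs: "length ds' = length ds" "length vs = Suc (length ds)" "hd vs = x" "last vs = h"
        and st: "\<And>k. k < length ds \<Longrightarrow> vs ! k \<in> Hom \<A> (src \<A> (ds ! k)) (src \<A> (ds' ! k)) \<and>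
           cmp \<A> (ds' ! k) (vs ! k) = cmp \<A> (vs ! Suc k) (ds ! k)" unfolding 2[of x, symmetric] by auto
      have "vs ! 0 = x" using vs by (cases vs) auto
      have "length (g # vs) = Suc (length (d # ds)) \<and> hd (g # vs) = g \<and> last (g # vs) = h \<and>
        (\<forall>k < length (d # ds). (g # vs) ! k \<in> Hom \<A> (src \<A> ((d # ds) ! k)) (src \<A> ((d' # ds') ! k)) \<and>
           cmp \<A> ((d' # ds') ! k) ((g # vs) ! k) = cmp \<A> ((g # vs) ! Suc k) ((d # ds) ! k))"
      proof (intro conjI allI impI)
        show "last (g # vs) = h" using vs by auto
        fix k assume "k < length (d # ds)"
        thus "(g # vs) ! k \<in> Hom \<A> (src \<A> ((d # ds) ! k)) (src \<A> ((d' # ds') ! k))"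
          "cmp \<A> ((d' # ds') ! k) ((g # vs) ! k) = cmp \<A> ((g # vs) ! Suc k) ((d # ds) ! k)"
          using st[of "k - 1"] x \<open>vs ! 0 = x\<close> by (cases k; simp)+
      qed (use vs in auto)
      thus ?L using vs by (metis length_Cons)
    qed
  qed auto
  from this[of "idm \<A> B" "idm \<A> A"] show ?thesis unfolding seq_map_def by blast
qed

lemma emor_append:
  "length E = length E' \<Longrightarrow> emor \<A> g h (E @ F) (E' @ F') \<longleftrightarrow> (\<exists>x. emor \<A> g x E E' \<and> emor \<A> x h F F')"
  by (induction E E' arbitrary: g rule: list_induct2) auto

lemma path_append: "path \<A> B (E @ F) A \<longleftrightarrow> (\<exists>Z. path \<A> B E Z \<and> path \<A> Z F A)"
  by (induction E arbitrary: B) auto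

lemma path_unique: "path \<A> B E A \<Longrightarrow> path \<A> B' E A' \<Longrightarrow> E \<noteq> [] \<Longrightarrow> B = B' \<and> A = A'"
proof (induction E arbitrary: B B')
  case (Cons d E)
  thus ?case by (cases E) auto
qed auto

lemma path_opcat: "path \<A> B E A \<Longrightarrow> path (opcat \<A>) A (rev E) B"
  by (induction E arbitrary: B) (auto simp: path_append)

context preadditive_category
begin

lemma emor_src:
  assumes "emor \<A> g h E E'" "path \<A> B E A" "path \<A> B' E' A'" "h \<in> Hom \<A> A A'"
  shows "g \<in> Hom \<A> B B'"
  using assms by (cases E; cases E') auto

lemma emor_cmp:
  assumes "emor \<A> g h E E'" "emor \<A> g' h' E' E''" "path \<A> B E A" "path \<A> B' E' A'" "path \<A> B'' E'' A''"
    "h \<in> Hom \<A> A A'" "h' \<in> Hom \<A> A' A''"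
  shows "emor \<A> (g' \<cdot> g) (h' \<cdot> h) E E''"
  using assms
proof (induction E arbitrary: E' E'' g g' B B' B'')
  case Nil
  thus ?case by (cases E'; cases E'') auto
next
  case (Cons d ds)
  obtain d' ds' d'' ds'' where e: "E' = d' # ds'" "E'' = d'' # ds''"
    using Cons.prems by (cases E'; cases E'') auto
  obtain x where x: "d' \<cdot> g = x \<cdot> d" "emor \<A> x h ds ds'" using Cons.prems e by auto
  obtain x' where x': "d'' \<cdot> g' = x' \<cdot> d'" "emor \<A> x' h' ds' ds''" using Cons.prems e by auto
  have t: "x \<in> Hom \<A> (cod d) (cod d')" using emor_src[OF x(2)] Cons.prems e by auto
  have t': "x' \<in> Hom \<A> (cod d') (cod d'')" using emor_src[OF x'(2)] Cons.prems e by auto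
  have g: "g \<in> Hom \<A> (dom d) (dom d')" "g' \<in> Hom \<A> (dom d') (dom d'')"
    and d: "d \<in> Arr \<A>" "d' \<in> Arr \<A>" "d'' \<in> Arr \<A>" using Cons.prems e by auto
  have "d'' \<cdot> (g' \<cdot> g) = (x' \<cdot> x) \<cdot> d"
    using reassoc[OF x'(1), of g] x(1) g d t t' by (simp add: Hom_iff)
  moreover have "emor \<A> (x' \<cdot> x) (h' \<cdot> h) ds ds''"
    by (rule Cons.IH[OF x(2) x'(2)]) (use Cons.prems e in auto)
  ultimately show ?case using g e by (auto simp: Hom_iff)
qed

lemma emor_id: "path \<A> B E A \<Longrightarrow> A \<in> Obj \<A> \<Longrightarrow> emor \<A> (ide B) (ide A) E E"
proof (induction E arbitrary: B)
  case (Cons d ds)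
  hence "emor \<A> (ide (cod d)) (ide A) ds ds" by auto
  moreover have "d \<cdot> ide B = ide (cod d) \<cdot> d" using Cons.prems by auto
  ultimately show ?case unfolding emor.simps Hom_iff using Cons.prems
    by (intro conjI exI[of _ "ide (cod d)"]) auto
qed auto

text \<open>Comparing push-out and pull-back along this morphism shows that pull-back along zero
  gives the neutral class, see \<open>pull_zero\<close>.\<close>

lemma emor_zero:
  "path \<A> B E A \<Longrightarrow> path \<A> B' E' A' \<Longrightarrow> A \<in> Obj \<A> \<Longrightarrow> A' \<in> Obj \<A> \<Longrightarrow> length E = length E' \<Longrightarrow>
    emor \<A> (zm B B') (zm A A') E E'"
proof (induction E arbitrary: B B' E')
  case (Cons d ds)
  then obtain d' ds' where e: "E' = d' # ds'" by (cases E') auto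
  have "emor \<A> (zm (cod d) (cod d')) (zm A A') ds ds'"
    by (rule Cons.IH) (use Cons.prems e in auto)
  moreover have "d' \<cdot> zm B B' = zm (cod d) (cod d') \<cdot> d" using Cons.prems e by auto
  ultimately show ?case unfolding e emor.simps Hom_iff using Cons.prems e
    by (intro conjI exI[of _ "zm (cod d) (cod d')"]) auto
qed auto

lemma emor_opcat:
  assumes "emor \<A> g h E E'" "path \<A> B E A" "path \<A> B' E' A'" "h \<in> Hom \<A> A A'"
  shows "emor (opcat \<A>) h g (rev E') (rev E)"
  using assms
proof (induction E arbitrary: E' g B B')
  case Nil
  thus ?case by (cases E') auto
next
  case (Cons d ds)
  then obtain d' ds' where e: "E' = d' # ds'" by (cases E') auto
  obtain x where x: "d' \<cdot> g = x \<cdot> d" "emor \<A> x h ds ds'" using Cons.prems e by auto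
  have t: "x \<in> Hom \<A> (cod d) (cod d')" using emor_src[OF x(2)] Cons.prems e by auto
  have "emor (opcat \<A>) h x (rev ds') (rev ds)"
    by (rule Cons.IH[OF x(2)]) (use Cons.prems e in auto)
  moreover have "emor (opcat \<A>) x g [d'] [d]" using x t by auto
  ultimately show ?case using emor_length[OF x(2)] by (auto simp: e emor_append simp del: emor.simps)
qed

end

context extension_closed_subcategory
begin

section \<open>Sequences spliced from conflations and their push-outs\<close>

abbreviation "cf \<equiv> conflation \<A> \<C>"
abbreviation "xs \<equiv> ext_seq \<A> \<C>"
abbreviation "cls \<equiv> ext_class \<A> \<C>"
abbreviation "EC \<equiv> ext_carrier \<A> \<C>"
abbreviation "pu \<equiv> push \<A> \<C>"
abbreviation "pl \<equiv> pull \<A> \<C>"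

lemma obj [simp]: "X \<in> \<C> \<Longrightarrow> X \<in> Obj \<A>"
  using sub_Obj by blast

lemma cfI: "short_exact \<A> i p \<Longrightarrow> dom i \<in> \<C> \<Longrightarrow> cod p \<in> \<C> \<Longrightarrow> cf i p"
  unfolding conflation_def using extension_closed by blast

lemma cfD:
  assumes "cf i p"
  shows "short_exact \<A> i p" "dom i \<in> \<C>" "cod p \<in> \<C>" "dom p \<in> \<C>" "i \<in> Arr \<A>" "p \<in> Arr \<A>" "cod i = dom p"
    "p \<cdot> i = zm (dom i) (cod p)"
  using assms short_exactD[of i p] unfolding conflation_def by auto

lemma cf_opcat [simp]: "conflation (opcat \<A>) \<C> p i \<longleftrightarrow> cf i p"
  unfolding conflation_def using short_exactD(7)[of i p] by auto

lemma xs_path: "xs t A B E \<Longrightarrow> path \<A> B E A"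
proof (induction rule: ext_seq.induct)
  case (single i p)
  thus ?case using cfD[OF single] by simp
next
  case (splice i p t A d ds)
  thus ?case using cfD[OF splice(1)] by auto
qed

lemma xs_length: "xs t A B E \<Longrightarrow> length E = Suc t \<and> t \<ge> 1 \<and> A \<in> \<C> \<and> B \<in> \<C>"
  by (induction rule: ext_seq.induct) (auto dest: cfD)

lemma xs_cases:
  assumes "xs t A B E"
  obtains (single) i p where "t = 1" "E = [i, p]" "cf i p" "A = cod p" "B = dom i"
  | (splice) i p d ds t' where "t = Suc t'" "cf i p" "B = dom i" "xs t' A (cod p) (d # ds)" "ds \<noteq> []" "E = i # (d \<cdot> p) # ds"
  using assms
proof (cases rule: ext_seq.cases)
  case (splice i p t' d ds)
  have "ds \<noteq> []" using xs_length[OF splice(5)] by auto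
  thus ?thesis using that(2) splice by blast
qed (use that in blast)

lemma xs_unique: "xs t A B E \<Longrightarrow> xs t' A' B' E \<Longrightarrow> t = t' \<and> A = A' \<and> B = B'"
  using path_unique xs_path xs_length by (metis Suc_inject list.size(3) nat.distinct(1))

lemma xs_yo: "xs s Z B E \<Longrightarrow> xs t A Z F \<Longrightarrow> xs (s + t) A B (yo \<A> E F)"
proof (induction s Z B E arbitrary: F rule: ext_seq.induct)
  case (single i p)
  then obtain f F' where "F = f # F'" using xs_length[OF single(2)] by (cases F) auto
  thus ?case using ext_seq.splice[OF single(1)] single(2) by (simp add: yo_def)
next
  case (splice i p s Z d ds)
  have l: "length ds \<ge> 1" using xs_length[OF splice(2)] by auto
  then obtain ds' x where ds: "ds = ds' @ [x]" by (cases ds rule: rev_cases) auto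
  have e: "yo \<A> (d # ds) F = d # (ds' @ (hd F \<cdot> x) # tl F)" by (simp add: yo_def ds)
  have "xs (Suc (s + t)) A (dom i) (i # (d \<cdot> p) # (ds' @ (hd F \<cdot> x) # tl F))"
    by (rule ext_seq.splice[OF splice(1)]) (use splice.IH[OF splice.prems] e in simp)
  thus ?case by (simp add: yo_def ds)
qed

lemma xs_opcat: "xs t A B E \<Longrightarrow> ext_seq (opcat \<A>) \<C> t B A (rev E)"
proof (induction rule: ext_seq.induct)
  case (single i p)
  thus ?case using ext_seq.single[of "opcat \<A>" \<C> p i] by simp
next
  case (splice i p t A d ds)
  have 1: "ext_seq (opcat \<A>) \<C> 1 (dom i) (cod p) [p, i]"
    using ext_seq.single[of "opcat \<A>" \<C> p i] splice(1) by simp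
  from extension_closed_subcategory.xs_yo[OF opcat_ecs splice(3) 1] show ?case by (simp add: yo_def)
qed

lemma emor_single:
  assumes "cf i p" "cf i' p'" "h \<in> Hom \<A> (cod p) (cod p')"
  shows "emor \<A> g h [i, p] [i', p'] \<longleftrightarrow> (\<exists>x. ses_map \<A> g x h i p i' p')"
  using assms cfD(7) by (auto simp: ses_map_def)

text \<open>The component c at the splice is not part of the data of \<open>emor\<close>. It exists
  because p is the cokernel of i and p' x i = p' i' g = 0, and it fits the next square because p can
  be cancelled.\<close>

lemma emor_splice:
  assumes ip: "cf i p" "cf i' p'" and pa: "path \<A> (cod p) (d # ds) A" "path \<A> (cod p') (d' # ds') A'"
    and h: "h \<in> Hom \<A> A A'"
  shows "emor \<A> g h (i # (d \<cdot> p) # ds) (i' # (d' \<cdot> p') # ds') \<longleftrightarrow>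
    (\<exists>x c. ses_map \<A> g x c i p i' p' \<and> emor \<A> c h (d # ds) (d' # ds'))" (is "?L \<longleftrightarrow> ?R")
proof -
  note I = cfD[OF ip(1)] and I' = cfD[OF ip(2)]
  have d: "d \<in> Arr \<A>" "dom d = cod p" "d' \<in> Arr \<A>" "dom d' = cod p'"
    "path \<A> (cod d) ds A" "path \<A> (cod d') ds' A'" using pa by auto
  show ?thesis
  proof
    assume ?L
    then obtain x y where g: "g \<in> Hom \<A> (dom i) (dom i')" and x: "i' \<cdot> g = x \<cdot> i" "x \<in> Hom \<A> (dom (d \<cdot> p)) (dom (d' \<cdot> p'))"
      and y: "(d' \<cdot> p') \<cdot> x = y \<cdot> (d \<cdot> p)" "emor \<A> y h ds ds'" by auto
    have xt: "x \<in> Arr \<A>" "dom x = dom p" "cod x = dom p'" using x(2) d I I' by (auto simp: Hom_iff)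
    have yt: "y \<in> Arr \<A>" "dom y = cod d" "cod y = cod d'" using emor_src[OF y(2) d(5,6) h] by (auto simp: Hom_iff)
    have gt: "g \<in> Arr \<A>" "dom g = dom i" "cod g = dom i'" using g by (auto simp: Hom_iff)
    have "(p' \<cdot> x) \<cdot> i = zm (dom i) (cod (p' \<cdot> x))"
      using reassoc[OF I'(8), of g] x(1) xt gt I I' by simp
    then obtain c where c: "c \<in> Arr \<A>" "cod c = cod (p' \<cdot> x)" "dom c = cod p" "c \<cdot> p = p' \<cdot> x"
      by (rule_tac is_cokernel_lift[OF short_exactD(2)[OF I(1)], of "p' \<cdot> x"]) (use xt I I' in auto)
    have ct: "cod c = cod p'" using c xt I' by simp
    have "(d' \<cdot> c) \<cdot> p = (y \<cdot> d) \<cdot> p" using y(1) c d ct xt yt I I' by simp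
    hence "d' \<cdot> c = y \<cdot> d"
      by (rule epicD[OF short_exactD(4)[OF I(1)]]) (use c d ct xt yt I I' in auto)
    hence "emor \<A> c h (d # ds) (d' # ds')" using y(2) c ct d by (auto simp: Hom_iff)
    moreover have "ses_map \<A> g x c i p i' p'" unfolding ses_map_def Hom_iff using gt xt c ct x(1) I I' by simp
    ultimately show ?R by blast
  next
    assume ?R
    then obtain x c where m: "ses_map \<A> g x c i p i' p'" and e: "emor \<A> c h (d # ds) (d' # ds')" by blast
    note M = ses_mapD[OF m]
    obtain y where y: "d' \<cdot> c = y \<cdot> d" "emor \<A> y h ds ds'" using e by auto
    have yt: "y \<in> Arr \<A>" "dom y = cod d" "cod y = cod d'" using emor_src[OF y(2) d(5,6) h] by (auto simp: Hom_iff)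
    have "(d' \<cdot> p') \<cdot> x = y \<cdot> (d \<cdot> p)"
      using M(11) reassoc[OF y(1), of p] M(1-9) yt d I I' by simp
    thus ?L unfolding emor.simps Hom_iff using M y I I' d
      by (intro conjI exI[of _ x] exI[of _ y]) simp_all
  qed
qed

lemma pushout_cf:
  assumes ip: "cf i p" and po: "is_pushout \<A> i g i' x" and g: "cod g \<in> \<C>"
  obtains p' where "cf i' p'" "p' \<cdot> x = p" "cod p' = cod p" "ses_map \<A> g x (ide (cod p)) i p i' p'"
proof -
  note I = cfD[OF ip] and P = is_pushoutD[OF po]
  obtain e where e: "e \<in> Arr \<A>" "dom e = cod i'" "cod e = cod p" "e \<cdot> i' = zm (cod g) (cod p)" "e \<cdot> x = p"
    using is_pushout_lift[OF po, of "zm (cod g) (cod p)" p] P I g by auto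
  have "short_exact \<A> i' e" by (rule pushout_short_exact[OF I(1) po]) (use e P in auto)
  hence "cf i' e" by (rule cfI) (use e P g I in auto)
  moreover have "ses_map \<A> g x (ide (cod p)) i p i' e" unfolding ses_map_def Hom_iff using e P I by auto
  ultimately show ?thesis using that e by blast
qed

lemma pushout_factor:
  assumes m: "ses_map \<A> g y c i p i2 p2" and po: "is_pushout \<A> i g i' x" and m': "ses_map \<A> g x (ide (cod p)) i p i' p'"
    and se: "short_exact \<A> i p" "short_exact \<A> i' p'" "short_exact \<A> i2 p2"
  obtains z where "ses_map \<A> (ide (cod g)) z c i' p' i2 p2"
proof -
  note M = ses_mapD[OF m] and P = is_pushoutD[OF po] and S = short_exactD(5-8)[OF se(1)]
    and S' = short_exactD(5-8)[OF se(2)] and S2 = short_exactD(5-8)[OF se(3)]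
  have N: "cod p' = cod p" "p' \<cdot> x = p" using ses_mapD(9,11)[OF m'] S by auto
  obtain z where z: "z \<in> Arr \<A>" "dom z = cod i'" "cod z = cod i2" "z \<cdot> i' = i2" "z \<cdot> x = y"
    by (rule is_pushout_lift[OF po, of i2 y]) (use M P S2 in auto)
  have "p2 \<cdot> z = c \<cdot> p'"
  proof (rule is_pushout_ext[OF po])
    show "(p2 \<cdot> z) \<cdot> i' = (c \<cdot> p') \<cdot> i'" using z M(1-9) P(1-8) S(1-3) S'(1-3) S2(1-3) N(1) by (simp add: S2(4) S'(4))
    show "(p2 \<cdot> z) \<cdot> x = (c \<cdot> p') \<cdot> x" using z M(1-9) P(1-8) S(1-3) S'(1-3) S2(1-3) N by (simp add: M(11))
  qed (use z M(1-9) P(1-8) S(1-3) S'(1-3) S2(1-3) N in auto)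
  hence "ses_map \<A> (ide (cod g)) z c i' p' i2 p2"
    unfolding ses_map_def Hom_iff using z M(1-9) P(1-8) S(1-3) S'(1-3) S2(1-3) N by auto
  thus ?thesis by (rule that)
qed

lemma ex_seq_pushout:
  assumes E: "xs t A B E" and g: "g \<in> Hom \<A> B B'"
  shows "\<exists>E'. seq_pushout \<A> g E E'"
proof -
  have *: "\<exists>E'. seq_pushout \<A> g (i # e # ds) E'" if i: "i \<in> Arr \<A>" "dom i = B" and e: "e \<in> Arr \<A>" "dom e = cod i"
    "e \<cdot> i = zm B (cod e)" for i e ds
  proof -
    have gt: "g \<in> Arr \<A>" "dom g = B" using g by (auto simp: Hom_iff)
    obtain i' x where po: "is_pushout \<A> i g i' x" using ex_pushout[of i g] i gt by metis
    note P = is_pushoutD[OF po]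
    obtain e' where "e' \<in> Arr \<A>" "dom e' = cod i'" "cod e' = cod e" "e' \<cdot> i' = zm (cod g) (cod e)" "e' \<cdot> x = e"
      using is_pushout_lift[OF po, of "zm (cod g) (cod e)" e] P e i gt by auto
    thus ?thesis unfolding seq_pushout_def Hom_iff using po by blast
  qed
  from E show ?thesis
  proof (cases rule: xs_cases)
    case (single i p)
    note I = cfD[OF single(3)]
    show ?thesis unfolding single(2) by (rule *) (use single I in auto)
  next
    case (splice i p d ds t')
    note I = cfD[OF splice(2)]
    have "d \<in> Arr \<A>" "dom d = cod p" using xs_path[OF splice(4)] by auto
    thus ?thesis unfolding splice(6) by (intro *) (use splice I in auto)
  qed
qed

text \<open>The last conjunct is the universal property: a morphism out of E with left component g
  passes through the push-out, keeping its right component. Pushed classes are later handled through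
  it and not through the construction.\<close>

lemma seq_pushout_xs:
  assumes E: "xs t A B E" and po: "seq_pushout \<A> g E E'" and g: "cod g \<in> \<C>"
  shows "xs t A (cod g) E' \<and> emor \<A> g (ide A) E E' \<and>
    (\<forall>h E2 A2. xs t A2 (cod g) E2 \<and> h \<in> Hom \<A> A A2 \<and> emor \<A> g h E E2 \<longrightarrow> emor \<A> (ide (cod g)) h E' E2)"
proof -
  obtain i e ds i' e' x where e: "E = i # e # ds" "E' = i' # e' # ds" and po: "is_pushout \<A> i g i' x"
    and e': "e' \<in> Hom \<A> (cod i') (cod e)" "e' \<cdot> x = e" "e' \<cdot> i' = zm (cod g) (cod e)"
    using po unfolding seq_pushout_def by blast
  note P = is_pushoutD[OF po]
  from E show ?thesis
  proof (cases rule: xs_cases)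
    case (single i0 p)
    hence [simp]: "i0 = i" "e = p" "ds = []" using e by auto
    note I = cfD[OF single(3)[simplified]]
    obtain p' where p': "cf i' p'" "p' \<cdot> x = p" "cod p' = cod p" and m: "ses_map \<A> g x (ide (cod p)) i p i' p'"
      by (rule pushout_cf[OF single(3)[simplified] po g])
    note I' = cfD[OF p'(1)]
    \<comment> \<open>\<open>seq_pushout\<close> prescribes the inner arrow only by its composites
      with the two legs of the push-out. These determine it, so it must be the deflation of the
      pushed conflation.\<close>
    have "e' = p'"
      by (rule is_pushout_ext[OF po]) (use e' p' I I' P in \<open>auto simp: Hom_iff\<close>)
    hence [simp]: "e' = p'" .
    have 1: "xs t A (cod g) E'" using ext_seq.single[OF p'(1)] P p' single e by simp
    have 2: "emor \<A> g (ide A) E E'" unfolding e using emor_single[OF single(3) p'(1), of "ide A" g] m single p' I by (auto simp: Hom_iff)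
    have 3: "emor \<A> (ide (cod g)) h E' E2" if E2: "xs t A2 (cod g) E2" "h \<in> Hom \<A> A A2" "emor \<A> g h E E2" for h E2 A2
      using E2(1)
    proof (cases rule: xs_cases)
      case s2: (single i2 p2)
      have "\<exists>y. ses_map \<A> g y h i p i2 p2"
        using E2 emor_single[OF single(3) s2(3), of h g] single s2 e by simp
      then obtain y where y: "ses_map \<A> g y h i p i2 p2" by blast
      obtain z where "ses_map \<A> (ide (cod g)) z h i' p' i2 p2"
        by (rule pushout_factor[OF y po m]) (use I I' cfD[OF s2(3)] in auto)
      thus ?thesis using emor_single[OF p'(1) s2(3), of h] E2(2) p' s2 e single by auto
    next
      case s2: (splice i2 p2 d2 ds2 t2)
      thus ?thesis using single xs_length[OF s2(4)] by simp
    qed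
    show ?thesis using 1 2 3 by blast
  next
    case (splice i0 p d ds0 t')
    hence [simp]: "i0 = i" "e = d \<cdot> p" "ds0 = ds" using e by auto
    note I = cfD[OF splice(2)[simplified]]
    have d: "d \<in> Arr \<A>" "dom d = cod p" using xs_path[OF splice(4)] by auto
    obtain p' where p': "cf i' p'" "p' \<cdot> x = p" "cod p' = cod p" and m: "ses_map \<A> g x (ide (cod p)) i p i' p'"
      by (rule pushout_cf[OF splice(2)[simplified] po g])
    note I' = cfD[OF p'(1)]
    have "e' = d \<cdot> p'"
      by (rule is_pushout_ext[OF po]) (use e' p' I I' P d in \<open>auto simp: Hom_iff\<close>)
    hence [simp]: "e' = d \<cdot> p'" .
    have xd: "xs t' A (cod p') (d # ds)" using splice(4) p' by simp
    have 1: "xs t A (cod g) E'" using ext_seq.splice[OF p'(1) xd] P p' splice e by simp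
    have pa: "path \<A> (cod p) (d # ds) A" using xs_path[OF splice(4)] by simp
    have A: "A \<in> Obj \<A>" using xs_length[OF E] by simp
    have 2: "emor \<A> g (ide A) E E'" unfolding e
      using emor_splice[OF splice(2)[simplified] p'(1) pa, of d ds A "ide A" g] m p' emor_id[OF pa A] pa A by (auto simp: Hom_iff)
    have 3: "emor \<A> (ide (cod g)) h E' E2" if E2: "xs t A2 (cod g) E2" "h \<in> Hom \<A> A A2" "emor \<A> g h E E2" for h E2 A2
      using E2(1)
    proof (cases rule: xs_cases)
      case s2: (single i2 p2)
      thus ?thesis using splice xs_length[OF splice(4)] by simp
    next
      case s2: (splice i2 p2 d2 ds2 t2)
      have pa2: "path \<A> (cod p2) (d2 # ds2) A2" using xs_path[OF s2(4)] by simp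
      have "\<exists>y c. ses_map \<A> g y c i p i2 p2 \<and> emor \<A> c h (d # ds) (d2 # ds2)"
        using emor_splice[OF splice(2)[simplified] s2(2) pa pa2 E2(2), of g] E2(3) e s2 by simp
      then obtain y c where y: "ses_map \<A> g y c i p i2 p2" and c: "emor \<A> c h (d # ds) (d2 # ds2)" by blast
      obtain z where "ses_map \<A> (ide (cod g)) z c i' p' i2 p2"
        by (rule pushout_factor[OF y po m]) (use I I' cfD[OF s2(2)] in auto)
      thus ?thesis using emor_splice[OF p'(1) s2(2) _ pa2 E2(2), of d ds] c p' pa e s2 by auto
    qed
    show ?thesis using 1 2 3 by blast
  qed
qed


section \<open>The equivalence of sequences and its classes\<close>

lemma ext_stepD:
  assumes "(E, E') \<in> ext_step \<A> \<C>" "xs t A B E"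
  shows "xs t A B E'" "emor \<A> (ide B) (ide A) E E'"
  using assms xs_unique unfolding ext_step_def seq_map_iff_emor by blast+

lemma ext_stepD':
  assumes "(E, E') \<in> ext_step \<A> \<C>" "xs t A B E'"
  shows "xs t A B E" "emor \<A> (ide B) (ide A) E E'"
  using assms xs_unique unfolding ext_step_def seq_map_iff_emor by blast+

lemma ext_stepI: "xs t A B E \<Longrightarrow> xs t A B E' \<Longrightarrow> emor \<A> (ide B) (ide A) E E' \<Longrightarrow> (E, E') \<in> ext_step \<A> \<C>"
  unfolding ext_step_def seq_map_iff_emor by blast

lemma ext_equiv_refl [simp]: "(E, E) \<in> ext_equiv \<A> \<C>"
  by (simp add: ext_equiv_def)

lemma ext_equiv_sym: "(E, E') \<in> ext_equiv \<A> \<C> \<Longrightarrow> (E', E) \<in> ext_equiv \<A> \<C>"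
  unfolding ext_equiv_def by (meson sym_Un_converse sym_rtrancl symD)

lemma ext_equiv_trans: "(E, E') \<in> ext_equiv \<A> \<C> \<Longrightarrow> (E', E'') \<in> ext_equiv \<A> \<C> \<Longrightarrow> (E, E'') \<in> ext_equiv \<A> \<C>"
  unfolding ext_equiv_def by (rule rtrancl_trans)

lemma ext_equivI: "xs t A B E \<Longrightarrow> xs t A B E' \<Longrightarrow> emor \<A> (ide B) (ide A) E E' \<Longrightarrow> (E, E') \<in> ext_equiv \<A> \<C>"
  unfolding ext_equiv_def using ext_stepI by blast

lemma mem_cls: "E' \<in> cls E \<longleftrightarrow> (E, E') \<in> ext_equiv \<A> \<C>"
  by (simp add: ext_class_def)

lemma cls_eq_iff: "cls E = cls E' \<longleftrightarrow> (E, E') \<in> ext_equiv \<A> \<C>"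
proof
  assume "cls E = cls E'"
  moreover have "E' \<in> cls E'" by (simp add: mem_cls)
  ultimately show "(E, E') \<in> ext_equiv \<A> \<C>" by (metis mem_cls)
next
  assume "(E, E') \<in> ext_equiv \<A> \<C>"
  thus "cls E = cls E'" unfolding set_eq_iff mem_cls by (meson ext_equiv_trans ext_equiv_sym)
qed

lemma cls_eqI: "xs t A B E \<Longrightarrow> xs t A B E' \<Longrightarrow> emor \<A> (ide B) (ide A) E E' \<Longrightarrow> cls E = cls E'"
  using cls_eq_iff ext_equivI by blast

text \<open>\<open>ext_equiv\<close> is a bare reflexive transitive closure on lists. Each step
  preserves length and ends, so these can be carried along, and the step case receives an honest
  morphism that points one way or the other.\<close>

lemma ext_equiv_induct [consumes 2, case_names refl step]:
  assumes "(E, E') \<in> ext_equiv \<A> \<C>" "xs t A B E" and r: "\<And>E. xs t A B E \<Longrightarrow> P E E"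
    and s: "\<And>E E1 E2. xs t A B E \<Longrightarrow> xs t A B E1 \<Longrightarrow> xs t A B E2 \<Longrightarrow> P E E1 \<Longrightarrow>
      (emor \<A> (ide B) (ide A) E1 E2 \<or> emor \<A> (ide B) (ide A) E2 E1) \<Longrightarrow> P E E2"
  shows "xs t A B E' \<and> P E E'"
  using assms(1) unfolding ext_equiv_def
proof (induction rule: rtrancl_induct)
  case base
  thus ?case using assms(2) r by blast
next
  case (step E1 E2)
  note IH = step.IH
  have "xs t A B E2 \<and> (emor \<A> (ide B) (ide A) E1 E2 \<or> emor \<A> (ide B) (ide A) E2 E1)"
    using step.hyps(2) ext_stepD[of E1 E2 t A B] ext_stepD'[of E2 E1 t A B] IH by blast
  thus ?case using s[OF assms(2), of E1 E2] IH by blast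
qed

lemma ext_equiv_xs: "(E, E') \<in> ext_equiv \<A> \<C> \<Longrightarrow> xs t A B E \<Longrightarrow> xs t A B E'"
  using ext_equiv_induct[where P = "\<lambda>_ _. True"] by blast

lemma EC_iff: "\<gamma> \<in> EC t A B \<longleftrightarrow> (\<exists>E. xs t A B E \<and> \<gamma> = cls E)"
  unfolding ext_carrier_def quotient_def ext_class_def by auto

lemma EC_cls [simp]: "xs t A B E \<Longrightarrow> cls E \<in> EC t A B"
  using EC_iff by blast

lemma EC_E:
  assumes "\<gamma> \<in> EC t A B"
  obtains E where "xs t A B E" "\<gamma> = cls E"
  using assms EC_iff by blast

lemma EC_obj: "\<gamma> \<in> EC t A B \<Longrightarrow> A \<in> \<C> \<and> B \<in> \<C> \<and> t \<ge> 1"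
  using EC_E xs_length by metis

text \<open>The union defining \<open>push\<close> collapses to one class: by the universal property
  every push-out of E is linked to E', and along a zigzag the push-outs of neighbouring sequences
  are linked. So a pushed class may be computed from any morphism with left component g and the
  identity on the right.\<close>

lemma push_cls:
  assumes E: "xs t A B E" and E': "xs t A B' E'" and m: "emor \<A> g (ide A) E E'" and g: "g \<in> Hom \<A> B B'"
  shows "pu g (cls E) = cls E'"
proof -
  have B': "B' \<in> \<C>" and tg: "cod g = B'" and AO: "A \<in> Obj \<A>" using xs_length[OF E'] g by (auto simp: Hom_iff)
  have idA: "ide A \<in> Hom \<A> A A" using AO by (simp add: Hom_iff)
  have idB: "ide B' \<in> Hom \<A> B' B'" using B' by (simp add: Hom_iff)
  note po = seq_pushout_xs[of t A _ _ g, unfolded tg, OF _ _ B']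
  have fac: "(F, G) \<in> ext_equiv \<A> \<C>" if "xs t A B E1" "seq_pushout \<A> g E1 F" "xs t A B' G" "emor \<A> g (ide A) E1 G" for E1 F G
  proof -
    note p = po[OF that(1,2)]
    show ?thesis by (rule ext_equivI[of t A B']) (use p that idA in blast)+
  qed
  have main: "xs t A B E2 \<and> (\<forall>F F'. seq_pushout \<A> g E1 F \<and> seq_pushout \<A> g E2 F' \<longrightarrow> (F, F') \<in> ext_equiv \<A> \<C>)"
    if "(E1, E2) \<in> ext_equiv \<A> \<C>" "xs t A B E1" for E1 E2
    using that
  proof (induction rule: ext_equiv_induct)
    case (refl E0)
    show ?case using po[OF refl] fac[OF refl] by blast
  next
    case (step E0 E1 E2)
    \<comment> \<open>The morphism from F1 to F2, followed by the one from F2 to its push-out F',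
      has left component g and so factors through the push-out F of F1.\<close>
    have 1: "(F, F') \<in> ext_equiv \<A> \<C>" if e: "emor \<A> (ide B) (ide A) F1 F2" "xs t A B F1" "xs t A B F2"
        "seq_pushout \<A> g F1 F" "seq_pushout \<A> g F2 F'" for F1 F2 F F'
    proof (rule fac[OF e(2,4)])
      note p = po[OF e(3,5)]
      show "xs t A B' F'" using p by blast
      have "emor \<A> (g \<cdot> ide B) (ide A \<cdot> ide A) F1 F'"
        by (rule emor_cmp[OF e(1) conjunct1[OF conjunct2[OF p]] xs_path[OF e(2)] xs_path[OF e(3)] xs_path[OF conjunct1[OF p]] idA idA])
      thus "emor \<A> g (ide A) F1 F'" using g AO by (simp add: Hom_iff)
    qed
    have "(F, F') \<in> ext_equiv \<A> \<C>" if "seq_pushout \<A> g E0 F" "seq_pushout \<A> g E2 F'" for F F'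
    proof -
      obtain F1 where F1: "seq_pushout \<A> g E1 F1" using ex_seq_pushout[OF step(2) g] by blast
      have "(F, F1) \<in> ext_equiv \<A> \<C>" using step(4) that(1) F1 by blast
      moreover have "(F1, F') \<in> ext_equiv \<A> \<C>" using step(5) 1 step(2,3) F1 that(2) ext_equiv_sym by blast
      ultimately show ?thesis by (rule ext_equiv_trans)
    qed
    thus ?case by blast
  qed
  obtain F where F: "seq_pushout \<A> g E F" using ex_seq_pushout[OF E g] by blast
  have FE: "cls F = cls E'" using fac[OF E F E' m] cls_eq_iff by blast
  have "cls F' = cls E'" if "E1 \<in> cls E" "seq_pushout \<A> g E1 F'" for E1 F'
    using main[of E E1] that E F FE cls_eq_iff by (metis mem_cls)
  moreover have "E \<in> cls E" by (simp add: mem_cls)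
  ultimately have "{ext_class \<A> \<C> F' |E1 F'. E1 \<in> cls E \<and> seq_pushout \<A> g E1 F'} = {cls E'}" using F by blast
  thus ?thesis unfolding push_def by simp
qed

section \<open>Pull-back of classes through the opposite category\<close>

lemma ext_equiv_opcat1:
  assumes "(E, E') \<in> ext_equiv \<A> \<C>"
  shows "(rev E, rev E') \<in> ext_equiv (opcat \<A>) \<C>"
  using assms unfolding ext_equiv_def
proof (induction rule: rtrancl_induct)
  case (step E1 E2)
  \<comment> \<open>Reversal turns a morphism around, which is harmless since the relation is
    generated by steps in both directions.\<close>
  have *: "(rev E2, rev E1) \<in> ext_step (opcat \<A>) \<C>" if st: "(E1, E2) \<in> ext_step \<A> \<C>" for E1 E2
  proof -
    obtain t A B where t: "xs t A B E1" "xs t A B E2" "emor \<A> (ide B) (ide A) E1 E2"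
      using st unfolding ext_step_def seq_map_iff_emor by blast
    have "emor (opcat \<A>) (ide A) (ide B) (rev E2) (rev E1)"
      by (rule emor_opcat[OF t(3) xs_path[OF t(1)] xs_path[OF t(2)]]) (use xs_length[OF t(1)] in \<open>auto simp: Hom_iff\<close>)
    thus ?thesis using xs_opcat[OF t(1)] xs_opcat[OF t(2)] unfolding ext_step_def seq_map_iff_emor by auto
  qed
  have "(rev E1, rev E2) \<in> ext_step (opcat \<A>) \<C> \<union> (ext_step (opcat \<A>) \<C>)\<inverse>"
    using step(2) * by blast
  thus ?case using step(3) by (rule_tac rtrancl_into_rtrancl)
qed auto

lemma ext_equiv_opcat: "(rev E, rev E') \<in> ext_equiv (opcat \<A>) \<C> \<longleftrightarrow> (E, E') \<in> ext_equiv \<A> \<C>"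
  using ext_equiv_opcat1[of E E'] extension_closed_subcategory.ext_equiv_opcat1[OF opcat_ecs, of "rev E" "rev E'"] by auto

lemma ext_class_opcat: "ext_class (opcat \<A>) \<C> (rev E) = rev ` cls E"
proof -
  have "F \<in> ext_class (opcat \<A>) \<C> (rev E) \<longleftrightarrow> rev F \<in> cls E" for F
    using ext_equiv_opcat[of E "rev F"] by (simp add: ext_class_def)
  moreover have "F \<in> rev ` cls E \<longleftrightarrow> rev F \<in> cls E" for F
    by (metis image_iff rev_rev_ident)
  ultimately show ?thesis by blast
qed

lemma xs_opcat_iff: "ext_seq (opcat \<A>) \<C> t B A E \<longleftrightarrow> xs t A B (rev E)"
  using xs_opcat[of t A B "rev E"] extension_closed_subcategory.xs_opcat[OF opcat_ecs, of t B A E] by auto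

lemma EC_opcat: "ext_carrier (opcat \<A>) \<C> t B A = image rev ` EC t A B"
proof -
  have "\<gamma> \<in> ext_carrier (opcat \<A>) \<C> t B A \<longleftrightarrow> \<gamma> \<in> image rev ` EC t A B" for \<gamma>
  proof
    assume "\<gamma> \<in> ext_carrier (opcat \<A>) \<C> t B A"
    then obtain E where E: "ext_seq (opcat \<A>) \<C> t B A E" "\<gamma> = ext_class (opcat \<A>) \<C> E"
      using extension_closed_subcategory.EC_E[OF opcat_ecs] by metis
    have "\<gamma> = rev ` cls (rev E)" using E(2) ext_class_opcat[of "rev E"] by simp
    thus "\<gamma> \<in> image rev ` EC t A B" using E(1) xs_opcat_iff by auto
  next
    assume "\<gamma> \<in> image rev ` EC t A B"
    then obtain E where E: "xs t A B E" "\<gamma> = rev ` cls E" using EC_E by blast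
    thus "\<gamma> \<in> ext_carrier (opcat \<A>) \<C> t B A"
      using extension_closed_subcategory.EC_cls[OF opcat_ecs xs_opcat[OF E(1)]] ext_class_opcat[of E] by simp
  qed
  thus ?thesis by blast
qed

text \<open>Push-out in the opposite category is pull-back read backwards. Through this equation
  \<open>pull_cls\<close> and \<open>ex_pull\<close> are obtained from their counterparts for
  push-outs.\<close>

lemma push_opcat: "push (opcat \<A>) \<C> h (rev ` \<gamma>) = rev ` pl \<gamma> h"
proof -
  have *: "seq_pushout (opcat \<A>) h (rev E) F \<longleftrightarrow> seq_pullback \<A> h E (rev F)" for E F
  proof
    assume "seq_pushout (opcat \<A>) h (rev E) F"
    then obtain d e ds d' e' x where 1: "rev E = d # e # ds" "F = d' # e' # ds"
      and 2: "is_pullback \<A> d h d' x" "e' \<in> Hom \<A> (dom e) (dom d')" "x \<cdot> e' = e" "d' \<cdot> e' = zm (dom e) (dom h)"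
      unfolding seq_pushout_def by auto
    have "E = rev ds @ [e, d]" "rev F = rev ds @ [e', d']" using 1 rev_swap[of E] by auto
    thus "seq_pullback \<A> h E (rev F)" unfolding seq_pullback_def using 2 by blast
  next
    assume "seq_pullback \<A> h E (rev F)"
    then obtain ds e d e' d' x where 1: "E = ds @ [e, d]" "rev F = ds @ [e', d']"
      and 2: "is_pullback \<A> d h d' x" "e' \<in> Hom \<A> (dom e) (dom d')" "x \<cdot> e' = e" "d' \<cdot> e' = zm (dom e) (dom h)"
      unfolding seq_pullback_def by blast
    have "rev E = d # e # rev ds" "F = d' # e' # rev ds" using 1 rev_swap[of F] by auto
    thus "seq_pushout (opcat \<A>) h (rev E) F" unfolding seq_pushout_def using 2 by auto
  qed
  have "{ext_class (opcat \<A>) \<C> F |E F. E \<in> rev ` \<gamma> \<and> seq_pushout (opcat \<A>) h E F} =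
     image rev ` {cls F |E F. E \<in> \<gamma> \<and> seq_pullback \<A> h E F}" (is "?X = ?Y")
  proof (intro equalityI subsetI)
    fix z assume "z \<in> ?X"
    then obtain E F where "z = ext_class (opcat \<A>) \<C> F" "E \<in> \<gamma>" "seq_pushout (opcat \<A>) h (rev E) F" by blast
    thus "z \<in> ?Y" using * ext_class_opcat[of "rev F"] by auto
  next
    fix z assume "z \<in> ?Y"
    then obtain E F where "z = rev ` cls F" "E \<in> \<gamma>" "seq_pullback \<A> h E F" by blast
    moreover from this have "seq_pushout (opcat \<A>) h (rev E) (rev F)" using * by simp
    ultimately show "z \<in> ?X" using ext_class_opcat[of F, symmetric] by auto
  qed
  thus ?thesis unfolding push_def pull_def by auto
qed

lemma pull_cls:
  assumes E: "xs t A B E" and E': "xs t A' B E'" and m: "emor \<A> (ide B) h E' E" and h: "h \<in> Hom \<A> A' A"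
  shows "pl (cls E) h = cls E'"
proof -
  have "push (opcat \<A>) \<C> h (ext_class (opcat \<A>) \<C> (rev E)) = ext_class (opcat \<A>) \<C> (rev E')"
    by (rule extension_closed_subcategory.push_cls[OF opcat_ecs xs_opcat[OF E] xs_opcat[OF E']])
      (use emor_opcat[OF m xs_path[OF E'] xs_path[OF E] h] h in auto)
  hence "rev ` pl (cls E) h = rev ` cls E'" by (simp add: ext_class_opcat push_opcat)
  thus ?thesis by (simp add: inj_image_eq_iff)
qed

lemma ex_push:
  assumes E: "xs t A B E" and g: "g \<in> Hom \<A> B B'" "B' \<in> \<C>"
  obtains E' where "xs t A B' E'" "emor \<A> g (ide A) E E'" "pu g (cls E) = cls E'"
    "\<And>h E2 A2. xs t A2 B' E2 \<Longrightarrow> h \<in> Hom \<A> A A2 \<Longrightarrow> emor \<A> g h E E2 \<Longrightarrow> emor \<A> (ide B') h E' E2"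
proof -
  obtain E' where E': "seq_pushout \<A> g E E'" using ex_seq_pushout[OF E g(1)] by blast
  have tg: "cod g = B'" using g by (simp add: Hom_iff)
  note p = seq_pushout_xs[OF E E', unfolded tg, OF g(2)]
  show ?thesis by (rule that[of E']) (use p push_cls[OF E _ _ g(1)] in blast)+
qed

text \<open>The morphism factors through the push-out of E along g. The remaining part has the
  identity on the left and h on the right, so it displays that push-out as the pull-back of E' along
  h.\<close>

lemma push_pull_emor:
  assumes E: "xs t A B E" and E': "xs t A' B' E'" and m: "emor \<A> g h E E'" and h: "h \<in> Hom \<A> A A'"
  shows "pu g (cls E) = pl (cls E') h"
proof -
  have g: "g \<in> Hom \<A> B B'" by (rule emor_src[OF m xs_path[OF E] xs_path[OF E'] h])
  obtain F where F: "xs t A B' F" "pu g (cls E) = cls F" and u: "\<And>h E2 A2. xs t A2 B' E2 \<Longrightarrow> h \<in> Hom \<A> A A2 \<Longrightarrow> emor \<A> g h E E2 \<Longrightarrow> emor \<A> (ide B') h F E2"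
    using ex_push[OF E g] xs_length[OF E'] by metis
  have "pl (cls E') h = cls F" by (rule pull_cls[OF E' F(1) u[OF E' h m] h])
  thus ?thesis using F by simp
qed

lemma ex_pull:
  assumes E: "xs t A B E" and h: "h \<in> Hom \<A> A' A" "A' \<in> \<C>"
  obtains E' where "xs t A' B E'" "emor \<A> (ide B) h E' E" "pl (cls E) h = cls E'"
proof -
  have h': "h \<in> Hom (opcat \<A>) A A'" using h by simp
  obtain F where F: "ext_seq (opcat \<A>) \<C> t B A' F" "emor (opcat \<A>) h (ide B) (rev E) F"
    using extension_closed_subcategory.ex_push[OF opcat_ecs xs_opcat[OF E] h' h(2)] by (metis opcat_simps(5))
  have x: "xs t A' B (rev F)" using F(1) xs_opcat_iff by blast
  have "emor (opcat (opcat \<A>)) (ide B) h (rev F) (rev (rev E))"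
    by (rule preadditive_category.emor_opcat[OF opcat_preadditive F(2)])
      (use path_opcat[OF xs_path[OF E]] extension_closed_subcategory.xs_path[OF opcat_ecs F(1)] xs_length[OF E] in \<open>auto simp: Hom_iff\<close>)
  hence m: "emor \<A> (ide B) h (rev F) E" by simp
  show ?thesis by (rule that[OF x m pull_cls[OF E x m h(1)]])
qed

lemma push_EC [simp]: "\<gamma> \<in> EC t A B \<Longrightarrow> g \<in> Hom \<A> B B' \<Longrightarrow> B' \<in> \<C> \<Longrightarrow> pu g \<gamma> \<in> EC t A B'"
  by (metis EC_E EC_cls ex_push)

lemma pull_EC [simp]: "\<gamma> \<in> EC t A B \<Longrightarrow> h \<in> Hom \<A> A' A \<Longrightarrow> A' \<in> \<C> \<Longrightarrow> pl \<gamma> h \<in> EC t A' B"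
  by (metis EC_E EC_cls ex_pull)

lemma push_push:
  assumes "\<gamma> \<in> EC t A B" "g \<in> Hom \<A> B B'" "g' \<in> Hom \<A> B' B''" "B' \<in> \<C>" "B'' \<in> \<C>"
  shows "pu g' (pu g \<gamma>) = pu (g' \<cdot> g) \<gamma>"
proof -
  obtain E where E: "xs t A B E" "\<gamma> = cls E" using assms(1) EC_E by blast
  obtain F where F: "xs t A B' F" "emor \<A> g (ide A) E F" "pu g (cls E) = cls F" using ex_push[OF E(1) assms(2,4)] by metis
  obtain G where G: "xs t A B'' G" "emor \<A> g' (ide A) F G" "pu g' (cls F) = cls G" using ex_push[OF F(1) assms(3,5)] by metis
  have A: "ide A \<in> Hom \<A> A A" "A \<in> Obj \<A>" using xs_length[OF E(1)] by (auto simp: Hom_iff)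
  have "emor \<A> (g' \<cdot> g) (ide A \<cdot> ide A) E G"
    by (rule emor_cmp[OF F(2) G(2) xs_path[OF E(1)] xs_path[OF F(1)] xs_path[OF G(1)] A(1) A(1)])
  hence "emor \<A> (g' \<cdot> g) (ide A) E G" using A by simp
  thus ?thesis using push_cls[OF E(1) G(1)] assms E F G by (simp add: Hom_iff)
qed

lemma pull_pull:
  assumes "\<gamma> \<in> EC t A B" "h \<in> Hom \<A> A' A" "h' \<in> Hom \<A> A'' A'" "A' \<in> \<C>" "A'' \<in> \<C>"
  shows "pl (pl \<gamma> h) h' = pl \<gamma> (h \<cdot> h')"
proof -
  obtain E where E: "xs t A B E" "\<gamma> = cls E" using assms(1) EC_E by blast
  obtain F where F: "xs t A' B F" "emor \<A> (ide B) h F E" "pl (cls E) h = cls F" using ex_pull[OF E(1) assms(2,4)] by metis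
  obtain G where G: "xs t A'' B G" "emor \<A> (ide B) h' G F" "pl (cls F) h' = cls G" using ex_pull[OF F(1) assms(3,5)] by metis
  have B: "B \<in> Obj \<A>" using xs_length[OF E(1)] by auto
  have "emor \<A> (ide B \<cdot> ide B) (h \<cdot> h') G E"
    by (rule emor_cmp[OF G(2) F(2) xs_path[OF G(1)] xs_path[OF F(1)] xs_path[OF E(1)] assms(3,2)])
  hence "emor \<A> (ide B) (h \<cdot> h') G E" using B by simp
  thus ?thesis using pull_cls[OF E(1) G(1)] assms E F G by (simp add: Hom_iff)
qed

lemma push_id [simp]: "\<gamma> \<in> EC t A B \<Longrightarrow> pu (ide B) \<gamma> = \<gamma>"
proof -
  assume "\<gamma> \<in> EC t A B"
  then obtain E where E: "xs t A B E" "\<gamma> = cls E" using EC_E by blast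
  thus ?thesis using push_cls[OF E(1) E(1) emor_id[OF xs_path[OF E(1)]]] xs_length[OF E(1)] by (simp add: Hom_iff)
qed

lemma pull_id [simp]: "\<gamma> \<in> EC t A B \<Longrightarrow> pl \<gamma> (ide A) = \<gamma>"
proof -
  assume "\<gamma> \<in> EC t A B"
  then obtain E where E: "xs t A B E" "\<gamma> = cls E" using EC_E by blast
  thus ?thesis using pull_cls[OF E(1) E(1) emor_id[OF xs_path[OF E(1)]]] xs_length[OF E(1)] by (simp add: Hom_iff)
qed

lemma push_pull:
  assumes "\<gamma> \<in> EC t A B" "g \<in> Hom \<A> B B'" "h \<in> Hom \<A> A' A" "B' \<in> \<C>" "A' \<in> \<C>"
  shows "pu g (pl \<gamma> h) = pl (pu g \<gamma>) h"
proof -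
  obtain E where E: "xs t A B E" "\<gamma> = cls E" using assms(1) EC_E by blast
  obtain F where F: "xs t A' B F" "emor \<A> (ide B) h F E" "pl (cls E) h = cls F" using ex_pull[OF E(1) assms(3,5)] by metis
  obtain G where G: "xs t A B' G" "emor \<A> g (ide A) E G" "pu g (cls E) = cls G" using ex_push[OF E(1) assms(2,4)] by metis
  have A: "ide A \<in> Hom \<A> A A" using xs_length[OF E(1)] by (auto simp: Hom_iff)
  have "emor \<A> (g \<cdot> ide B) (ide A \<cdot> h) F G"
    by (rule emor_cmp[OF F(2) G(2) xs_path[OF F(1)] xs_path[OF E(1)] xs_path[OF G(1)] assms(3) A])
  hence "emor \<A> g h F G" using assms(2,3) by (simp add: Hom_iff)
  from push_pull_emor[OF F(1) G(1) this assms(3)] show ?thesis using E F G by simp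
qed

end

section \<open>Yoneda products and roofs\<close>

text \<open>The Yoneda product of classes, encoded as a union over representatives like
  \<open>push\<close>; the left factor is the left part of the spliced sequence.\<close>

definition ymul :: "('o, 'm) addcat \<Rightarrow> 'o set \<Rightarrow> 'm list set \<Rightarrow> 'm list set \<Rightarrow> 'm list set" where
  "ymul \<A> \<C> \<gamma> \<rho> = \<Union> {ext_class \<A> \<C> (yo \<A> E F) | E F. E \<in> \<gamma> \<and> F \<in> \<rho>}"

context extension_closed_subcategory
begin

abbreviation "ym \<equiv> ymul \<A> \<C>"

lemma emor_yo:
  assumes m: "emor \<A> g c E E'" "emor \<A> c h F F'" and p: "xs s Z B E" "xs s Z' B' E'" "xs t A Z F" "xs t A' Z' F'"
    and h: "h \<in> Hom \<A> A A'"
  shows "emor \<A> g h (yo \<A> E F) (yo \<A> E' F')"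
proof -
  have l: "E \<noteq> []" "E' \<noteq> []" "F \<noteq> []" "F' \<noteq> []" "length E = length E'"
    using xs_length[OF p(1)] xs_length[OF p(2)] xs_length[OF p(3)] xs_length[OF p(4)] by auto
  obtain E0 e where E: "E = E0 @ [e]" using l by (cases E rule: rev_cases) auto
  obtain E0' e' where E': "E' = E0' @ [e']" using l by (cases E' rule: rev_cases) auto
  obtain f F0 where F: "F = f # F0" using l by (cases F) auto
  obtain f' F0' where F': "F' = f' # F0'" using l by (cases F') auto
  have le: "length E0 = length E0'" using l E E' by simp
  obtain x where x: "emor \<A> g x E0 E0'" "emor \<A> x c [e] [e']" using m(1) le unfolding E E' by (auto simp: emor_append simp del: emor.simps)
  obtain y where y: "f' \<cdot> c = y \<cdot> f" "emor \<A> y h F0 F0'" using m(2) F F' by auto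
  have pe: "e \<in> Arr \<A>" "cod e = Z" "e' \<in> Arr \<A>" "cod e' = Z'" 
    using xs_path[OF p(1)] xs_path[OF p(2)] E E' by (auto simp: path_append)
  have pf: "f \<in> Arr \<A>" "dom f = Z" "f' \<in> Arr \<A>" "dom f' = Z'" "path \<A> (cod f) F0 A" "path \<A> (cod f') F0' A'"
    using xs_path[OF p(3)] xs_path[OF p(4)] F F' by auto
  have yt: "y \<in> Hom \<A> (cod f) (cod f')" by (rule emor_src[OF y(2) pf(5,6) h])
  have ct: "c \<in> Hom \<A> Z Z'" by (rule emor_src[OF m(2) xs_path[OF p(3)] xs_path[OF p(4)] h])
  have xt: "x \<in> Hom \<A> (dom e) (dom e')" and xe: "e' \<cdot> x = c \<cdot> e" using x(2) by auto
  have "(f' \<cdot> e') \<cdot> x = y \<cdot> (f \<cdot> e)"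
    using xe reassoc[OF y(1), of e] pe pf yt ct xt by (simp add: Hom_iff)
  hence "emor \<A> x h ((f \<cdot> e) # F0) ((f' \<cdot> e') # F0')"
    unfolding emor.simps using y(2) xt pe pf by (auto simp: Hom_iff)
  thus ?thesis using x(1) le unfolding yo_def E E' F F' by (auto simp: emor_append simp del: emor.simps)
qed

text \<open>The common argument for the two binary operations \<open>ymul\<close> and
  \<open>ext_dsum\<close>: if \<phi> respects single morphisms, one representative at a time can be
  moved along its zigzag.\<close>

lemma Union_cls:
  assumes E: "xs s Z B E" and F: "xs t A Y F"
    and step: "\<And>E E' F F'. xs s Z B E \<Longrightarrow> xs s Z B E' \<Longrightarrow> xs t A Y F \<Longrightarrow> xs t A Y F' \<Longrightarrow>
      emor \<A> (ide B) (ide Z) E E' \<Longrightarrow> emor \<A> (ide Y) (ide A) F F' \<Longrightarrow> cls (\<phi> E F) = cls (\<phi> E' F')"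
  shows "\<Union> {cls (\<phi> E1 F1) | E1 F1. E1 \<in> cls E \<and> F1 \<in> cls F} = cls (\<phi> E F)"
proof -
  have id: "emor \<A> (ide B) (ide Z) G G" if "xs s Z B G" for G
    using emor_id[OF xs_path[OF that]] xs_length[OF that] by simp
  have id': "emor \<A> (ide Y) (ide A) G G" if "xs t A Y G" for G
    using emor_id[OF xs_path[OF that]] xs_length[OF that] by simp
  have 1: "cls (\<phi> E1 F) = cls (\<phi> E F)" if "E1 \<in> cls E" for E1
  proof -
    from that have "(E, E1) \<in> ext_equiv \<A> \<C>" by (simp add: mem_cls)
    from ext_equiv_induct[OF this E, where P = "\<lambda>E E1. cls (\<phi> E1 F) = cls (\<phi> E F)"]
    show ?thesis
    proof (rule conjunct2)
      fix E0 E1 E2 assume a: "xs s Z B E1" "xs s Z B E2" "cls (\<phi> E1 F) = cls (\<phi> E0 F)"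
        "emor \<A> (ide B) (ide Z) E1 E2 \<or> emor \<A> (ide B) (ide Z) E2 E1"
      show "cls (\<phi> E2 F) = cls (\<phi> E0 F)"
        using a(4) step[OF a(1,2) F F _ id'[OF F]] step[OF a(2,1) F F _ id'[OF F]] a(3) by auto
    qed simp
  qed
  have 2: "cls (\<phi> E1 F1) = cls (\<phi> E1 F)" if "F1 \<in> cls F" and E1: "xs s Z B E1" for E1 F1
  proof -
    from that have "(F, F1) \<in> ext_equiv \<A> \<C>" by (simp add: mem_cls)
    from ext_equiv_induct[OF this F, where P = "\<lambda>F F1. cls (\<phi> E1 F1) = cls (\<phi> E1 F)"]
    show ?thesis
    proof (rule conjunct2)
      fix F0 F1 F2 assume a: "xs t A Y F1" "xs t A Y F2" "cls (\<phi> E1 F1) = cls (\<phi> E1 F0)"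
        "emor \<A> (ide Y) (ide A) F1 F2 \<or> emor \<A> (ide Y) (ide A) F2 F1"
      show "cls (\<phi> E1 F2) = cls (\<phi> E1 F0)"
        using a(4) step[OF E1 E1 a(1,2) id[OF E1]] step[OF E1 E1 a(2,1) id[OF E1]] a(3) by auto
    qed simp
  qed
  have eq: "cls (\<phi> E1 F1) = cls (\<phi> E F)" if "E1 \<in> cls E" "F1 \<in> cls F" for E1 F1
  proof -
    have "xs s Z B E1" using ext_equiv_xs[OF _ E] that(1) by (simp add: mem_cls)
    from 2[OF that(2) this] 1[OF that(1)] show ?thesis by simp
  qed
  have mem: "E \<in> cls E" "F \<in> cls F" by (simp_all add: mem_cls)
  show ?thesis
  proof (intro equalityI subsetI)
    fix G assume "G \<in> \<Union> {cls (\<phi> E1 F1) | E1 F1. E1 \<in> cls E \<and> F1 \<in> cls F}"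
    then obtain E1 F1 where "E1 \<in> cls E" "F1 \<in> cls F" "G \<in> cls (\<phi> E1 F1)" by blast
    thus "G \<in> cls (\<phi> E F)" using eq by simp
  next
    fix G assume "G \<in> cls (\<phi> E F)"
    thus "G \<in> \<Union> {cls (\<phi> E1 F1) | E1 F1. E1 \<in> cls E \<and> F1 \<in> cls F}" using mem by blast
  qed
qed

lemma ymul_cls:
  assumes E: "xs s Z B E" and F: "xs t A Z F"
  shows "ym (cls E) (cls F) = cls (yo \<A> E F)"
  unfolding ymul_def
proof (rule Union_cls[OF E F])
  fix E E' F F' assume a: "xs s Z B E" "xs s Z B E'" "xs t A Z F" "xs t A Z F'"
    and m: "emor \<A> (ide B) (ide Z) E E'" "emor \<A> (ide Z) (ide A) F F'"
  have "ide A \<in> Hom \<A> A A" using xs_length[OF a(3)] by (simp add: Hom_iff)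
  from emor_yo[OF m a this] show "cls (yo \<A> E F) = cls (yo \<A> E' F')"
    by (rule cls_eqI[OF xs_yo[OF a(1,3)] xs_yo[OF a(2,4)]])
qed

lemma ymul_EC [simp]: "\<gamma> \<in> EC s Z B \<Longrightarrow> \<rho> \<in> EC t A Z \<Longrightarrow> ym \<gamma> \<rho> \<in> EC (s + t) A B"
  by (elim EC_E) (simp add: ymul_cls EC_cls[OF xs_yo])

lemma push_ymul:
  assumes "\<gamma> \<in> EC s Z B" "\<rho> \<in> EC t A Z" "g \<in> Hom \<A> B B'" "B' \<in> \<C>"
  shows "pu g (ym \<gamma> \<rho>) = ym (pu g \<gamma>) \<rho>"
proof -
  obtain E where E: "xs s Z B E" "\<gamma> = cls E" using assms(1) EC_E by blast
  obtain F where F: "xs t A Z F" "\<rho> = cls F" using assms(2) EC_E by blast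
  have o: "A \<in> Obj \<A>" "ide A \<in> Hom \<A> A A" using xs_length[OF F(1)] by (auto simp: Hom_iff)
  obtain G where G: "xs s Z B' G" "emor \<A> g (ide Z) E G" "pu g (cls E) = cls G" using ex_push[OF E(1) assms(3,4)] by metis
  have "emor \<A> g (ide A) (yo \<A> E F) (yo \<A> G F)"
    by (rule emor_yo[OF G(2) emor_id[OF xs_path[OF F(1)] o(1)] E(1) G(1) F(1) F(1) o(2)])
  from push_cls[OF xs_yo[OF E(1) F(1)] xs_yo[OF G(1) F(1)] this assms(3)]
  show ?thesis using ymul_cls[OF E(1) F(1)] ymul_cls[OF G(1) F(1)] E F G by simp
qed

lemma pull_ymul:
  assumes "\<gamma> \<in> EC s Z B" "\<rho> \<in> EC t A Z" "h \<in> Hom \<A> A' A" "A' \<in> \<C>"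
  shows "pl (ym \<gamma> \<rho>) h = ym \<gamma> (pl \<rho> h)"
proof -
  obtain E where E: "xs s Z B E" "\<gamma> = cls E" using assms(1) EC_E by blast
  obtain F where F: "xs t A Z F" "\<rho> = cls F" using assms(2) EC_E by blast
  have o: "Z \<in> Obj \<A>" using xs_length[OF F(1)] by auto
  obtain G where G: "xs t A' Z G" "emor \<A> (ide Z) h G F" "pl (cls F) h = cls G" using ex_pull[OF F(1) assms(3,4)] by metis
  have "emor \<A> (ide B) h (yo \<A> E G) (yo \<A> E F)"
    by (rule emor_yo[OF emor_id[OF xs_path[OF E(1)] o(1)] G(2) E(1) E(1) G(1) F(1) assms(3)])
  from pull_cls[OF xs_yo[OF E(1) F(1)] xs_yo[OF E(1) G(1)] this assms(3)]
  show ?thesis using ymul_cls[OF E(1) F(1)] ymul_cls[OF E(1) G(1)] E F G by simp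
qed

text \<open>The splice through the pull-back maps to the splice through the push-out, with
  identities at the ends and c at the joint.\<close>

lemma ymul_mid:
  assumes "\<gamma> \<in> EC s Z' B" "\<rho> \<in> EC t A Z" "c \<in> Hom \<A> Z Z'"
  shows "ym (pl \<gamma> c) \<rho> = ym \<gamma> (pu c \<rho>)"
proof -
  obtain E where E: "xs s Z' B E" "\<gamma> = cls E" using assms(1) EC_E by blast
  obtain F where F: "xs t A Z F" "\<rho> = cls F" using assms(2) EC_E by blast
  have o: "ide A \<in> Hom \<A> A A" "Z \<in> \<C>" "Z' \<in> \<C>" using xs_length[OF F(1)] xs_length[OF E(1)] by (auto simp: Hom_iff)
  obtain E' where E': "xs s Z B E'" "emor \<A> (ide B) c E' E" "pl (cls E) c = cls E'" using ex_pull[OF E(1) assms(3) o(2)] by metis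
  obtain F' where F': "xs t A Z' F'" "emor \<A> c (ide A) F F'" "pu c (cls F) = cls F'" using ex_push[OF F(1) assms(3) o(3)] by metis
  have "cls (yo \<A> E' F) = cls (yo \<A> E F')"
    by (rule cls_eqI[OF xs_yo[OF E'(1) F(1)] xs_yo[OF E(1) F'(1)] emor_yo[OF E'(2) F'(2) E'(1) E(1) F(1) F'(1) o(1)]])
  thus ?thesis using ymul_cls[OF E'(1) F(1)] ymul_cls[OF E(1) F'(1)] E E' F F' by simp
qed

lemma ymul_assoc:
  assumes "\<gamma> \<in> EC s Z B" "\<rho> \<in> EC t W Z" "\<sigma> \<in> EC r A W"
  shows "ym (ym \<gamma> \<rho>) \<sigma> = ym \<gamma> (ym \<rho> \<sigma>)"
proof -
  obtain E where E: "xs s Z B E" "\<gamma> = cls E" using assms(1) EC_E by blast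
  obtain F where F: "xs t W Z F" "\<rho> = cls F" using assms(2) EC_E by blast
  obtain G where G: "xs r A W G" "\<sigma> = cls G" using assms(3) EC_E by blast
  obtain f F1 where f: "F = f # F1" using xs_length[OF F(1)] by (cases F) auto
  have "F1 \<noteq> []" using xs_length[OF F(1)] f by auto
  then obtain F2 f' where f': "F1 = F2 @ [f']" by (cases F1 rule: rev_cases) auto
  have "yo \<A> (yo \<A> E F) G = yo \<A> E (yo \<A> F G)" by (simp add: yo_def f f' butlast_append)
  thus ?thesis
    using ymul_cls[OF E(1) F(1)] ymul_cls[OF F(1) G(1)] ymul_cls[OF xs_yo[OF E(1) F(1)] G(1)] ymul_cls[OF E(1) xs_yo[OF F(1) G(1)]]
    by (simp add: E F G)
qed

lemma ymul_opcat:
  assumes "\<gamma> \<in> EC s Z B" "\<rho> \<in> EC t A Z"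
  shows "ymul (opcat \<A>) \<C> (rev ` \<rho>) (rev ` \<gamma>) = rev ` ym \<gamma> \<rho>"
proof -
  obtain E where E: "xs s Z B E" "\<gamma> = cls E" using assms(1) EC_E by blast
  obtain F where F: "xs t A Z F" "\<rho> = cls F" using assms(2) EC_E by blast
  obtain E0 e where e: "E = E0 @ [e]" using xs_length[OF E(1)] by (cases E rule: rev_cases) auto
  obtain f F0 where f: "F = f # F0" using xs_length[OF F(1)] by (cases F) auto
  have "yo (opcat \<A>) (rev F) (rev E) = rev (yo \<A> E F)" by (simp add: yo_def e f)
  thus ?thesis
    using extension_closed_subcategory.ymul_cls[OF opcat_ecs xs_opcat[OF F(1)] xs_opcat[OF E(1)]] ymul_cls[OF E(1) F(1)]
    by (simp add: E F ext_class_opcat)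
qed

section \<open>Classes of length one\<close>

lemma EC_1_E:
  assumes "\<gamma> \<in> EC 1 A B"
  obtains i p where "cf i p" "dom i = B" "cod p = A" "\<gamma> = cls [i, p]" "xs 1 A B [i, p]"
proof -
  obtain E where E: "xs 1 A B E" "\<gamma> = cls E" using assms EC_E by blast
  from E(1) show ?thesis
  proof (cases rule: xs_cases)
    case (single i p)
    thus ?thesis using that E by blast
  next
    case (splice i p d ds t')
    thus ?thesis using xs_length[OF splice(4)] by simp
  qed
qed

lemma xs_1: "cf i p \<Longrightarrow> dom i = B \<Longrightarrow> cod p = A \<Longrightarrow> xs 1 A B [i, p]"
  using ext_seq.single[of \<A> \<C> i p] by simp

lemma EC_Suc_E:
  assumes "\<gamma> \<in> EC (Suc t) A B" "t \<ge> 1"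
  obtains Z \<epsilon> \<rho> where "Z \<in> \<C>" "\<epsilon> \<in> EC 1 Z B" "\<rho> \<in> EC t A Z" "\<gamma> = ym \<epsilon> \<rho>"
proof -
  obtain E where E: "xs (Suc t) A B E" "\<gamma> = cls E" using assms EC_E by blast
  from E(1) show ?thesis
  proof (cases rule: xs_cases)
    case (single i p)
    thus ?thesis using assms by simp
  next
    case (splice i p d ds t')
    have 1: "xs 1 (cod p) B [i, p]" using xs_1 splice by blast
    have 2: "xs t A (cod p) (d # ds)" using splice by simp
    have "yo \<A> [i, p] (d # ds) = E" using splice by (simp add: yo_def)
    hence "\<gamma> = ym (cls [i, p]) (cls (d # ds))" using ymul_cls[OF 1 2] E by simp
    thus ?thesis using that[OF _ EC_cls[OF 1] EC_cls[OF 2]] cfD[OF splice(2)] by blast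
  qed
qed

lemma ses_map_idD:
  assumes "ses_map \<A> (ide B) y c i p i' p'" "cf i p" "cf i' p'" "dom i = B"
  shows "dom i' = B" "y \<cdot> i = i'"
proof -
  note M = ses_mapD[OF assms(1)] and I = cfD[OF assms(2)] and I' = cfD[OF assms(3)]
  show "dom i' = B" using M(3) I assms(4) by simp
  thus "y \<cdot> i = i'" using M(10) I' by simp
qed

text \<open>In length one the zigzag collapses, since backward steps can be inverted by
  \<open>short_five\<close>; equality of classes thus gives an actual map of conflations. In greater
  length no such inversion is available, and \<open>roofs\<close> takes its place.\<close>

lemma cls_1_eq:
  assumes ip: "cf i p" "cf i' p'" and o: "dom i = B" "dom i' = B" "cod p = A" "cod p' = A" and c: "cls [i, p] = cls [i', p']"
  obtains x where "ses_map \<A> (ide B) x (ide A) i p i' p'"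
proof -
  let ?Q = "\<lambda>E E'. \<forall>i p i' p'. E = [i, p] \<longrightarrow> E' = [i', p'] \<longrightarrow> cf i p \<longrightarrow> cf i' p' \<longrightarrow> (\<exists>x. ses_map \<A> (ide B) x (ide A) i p i' p')"
  have E: "xs 1 A B [i, p]" by (rule xs_1) (use ip o in auto)
  have BO: "B \<in> Obj \<A>" "A \<in> Obj \<A>" using xs_length[OF E] by auto
  have "([i, p], [i', p']) \<in> ext_equiv \<A> \<C>" using c cls_eq_iff by blast
  from ext_equiv_induct[OF this E, where P = ?Q] have "?Q [i, p] [i', p']"
  proof (rule conjunct2)
    fix E assume E: "xs 1 A B E"
    show "?Q E E"
    proof (intro allI impI)
      fix i p i' p' assume "E = [i, p]" "E = [i', p']" "cf i p" "cf i' p'"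
      moreover from this have "dom i = B" "cod p = A" using xs_path[OF E] by auto
      ultimately show "\<exists>x. ses_map \<A> (ide B) x (ide A) i p i' p'" using ses_map_id[of i p] cfD(1) by auto
    qed
  next
    fix E E1 E2 assume a: "xs 1 A B E" "xs 1 A B E1" "xs 1 A B E2" "?Q E E1"
      "emor \<A> (ide B) (ide A) E1 E2 \<or> emor \<A> (ide B) (ide A) E2 E1"
    show "?Q E E2"
    proof (intro allI impI)
      fix i p i2 p2 assume E: "E = [i, p]" "E2 = [i2, p2]" "cf i p" "cf i2 p2"
      obtain i1 p1 where E1: "E1 = [i1, p1]" "cf i1 p1"
        using a(2) by (cases rule: xs_cases) (auto dest: xs_length)
      obtain x where x: "ses_map \<A> (ide B) x (ide A) i p i1 p1" using a(4) E E1 by blast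
      have o1: "dom i1 = B" "cod p1 = A" "dom i2 = B" "cod p2 = A" using xs_path[OF a(2)] xs_path[OF a(3)] E E1 by auto
      have "\<exists>y. ses_map \<A> (ide B) y (ide A) i1 p1 i2 p2"
        using a(5)
      proof
        assume "emor \<A> (ide B) (ide A) E1 E2"
        moreover have "ide A \<in> Hom \<A> (cod p1) (cod p2)" using o1 BO by (simp add: Hom_iff)
        ultimately show ?thesis using emor_single[OF E1(2) E(4)] E(2) E1(1) by blast
      next
        assume "emor \<A> (ide B) (ide A) E2 E1"
        hence "\<exists>y. ses_map \<A> (ide B) y (ide A) i2 p2 i1 p1"
        proof -
          have "ide A \<in> Hom \<A> (cod p2) (cod p1)" using o1 BO by (simp add: Hom_iff)
          thus ?thesis using emor_single[OF E(4) E1(2)] \<open>emor \<A> (ide B) (ide A) E2 E1\<close> E(2) E1(1) by blast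
        qed
        thus ?thesis using short_five[OF _ cfD(1)[OF E(4)] cfD(1)[OF E1(2)] o1(3,4)] by metis
      qed
      then obtain y where y: "ses_map \<A> (ide B) y (ide A) i1 p1 i2 p2" by blast
      from ses_map_cmp[OF x y cfD(1)[OF E(3)] cfD(1)[OF E1(2)] cfD(1)[OF E(4)]]
      show "\<exists>x. ses_map \<A> (ide B) x (ide A) i p i2 p2" using BO by auto
    qed
  qed
  thus ?thesis using ip that by blast
qed

lemma cls_pull_1:
  assumes "ses_map \<A> (ide B) y c i p i' p'" "cf i p" "cf i' p'" "dom i = B"
  shows "pl (cls [i', p']) c = cls [i, p]"
proof (rule pull_cls)
  note M = ses_mapD[OF assms(1)]
  show "xs 1 (cod p') B [i', p']" by (rule xs_1) (use assms ses_map_idD[OF assms] in auto)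
  show "xs 1 (cod p) B [i, p]" by (rule xs_1) (use assms in auto)
  show c: "c \<in> Hom \<A> (cod p) (cod p')" using M by (simp add: Hom_iff)
  show "emor \<A> (ide B) c [i, p] [i', p']" using emor_single[OF assms(2,3) c] assms(1) by blast
qed

text \<open>The constructed pull-back agrees with the given conflation only as a class;
  \<open>cls_1_eq\<close> supplies the map that is composed with the projection.\<close>

lemma pull_1_E:
  assumes ip: "cf i p" and c: "c \<in> Hom \<A> Z (cod p)" "Z \<in> \<C>" and B: "dom i = B" and e: "cf i' p'" "dom i' = B" "cod p' = Z" "pl (cls [i, p]) c = cls [i', p']"
  obtains y where "ses_map \<A> (ide B) y c i' p' i p"
proof -
  note I = cfD[OF ip]
  obtain i'' p'' y where 1: "short_exact \<A> i'' p''" "ses_map \<A> (ide (dom i)) y c i'' p'' i p"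
    "dom i'' = dom i" "cod p'' = dom c" "is_pullback \<A> p c p'' y"
    by (rule ses_map_pullback[OF I(1), of c]) (use c in \<open>auto simp: Hom_iff\<close>)
  have cZ: "dom c = Z" "c \<in> Arr \<A>" "cod c = cod p" using c by (auto simp: Hom_iff)
  have c2: "cf i'' p''" by (rule cfI[OF 1(1)]) (use 1 I cZ c B in auto)
  have m: "ses_map \<A> (ide B) y c i'' p'' i p" using 1(2) B by simp
  have "cls [i', p'] = cls [i'', p'']" using cls_pull_1[OF m c2 ip] 1 e B by simp
  then obtain x where x: "ses_map \<A> (ide B) x (ide Z) i' p' i'' p''"
    using cls_1_eq[OF e(1) c2, of B Z] e 1 B cZ by metis
  from ses_map_cmp[OF x m cfD(1)[OF e(1)] 1(1) I(1)]
  have "ses_map \<A> (ide B) (y \<cdot> x) c i' p' i p" using cZ I B c by auto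
  thus ?thesis by (rule that)
qed

lemma push_1_E:
  assumes ip: "cf i p" and g: "g \<in> Hom \<A> (dom i) B'" "B' \<in> \<C>" and e: "cf i' p'" "dom i' = B'" "cod p' = cod p" "pu g (cls [i, p]) = cls [i', p']"
  obtains y where "ses_map \<A> g y (ide (cod p)) i p i' p'"
proof -
  note I = cfD[OF ip]
  have gt: "g \<in> Arr \<A>" "dom g = dom i" "cod g = B'" using g by (auto simp: Hom_iff)
  obtain i'' x where po: "is_pushout \<A> i g i'' x" using ex_pushout[of i g] I gt by metis
  obtain p'' where c2: "cf i'' p''" "p'' \<cdot> x = p" "cod p'' = cod p" and m: "ses_map \<A> g x (ide (cod p)) i p i'' p''"
    by (rule pushout_cf[OF ip po]) (use gt g in auto)
  have s: "dom i'' = B'" using is_pushoutD[OF po] gt by simp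
  have idA: "ide (cod p) \<in> Hom \<A> (cod p) (cod p'')" using I c2 by (simp add: Hom_iff)
  have "pu g (cls [i, p]) = cls [i'', p'']"
    by (rule push_cls[OF xs_1[OF ip refl refl] xs_1[OF c2(1) s c2(3)] _ g(1)])
      (use emor_single[OF ip c2(1) idA] m in auto)
  hence "cls [i'', p''] = cls [i', p']" using e by simp
  then obtain z where z: "ses_map \<A> (ide B') z (ide (cod p)) i'' p'' i' p'"
    using cls_1_eq[OF c2(1) e(1), of B' "cod p"] e s c2 by metis
  from ses_map_cmp[OF m z I(1) cfD(1)[OF c2(1)] cfD(1)[OF e(1)]]
  have "ses_map \<A> g (z \<cdot> x) (ide (cod p)) i p i' p'" using gt I by auto
  thus ?thesis by (rule that)
qed

section \<open>Mayer-Vietoris and roofs\<close>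

lemma pullback_cf:
  assumes jh: "cf j h" and pb: "is_pullback \<A> h k q2 q1" and k: "dom k \<in> \<C>"
  obtains j' where "cf j' q2" "dom j' = dom j" "ses_map \<A> (ide (dom j)) q1 k j' q2 j h"
proof -
  have op: "conflation (opcat \<A>) \<C> h j" "is_pushout (opcat \<A>) h k q2 q1" "tgt (opcat \<A>) k \<in> \<C>" using assms by auto
  obtain j' where "conflation (opcat \<A>) \<C> q2 j'" "q1 \<cdot> j' = j" "dom j' = dom j"
    "ses_map (opcat \<A>) k q1 (ide (dom j)) h j q2 j'"
    using extension_closed_subcategory.pushout_cf[OF opcat_ecs op] by auto
  thus ?thesis using that[of j'] ses_map_opcat[of j' q2 j h k q1 "ide (dom j)"] cfD(1)[OF jh] cfD(1)[of j' q2] by simp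
qed

text \<open>Exactness, at the middle term, of the Mayer-Vietoris sequence that Ext^t(A, -) yields
  for the pull-back square of a deflation h and an arrow k.\<close>

definition mayer_vietoris :: "nat \<Rightarrow> bool" where
  "mayer_vietoris t \<longleftrightarrow> (\<forall>j h k q1 q2 A \<gamma>1 \<gamma>2. cf j h \<and> is_pullback \<A> h k q2 q1 \<and> dom k \<in> \<C> \<and>
     \<gamma>1 \<in> EC t A (dom h) \<and> \<gamma>2 \<in> EC t A (dom k) \<and> pu h \<gamma>1 = pu k \<gamma>2 \<longrightarrow>
     (\<exists>\<gamma>3 \<in> EC t A (dom q1). pu q1 \<gamma>3 = \<gamma>1 \<and> pu q2 \<gamma>3 = \<gamma>2))"

text \<open>The converse implication is immediate from \<open>ymul_mid\<close>; the content is that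
  one span at the splice replaces a zigzag of arbitrary length.\<close>

definition roofs :: "nat \<Rightarrow> bool" where
  "roofs t \<longleftrightarrow> (\<forall>Z1 Z2 A B \<epsilon>1 \<epsilon>2 \<rho>1 \<rho>2. \<epsilon>1 \<in> EC 1 Z1 B \<and> \<epsilon>2 \<in> EC 1 Z2 B \<and> \<rho>1 \<in> EC t A Z1 \<and> \<rho>2 \<in> EC t A Z2 \<and>
     ym \<epsilon>1 \<rho>1 = ym \<epsilon>2 \<rho>2 \<longrightarrow>
     (\<exists>Z c1 c2. \<exists>\<rho> \<in> EC t A Z. Z \<in> \<C> \<and> c1 \<in> Hom \<A> Z Z1 \<and> c2 \<in> Hom \<A> Z Z2 \<and> pu c1 \<rho> = \<rho>1 \<and> pu c2 \<rho> = \<rho>2 \<and>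
        pl \<epsilon>1 c1 = pl \<epsilon>2 c2))"

text \<open>The lift is the conflation of \<open>short_exact_pullback_middle\<close>. Its left term
  lies in C because it is the middle term of the conflation obtained by pulling back that of
  h.\<close>

lemma mayer_vietoris_1: "mayer_vietoris 1"
  unfolding mayer_vietoris_def
proof (intro allI impI, elim conjE)
  fix j h k q1 q2 A \<gamma>1 \<gamma>2
  assume jh: "cf j h" and pb: "is_pullback \<A> h k q2 q1" and k: "dom k \<in> \<C>"
    and g: "\<gamma>1 \<in> EC 1 A (dom h)" "\<gamma>2 \<in> EC 1 A (dom k)" "pu h \<gamma>1 = pu k \<gamma>2"
  note J = cfD[OF jh] and P = is_pullbackD[OF pb]
  obtain i1 p1 where 1: "cf i1 p1" "dom i1 = dom h" "cod p1 = A" "\<gamma>1 = cls [i1, p1]" "xs 1 A (dom h) [i1, p1]"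
    by (rule EC_1_E[OF g(1)])
  obtain i2 p2 where 2: "cf i2 p2" "dom i2 = dom k" "cod p2 = A" "\<gamma>2 = cls [i2, p2]" "xs 1 A (dom k) [i2, p2]"
    by (rule EC_1_E[OF g(2)])
  have V: "cod h \<in> \<C>" "h \<in> Hom \<A> (dom i1) (cod h)" "k \<in> Hom \<A> (dom i2) (cod h)" "h \<in> Hom \<A> (dom h) (cod h)"
    using J P 1 2 by (auto simp: Hom_iff)
  obtain i p where 3: "cf i p" "dom i = cod h" "cod p = A" "pu h \<gamma>1 = cls [i, p]" "xs 1 A (cod h) [i, p]"
    by (rule EC_1_E[OF push_EC[OF g(1) V(4,1)]])
  obtain y1 where y1: "ses_map \<A> h y1 (ide (cod p1)) i1 p1 i p"
    by (rule push_1_E[OF 1(1) V(2,1) 3(1,2)]) (use 1 3 in auto)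
  obtain y2 where y2: "ses_map \<A> k y2 (ide (cod p2)) i2 p2 i p"
    by (rule push_1_E[OF 2(1) V(3,1) 3(1,2)]) (use g 2 3 in auto)
  have m: "ses_map \<A> h y1 (ide A) i1 p1 i p" "ses_map \<A> k y2 (ide A) i2 p2 i p" using y1 y2 1 2 by auto
  obtain i3 p3 r1 r2 where 4: "short_exact \<A> i3 p3" "dom i3 = dom q1" "cod p3 = A"
    "ses_map \<A> q1 r1 (ide A) i3 p3 i1 p1" "ses_map \<A> q2 r2 (ide A) i3 p3 i2 p2"
    by (rule short_exact_pullback_middle[OF cfD(1)[OF 1(1)] cfD(1)[OF 2(1)] cfD(1)[OF 3(1)] m 3(3) pb])
      (use short_exactD[OF J(1)] in auto)
  obtain j' where j': "cf j' q2" by (rule pullback_cf[OF jh pb k])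
  have "cf i3 p3" by (rule cfI[OF 4(1)]) (use 4 cfD[OF j'] P cfD[OF 1(1)] 1 in auto)
  note 4 = this 4
  have o: "A \<in> Obj \<A>" "ide A \<in> Hom \<A> (cod p3) (cod p1)" "ide A \<in> Hom \<A> (cod p3) (cod p2)"
    using 1 2 4 cfD[OF 1(1)] by (auto simp: Hom_iff)
  have x3: "xs 1 A (dom q1) [i3, p3]" by (rule xs_1) (use 4 in auto)
  have q: "q1 \<in> Hom \<A> (dom q1) (dom h)" "q2 \<in> Hom \<A> (dom q1) (dom k)" using P by (auto simp: Hom_iff)
  have "pu q1 (cls [i3, p3]) = \<gamma>1" unfolding 1(4)
    by (rule push_cls[OF x3 1(5) _ q(1)]) (use emor_single[OF 4(1) 1(1) o(2)] 4 in auto)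
  moreover have "pu q2 (cls [i3, p3]) = \<gamma>2" unfolding 2(4)
    by (rule push_cls[OF x3 2(5) _ q(2)]) (use emor_single[OF 4(1) 2(1) o(3)] 4 in auto)
  ultimately show "\<exists>\<gamma>3 \<in> EC 1 A (dom q1). pu q1 \<gamma>3 = \<gamma>1 \<and> pu q2 \<gamma>3 = \<gamma>2"
    using EC_cls[OF x3] by blast
qed

text \<open>After the first conflations are split off, a roof replaces the two tails by one class
  \<rho>. The heads, pulled back along the roof, then have equal images, and the case of length one
  glues them to a single \<epsilon>; the product of \<epsilon> and \<rho> is the lift.\<close>

lemma mayer_vietoris_Suc:
  assumes "roofs t" "t \<ge> 1"
  shows "mayer_vietoris (Suc t)"
  unfolding mayer_vietoris_def
proof (intro allI impI, elim conjE)
  fix j h k q1 q2 A \<gamma>1 \<gamma>2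
  assume jh: "cf j h" and pb: "is_pullback \<A> h k q2 q1" and k: "dom k \<in> \<C>"
    and g: "\<gamma>1 \<in> EC (Suc t) A (dom h)" "\<gamma>2 \<in> EC (Suc t) A (dom k)" "pu h \<gamma>1 = pu k \<gamma>2"
  note J = cfD[OF jh] and P = is_pullbackD[OF pb]
  obtain Z1 \<epsilon>1 \<rho>1 where 1: "Z1 \<in> \<C>" "\<epsilon>1 \<in> EC 1 Z1 (dom h)" "\<rho>1 \<in> EC t A Z1" "\<gamma>1 = ym \<epsilon>1 \<rho>1"
    by (rule EC_Suc_E[OF g(1) assms(2)])
  obtain Z2 \<epsilon>2 \<rho>2 where 2: "Z2 \<in> \<C>" "\<epsilon>2 \<in> EC 1 Z2 (dom k)" "\<rho>2 \<in> EC t A Z2" "\<gamma>2 = ym \<epsilon>2 \<rho>2"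
    by (rule EC_Suc_E[OF g(2) assms(2)])
  obtain j' where j': "cf j' q2" by (rule pullback_cf[OF jh pb k])
  have V: "cod h \<in> \<C>" "h \<in> Hom \<A> (dom h) (cod h)" "k \<in> Hom \<A> (dom k) (cod h)"
    "q1 \<in> Hom \<A> (dom q1) (dom h)" "q2 \<in> Hom \<A> (dom q1) (dom k)" "dom h \<in> \<C>" "dom q1 \<in> \<C>"
    using J P cfD[OF j'] by (auto simp: Hom_iff)
  have "ym (pu h \<epsilon>1) \<rho>1 = ym (pu k \<epsilon>2) \<rho>2"
    using g(3) push_ymul[OF 1(2,3) V(2,1)] push_ymul[OF 2(2,3) V(3,1)] 1 2 by simp
  then obtain Z c1 c2 \<rho> where r: "\<rho> \<in> EC t A Z" "Z \<in> \<C>" "c1 \<in> Hom \<A> Z Z1" "c2 \<in> Hom \<A> Z Z2" "pu c1 \<rho> = \<rho>1" "pu c2 \<rho> = \<rho>2"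
        "pl (pu h \<epsilon>1) c1 = pl (pu k \<epsilon>2) c2"
    using assms(1) push_EC[OF 1(2) V(2,1)] push_EC[OF 2(2) V(3,1)] 1(3) 2(3) unfolding roofs_def by blast
  have "pu h (pl \<epsilon>1 c1) = pu k (pl \<epsilon>2 c2)"
    using push_pull[OF 1(2) V(2) r(3) V(1) r(2)] push_pull[OF 2(2) V(3) r(4) V(1) r(2)] r(7) by simp
  then obtain \<epsilon> where e: "\<epsilon> \<in> EC 1 Z (dom q1)" "pu q1 \<epsilon> = pl \<epsilon>1 c1" "pu q2 \<epsilon> = pl \<epsilon>2 c2"
    using mayer_vietoris_1 jh pb k pull_EC[OF 1(2) r(3,2)] pull_EC[OF 2(2) r(4,2)] unfolding mayer_vietoris_def by blast
  have "pu q1 (ym \<epsilon> \<rho>) = \<gamma>1" "pu q2 (ym \<epsilon> \<rho>) = \<gamma>2"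
    using push_ymul[OF e(1) r(1) V(4,6)] push_ymul[OF e(1) r(1) V(5) k] e ymul_mid[OF 1(2) r(1,3)] ymul_mid[OF 2(2) r(1,4)] r 1 2 by auto
  moreover have "ym \<epsilon> \<rho> \<in> EC (Suc t) A (dom q1)" using ymul_EC[OF e(1) r(1)] by simp
  ultimately show "\<exists>\<gamma>3 \<in> EC (Suc t) A (dom q1). pu q1 \<gamma>3 = \<gamma>1 \<and> pu q2 \<gamma>3 = \<gamma>2" by blast
qed

text \<open>A roof over two given conflations instead of classes. The maps of conflations are kept,
  because extending the roof along a zigzag requires composing them.\<close>

definition roof :: "nat \<Rightarrow> 'o \<Rightarrow> 'o \<Rightarrow> 'm \<Rightarrow> 'm \<Rightarrow> 'm list set \<Rightarrow> 'm \<Rightarrow> 'm \<Rightarrow> 'm list set \<Rightarrow> bool" where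
  "roof t A B i1 p1 \<rho>1 i2 p2 \<rho>2 \<longleftrightarrow> (\<exists>i p y1 y2 c1 c2. \<exists>\<rho> \<in> EC t A (cod p). cf i p \<and> dom i = B \<and>
     ses_map \<A> (ide B) y1 c1 i p i1 p1 \<and> ses_map \<A> (ide B) y2 c2 i p i2 p2 \<and> pu c1 \<rho> = \<rho>1 \<and> pu c2 \<rho> = \<rho>2)"

text \<open>To complete the cospan \<open>c\<^sub>1\<close>, \<open>c\<^sub>2\<close>, the first leg is made a deflation by adding the middle term
  of the target conflation, whose contribution to the pulled back extension vanishes.\<close>

lemma roof_cospan:
  assumes mv: "mayer_vietoris t" and c: "cf i1 p1" "cf i2 p2" "cf i p" and B: "dom i1 = B" "dom i2 = B" "dom i = B"
    and m1: "ses_map \<A> (ide B) y1 c1 i1 p1 i p" and m2: "ses_map \<A> (ide B) y2 c2 i2 p2 i p"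
    and r: "\<rho>1 \<in> EC t A (cod p1)" "\<rho>2 \<in> EC t A (cod p2)" "pu c1 \<rho>1 = pu c2 \<rho>2"
  shows "roof t A B i1 p1 \<rho>1 i2 p2 \<rho>2"
proof -
  note M1 = ses_mapD(1-9)[OF m1] and M2 = ses_mapD(1-9)[OF m2] and N1 = ses_mapD(11)[OF m1] and N2 = ses_mapD(11)[OF m2]
    and I1 = cfD[OF c(1)] and I2 = cfD[OF c(2)] and I = cfD[OF c(3)]
  note e1 = ses_map_idD(2)[OF m1 c(1,3) B(1)] and e2 = ses_map_idD(2)[OF m2 c(2,3) B(2)]
  let ?Z1 = "cod p1" and ?Y = "dom p" and ?Z = "cod p"
  have BO: "B \<in> Obj \<A>" using B I by auto
  have Z: "?Z1 \<in> Obj \<A>" "?Y \<in> Obj \<A>" using I1 I by auto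
  have pb1: "is_pullback \<A> p c1 p1 y1" by (rule ses_map_is_pullback[OF m1 I1(1) I(1) B(1)])
  have pb2: "is_pullback \<A> p c2 p2 y2" by (rule ses_map_is_pullback[OF m2 I2(1) I(1) B(2)])
  define h where "h = copair c1 p"
  define j where "j = pair p1 (neg y1)"
  have h: "h \<in> Arr \<A>" "dom h = bs ?Z1 ?Y" "cod h = ?Z" "h \<cdot> in1 ?Z1 ?Y = c1"
    using M1 I by (auto simp: h_def)
  have "short_exact \<A> j h" unfolding h_def j_def
    by (rule copair_kernel[OF short_exactD(4)[OF I(1)] _ _ pb1]) (use M1 in auto)
  hence jh: "cf j h" by (rule cfI) (use h I I1 M1 in \<open>auto simp: j_def\<close>)
  obtain q2 q1 where pb: "is_pullback \<A> h c2 q2 q1" using ex_pullback[of h c2] h M2 by metis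
  note P = is_pullbackD[OF pb]
  have kC: "dom c2 \<in> \<C>" using M2 I2 by simp
  obtain j' where j': "cf j' q2" by (rule pullback_cf[OF jh pb kC])
  have U: "dom q1 \<in> \<C>" using cfD[OF j'] P by simp
  have c1: "c1 \<in> Hom \<A> ?Z1 ?Z" "in1 ?Z1 ?Y \<in> Hom \<A> ?Z1 (dom h)" "h \<in> Hom \<A> (dom h) ?Z" "dom h \<in> \<C>"
    using M1 h Z I cfD[OF jh] by (auto simp: Hom_iff)
  \<comment> \<open>Because h restricts to c1 on the first summand, moving \<rho>1 to the source of
    h turns the hypothesis into one about the deflation h.\<close>
  have "pu h (pu (in1 ?Z1 ?Y) \<rho>1) = pu c2 \<rho>2"
    using push_push[OF r(1) c1(2,3,4) I(3)] r(3) h by simp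
  moreover have "pu (in1 ?Z1 ?Y) \<rho>1 \<in> EC t A (dom h)" using push_EC[OF r(1) c1(2,4)] .
  moreover have "\<rho>2 \<in> EC t A (dom c2)" using r(2) M2 by simp
  ultimately obtain \<rho> where rho: "\<rho> \<in> EC t A (dom q1)" "pu q1 \<rho> = pu (in1 ?Z1 ?Y) \<rho>1" "pu q2 \<rho> = \<rho>2"
    using mv jh pb kC unfolding mayer_vietoris_def by blast
  define d where "d = pr1 ?Z1 ?Y \<cdot> q1"
  define y where "y = pr2 ?Z1 ?Y \<cdot> q1"
  have d: "d \<in> Arr \<A>" "dom d = dom q1" "cod d = ?Z1" "y \<in> Arr \<A>" "dom y = dom q1" "cod y = ?Y"
    using P h Z by (auto simp: d_def y_def)
  have "pu d \<rho> = \<rho>1"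
  proof -
    have t: "q1 \<in> Hom \<A> (dom q1) (dom h)" "pr1 ?Z1 ?Y \<in> Hom \<A> (dom h) ?Z1" using P h Z by (auto simp: Hom_iff)
    have "pu d \<rho> = pu (pr1 ?Z1 ?Y) (pu q1 \<rho>)" unfolding d_def by (rule push_push[OF rho(1) t c1(4) I1(3), symmetric])
    also have "\<dots> = pu (pr1 ?Z1 ?Y \<cdot> in1 ?Z1 ?Y) \<rho>1" unfolding rho(2) by (rule push_push[OF r(1) c1(2) t(2) c1(4) I1(3)])
    finally show ?thesis using Z r by simp
  qed
  note rd = this
  have hq: "c2 \<cdot> q2 = (c1 \<cdot> d) \<boxplus> (p \<cdot> y)"
    using P(9) copair_cmp[of c1 p q1] M1 I P h by (simp add: h_def d_def y_def)
  obtain i3 p3 w1 where 3: "short_exact \<A> i3 p3" "ses_map \<A> (ide (dom i1)) w1 d i3 p3 i1 p1"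
    "dom i3 = dom i1" "cod p3 = dom d" by (rule ses_map_pullback[OF I1(1) d(1,3)])
  have c3: "cf i3 p3" by (rule cfI[OF 3(1)]) (use 3 I1 d U in auto)
  note I3 = cfD[OF c3]
  have m3: "ses_map \<A> (ide B) w1 d i3 p3 i1 p1" using 3 B by simp
  note M3 = ses_mapD(1-9)[OF m3] and N3 = ses_mapD(11)[OF m3] and e3 = ses_map_idD(2)[OF m3 c3 c(1)]
  \<comment> \<open>From c2 q2 = c1 d + p y, the arrow y1 w1 covers only the part c1 d. Adding y p3
    corrects this without changing the restriction along i3, as p3 i3 = 0; the result lifts to the
    source of p2, the pull-back of p along c2.\<close>
  define m where "m = (y1 \<cdot> w1) \<boxplus> (y \<cdot> p3)"
  have mt: "m \<in> Arr \<A>" "dom m = dom p3" "cod m = dom p" using M1 M3 d I3 I I1 3 by (auto simp: m_def)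
  have pm: "p \<cdot> m = c2 \<cdot> (q2 \<cdot> p3)"
  proof -
    have "p \<cdot> m = (c1 \<cdot> (d \<cdot> p3)) \<boxplus> (p \<cdot> (y \<cdot> p3))"
      using reassoc[OF N1, of w1] N3 M1 M3 d I3 I I1 3(4) by (simp add: m_def)
    also have "\<dots> = ((c1 \<cdot> d) \<boxplus> (p \<cdot> y)) \<cdot> p3" using M1 d I3 I I1 3(4) by simp
    also have "\<dots> = c2 \<cdot> (q2 \<cdot> p3)" unfolding hq[symmetric] using M2 P(1-8) I3 3(4) d by simp
    finally show ?thesis .
  qed
  obtain w2 where w2: "w2 \<in> Arr \<A>" "cod w2 = dom p2" "dom w2 = dom p3" "p2 \<cdot> w2 = q2 \<cdot> p3" "y2 \<cdot> w2 = m"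
    by (rule is_pullback_lift[OF pb2, of "q2 \<cdot> p3" m]) (use pm mt P(1-8) M2 I3 I2 3(4) d in auto)
  have "w2 \<cdot> i3 = i2"
  proof (rule is_pullback_ext[OF pb2])
    show "p2 \<cdot> (w2 \<cdot> i3) = p2 \<cdot> i2"
      using reassoc[OF w2(4), of i3] w2(1-3) I3 I2 P(1-8) 3(3,4) d B M2 by simp
    have "y2 \<cdot> (w2 \<cdot> i3) = m \<cdot> i3" using reassoc[OF w2(5), of i3] w2(1-3) I3 M2 I2 by simp
    also have "\<dots> = i" using M1 M3 d I3 I I1 3(3,4) B e1 e3 by (simp add: m_def)
    finally show "y2 \<cdot> (w2 \<cdot> i3) = y2 \<cdot> i2" using e2 by simp
  qed (use w2(1-3) I3 I2 3(3) B in auto)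
  hence m4: "ses_map \<A> (ide B) w2 q2 i3 p3 i2 p2"
    unfolding ses_map_def Hom_iff using w2(1-4) I3 I2 P(1-8) M2 3(3,4) d B BO by auto
  have "\<rho> \<in> EC t A (cod p3)" using rho 3 d by simp
  thus ?thesis unfolding roof_def using c3 m3 m4 rd rho(3) 3(3) B(1) by blast
qed

lemma yo_single: "yo \<A> [i, p] (d # ds) = i # (d \<cdot> p) # ds"
  by (simp add: yo_def)

lemma emor_yo_E:
  assumes "emor \<A> (ide B) (ide A) (yo \<A> [i, p] F) (yo \<A> [i', p'] F')" "cf i p" "cf i' p'" "xs t A (cod p) F" "xs t A (cod p') F'"
  obtains x c where "ses_map \<A> (ide B) x c i p i' p'" "pu c (cls F) = cls F'"
proof -
  obtain d ds where F: "F = d # ds" using xs_length[OF assms(4)] by (cases F) auto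
  obtain d' ds' where F': "F' = d' # ds'" using xs_length[OF assms(5)] by (cases F') auto
  have h: "ide A \<in> Hom \<A> A A" using xs_length[OF assms(4)] by (simp add: Hom_iff)
  obtain x c where m: "ses_map \<A> (ide B) x c i p i' p'" and e: "emor \<A> c (ide A) F F'"
    using assms(1) emor_splice[OF assms(2,3) xs_path[OF assms(4)[unfolded F]] xs_path[OF assms(5)[unfolded F']] h]
    unfolding F F' yo_single by blast
  have "c \<in> Hom \<A> (cod p) (cod p')" using ses_mapD[OF m] by (simp add: Hom_iff)
  from push_cls[OF assms(4,5) e this] show ?thesis using that m by blast
qed

text \<open>Induction along the zigzag. A forward morphism prolongs the right leg of the roof. A
  backward one produces a cospan with that leg; \<open>roof_cospan\<close> turns it into a span, and
  the left leg of the roof is composed with the new one.\<close>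

lemma roofs_step:
  assumes mv: "mayer_vietoris t" and t: "t \<ge> 1"
  shows "roofs t"
  unfolding roofs_def
proof (intro allI impI, elim conjE)
  fix Z1 Z2 A B \<epsilon>1 \<epsilon>2 \<rho>1 \<rho>2
  assume a: "\<epsilon>1 \<in> EC 1 Z1 B" "\<epsilon>2 \<in> EC 1 Z2 B" "\<rho>1 \<in> EC t A Z1" "\<rho>2 \<in> EC t A Z2" "ym \<epsilon>1 \<rho>1 = ym \<epsilon>2 \<rho>2"
  \<comment> \<open>All presentations of both sequences as splices are quantified, since the
    intermediate sequences come without a chosen decomposition.\<close>
  let ?Q = "\<lambda>E E'. \<forall>i p i' p' F F'. E = yo \<A> [i, p] F \<longrightarrow> E' = yo \<A> [i', p'] F' \<longrightarrow> cf i p \<longrightarrow> cf i' p' \<longrightarrow>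
     dom i = B \<longrightarrow> dom i' = B \<longrightarrow>
     xs t A (cod p) F \<longrightarrow> xs t A (cod p') F' \<longrightarrow> roof t A B i p (cls F) i' p' (cls F')"
  obtain i1 p1 where 1: "cf i1 p1" "dom i1 = B" "cod p1 = Z1" "\<epsilon>1 = cls [i1, p1]" "xs 1 Z1 B [i1, p1]" by (rule EC_1_E[OF a(1)])
  obtain i2 p2 where 2: "cf i2 p2" "dom i2 = B" "cod p2 = Z2" "\<epsilon>2 = cls [i2, p2]" "xs 1 Z2 B [i2, p2]" by (rule EC_1_E[OF a(2)])
  obtain F1 where F1: "xs t A Z1 F1" "\<rho>1 = cls F1" using a(3) EC_E by blast
  obtain F2 where F2: "xs t A Z2 F2" "\<rho>2 = cls F2" using a(4) EC_E by blast
  have AO: "A \<in> Obj \<A>" "B \<in> Obj \<A>" using xs_length[OF F1(1)] xs_length[OF 1(5)] by auto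
  have E: "xs (Suc t) A B (yo \<A> [i1, p1] F1)" using xs_yo[OF 1(5) F1(1)] by simp
  have "(yo \<A> [i1, p1] F1, yo \<A> [i2, p2] F2) \<in> ext_equiv \<A> \<C>"
    using a(5) ymul_cls[OF 1(5) F1(1)] ymul_cls[OF 2(5) F2(1)] cls_eq_iff 1 2 F1 F2 by simp
  from ext_equiv_induct[OF this E, where P = ?Q] have "?Q (yo \<A> [i1, p1] F1) (yo \<A> [i2, p2] F2)"
  proof (rule conjunct2)
    fix E assume E: "xs (Suc t) A B E"
    show "?Q E E"
    proof (intro allI impI)
      fix i p i' p' F F' assume b: "E = yo \<A> [i, p] F" "E = yo \<A> [i', p'] F'" "cf i p" "cf i' p'" "dom i = B" "dom i' = B"
        "xs t A (cod p) F" "xs t A (cod p') F'"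
      \<comment> \<open>Even a single sequence may be presented as a splice in two ways; its
        identity morphism compares them.\<close>
      have "emor \<A> (ide B) (ide A) E E" by (rule emor_id[OF xs_path[OF E] AO(1)])
      then obtain x c where x: "ses_map \<A> (ide B) x c i p i' p'" "pu c (cls F) = cls F'"
        using emor_yo_E[OF _ b(3,4,7,8)] b(1,2) by metis
      have "ses_map \<A> (ide B) (ide (cod i)) (ide (cod p)) i p i p" using ses_map_id[OF cfD(1)[OF b(3)]] b(5) by simp
      thus "roof t A B i p (cls F) i' p' (cls F')" unfolding roof_def using x b(3,5) EC_cls[OF b(7)] push_id by blast
    qed
  next
    fix E E1 E2 assume s: "xs (Suc t) A B E" "xs (Suc t) A B E1" "xs (Suc t) A B E2" "?Q E E1"
      "emor \<A> (ide B) (ide A) E1 E2 \<or> emor \<A> (ide B) (ide A) E2 E1"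
    show "?Q E E2"
    proof (intro allI impI)
      fix i p i' p' F F' assume b: "E = yo \<A> [i, p] F" "E2 = yo \<A> [i', p'] F'" "cf i p" "cf i' p'" "dom i = B" "dom i' = B"
        "xs t A (cod p) F" "xs t A (cod p') F'"
      obtain j q G where e1: "E1 = yo \<A> [j, q] G" "cf j q" "dom j = B" "xs t A (cod q) G"
        using s(2)
      proof (cases rule: xs_cases)
        case (single i p)
        thus ?thesis using t by simp
      next
        case (splice i p d ds t')
        thus ?thesis using that[of i p "d # ds"] by (simp add: yo_single)
      qed
      from s(4) b e1 have "roof t A B i p (cls F) j q (cls G)" by blast
      then obtain k r y1 y2 c1 c2 \<rho> where r: "\<rho> \<in> EC t A (cod r)" "cf k r" "dom k = B"
         "ses_map \<A> (ide B) y1 c1 k r i p" "ses_map \<A> (ide B) y2 c2 k r j q" "pu c1 \<rho> = cls F" "pu c2 \<rho> = cls G"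
        unfolding roof_def by blast
      have ct: "c1 \<in> Hom \<A> (cod r) (cod p)" "c2 \<in> Hom \<A> (cod r) (cod q)"
        using ses_mapD[OF r(4)] ses_mapD[OF r(5)] by (auto simp: Hom_iff)
      from s(5) show "roof t A B i p (cls F) i' p' (cls F')"
      proof
        assume "emor \<A> (ide B) (ide A) E1 E2"
        then obtain x c where x: "ses_map \<A> (ide B) x c j q i' p'" "pu c (cls G) = cls F'"
          using emor_yo_E[OF _ e1(2) b(4) e1(4) b(8)] e1(1) b(2) by metis
        have cc: "c \<in> Hom \<A> (cod q) (cod p')" using ses_mapD[OF x(1)] by (auto simp: Hom_iff)
        have "ses_map \<A> (ide B) (x \<cdot> y2) (c \<cdot> c2) k r i' p'"
          using ses_map_cmp[OF r(5) x(1) cfD(1)[OF r(2)] cfD(1)[OF e1(2)] cfD(1)[OF b(4)]] AO by simp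
        moreover have "pu (c \<cdot> c2) \<rho> = cls F'"
          using push_push[OF r(1) ct(2) cc] cfD[OF e1(2)] cfD[OF b(4)] r(7) x(2) by simp
        ultimately show ?thesis unfolding roof_def using r by blast
      next
        assume "emor \<A> (ide B) (ide A) E2 E1"
        then obtain x c where x: "ses_map \<A> (ide B) x c i' p' j q" "pu c (cls F') = cls G"
          using emor_yo_E[OF _ b(4) e1(2) b(8) e1(4)] e1(1) b(2) by metis
        have "roof t A B k r \<rho> i' p' (cls F')"
          by (rule roof_cospan[OF mv r(2) b(4) e1(2) r(3) b(6) e1(3) r(5) x(1) r(1) EC_cls[OF b(8)]]) (use r x in simp)
        then obtain k' r' z1 z2 d1 d2 \<rho>' where r': "\<rho>' \<in> EC t A (cod r')" "cf k' r'" "dom k' = B"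
           "ses_map \<A> (ide B) z1 d1 k' r' k r" "ses_map \<A> (ide B) z2 d2 k' r' i' p'" "pu d1 \<rho>' = \<rho>" "pu d2 \<rho>' = cls F'"
          unfolding roof_def by blast
        have d1: "d1 \<in> Hom \<A> (cod r') (cod r)" using ses_mapD[OF r'(4)] by (auto simp: Hom_iff)
        have "ses_map \<A> (ide B) (y1 \<cdot> z1) (c1 \<cdot> d1) k' r' i p"
          using ses_map_cmp[OF r'(4) r(4) cfD(1)[OF r'(2)] cfD(1)[OF r(2)] cfD(1)[OF b(3)]] AO by simp
        moreover have "pu (c1 \<cdot> d1) \<rho>' = cls F"
          using push_push[OF r'(1) d1 ct(1)] cfD[OF r(2)] cfD[OF b(3)] r(6) r'(6) by simp
        ultimately show ?thesis unfolding roof_def using r' by blast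
      qed
    qed
  qed
  hence "roof t A B i1 p1 \<rho>1 i2 p2 \<rho>2" using 1 2 F1 F2 by blast
  then obtain i p y1 y2 c1 c2 \<rho> where r: "\<rho> \<in> EC t A (cod p)" "cf i p" "dom i = B"
     "ses_map \<A> (ide B) y1 c1 i p i1 p1" "ses_map \<A> (ide B) y2 c2 i p i2 p2" "pu c1 \<rho> = \<rho>1" "pu c2 \<rho> = \<rho>2"
    unfolding roof_def by blast
  have "c1 \<in> Hom \<A> (cod p) Z1" "c2 \<in> Hom \<A> (cod p) Z2"
    using ses_mapD[OF r(4)] ses_mapD[OF r(5)] 1 2 by (auto simp: Hom_iff)
  moreover have "pl \<epsilon>1 c1 = pl \<epsilon>2 c2" using cls_pull_1[OF r(4,2) 1(1) r(3)] cls_pull_1[OF r(5,2) 2(1) r(3)] 1 2 by simp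
  ultimately show "\<exists>Z c1 c2. \<exists>\<rho> \<in> EC t A Z. Z \<in> \<C> \<and> c1 \<in> Hom \<A> Z Z1 \<and> c2 \<in> Hom \<A> Z Z2 \<and> pu c1 \<rho> = \<rho>1 \<and> pu c2 \<rho> = \<rho>2 \<and>
        pl \<epsilon>1 c1 = pl \<epsilon>2 c2" using r cfD[OF r(2)] by blast
qed

text \<open>Both properties climb together: Mayer-Vietoris in length t gives roofs in length t, and
  these give Mayer-Vietoris in length t + 1.\<close>

lemma mayer_vietoris: "t \<ge> 1 \<Longrightarrow> mayer_vietoris t"
proof (induction t rule: nat_induct_at_least)
  case base
  show ?case by (rule mayer_vietoris_1)
next
  case (Suc t)
  thus ?case using roofs_step mayer_vietoris_Suc by blast
qed

lemma roofs: "t \<ge> 1 \<Longrightarrow> roofs t"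
  using roofs_step mayer_vietoris by blast

end

section \<open>Baer sums\<close>

context abelian_category
begin

lemma biprod_short_exact:
  assumes "X \<in> Obj \<A>" "Y \<in> Obj \<A>"
  shows "short_exact \<A> (in1 X Y) (pr2 X Y)"
proof (rule short_exactI_epic)
  show "epic \<A> (pr2 X Y)"
  proof (rule epicI)
    fix u assume u: "u \<in> Arr \<A>" "dom u = cod (pr2 X Y)" "u \<cdot> pr2 X Y = zm (dom (pr2 X Y)) (cod u)"
    have "u = (u \<cdot> pr2 X Y) \<cdot> in2 X Y" using u(1,2) assms by simp
    also have "\<dots> = zm Y (cod u)" unfolding u(3) using u(1,2) assms by simp
    finally show "u = zm (cod (pr2 X Y)) (cod u)" using assms by simp
  qed (use assms in simp)
  show "is_kernel \<A> (in1 X Y) (pr2 X Y)"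
  proof (rule is_kernelI)
    show "monic \<A> (in1 X Y)"
    proof (rule monicI)
      fix u assume u: "u \<in> Arr \<A>" "cod u = dom (in1 X Y)" "in1 X Y \<cdot> u = zm (dom u) (cod (in1 X Y))"
      have "u = pr1 X Y \<cdot> (in1 X Y \<cdot> u)" using u(1,2) assms by simp
      also have "\<dots> = zm (dom u) X" unfolding u(3) using u(1,2) assms by simp
      finally show "u = zm (dom u) (dom (in1 X Y))" using assms by simp
    qed (use assms in simp)
    fix u assume u: "u \<in> Arr \<A>" "cod u = dom (pr2 X Y)" "pr2 X Y \<cdot> u = zm (dom u) (cod (pr2 X Y))"
    have "in1 X Y \<cdot> (pr1 X Y \<cdot> u) = u" using biprod_split[of u X Y] u assms by simp
    thus "\<exists>w. w \<in> Arr \<A> \<and> dom w = dom u \<and> cod w = dom (in1 X Y) \<and> in1 X Y \<cdot> w = u"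
      using u assms by (intro exI[of _ "pr1 X Y \<cdot> u"]) simp
  qed (use assms in simp_all)
qed

section \<open>Morphisms between sequences and their direct sums\<close>

lemma emor_dsum:
  assumes "length E = length E'" "emor \<A> g h E F" "emor \<A> g' h' E' F'" "path \<A> B E A" "path \<A> B' E' A'"
    "path \<A> C F D" "path \<A> C' F' D'" "h \<in> Hom \<A> A D" "h' \<in> Hom \<A> A' D'"
  shows "emor \<A> (dsum \<A> g g') (dsum \<A> h h') (map2 (dsum \<A>) E E') (map2 (dsum \<A>) F F')"
  using assms
proof (induction E E' arbitrary: g g' F F' B B' C C' rule: list_induct2)
  case Nil
  thus ?case by (cases F; cases F') auto
next
  case (Cons d ds d' ds')
  obtain e es e' es' where F: "F = e # es" "F' = e' # es'" using Cons.prems by (cases F; cases F') auto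
  obtain x where x: "e \<cdot> g = x \<cdot> d" "emor \<A> x h ds es" using Cons.prems F by auto
  obtain x' where x': "e' \<cdot> g' = x' \<cdot> d'" "emor \<A> x' h' ds' es'" using Cons.prems F by auto
  have t: "x \<in> Hom \<A> (cod d) (cod e)" using emor_src[OF x(2)] Cons.prems F by auto
  have t': "x' \<in> Hom \<A> (cod d') (cod e')" using emor_src[OF x'(2)] Cons.prems F by auto
  have 1: "emor \<A> (dsum \<A> x x') (dsum \<A> h h') (map2 (dsum \<A>) ds ds') (map2 (dsum \<A>) es es')"
    by (rule Cons.IH[OF x(2) x'(2)]) (use Cons.prems F in auto)
  have ty: "d \<in> Arr \<A>" "d' \<in> Arr \<A>" "e \<in> Arr \<A>" "e' \<in> Arr \<A>" "g \<in> Arr \<A>" "dom g = dom d" "cod g = dom e"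
    "g' \<in> Arr \<A>" "dom g' = dom d'" "cod g' = dom e'" using Cons.prems F by (auto simp: Hom_iff)
  have 2: "dsum \<A> e e' \<cdot> dsum \<A> g g' = dsum \<A> x x' \<cdot> dsum \<A> d d'"
    using dsum_cmp[of g g' e e'] dsum_cmp[of d d' x x'] x(1) x'(1) ty t t' by (simp add: Hom_iff)
  have "dsum \<A> g g' \<in> Hom \<A> (dom (dsum \<A> d d')) (dom (dsum \<A> e e'))" using ty by (simp add: Hom_iff)
  thus ?case unfolding F list.map zip_Cons_Cons prod.case emor.simps using 1 2 by blast
qed

lemma emor_pr1:
  assumes "length E = length E'" "path \<A> B E A" "path \<A> B' E' A'" "A \<in> Obj \<A>" "A' \<in> Obj \<A>"
  shows "emor \<A> (pr1 B B') (pr1 A A') (map2 (dsum \<A>) E E') E"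
  using assms
proof (induction E E' arbitrary: B B' rule: list_induct2)
  case (Cons d ds d' ds')
  have ty: "d \<in> Arr \<A>" "d' \<in> Arr \<A>" "dom d = B" "dom d' = B'" using Cons.prems by auto
  have o: "B \<in> Obj \<A>" "B' \<in> Obj \<A>" using ty by auto
  have 1: "emor \<A> (pr1 (cod d) (cod d')) (pr1 A A') (map2 (dsum \<A>) ds ds') ds"
    by (rule Cons.IH) (use Cons.prems in auto)
  have 2: "d \<cdot> pr1 B B' = pr1 (cod d) (cod d') \<cdot> (dsum \<A> d d')" using ty o by simp
  have "pr1 B B' \<in> Hom \<A> (dom (dsum \<A> d d')) (dom d)" using ty o by (simp add: Hom_iff)
  thus ?case unfolding list.map zip_Cons_Cons prod.case emor.simps using 1 2 by blast
qed auto

lemma emor_pr2: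
  assumes "length E = length E'" "path \<A> B E A" "path \<A> B' E' A'" "A \<in> Obj \<A>" "A' \<in> Obj \<A>"
  shows "emor \<A> (pr2 B B') (pr2 A A') (map2 (dsum \<A>) E E') E'"
  using assms
proof (induction E E' arbitrary: B B' rule: list_induct2)
  case (Cons d ds d' ds')
  have ty: "d \<in> Arr \<A>" "d' \<in> Arr \<A>" "dom d = B" "dom d' = B'" using Cons.prems by auto
  have o: "B \<in> Obj \<A>" "B' \<in> Obj \<A>" using ty by auto
  have 1: "emor \<A> (pr2 (cod d) (cod d')) (pr2 A A') (map2 (dsum \<A>) ds ds') ds'"
    by (rule Cons.IH) (use Cons.prems in auto)
  have 2: "d' \<cdot> pr2 B B' = pr2 (cod d) (cod d') \<cdot> (dsum \<A> d d')" using ty o by simp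
  have "pr2 B B' \<in> Hom \<A> (dom (dsum \<A> d d')) (dom d')" using ty o by (simp add: Hom_iff)
  thus ?case unfolding list.map zip_Cons_Cons prod.case emor.simps using 1 2 by blast
qed auto

lemma emor_in1:
  assumes "length E = length E'" "path \<A> B E A" "path \<A> B' E' A'" "A \<in> Obj \<A>" "A' \<in> Obj \<A>"
  shows "emor \<A> (in1 B B') (in1 A A') E (map2 (dsum \<A>) E E')"
  using assms
proof (induction E E' arbitrary: B B' rule: list_induct2)
  case (Cons d ds d' ds')
  have ty: "d \<in> Arr \<A>" "d' \<in> Arr \<A>" "dom d = B" "dom d' = B'" using Cons.prems by auto
  have o: "B \<in> Obj \<A>" "B' \<in> Obj \<A>" using ty by auto
  have 1: "emor \<A> (in1 (cod d) (cod d')) (in1 A A') ds (map2 (dsum \<A>) ds ds')"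
    by (rule Cons.IH) (use Cons.prems in auto)
  have 2: "(dsum \<A> d d') \<cdot> in1 B B' = in1 (cod d) (cod d') \<cdot> d" using ty o by simp
  have "in1 B B' \<in> Hom \<A> (dom d) (dom (dsum \<A> d d'))" using ty o by (simp add: Hom_iff)
  thus ?case unfolding list.map zip_Cons_Cons prod.case emor.simps using 1 2 by blast
qed auto

lemma emor_in2:
  assumes "length E = length E'" "path \<A> B E A" "path \<A> B' E' A'" "A \<in> Obj \<A>" "A' \<in> Obj \<A>"
  shows "emor \<A> (in2 B B') (in2 A A') E' (map2 (dsum \<A>) E E')"
  using assms
proof (induction E E' arbitrary: B B' rule: list_induct2)
  case (Cons d ds d' ds')
  have ty: "d \<in> Arr \<A>" "d' \<in> Arr \<A>" "dom d = B" "dom d' = B'" using Cons.prems by auto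
  have o: "B \<in> Obj \<A>" "B' \<in> Obj \<A>" using ty by auto
  have 1: "emor \<A> (in2 (cod d) (cod d')) (in2 A A') ds' (map2 (dsum \<A>) ds ds')"
    by (rule Cons.IH) (use Cons.prems in auto)
  have 2: "(dsum \<A> d d') \<cdot> in2 B B' = in2 (cod d) (cod d') \<cdot> d'" using ty o by simp
  have "in2 B B' \<in> Hom \<A> (dom d') (dom (dsum \<A> d d'))" using ty o by (simp add: Hom_iff)
  thus ?case unfolding list.map zip_Cons_Cons prod.case emor.simps using 1 2 by blast
qed auto

lemma emor_diag:
  assumes "path \<A> B E A" "A \<in> Obj \<A>"
  shows "emor \<A> (diag \<A> B) (diag \<A> A) E (map2 (dsum \<A>) E E)"
  using assms
proof (induction E arbitrary: B)
  case (Cons d ds)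
  have ty: "d \<in> Arr \<A>" "dom d = B" using Cons.prems by auto
  have o: "B \<in> Obj \<A>" using ty by auto
  have 1: "emor \<A> (diag \<A> (cod d)) (diag \<A> A) ds (map2 (dsum \<A>) ds ds)"
    by (rule Cons.IH) (use Cons.prems in auto)
  have 2: "(dsum \<A> d d) \<cdot> diag \<A> B = diag \<A> (cod d) \<cdot> d" using dsum_diag[of d] ty o by simp
  have "diag \<A> B \<in> Hom \<A> (dom d) (dom (dsum \<A> d d))" using ty o by (simp add: Hom_iff)
  thus ?case unfolding list.map zip_Cons_Cons prod.case emor.simps using 1 2 by blast
qed auto

lemma emor_codiag:
  assumes "path \<A> B E A" "A \<in> Obj \<A>"
  shows "emor \<A> (codiag \<A> B) (codiag \<A> A) (map2 (dsum \<A>) E E) E"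
  using assms
proof (induction E arbitrary: B)
  case (Cons d ds)
  have ty: "d \<in> Arr \<A>" "dom d = B" using Cons.prems by auto
  have o: "B \<in> Obj \<A>" using ty by auto
  have 1: "emor \<A> (codiag \<A> (cod d)) (codiag \<A> A) (map2 (dsum \<A>) ds ds) ds"
    by (rule Cons.IH) (use Cons.prems in auto)
  have 2: "d \<cdot> codiag \<A> B = codiag \<A> (cod d) \<cdot> (dsum \<A> d d)" using dsum_codiag[of d] ty o by simp
  have "codiag \<A> B \<in> Hom \<A> (dom (dsum \<A> d d)) (dom d)" using ty o by (simp add: Hom_iff)
  thus ?case unfolding list.map zip_Cons_Cons prod.case emor.simps using 1 2 by blast
qed auto

end

context extension_closed_subcategory
begin

abbreviation "bsum \<equiv> baer_sum \<A> \<C>"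

text \<open>\<open>biprod\<close> is chosen in the ambient category, whereas
  \<open>sub_biproduct\<close> only places some biproduct in C; the chosen one is an extension of Y
  by X.\<close>

lemma bs_sub [simp]: "X \<in> \<C> \<Longrightarrow> Y \<in> \<C> \<Longrightarrow> bs X Y \<in> \<C>"
  using extension_closed[OF biprod_short_exact[of X Y]] by simp

lemma dsum_cf: "cf i p \<Longrightarrow> cf i' p' \<Longrightarrow> cf (dsum \<A> i i') (dsum \<A> p p')"
  by (rule cfI[OF dsum_short_exact]) (auto simp: cfD)

lemma xs_dsum: "xs t A B E \<Longrightarrow> xs t A' B' E' \<Longrightarrow> xs t (bs A A') (bs B B') (map2 (dsum \<A>) E E')"
proof (induction t A B E arbitrary: B' E' rule: ext_seq.induct)
  case (single i p)
  from single(2) show ?case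
  proof (cases rule: xs_cases)
    case s: (single i' p')
    show ?thesis using ext_seq.single[OF dsum_cf[OF single(1) s(3)]] s cfD[OF single(1)] cfD[OF s(3)] by simp
  next
    case (splice i' p' d' ds' t')
    thus ?thesis using xs_length[OF splice(4)] by simp
  qed
next
  case (splice i p t A d ds)
  from splice.prems show ?case
  proof (cases rule: xs_cases)
    case (single i' p')
    thus ?thesis using xs_length[OF splice(2)] by simp
  next
    case s: (splice i' p' d' ds' t')
    note I = cfD[OF splice(1)] and I' = cfD[OF s(2)]
    have d: "d \<in> Arr \<A>" "dom d = cod p" "d' \<in> Arr \<A>" "dom d' = cod p'"
      using xs_path[OF splice(2)] xs_path[OF s(4)] by auto
    have "xs t (bs A A') (cod (dsum \<A> p p')) (dsum \<A> d d' # map2 (dsum \<A>) ds ds')"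
      using splice.IH[of "cod p'" "d' # ds'"] s I I' by simp
    from ext_seq.splice[OF dsum_cf[OF splice(1) s(2)] this]
    show ?thesis using s I I' d by (simp add: dsum_cmp)
  qed
qed

lemma ext_dsum_cls:
  assumes E: "xs t A B E" and F: "xs t A' B' F"
  shows "ext_dsum \<A> \<C> (cls E) (cls F) = cls (map2 (dsum \<A>) E F)"
  unfolding ext_dsum_def
proof (rule Union_cls[OF E F])
  fix G G' H H' assume a: "xs t A B G" "xs t A B G'" "xs t A' B' H" "xs t A' B' H'"
    and m: "emor \<A> (ide B) (ide A) G G'" "emor \<A> (ide B') (ide A') H H'"
  have o: "A \<in> Obj \<A>" "B \<in> Obj \<A>" "A' \<in> Obj \<A>" "B' \<in> Obj \<A>" using xs_length[OF E] xs_length[OF F] by auto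
  have id: "ide A \<in> Hom \<A> A A" "ide A' \<in> Hom \<A> A' A'" using o by (auto simp: Hom_iff)
  have "length G = length H" using xs_length[OF a(1)] xs_length[OF a(3)] by simp
  from emor_dsum[OF this m xs_path[OF a(1)] xs_path[OF a(3)] xs_path[OF a(2)] xs_path[OF a(4)] id]
  have "emor \<A> (ide (bs B B')) (ide (bs A A')) (map2 (dsum \<A>) G H) (map2 (dsum \<A>) G' H')"
    using o by (simp add: dsum_id)
  thus "cls (map2 (dsum \<A>) G H) = cls (map2 (dsum \<A>) G' H')"
    by (rule cls_eqI[OF xs_dsum[OF a(1,3)] xs_dsum[OF a(2,4)]])
qed

lemma diag_Hom: "X \<in> \<C> \<Longrightarrow> diag \<A> X \<in> Hom \<A> X (bs X X)" "X \<in> \<C> \<Longrightarrow> codiag \<A> X \<in> Hom \<A> (bs X X) X"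
  by (simp_all add: Hom_iff)

lemma biprod_Hom:
  assumes "X \<in> \<C>" "Y \<in> \<C>"
  shows "pr1 X Y \<in> Hom \<A> (bs X Y) X" "pr2 X Y \<in> Hom \<A> (bs X Y) Y" "in1 X Y \<in> Hom \<A> X (bs X Y)" "in2 X Y \<in> Hom \<A> Y (bs X Y)"
  using assms by (simp_all add: Hom_iff)

lemma bsum_cls:
  assumes E: "xs t A B E" and F: "xs t A B F"
  shows "bsum A B (cls E) (cls F) = pu (codiag \<A> B) (pl (cls (map2 (dsum \<A>) E F)) (diag \<A> A))"
  unfolding baer_sum_def using ext_dsum_cls[OF E F] by simp

text \<open>The diagonal is a morphism from E to its direct sum with itself, so pulling that sum
  back along the diagonal of A is pushing E along the diagonal of B. Hence the Baer sum is E pushed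
  along the composite of diagonal, direct sum of g and g', and codiagonal, which
  \<open>codiag_dsum_diag\<close> evaluates.\<close>

lemma push_plus:
  assumes x: "\<gamma> \<in> EC t A B" and g: "g \<in> Hom \<A> B B'" "g' \<in> Hom \<A> B B'" and B': "B' \<in> \<C>"
  shows "pu (g \<boxplus> g') \<gamma> = bsum A B' (pu g \<gamma>) (pu g' \<gamma>)"
proof -
  obtain E where E: "xs t A B E" "\<gamma> = cls E" using x EC_E by blast
  obtain F where F: "xs t A B' F" "emor \<A> g (ide A) E F" "pu g \<gamma> = cls F" using ex_push[OF E(1) g(1) B'] E by metis
  obtain F' where F': "xs t A B' F'" "emor \<A> g' (ide A) E F'" "pu g' \<gamma> = cls F'" using ex_push[OF E(1) g(2) B'] E by metis
  have o: "A \<in> \<C>" "B \<in> \<C>" "ide A \<in> Hom \<A> A A" using xs_length[OF E(1)] by (auto simp: Hom_iff)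
  have gt: "g \<in> Arr \<A>" "dom g = B" "cod g = B'" "g' \<in> Arr \<A>" "dom g' = B" "cod g' = B'" using g by (auto simp: Hom_iff)
  have d: "dsum \<A> g g' \<in> Hom \<A> (bs B B) (bs B' B')" using gt by (simp add: Hom_iff)
  note EE = xs_dsum[OF E(1) E(1)]
  have "emor \<A> (dsum \<A> g g') (ide (bs A A)) (map2 (dsum \<A>) E E) (map2 (dsum \<A>) F F')"
    using emor_dsum[OF refl F(2) F'(2) xs_path[OF E(1)] xs_path[OF E(1)] xs_path[OF F(1)] xs_path[OF F'(1)] o(3,3)] o by (simp add: dsum_id)
  from push_cls[OF EE xs_dsum[OF F(1) F'(1)] this d]
  have 1: "cls (map2 (dsum \<A>) F F') = pu (dsum \<A> g g') (cls (map2 (dsum \<A>) E E))" by simp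
  have 2: "pl (cls (map2 (dsum \<A>) E E)) (diag \<A> A) = pu (diag \<A> B) \<gamma>"
    using push_pull_emor[OF E(1) EE emor_diag[OF xs_path[OF E(1)]] diag_Hom(1)[OF o(1)]] o E by simp
  have "bsum A B' (pu g \<gamma>) (pu g' \<gamma>) = pu (codiag \<A> B') (pl (pu (dsum \<A> g g') (cls (map2 (dsum \<A>) E E))) (diag \<A> A))"
    using bsum_cls[OF F(1) F'(1)] F F' 1 by simp
  also have "\<dots> = pu (codiag \<A> B') (pu (dsum \<A> g g') (pu (diag \<A> B) \<gamma>))"
    using push_pull[OF EC_cls[OF EE] d diag_Hom(1)[OF o(1)]] 2 o B' by simp
  also have "\<dots> = pu (codiag \<A> B') (pu (dsum \<A> g g' \<cdot> diag \<A> B) \<gamma>)"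
    using push_push[OF x diag_Hom(1)[OF o(2)] d] o B' by simp
  also have "\<dots> = pu (codiag \<A> B' \<cdot> (dsum \<A> g g' \<cdot> diag \<A> B)) \<gamma>"
    using push_push[OF x cmp_in_Hom[OF diag_Hom(1)[OF o(2)] d] diag_Hom(2)[OF B']] o B' by simp
  also have "codiag \<A> B' \<cdot> (dsum \<A> g g' \<cdot> diag \<A> B) = g \<boxplus> g'" using codiag_dsum_diag[of g g'] gt by simp
  finally show ?thesis by simp
qed

text \<open>The mirror image of \<open>push_plus\<close>: now the codiagonal is the morphism between
  E and its direct sum with itself.\<close>

lemma pull_plus:
  assumes x: "\<gamma> \<in> EC t A B" and h: "h \<in> Hom \<A> A' A" "h' \<in> Hom \<A> A' A" and A': "A' \<in> \<C>"
  shows "pl \<gamma> (h \<boxplus> h') = bsum A' B (pl \<gamma> h) (pl \<gamma> h')"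
proof -
  obtain E where E: "xs t A B E" "\<gamma> = cls E" using x EC_E by blast
  obtain F where F: "xs t A' B F" "emor \<A> (ide B) h F E" "pl \<gamma> h = cls F" using ex_pull[OF E(1) h(1) A'] E by metis
  obtain F' where F': "xs t A' B F'" "emor \<A> (ide B) h' F' E" "pl \<gamma> h' = cls F'" using ex_pull[OF E(1) h(2) A'] E by metis
  have o: "A \<in> \<C>" "B \<in> \<C>" using xs_length[OF E(1)] by auto
  have gt: "h \<in> Arr \<A>" "dom h = A'" "cod h = A" "h' \<in> Arr \<A>" "dom h' = A'" "cod h' = A" using h by (auto simp: Hom_iff)
  have d: "dsum \<A> h h' \<in> Hom \<A> (bs A' A') (bs A A)" using gt by (simp add: Hom_iff)
  note EE = xs_dsum[OF E(1) E(1)]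
  have l: "length F = length F'" using xs_length[OF F(1)] xs_length[OF F'(1)] by simp
  have "emor \<A> (ide (bs B B)) (dsum \<A> h h') (map2 (dsum \<A>) F F') (map2 (dsum \<A>) E E)"
    using emor_dsum[OF l F(2) F'(2) xs_path[OF F(1)] xs_path[OF F'(1)] xs_path[OF E(1)] xs_path[OF E(1)] h] o by (simp add: dsum_id)
  from pull_cls[OF EE xs_dsum[OF F(1) F'(1)] this d]
  have 1: "cls (map2 (dsum \<A>) F F') = pl (cls (map2 (dsum \<A>) E E)) (dsum \<A> h h')" by simp
  have 2: "pu (codiag \<A> B) (cls (map2 (dsum \<A>) E E)) = pl \<gamma> (codiag \<A> A)"
    using push_pull_emor[OF EE E(1) emor_codiag[OF xs_path[OF E(1)]] diag_Hom(2)[OF o(1)]] o E by simp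
  have "bsum A' B (pl \<gamma> h) (pl \<gamma> h') = pu (codiag \<A> B) (pl (pl (cls (map2 (dsum \<A>) E E)) (dsum \<A> h h')) (diag \<A> A'))"
    using bsum_cls[OF F(1) F'(1)] F F' 1 by simp
  also have "\<dots> = pu (codiag \<A> B) (pl (cls (map2 (dsum \<A>) E E)) (dsum \<A> h h' \<cdot> diag \<A> A'))"
    using pull_pull[OF EC_cls[OF EE] d diag_Hom(1)[OF A']] A' by simp
  also have "\<dots> = pl (pu (codiag \<A> B) (cls (map2 (dsum \<A>) E E))) (dsum \<A> h h' \<cdot> diag \<A> A')"
    by (rule push_pull[OF EC_cls[OF EE] diag_Hom(2)[OF o(2)] cmp_in_Hom[OF diag_Hom(1)[OF A'] d] o(2) A'])
  also have "\<dots> = pl \<gamma> (codiag \<A> A \<cdot> (dsum \<A> h h' \<cdot> diag \<A> A'))"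
    unfolding 2 using pull_pull[OF x diag_Hom(2)[OF o(1)] cmp_in_Hom[OF diag_Hom(1)[OF A'] d]] o A' by simp
  also have "codiag \<A> A \<cdot> (dsum \<A> h h' \<cdot> diag \<A> A') = h \<boxplus> h'" using codiag_dsum_diag[of h h'] gt by simp
  finally show ?thesis by simp
qed

text \<open>The functor \<open>Ext\<^sup>t(A, -)\<close> preserves binary products, hence takes values in abelian groups, with addition
  induced by that of morphisms; by \<open>push_plus\<close> the Baer sum is this addition.\<close>

lemma ex_pairing:
  assumes "\<gamma> \<in> EC t A B" "\<gamma>' \<in> EC t A B'"
  obtains z where "z \<in> EC t A (bs B B')" "pu (pr1 B B') z = \<gamma>" "pu (pr2 B B') z = \<gamma>'"
proof -
  obtain E where E: "xs t A B E" "\<gamma> = cls E" using assms(1) EC_E by blast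
  obtain E' where E': "xs t A B' E'" "\<gamma>' = cls E'" using assms(2) EC_E by blast
  have o: "A \<in> \<C>" "B \<in> \<C>" "B' \<in> \<C>" using xs_length[OF E(1)] xs_length[OF E'(1)] by auto
  have l: "length E = length E'" using xs_length[OF E(1)] xs_length[OF E'(1)] by simp
  note D = xs_dsum[OF E(1) E'(1)] and H = biprod_Hom[OF o(1,1)] biprod_Hom[OF o(2,3)]
  have e: "pu (pr1 B B') (cls (map2 (dsum \<A>) E E')) = pl \<gamma> (pr1 A A)"
    "pu (pr2 B B') (cls (map2 (dsum \<A>) E E')) = pl \<gamma>' (pr2 A A)"
    using push_pull_emor[OF D E(1) emor_pr1[OF l xs_path[OF E(1)] xs_path[OF E'(1)]] H(1)]
      push_pull_emor[OF D E'(1) emor_pr2[OF l xs_path[OF E(1)] xs_path[OF E'(1)]] H(2)] o E E' by auto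
  let ?z = "pl (cls (map2 (dsum \<A>) E E')) (diag \<A> A)"
  have "pu (pr1 B B') ?z = pl \<gamma> (pr1 A A \<cdot> diag \<A> A)" "pu (pr2 B B') ?z = pl \<gamma>' (pr2 A A \<cdot> diag \<A> A)"
    using push_pull[OF EC_cls[OF D] H(5) diag_Hom(1)[OF o(1)]] push_pull[OF EC_cls[OF D] H(6) diag_Hom(1)[OF o(1)]]
      pull_pull[OF assms(1) H(1) diag_Hom(1)[OF o(1)]] pull_pull[OF assms(2) H(2) diag_Hom(1)[OF o(1)]] e o by auto
  moreover have "?z \<in> EC t A (bs B B')" by (rule pull_EC[OF EC_cls[OF D] diag_Hom(1)[OF o(1)] o(1)])
  ultimately show ?thesis using that o assms by simp
qed

text \<open>Dual to \<open>ex_pairing\<close>. It serves to prove additivity of the Yoneda product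
  in its right factor, and to obtain two given units from one class in
  \<open>ex_co_angled_pair\<close>.\<close>

lemma ex_copairing:
  assumes "\<gamma> \<in> EC t A B" "\<gamma>' \<in> EC t A' B"
  obtains w where "w \<in> EC t (bs A A') B" "pl w (in1 A A') = \<gamma>" "pl w (in2 A A') = \<gamma>'"
proof -
  obtain E where E: "xs t A B E" "\<gamma> = cls E" using assms(1) EC_E by blast
  obtain E' where E': "xs t A' B E'" "\<gamma>' = cls E'" using assms(2) EC_E by blast
  have o: "A \<in> \<C>" "A' \<in> \<C>" "B \<in> \<C>" using xs_length[OF E(1)] xs_length[OF E'(1)] by auto
  have l: "length E = length E'" using xs_length[OF E(1)] xs_length[OF E'(1)] by simp
  note D = xs_dsum[OF E(1) E'(1)] and H = biprod_Hom[OF o(3,3)] biprod_Hom[OF o(1,2)]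
  have e: "pl (cls (map2 (dsum \<A>) E E')) (in1 A A') = pu (in1 B B) \<gamma>"
    "pl (cls (map2 (dsum \<A>) E E')) (in2 A A') = pu (in2 B B) \<gamma>'"
    using push_pull_emor[OF E(1) D emor_in1[OF l xs_path[OF E(1)] xs_path[OF E'(1)]] H(7)]
      push_pull_emor[OF E'(1) D emor_in2[OF l xs_path[OF E(1)] xs_path[OF E'(1)]] H(8)] o E E' by auto
  let ?w = "pu (codiag \<A> B) (cls (map2 (dsum \<A>) E E'))"
  have "pl ?w (in1 A A') = pu (codiag \<A> B \<cdot> in1 B B) \<gamma>" "pl ?w (in2 A A') = pu (codiag \<A> B \<cdot> in2 B B) \<gamma>'"
    using push_pull[OF EC_cls[OF D] diag_Hom(2)[OF o(3)] H(7)] push_pull[OF EC_cls[OF D] diag_Hom(2)[OF o(3)] H(8)]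
      push_push[OF assms(1) H(3) diag_Hom(2)[OF o(3)]] push_push[OF assms(2) H(4) diag_Hom(2)[OF o(3)]] e o by auto
  moreover have "?w \<in> EC t (bs A A') B" by (rule push_EC[OF EC_cls[OF D] diag_Hom(2)[OF o(3)] o(3)])
  ultimately show ?thesis using that o assms by simp
qed

lemma EC_nonempty: "t \<ge> 1 \<Longrightarrow> A \<in> \<C> \<Longrightarrow> B \<in> \<C> \<Longrightarrow> EC t A B \<noteq> {}"
proof (induction t arbitrary: B rule: nat_induct_at_least)
  case base
  have "cf (in1 B A) (pr2 B A)" by (rule cfI[OF biprod_short_exact]) (use base in auto)
  from EC_cls[OF xs_1[OF this, of B A]] show ?case using base by auto
next
  case (Suc t)
  have c: "cf (in1 B A) (pr2 B A)" by (rule cfI[OF biprod_short_exact]) (use Suc in auto)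
  obtain \<rho> where "\<rho> \<in> EC t A A" using Suc by blast
  from ymul_EC[OF EC_cls[OF xs_1[OF c, of B A]] this] show ?case using Suc by auto
qed

section \<open>The group structure on Ext\<close>

lemma bsum_pairing:
  assumes "\<gamma> \<in> EC t A B" "\<gamma>' \<in> EC t A B"
  obtains z where "z \<in> EC t A (bs B B)" "pu (pr1 B B) z = \<gamma>" "pu (pr2 B B) z = \<gamma>'"
    "bsum A B \<gamma> \<gamma>' = pu (pr1 B B \<boxplus> pr2 B B) z"
proof -
  obtain z where z: "z \<in> EC t A (bs B B)" "pu (pr1 B B) z = \<gamma>" "pu (pr2 B B) z = \<gamma>'" by (rule ex_pairing[OF assms])
  have B: "B \<in> \<C>" using EC_obj[OF assms(1)] by simp
  have "bsum A B \<gamma> \<gamma>' = pu (pr1 B B \<boxplus> pr2 B B) z" using push_plus[OF z(1) biprod_Hom(1,2)[OF B B] B] z by simp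
  thus ?thesis using that z by blast
qed

lemma plus_Hom: "f \<in> Hom \<A> X Y \<Longrightarrow> g \<in> Hom \<A> X Y \<Longrightarrow> f \<boxplus> g \<in> Hom \<A> X Y"
  by (simp add: Hom_iff)

lemma bsum_EC [simp]: "\<gamma> \<in> EC t A B \<Longrightarrow> \<gamma>' \<in> EC t A B \<Longrightarrow> bsum A B \<gamma> \<gamma>' \<in> EC t A B"
  using bsum_pairing[of \<gamma> t A B \<gamma>'] push_EC plus_Hom biprod_Hom EC_obj by metis

lemma bsum_comm:
  assumes "\<gamma> \<in> EC t A B" "\<gamma>' \<in> EC t A B"
  shows "bsum A B \<gamma> \<gamma>' = bsum A B \<gamma>' \<gamma>"
proof -
  obtain z where z: "z \<in> EC t A (bs B B)" "pu (pr1 B B) z = \<gamma>" "pu (pr2 B B) z = \<gamma>'"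
    "bsum A B \<gamma> \<gamma>' = pu (pr1 B B \<boxplus> pr2 B B) z" by (rule bsum_pairing[OF assms])
  have B: "B \<in> \<C>" using EC_obj[OF assms(1)] by simp
  have "bsum A B \<gamma>' \<gamma> = pu (pr2 B B \<boxplus> pr1 B B) z" using push_plus[OF z(1) biprod_Hom(2,1)[OF B B] B] z by simp
  moreover have "pr2 B B \<boxplus> pr1 B B = pr1 B B \<boxplus> pr2 B B" by (rule plus_comm) (use B in auto)
  ultimately show ?thesis using z by simp
qed

lemma bsum_assoc:
  assumes "\<gamma> \<in> EC t A B" "\<gamma>' \<in> EC t A B" "\<gamma>'' \<in> EC t A B"
  shows "bsum A B (bsum A B \<gamma> \<gamma>') \<gamma>'' = bsum A B \<gamma> (bsum A B \<gamma>' \<gamma>'')"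
proof -
  have B: "B \<in> \<C>" "bs B B \<in> \<C>" using EC_obj[OF assms(1)] by auto
  obtain y where y: "y \<in> EC t A (bs B B)" "pu (pr1 B B) y = \<gamma>" "pu (pr2 B B) y = \<gamma>'" by (rule ex_pairing[OF assms(1,2)])
  obtain z where z: "z \<in> EC t A (bs (bs B B) B)" "pu (pr1 (bs B B) B) z = y" "pu (pr2 (bs B B) B) z = \<gamma>''"
    by (rule ex_pairing[OF y(1) assms(3)])
  note H = biprod_Hom(1,2)[OF B(1,1)] biprod_Hom(1,2)[OF B(2,1)]
  define q1 where "q1 = pr1 B B \<cdot> pr1 (bs B B) B"
  define q2 where "q2 = pr2 B B \<cdot> pr1 (bs B B) B"
  define q3 where "q3 = pr2 (bs B B) B"
  have q: "q1 \<in> Hom \<A> (bs (bs B B) B) B" "q2 \<in> Hom \<A> (bs (bs B B) B) B" "q3 \<in> Hom \<A> (bs (bs B B) B) B"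
    unfolding q1_def q2_def q3_def using cmp_in_Hom[OF H(3,1)] cmp_in_Hom[OF H(3,2)] H(4) by auto
  have p: "pu q1 z = \<gamma>" "pu q2 z = \<gamma>'" "pu q3 z = \<gamma>''"
    unfolding q1_def q2_def q3_def using push_push[OF z(1) H(3) H(1)] push_push[OF z(1) H(3) H(2)] y z B by auto
  have "bsum A B (bsum A B \<gamma> \<gamma>') \<gamma>'' = pu ((q1 \<boxplus> q2) \<boxplus> q3) z"
    using push_plus[OF z(1) plus_Hom[OF q(1,2)] q(3) B(1)] push_plus[OF z(1) q(1,2) B(1)] p by simp
  moreover have "bsum A B \<gamma> (bsum A B \<gamma>' \<gamma>'') = pu (q1 \<boxplus> (q2 \<boxplus> q3)) z"
    using push_plus[OF z(1) q(1) plus_Hom[OF q(2,3)] B(1)] push_plus[OF z(1) q(2,3) B(1)] p by simp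
  moreover have "(q1 \<boxplus> q2) \<boxplus> q3 = q1 \<boxplus> (q2 \<boxplus> q3)" by (rule plus_assoc) (use q in \<open>auto simp: Hom_iff\<close>)
  ultimately show ?thesis by simp
qed

lemma zero_Hom: "X \<in> \<C> \<Longrightarrow> Y \<in> \<C> \<Longrightarrow> zm X Y \<in> Hom \<A> X Y"
  by (simp add: Hom_iff)

text \<open>Both classes are components of one class over the biproduct, and the two projections
  agree when followed by zero.\<close>

lemma push_zero_eq:
  assumes "\<gamma> \<in> EC t A B" "\<gamma>' \<in> EC t A B"
  shows "pu (zm B B) \<gamma> = pu (zm B B) \<gamma>'"
proof -
  have B: "B \<in> \<C>" "bs B B \<in> \<C>" using EC_obj[OF assms(1)] by auto
  obtain z where z: "z \<in> EC t A (bs B B)" "pu (pr1 B B) z = \<gamma>" "pu (pr2 B B) z = \<gamma>'" by (rule ex_pairing[OF assms])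
  show ?thesis
    using push_push[OF z(1) biprod_Hom(1)[OF B(1,1)] zero_Hom[OF B(1,1)]] push_push[OF z(1) biprod_Hom(2)[OF B(1,1)] zero_Hom[OF B(1,1)]] z B by simp
qed

lemma idm_Hom: "X \<in> \<C> \<Longrightarrow> ide X \<in> Hom \<A> X X"
  by (simp add: Hom_iff)

lemma bsum_push_zero:
  assumes "\<gamma> \<in> EC t A B" "\<gamma>' \<in> EC t A B"
  shows "bsum A B (pu (zm B B) \<gamma>) \<gamma>' = \<gamma>'"
proof -
  have B: "B \<in> \<C>" using EC_obj[OF assms(1)] by auto
  show ?thesis unfolding push_zero_eq[OF assms]
    using push_plus[OF assms(2) zero_Hom[OF B B] idm_Hom[OF B] B] assms B by simp
qed

abbreviation "EG \<equiv> Ext \<A> \<C>"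

lemma EG_simps [simp]: "carrier (EG t A B) = EC t A B" "mult (EG t A B) = bsum A B"
  by (simp_all add: Ext_def)

definition ez :: "nat \<Rightarrow> 'o \<Rightarrow> 'o \<Rightarrow> 'm list set" where "ez t A B = \<one>\<^bsub>EG t A B\<^esub>"

text \<open>Any class pushed along zero is neutral for the Baer sum, and commutativity makes neutral
  elements unique. This evaluates the definite description in \<open>Ext\<close>.\<close>

lemma push_zero:
  assumes "\<gamma> \<in> EC t A B"
  shows "pu (zm B B) \<gamma> = ez t A B"
proof -
  have B: "B \<in> \<C>" using EC_obj[OF assms] by auto
  have "(THE z. z \<in> EC t A B \<and> (\<forall>\<gamma> \<in> EC t A B. bsum A B z \<gamma> = \<gamma>)) = pu (zm B B) \<gamma>"
  proof (rule the_equality)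
    show c: "pu (zm B B) \<gamma> \<in> EC t A B \<and> (\<forall>\<gamma>' \<in> EC t A B. bsum A B (pu (zm B B) \<gamma>) \<gamma>' = \<gamma>')"
      using bsum_push_zero[OF assms] push_EC[OF assms zero_Hom[OF B B] B] by blast
    fix z assume z: "z \<in> EC t A B \<and> (\<forall>\<gamma> \<in> EC t A B. bsum A B z \<gamma> = \<gamma>)"
    have "pu (zm B B) \<gamma> = bsum A B z (pu (zm B B) \<gamma>)"
      by (rule bspec[OF conjunct2[OF z] conjunct1[OF c], symmetric])
    also have "\<dots> = bsum A B (pu (zm B B) \<gamma>) z" by (rule bsum_comm[OF conjunct1[OF z] conjunct1[OF c]])
    also have "\<dots> = z" by (rule bspec[OF conjunct2[OF c] conjunct1[OF z]])
    finally show "z = pu (zm B B) \<gamma>" by simp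
  qed
  thus ?thesis by (simp add: ez_def Ext_def)
qed

lemma ez_EC: "t \<ge> 1 \<Longrightarrow> A \<in> \<C> \<Longrightarrow> B \<in> \<C> \<Longrightarrow> ez t A B \<in> EC t A B"
proof -
  assume a: "t \<ge> 1" "A \<in> \<C>" "B \<in> \<C>"
  obtain \<gamma> where g: "\<gamma> \<in> EC t A B" using EC_nonempty[OF a] by blast
  show "ez t A B \<in> EC t A B" using push_EC[OF g zero_Hom[OF a(3,3)] a(3)] push_zero[OF g] by simp
qed

lemma Ext_comm_group:
  assumes "t \<ge> 1" "A \<in> \<C>" "B \<in> \<C>"
  shows "comm_group (EG t A B)"
proof -
  have o: "\<one>\<^bsub>EG t A B\<^esub> = ez t A B" by (simp add: ez_def)
  have l: "bsum A B (ez t A B) \<gamma> = \<gamma>" if "\<gamma> \<in> EC t A B" for \<gamma>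
    using bsum_push_zero[OF that that] push_zero[OF that] by simp
  have inv: "\<exists>\<gamma>' \<in> EC t A B. bsum A B \<gamma>' \<gamma> = ez t A B" if g: "\<gamma> \<in> EC t A B" for \<gamma>
  proof -
    have n: "neg (ide B) \<in> Hom \<A> B B" using assms by (simp add: Hom_iff)
    have "bsum A B (pu (neg (ide B)) \<gamma>) \<gamma> = ez t A B"
      using push_plus[OF g n idm_Hom[OF assms(3)] assms(3)] g push_zero[OF g] assms by simp
    thus ?thesis using push_EC[OF g n assms(3)] by blast
  qed
  show ?thesis
    by (rule comm_groupI) (use o l inv bsum_comm bsum_assoc ez_EC[OF assms] in auto)
qed

section \<open>Neutral classes and additivity of the operations\<close>

lemma push_zero':
  assumes "\<gamma> \<in> EC t A B" "B' \<in> \<C>"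
  shows "pu (zm B B') \<gamma> = ez t A B'"
proof -
  have B: "B \<in> \<C>" using EC_obj[OF assms(1)] by auto
  have "pu (zm B' B') (pu (zm B B') \<gamma>) = pu (zm B B') \<gamma>"
    using push_push[OF assms(1) zero_Hom[OF B assms(2)] zero_Hom[OF assms(2,2)]] assms B by simp
  thus ?thesis using push_zero[OF push_EC[OF assms(1) zero_Hom[OF B assms(2)] assms(2)]] by simp
qed

lemma pull_ez:
  assumes "h \<in> Hom \<A> A' A" "A' \<in> \<C>" "A \<in> \<C>" "B \<in> \<C>" "t \<ge> 1"
  shows "pl (ez t A B) h = ez t A' B"
proof -
  have g: "ez t A B \<in> EC t A B" using ez_EC assms by blast
  have "pl (pu (zm B B) (ez t A B)) h = pu (zm B B) (pl (ez t A B) h)"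
    using push_pull[OF g zero_Hom[OF assms(4,4)] assms(1)] assms by simp
  thus ?thesis using push_zero[OF g] push_zero[OF pull_EC[OF g assms(1,2)]] by simp
qed

lemma push_ez:
  assumes "g \<in> Hom \<A> B B'" "A \<in> \<C>" "B \<in> \<C>" "B' \<in> \<C>" "t \<ge> 1"
  shows "pu g (ez t A B) = ez t A B'"
proof -
  have e: "ez t A B \<in> EC t A B" using ez_EC assms by blast
  have "pu g (pu (zm B B) (ez t A B)) = pu (zm B B') (ez t A B)"
    using push_push[OF e zero_Hom[OF assms(3,3)] assms(1)] assms by (simp add: Hom_iff)
  thus ?thesis using push_zero[OF e] push_zero'[OF e assms(4)] by simp
qed

text \<open>The zero morphism from E to itself has zero at both ends, so pushing along zero and
  pulling along zero agree by \<open>push_pull_emor\<close>; the former is already known to be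
  neutral.\<close>

lemma pull_zero:
  assumes "\<gamma> \<in> EC t A B" "A' \<in> \<C>"
  shows "pl \<gamma> (zm A' A) = ez t A' B"
proof -
  obtain E where E: "xs t A B E" "\<gamma> = cls E" using assms(1) EC_E by blast
  have o: "A \<in> \<C>" "B \<in> \<C>" "t \<ge> 1" using xs_length[OF E(1)] by auto
  have "pu (zm B B) \<gamma> = pl \<gamma> (zm A A)"
    using push_pull_emor[OF E(1) E(1) emor_zero[OF xs_path[OF E(1)] xs_path[OF E(1)]] zero_Hom[OF o(1,1)]] o E by simp
  hence "ez t A' B = pl (pl \<gamma> (zm A A)) (zm A' A)"
    using push_zero[OF assms(1)] pull_ez[OF zero_Hom[OF assms(2) o(1)] assms(2) o] by simp
  thus ?thesis using pull_pull[OF assms(1) zero_Hom[OF o(1,1)] zero_Hom[OF assms(2) o(1)]] o assms by simp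
qed

lemma ymul_ez_l:
  assumes "\<rho> \<in> EC t A Z" "B \<in> \<C>" "s \<ge> 1"
  shows "ym (ez s Z B) \<rho> = ez (s + t) A B"
proof -
  have Z: "Z \<in> \<C>" using EC_obj[OF assms(1)] by simp
  have e: "ez s Z B \<in> EC s Z B" using ez_EC assms Z by blast
  show ?thesis using push_ymul[OF e assms(1) zero_Hom[OF assms(2,2)] assms(2)] push_zero[OF e] push_zero[OF ymul_EC[OF e assms(1)]] by simp
qed

lemma ymul_ez_r:
  assumes "\<gamma> \<in> EC s Z B" "A \<in> \<C>" "t \<ge> 1"
  shows "ym \<gamma> (ez t A Z) = ez (s + t) A B"
proof -
  have Z: "Z \<in> \<C>" "B \<in> \<C>" using EC_obj[OF assms(1)] by auto
  have e: "ez t A Z \<in> EC t A Z" using ez_EC assms Z by blast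
  show ?thesis using pull_ymul[OF assms(1) e zero_Hom[OF assms(2,2)] assms(2)] pull_zero[OF e assms(2)] pull_zero[OF ymul_EC[OF assms(1) e] assms(2)] by simp
qed

lemma push_bsum:
  assumes "\<gamma> \<in> EC t A B" "\<gamma>' \<in> EC t A B" "g \<in> Hom \<A> B B'" "B' \<in> \<C>"
  shows "pu g (bsum A B \<gamma> \<gamma>') = bsum A B' (pu g \<gamma>) (pu g \<gamma>')"
proof -
  obtain z where z: "z \<in> EC t A (bs B B)" "pu (pr1 B B) z = \<gamma>" "pu (pr2 B B) z = \<gamma>'"
    "bsum A B \<gamma> \<gamma>' = pu (pr1 B B \<boxplus> pr2 B B) z" by (rule bsum_pairing[OF assms(1,2)])
  have B: "B \<in> \<C>" using EC_obj[OF assms(1)] by simp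
  note H = biprod_Hom(1,2)[OF B B]
  have "pu g (bsum A B \<gamma> \<gamma>') = pu (g \<cdot> (pr1 B B \<boxplus> pr2 B B)) z"
    unfolding z(4) by (rule push_push[OF z(1) plus_Hom[OF H] assms(3) B assms(4)])
  also have "g \<cdot> (pr1 B B \<boxplus> pr2 B B) = (g \<cdot> pr1 B B) \<boxplus> (g \<cdot> pr2 B B)" by (rule plus_cmp[OF H assms(3)])
  also have "pu \<dots> z = bsum A B' (pu (g \<cdot> pr1 B B) z) (pu (g \<cdot> pr2 B B) z)"
    by (rule push_plus[OF z(1) cmp_in_Hom[OF H(1) assms(3)] cmp_in_Hom[OF H(2) assms(3)] assms(4)])
  finally show ?thesis using push_push[OF z(1) H(1) assms(3) B assms(4)] push_push[OF z(1) H(2) assms(3) B assms(4)] z by simp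
qed

lemma ymul_bsum_l:
  assumes "\<gamma> \<in> EC s Z B" "\<gamma>' \<in> EC s Z B" "\<rho> \<in> EC t A Z"
  shows "ym (bsum Z B \<gamma> \<gamma>') \<rho> = bsum A B (ym \<gamma> \<rho>) (ym \<gamma>' \<rho>)"
proof -
  obtain z where z: "z \<in> EC s Z (bs B B)" "pu (pr1 B B) z = \<gamma>" "pu (pr2 B B) z = \<gamma>'"
    "bsum Z B \<gamma> \<gamma>' = pu (pr1 B B \<boxplus> pr2 B B) z" by (rule bsum_pairing[OF assms(1,2)])
  have B: "B \<in> \<C>" using EC_obj[OF assms(1)] by simp
  note H = biprod_Hom(1,2)[OF B B]
  show ?thesis
    using push_ymul[OF z(1) assms(3) plus_Hom[OF H] B] push_ymul[OF z(1) assms(3) H(1) B] push_ymul[OF z(1) assms(3) H(2) B]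
      push_plus[OF ymul_EC[OF z(1) assms(3)] H B] z by simp
qed

lemma ymul_bsum_r:
  assumes "\<gamma> \<in> EC s Z B" "\<rho> \<in> EC t A Z" "\<rho>' \<in> EC t A Z"
  shows "ym \<gamma> (bsum A Z \<rho> \<rho>') = bsum A B (ym \<gamma> \<rho>) (ym \<gamma> \<rho>')"
proof -
  obtain w where w: "w \<in> EC t (bs A A) Z" "pl w (in1 A A) = \<rho>" "pl w (in2 A A) = \<rho>'" by (rule ex_copairing[OF assms(2,3)])
  have A: "A \<in> \<C>" using EC_obj[OF assms(2)] by simp
  note H = biprod_Hom(3,4)[OF A A]
  have "pl w (in1 A A \<boxplus> in2 A A) = bsum A Z \<rho> \<rho>'" using pull_plus[OF w(1) H A] w by simp
  thus ?thesis
    using pull_ymul[OF assms(1) w(1) plus_Hom[OF H] A] pull_ymul[OF assms(1) w(1) H(1) A] pull_ymul[OF assms(1) w(1) H(2) A]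
      pull_plus[OF ymul_EC[OF assms(1) w(1)] H A] w by simp
qed

section \<open>Exactness of the covariant long sequences\<close>

lemma ez_cf_section:
  assumes gq: "cf g q" and z: "cls [g, q] = ez 1 (cod q) (dom g)"
  obtains s where "s \<in> Hom \<A> (cod q) (dom q)" "q \<cdot> s = ide (cod q)"
proof -
  note G = cfD[OF gq]
  have "pu (zm (dom g) (dom g)) (cls [g, q]) = cls [g, q]"
    using push_zero[OF EC_cls[OF xs_1[OF gq refl refl]]] z by simp
  then obtain y where y: "ses_map \<A> (zm (dom g) (dom g)) y (ide (cod q)) g q g q"
    using push_1_E[OF gq zero_Hom[OF G(2,2)] G(2) gq refl refl] by blast
  note Y = ses_mapD[OF y]
  \<comment> \<open>A neutral class is unchanged by pushing along zero, so y is the middle of an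
    endomorphism with zero on the left and the identity on the right. It kills g, and its factor
    through q is the section.\<close>
  have "y \<cdot> g = zm (dom g) (cod y)" using Y G by simp
  then obtain s where s: "s \<in> Arr \<A>" "cod s = cod y" "dom s = cod q" "s \<cdot> q = y"
    using is_cokernel_lift[OF short_exactD(2)[OF G(1)], of y] Y G by auto
  have "(q \<cdot> s) \<cdot> q = ide (cod q) \<cdot> q" using Y G s by simp
  hence "q \<cdot> s = ide (cod q)"
    by (rule epicD[OF short_exactD(4)[OF G(1)]]) (use s Y G in auto)
  thus ?thesis using that[of s] s Y G by (simp add: Hom_iff)
qed

text \<open>The endomorphism with middle component s q has zero on the left and the identity on the
  right, so the class equals its own push-out along zero.\<close>

lemma section_ez:
  assumes gq: "cf g q" and s: "s \<in> Hom \<A> (cod q) (dom q)" "q \<cdot> s = ide (cod q)"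
  shows "cls [g, q] = ez 1 (cod q) (dom g)"
proof -
  note G = cfD[OF gq]
  have st: "s \<in> Arr \<A>" "dom s = cod q" "cod s = dom q" using s by (auto simp: Hom_iff)
  have m: "ses_map \<A> (zm (dom g) (dom g)) (s \<cdot> q) (ide (cod q)) g q g q"
    unfolding ses_map_def Hom_iff using G st reassoc[OF s(2), of q] by simp
  have x: "xs 1 (cod q) (dom g) [g, q]" by (rule xs_1[OF gq refl refl])
  have "pu (zm (dom g) (dom g)) (cls [g, q]) = cls [g, q]"
    by (rule push_cls[OF x x _ zero_Hom[OF G(2,2)]]) (use m emor_single[OF gq gq idm_Hom[OF G(3)]] in blast)
  thus ?thesis using push_zero[OF EC_cls[OF x]] by simp
qed

text \<open>The kernel pair of p has a diagonal, and this is a section of the pulled back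
  deflation.\<close>

lemma pull_own_deflation:
  assumes ip: "cf i p"
  shows "pl (cls [i, p]) p = ez 1 (dom p) (dom i)"
proof -
  note I = cfD[OF ip]
  obtain i' p' y where 1: "short_exact \<A> i' p'" "ses_map \<A> (ide (dom i)) y p i' p' i p"
    "dom i' = dom i" "cod p' = dom p" "is_pullback \<A> p p p' y"
    by (rule ses_map_pullback[OF I(1) I(6) refl])
  have c: "cf i' p'" by (rule cfI[OF 1(1)]) (use 1 I in auto)
  obtain s where "s \<in> Arr \<A>" "cod s = dom p'" "dom s = dom p" "p' \<cdot> s = ide (dom p)" "y \<cdot> s = ide (dom p)"
    using is_pullback_lift[OF 1(5), of "ide (dom p)" "ide (dom p)"] I by auto
  hence "cls [i', p'] = ez 1 (dom p) (dom i)" using section_ez[OF c, of s] 1 by (simp add: Hom_iff)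
  thus ?thesis using cls_pull_1[OF 1(2) c ip 1(3)] by simp
qed

text \<open>Exactness at Ext^1 into the left end. The pushed conflation splits, and composing with
  its retraction extends i over the middle term of the given conflation; this extension v induces u
  on the right ends.\<close>

lemma push_kernel_1:
  assumes ip: "cf i p" and x: "\<phi> \<in> EC 1 Z (dom i)" and z: "pu i \<phi> = ez 1 Z (dom p)"
  obtains u where "u \<in> Hom \<A> Z (cod p)" "\<phi> = pl (cls [i, p]) u"
proof -
  note I = cfD[OF ip]
  obtain f q where 1: "cf f q" "dom f = dom i" "cod q = Z" "\<phi> = cls [f, q]" "xs 1 Z (dom i) [f, q]" by (rule EC_1_E[OF x])
  note F = cfD[OF 1(1)]
  have iH: "i \<in> Hom \<A> (dom i) (dom p)" "i \<in> Hom \<A> (dom f) (dom p)" using I 1 by (auto simp: Hom_iff)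
  obtain g r where 2: "cf g r" "dom g = dom p" "cod r = Z" "pu i \<phi> = cls [g, r]" "xs 1 Z (dom p) [g, r]"
    by (rule EC_1_E[OF push_EC[OF x iH(1) I(4)]])
  note G = cfD[OF 2(1)]
  obtain y where y: "ses_map \<A> i y (ide (cod q)) f q g r"
    by (rule push_1_E[OF 1(1) iH(2) I(4) 2(1,2)]) (use 1 2 in auto)
  note Y = ses_mapD[OF y]
  obtain s where s: "s \<in> Hom \<A> (cod r) (dom r)" "r \<cdot> s = ide (cod r)"
    using ez_cf_section[OF 2(1)] z 2 by metis
  obtain t where t: "t \<in> Arr \<A>" "dom t = cod g" "cod t = dom g" "t \<cdot> g = ide (dom g)"
    by (rule section_retraction[OF G(1), of s]) (use s G in \<open>auto simp: Hom_iff\<close>)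
  define v where "v = t \<cdot> y"
  have v: "v \<in> Arr \<A>" "dom v = cod f" "cod v = dom p" using t Y 2 by (auto simp: v_def)
  have vf: "v \<cdot> f = i"
  proof -
    have "v \<cdot> f = t \<cdot> (g \<cdot> i)" unfolding v_def using t(1-3) Y F by simp
    also have "\<dots> = i" using reassoc[OF t(4), of i] t(1-3) G I 2 by simp
    finally show ?thesis .
  qed
  have "(p \<cdot> v) \<cdot> f = zm (dom f) (cod (p \<cdot> v))" using vf v F I 1 by simp
  then obtain u where u: "u \<in> Arr \<A>" "cod u = cod (p \<cdot> v)" "dom u = cod q" "u \<cdot> q = p \<cdot> v"
    by (rule_tac is_cokernel_lift[OF short_exactD(2)[OF F(1)], of "p \<cdot> v"]) (use v F I in auto)
  have m: "ses_map \<A> (ide (dom i)) v u f q i p"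
    unfolding ses_map_def Hom_iff using u v vf F I 1 by simp
  have "u \<in> Hom \<A> Z (cod p)" using u v I 1 by (simp add: Hom_iff)
  thus ?thesis using that cls_pull_1[OF m 1(1) ip 1(2)] 1(4) by simp
qed

text \<open>Exactness at Ext^(t+1) into the left end. The roof from the pushed product to a product
  with a neutral head moves the vanishing from the whole product to its head of length one, where
  \<open>push_kernel_1\<close> applies.\<close>

lemma push_kernel:
  assumes ip: "cf i p" and t: "t \<ge> 1" and g: "\<gamma> \<in> EC (Suc t) X (dom i)" and z: "pu i \<gamma> = ez (Suc t) X (dom p)"
  obtains \<xi> where "\<xi> \<in> EC t X (cod p)" "\<gamma> = ym (cls [i, p]) \<xi>"
proof -
  note I = cfD[OF ip]
  have iH: "i \<in> Hom \<A> (dom i) (dom p)" using I by (simp add: Hom_iff)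
  obtain Z1 \<epsilon>1 \<rho>1 where 1: "Z1 \<in> \<C>" "\<epsilon>1 \<in> EC 1 Z1 (dom i)" "\<rho>1 \<in> EC t X Z1" "\<gamma> = ym \<epsilon>1 \<rho>1" by (rule EC_Suc_E[OF g t])
  have e: "ez 1 Z1 (dom p) \<in> EC 1 Z1 (dom p)" using ez_EC 1 I by simp
  have "ym (pu i \<epsilon>1) \<rho>1 = ym (ez 1 Z1 (dom p)) \<rho>1"
    using push_ymul[OF 1(2,3) iH I(4)] ymul_ez_l[OF 1(3) I(4), of 1] z 1 by simp
  then obtain Z c1 c2 \<rho> where r: "\<rho> \<in> EC t X Z" "Z \<in> \<C>" "c1 \<in> Hom \<A> Z Z1" "c2 \<in> Hom \<A> Z Z1" "pu c1 \<rho> = \<rho>1" "pu c2 \<rho> = \<rho>1"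
        "pl (pu i \<epsilon>1) c1 = pl (ez 1 Z1 (dom p)) c2"
    using roofs[OF t] push_EC[OF 1(2) iH I(4)] e 1(3) unfolding roofs_def by blast
  have "pu i (pl \<epsilon>1 c1) = ez 1 Z (dom p)"
    using push_pull[OF 1(2) iH r(3) I(4) r(2)] r(7) pull_ez[OF r(4,2) 1(1) I(4), of 1] by simp
  then obtain u where u: "u \<in> Hom \<A> Z (cod p)" "pl \<epsilon>1 c1 = pl (cls [i, p]) u"
    by (rule push_kernel_1[OF ip pull_EC[OF 1(2) r(3,2)]])
  have "\<gamma> = ym (cls [i, p]) (pu u \<rho>)"
    using ymul_mid[OF 1(2) r(1,3)] ymul_mid[OF EC_cls[OF xs_1[OF ip refl refl]] r(1) u(1)] u r 1 by simp
  thus ?thesis using that push_EC[OF r(1) u(1) I(3)] by blast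
qed

text \<open>Exactness at Ext^t into the right end. The product is compared with that of a neutral
  class and the same \<xi>. The roof writes \<xi> as c1 \<rho>, where the conflation splits after
  pull-back along c1; a section then lifts c1 through p.\<close>

lemma connecting_kernel:
  assumes ip: "cf i p" and t: "t \<ge> 1" and g: "\<xi> \<in> EC t X (cod p)" and z: "ym (cls [i, p]) \<xi> = ez (Suc t) X (dom i)"
  obtains \<zeta> where "\<zeta> \<in> EC t X (dom p)" "\<xi> = pu p \<zeta>"
proof -
  note I = cfD[OF ip]
  have c: "cls [i, p] \<in> EC 1 (cod p) (dom i)" by (rule EC_cls[OF xs_1[OF ip refl refl]])
  have e: "ez 1 (cod p) (dom i) \<in> EC 1 (cod p) (dom i)" using ez_EC I by simp
  have "ym (cls [i, p]) \<xi> = ym (ez 1 (cod p) (dom i)) \<xi>" using ymul_ez_l[OF g I(2), of 1] z by simp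
  then obtain Z c1 c2 \<rho> where r: "\<rho> \<in> EC t X Z" "Z \<in> \<C>" "c1 \<in> Hom \<A> Z (cod p)" "c2 \<in> Hom \<A> Z (cod p)" "pu c1 \<rho> = \<xi>"
        "pl (cls [i, p]) c1 = pl (ez 1 (cod p) (dom i)) c2"
    using roofs[OF t] c e g unfolding roofs_def by blast
  have z1: "pl (cls [i, p]) c1 = ez 1 Z (dom i)" using pull_ez[OF r(4,2) I(3,2), of 1] r(6) by simp
  obtain j q where 1: "cf j q" "dom j = dom i" "cod q = Z" "pl (cls [i, p]) c1 = cls [j, q]"
    by (rule EC_1_E[OF pull_EC[OF c r(3,2)]])
  obtain y where y: "ses_map \<A> (ide (dom i)) y c1 j q i p"
    by (rule pull_1_E[OF ip r(3,2) refl 1])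
  obtain s where s: "s \<in> Hom \<A> Z (dom q)" "q \<cdot> s = ide Z"
    using ez_cf_section[OF 1(1)] z1 1 by metis
  note Y = ses_mapD[OF y]
  have st: "s \<in> Arr \<A>" "dom s = Z" "cod s = dom q" using s by (auto simp: Hom_iff)
  have "p \<cdot> (y \<cdot> s) = c1 \<cdot> (q \<cdot> s)" using reassoc[OF Y(11), of s] Y(1-9) st I cfD[OF 1(1)] by simp
  hence e1: "p \<cdot> (y \<cdot> s) = c1" using s(2) r(3) by (simp add: Hom_iff)
  have ys: "y \<cdot> s \<in> Hom \<A> Z (dom p)" using Y st I cfD[OF 1(1)] by (simp add: Hom_iff)
  have pH: "p \<in> Hom \<A> (dom p) (cod p)" using I by (simp add: Hom_iff)
  have "\<xi> = pu p (pu (y \<cdot> s) \<rho>)" using push_push[OF r(1) ys pH I(4,3)] e1 r by simp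
  thus ?thesis using that push_EC[OF r(1) ys I(4)] by blast
qed

text \<open>Exactness at the middle term. As the kernel of p, the inflation i is the pull-back of p
  along the arrow from a zero object, and Mayer-Vietoris lifts the pair formed by \<gamma> and the
  neutral class.\<close>

lemma push_middle:
  assumes ip: "cf i p" and t: "t \<ge> 1" and g: "\<gamma> \<in> EC t X (dom p)" and z: "pu p \<gamma> = ez t X (cod p)"
  obtains \<xi> where "\<xi> \<in> EC t X (dom i)" "\<gamma> = pu i \<xi>"
proof -
  note I = cfD[OF ip]
  obtain W where W: "W \<in> \<C>" "zero_object \<A> W" using sub_zero by blast
  let ?k = "zm W (cod p)" and ?q2 = "zm (dom i) W"
  have uniq: "u = v" if "u \<in> Arr \<A>" "v \<in> Arr \<A>" "cod u = W" "cod v = W" "dom u = dom v" for u v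
    using W(2) that unfolding zero_object_def Hom_iff by (metis src_in_Obj)
  have "is_pullback \<A> p ?k ?q2 i"
  proof (rule is_pullbackI)
    fix u v assume u: "u \<in> Arr \<A>" "v \<in> Arr \<A>" "cod u = dom ?k" "cod v = dom p" "dom u = dom v" "?k \<cdot> u = p \<cdot> v"
    have "p \<cdot> v = zm (dom v) (cod p)" using u W I by (metis zero_cmp zero_simps(2) obj)
    then obtain w where w: "w \<in> Arr \<A>" "dom w = dom v" "cod w = dom i" "i \<cdot> w = v"
      using is_kernel_lift[OF short_exactD(1)[OF I(1)], of v] u by metis
    have "?q2 \<cdot> w = u" by (rule uniq) (use w u W I in auto)
    thus "\<exists>w. w \<in> Arr \<A> \<and> cod w = dom ?q2 \<and> dom w = dom u \<and> ?q2 \<cdot> w = u \<and> i \<cdot> w = v"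
      using w u W I by (intro exI[of _ w]) auto
  next
    fix w w' assume "w \<in> Arr \<A>" "w' \<in> Arr \<A>" "cod w = dom ?q2" "cod w' = dom ?q2" "dom w = dom w'" "i \<cdot> w = i \<cdot> w'"
    thus "w = w'" using monicD[OF short_exactD(3)[OF I(1)], of w w'] W I by simp
  qed (use W I in auto)
  moreover have "dom ?k \<in> \<C>" "dom ?k = W" using W I by auto
  moreover have e: "ez t X W \<in> EC t X W" using ez_EC[OF t] EC_obj[OF g] W by blast
  moreover have "pu p \<gamma> = pu ?k (ez t X W)" using push_ez[OF zero_Hom[OF W(1) I(3)], of X t] z W I t EC_obj[OF g] by simp
  ultimately have "\<exists>\<gamma>3 \<in> EC t X (dom i). pu i \<gamma>3 = \<gamma> \<and> pu ?q2 \<gamma>3 = ez t X W"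
    using mayer_vietoris[OF t] ip g unfolding mayer_vietoris_def by metis
  thus ?thesis using that by blast
qed

text \<open>The neutral element is a definite description in each category separately. The two are
  matched by writing one as a push-out along zero and the other as a pull-back along zero.\<close>

lemma ez_opcat:
  assumes "t \<ge> 1" "A \<in> \<C>" "B \<in> \<C>"
  shows "extension_closed_subcategory.ez (opcat \<A>) \<C> t B A = rev ` ez t A B"
proof -
  have e: "ez t A B \<in> EC t A B" using ez_EC assms by blast
  hence "rev ` ez t A B \<in> ext_carrier (opcat \<A>) \<C> t B A" unfolding EC_opcat by blast
  from extension_closed_subcategory.push_zero[OF opcat_ecs this]
  show ?thesis using push_opcat[of "zm A A" "ez t A B"] pull_zero[OF e assms(2)] by simp
qed

section \<open>Contravariant exactness by duality\<close>

lemma ext_class_pair_opcat: "ext_class (opcat \<A>) \<C> [p, i] = rev ` cls [i, p]"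
  using ext_class_opcat[of "[i, p]"] by simp

lemma inj_rev_image: "rev ` \<gamma> = rev ` \<gamma>' \<Longrightarrow> \<gamma> = \<gamma>'"
  by (simp add: inj_image_eq_iff)

text \<open>This is \<open>push_kernel\<close> in the opposite category; lists are read backwards,
  so the Yoneda factors are exchanged.\<close>

lemma pull_kernel:
  assumes ip: "cf i p" and t: "t \<ge> 1" and g: "\<gamma> \<in> EC (Suc t) (cod p) Y" and z: "pl \<gamma> p = ez (Suc t) (dom p) Y"
  obtains \<xi> where "\<xi> \<in> EC t (dom i) Y" "\<gamma> = ym \<xi> (cls [i, p])"
proof -
  note I = cfD[OF ip]
  have Y: "Y \<in> \<C>" using EC_obj[OF g] by simp
  have "conflation (opcat \<A>) \<C> p i" using ip by simp
  moreover have "rev ` \<gamma> \<in> ext_carrier (opcat \<A>) \<C> (Suc t) Y (src (opcat \<A>) p)" using g by (simp add: EC_opcat)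
  moreover have "push (opcat \<A>) \<C> p (rev ` \<gamma>) = extension_closed_subcategory.ez (opcat \<A>) \<C> (Suc t) Y (src (opcat \<A>) i)"
    using push_opcat[of p \<gamma>] z ez_opcat[of "Suc t" "dom p" Y] I Y by simp
  ultimately obtain \<xi>' where x: "\<xi>' \<in> ext_carrier (opcat \<A>) \<C> t Y (tgt (opcat \<A>) i)" "rev ` \<gamma> = ymul (opcat \<A>) \<C> (ext_class (opcat \<A>) \<C> [p, i]) \<xi>'"
    using extension_closed_subcategory.push_kernel[OF opcat_ecs _ t] by metis
  then obtain \<xi> where xi: "\<xi> \<in> EC t (dom i) Y" "\<xi>' = rev ` \<xi>" unfolding EC_opcat by auto
  have "rev ` \<gamma> = rev ` ym \<xi> (cls [i, p])"
    using x(2) ymul_opcat[OF xi(1) EC_cls[OF xs_1[OF ip refl refl]]] by (simp add: xi ext_class_pair_opcat)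
  thus ?thesis using that[OF xi(1)] inj_rev_image by blast
qed

lemma connecting_kernel':
  assumes ip: "cf i p" and t: "t \<ge> 1" and g: "\<xi> \<in> EC t (dom i) Y" and z: "ym \<xi> (cls [i, p]) = ez (Suc t) (cod p) Y"
  obtains \<zeta> where "\<zeta> \<in> EC t (dom p) Y" "\<xi> = pl \<zeta> i"
proof -
  note I = cfD[OF ip]
  have Y: "Y \<in> \<C>" using EC_obj[OF g] by simp
  have "conflation (opcat \<A>) \<C> p i" using ip by simp
  moreover have "rev ` \<xi> \<in> ext_carrier (opcat \<A>) \<C> t Y (tgt (opcat \<A>) i)" using g by (simp add: EC_opcat)
  moreover have "ymul (opcat \<A>) \<C> (ext_class (opcat \<A>) \<C> [p, i]) (rev ` \<xi>) = extension_closed_subcategory.ez (opcat \<A>) \<C> (Suc t) Y (src (opcat \<A>) p)"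
    using ymul_opcat[OF g EC_cls[OF xs_1[OF ip refl refl]]] z ez_opcat[of "Suc t" "cod p" Y] I Y by (simp add: ext_class_pair_opcat)
  ultimately obtain \<zeta>' where x: "\<zeta>' \<in> ext_carrier (opcat \<A>) \<C> t Y (src (opcat \<A>) i)" "rev ` \<xi> = push (opcat \<A>) \<C> i \<zeta>'"
    using extension_closed_subcategory.connecting_kernel[OF opcat_ecs _ t] by metis
  then obtain \<zeta> where ze: "\<zeta> \<in> EC t (dom p) Y" "\<zeta>' = rev ` \<zeta>" using I unfolding EC_opcat by auto
  have "rev ` \<xi> = rev ` pl \<zeta> i" using x(2) push_opcat[of i \<zeta>] ze by simp
  thus ?thesis using that[OF ze(1)] inj_rev_image by blast
qed

text \<open>The cokernel of j i is p pushed out along j. Its object lies in C because the other leg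
  of that push-out is again an inflation. The purpose is to replace the middle term of a conflation
  by a larger one, an n-projective in \<open>right_unit_factorization\<close>.\<close>

lemma cf_inflation_cmp:
  assumes ip: "cf i p" and jq: "cf j q" and ij: "cod i = dom j"
  obtains c k where "cf (j \<cdot> i) c" "ses_map \<A> (ide (dom i)) j k i p (j \<cdot> i) c"
proof -
  note I = cfD[OF ip] and J = cfD[OF jq]
  have s: "dom j = dom p" using ij I by simp
  obtain k c where po: "is_pushout \<A> j p k c" using ex_pushout[OF J(5) I(6) s] by blast
  note P = is_pushoutD[OF po]
  obtain q' where q': "cf k q'" by (rule pushout_cf[OF jq po I(3)])
  have mon: "monic \<A> (j \<cdot> i)"
  proof (rule monicI)
    fix u assume u: "u \<in> Arr \<A>" "cod u = dom (j \<cdot> i)" "(j \<cdot> i) \<cdot> u = zm (dom u) (cod (j \<cdot> i))"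
    have "j \<cdot> (i \<cdot> u) = zm (dom (i \<cdot> u)) (cod j)" using u I J s by simp
    hence "i \<cdot> u = zm (dom (i \<cdot> u)) (dom j)"
      by (intro monic_zeroD[OF short_exactD(3)[OF J(1)]]) (use u I J s in auto)
    hence "u = zm (dom u) (dom i)"
      by (intro monic_zeroD[OF short_exactD(3)[OF I(1)]]) (use u I J s in auto)
    thus "u = zm (dom u) (dom (j \<cdot> i))" using I J s by simp
  qed (use I J s in auto)
  have ji: "c \<cdot> (j \<cdot> i) = zm (dom i) (cod c)"
    using reassoc[OF P(9)[symmetric], of i] P(1-8) I J s by simp
  have "is_cokernel \<A> c (j \<cdot> i)"
  proof (rule is_cokernelI)
    show "epic \<A> c"
    proof (rule epicI[OF P(4)])
      fix u assume u: "u \<in> Arr \<A>" "dom u = cod c" "u \<cdot> c = zm (dom c) (cod u)"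
      have "(u \<cdot> k) \<cdot> p = (u \<cdot> c) \<cdot> j" using u(1,2) P I J by simp
      hence "(u \<cdot> k) \<cdot> p = zm (dom p) (cod (u \<cdot> k))" using u P(1-8) I J s by simp
      hence "u \<cdot> k = zm (cod p) (cod (u \<cdot> k))"
        by (intro epic_zeroD[OF short_exactD(4)[OF I(1)]]) (use u P(1-8) I in auto)
      hence "u \<cdot> k = zm (cod p) (cod u)" using u P(1-8) by simp
      thus "u = zm (cod c) (cod u)"
        by (rule_tac is_pushout_ext[OF po]) (use u P(1-8) I J in auto)
    qed
    show "c \<cdot> (j \<cdot> i) = zm (dom (j \<cdot> i)) (cod c)" using ji I J s by simp
    fix u assume u: "u \<in> Arr \<A>" "dom u = cod (j \<cdot> i)" "u \<cdot> (j \<cdot> i) = zm (dom (j \<cdot> i)) (cod u)"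
    have "(u \<cdot> j) \<cdot> i = zm (dom i) (cod (u \<cdot> j))" using u I J s by simp
    then obtain v where v: "v \<in> Arr \<A>" "cod v = cod (u \<cdot> j)" "dom v = cod p" "v \<cdot> p = u \<cdot> j"
      by (rule_tac is_cokernel_lift[OF short_exactD(2)[OF I(1)], of "u \<cdot> j"]) (use u I J s in auto)
    obtain w where w: "w \<in> Arr \<A>" "dom w = cod k" "cod w = cod v" "w \<cdot> k = v" "w \<cdot> c = u"
      by (rule is_pushout_lift[OF po, of v u]) (use u v I J s in auto)
    show "\<exists>w. w \<in> Arr \<A> \<and> cod w = cod u \<and> dom w = cod c \<and> w \<cdot> c = u"
      using w v u P(8) I J s by (intro exI[of _ w]) auto
  qed (use P(1-8) I J s in auto)
  from short_exactI_monic[OF mon this] have "cf (j \<cdot> i) c" by (rule cfI) (use I J s P(1-8) cfD[OF q'] in auto)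
  moreover have "ses_map \<A> (ide (dom i)) j k i p (j \<cdot> i) c"
    unfolding ses_map_def Hom_iff using I J s P by auto
  ultimately show ?thesis by (rule that)
qed

end

section \<open>Dimension shifting in \<open>n\<close>-Frobenius categories\<close>

locale n_frobenius_category = extension_closed_subcategory \<A> \<C>
  for \<A> :: "('o, 'm) addcat" (structure) and \<C> +
  fixes n :: nat
  assumes n_pos: "n \<ge> 1" and frobenius: "n_Frobenius \<A> \<C> n"
begin

abbreviation "np \<equiv> n_projective \<A> \<C> n"

lemma np_sub: "np P \<Longrightarrow> P \<in> \<C>"
  by (simp add: n_projective_def)

lemma np_iff_injective: "np P \<longleftrightarrow> n_injective \<A> \<C> n P"
proof (cases "P \<in> \<C>")
  case True
  thus ?thesis using frobenius unfolding n_Frobenius_def by blast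
next
  case False
  thus ?thesis unfolding n_projective_def n_injective_def by blast
qed

lemma np_ez:
  assumes "np P" "\<gamma> \<in> EC t P Y" "t > n"
  shows "\<gamma> = ez t P Y"
proof -
  have "EC t P Y = {ez t P Y}"
    using assms EC_obj[OF assms(2)] unfolding n_projective_def ez_def by (metis EG_simps(1))
  thus ?thesis using assms(2) by blast
qed

lemma np_ez':
  assumes "np P" "\<gamma> \<in> EC t Y P" "t > n"
  shows "\<gamma> = ez t Y P"
proof -
  have "EC t Y P = {ez t Y P}"
    using assms EC_obj[OF assms(2)] unfolding np_iff_injective n_injective_def ez_def by (metis EG_simps(1))
  thus ?thesis using assms(2) by blast
qed

text \<open>As n-projectives and n-injectives coincide, vanishing need only be checked in the second
  variable, where \<open>push_kernel\<close> and \<open>push_middle\<close> apply.\<close>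

lemma npI:
  assumes P: "P \<in> \<C>" and z: "\<And>t Y \<gamma>. \<gamma> \<in> EC t Y P \<Longrightarrow> t > n \<Longrightarrow> \<gamma> = ez t Y P"
  shows "np P"
  unfolding np_iff_injective n_injective_def
proof (intro conjI P allI impI ballI)
  fix t Y assume "t > n" "Y \<in> \<C>"
  moreover from this have "ez t Y P \<in> EC t Y P" using ez_EC P n_pos by simp
  ultimately show "carrier (EG t Y P) = {\<one>\<^bsub>EG t Y P\<^esub>}" using z unfolding ez_def EG_simps by blast
qed

lemma ex_np_deflation:
  assumes "X \<in> \<C>"
  obtains i p where "cf i p" "cod p = X" "np (dom p)"
  using frobenius assms unfolding n_Frobenius_def deflation_def by metis

lemma ex_np_inflation:
  assumes "X \<in> \<C>"
  obtains i p where "cf i p" "dom i = X" "np (dom p)"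
proof -
  obtain i where i: "inflation \<A> \<C> i" "dom i = X" "n_injective \<A> \<C> n (cod i)"
    using frobenius assms unfolding n_Frobenius_def by blast
  then obtain p where p: "cf i p" unfolding inflation_def by blast
  thus ?thesis using that[OF p] i cfD(7)[OF p] np_iff_injective by simp
qed

lemma np_connecting_inj:
  assumes ip: "cf i p" "np (dom p)" and t: "t > n" and x: "\<xi> \<in> EC t X (cod p)" and z: "ym (cls [i, p]) \<xi> = ez (Suc t) X (dom i)"
  shows "\<xi> = ez t X (cod p)"
proof -
  note I = cfD[OF ip(1)]
  obtain \<zeta> where ze: "\<zeta> \<in> EC t X (dom p)" "\<xi> = pu p \<zeta>" using connecting_kernel[OF ip(1) _ x z] t by auto
  have "\<zeta> = ez t X (dom p)" by (rule np_ez'[OF ip(2) ze(1) t])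
  thus ?thesis using ze push_ez[of p "dom p" "cod p" X t] I EC_obj[OF x] by (simp add: Hom_iff)
qed

text \<open>The obstruction lives in degree t + 1, so t = n is allowed here, in contrast to
  \<open>np_connecting_inj\<close>, where it lives in degree t. This difference is the origin of P
  in degree n.\<close>

lemma np_connecting_surj:
  assumes ip: "cf i p" "np (dom p)" and t: "t \<ge> n" and g: "\<gamma> \<in> EC (Suc t) X (dom i)"
  obtains \<xi> where "\<xi> \<in> EC t X (cod p)" "\<gamma> = ym (cls [i, p]) \<xi>"
proof -
  note I = cfD[OF ip(1)]
  have "i \<in> Hom \<A> (dom i) (dom p)" using I by (simp add: Hom_iff)
  hence "pu i \<gamma> = ez (Suc t) X (dom p)" using np_ez'[OF ip(2) push_EC[OF g]] I t by simp
  moreover have "t \<ge> 1" using t n_pos by simp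
  ultimately show ?thesis using push_kernel[OF ip(1) _ g] that by blast
qed

lemma np_connecting_inj':
  assumes ip: "cf i p" "np (dom p)" and t: "t > n" and x: "\<xi> \<in> EC t (dom i) Y" and z: "ym \<xi> (cls [i, p]) = ez (Suc t) (cod p) Y"
  shows "\<xi> = ez t (dom i) Y"
proof -
  note I = cfD[OF ip(1)]
  obtain \<zeta> where ze: "\<zeta> \<in> EC t (dom p) Y" "\<xi> = pl \<zeta> i" using connecting_kernel'[OF ip(1) _ x z] t by auto
  have "\<zeta> = ez t (dom p) Y" by (rule np_ez[OF ip(2) ze(1) t])
  thus ?thesis using ze pull_ez[of i "dom i" "dom p" Y t] I EC_obj[OF x] by (simp add: Hom_iff)
qed

lemma np_connecting_surj':
  assumes ip: "cf i p" "np (dom p)" and t: "t \<ge> n" and g: "\<gamma> \<in> EC (Suc t) (cod p) Y"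
  obtains \<xi> where "\<xi> \<in> EC t (dom i) Y" "\<gamma> = ym \<xi> (cls [i, p])"
proof -
  note I = cfD[OF ip(1)]
  have "p \<in> Hom \<A> (dom p) (cod p)" using I by (simp add: Hom_iff)
  hence "pl \<gamma> p = ez (Suc t) (dom p) Y" using np_ez[OF ip(2) pull_EC[OF g]] I t by simp
  moreover have "t \<ge> 1" using t n_pos by simp
  ultimately show ?thesis using pull_kernel[OF ip(1) _ g] that by blast
qed

text \<open>The length t is kept apart from n, which governs the middle terms. This permits
  induction over the conflations and provides the units of length n + 1.\<close>

definition unit_seq :: "nat \<Rightarrow> 'o \<Rightarrow> 'o \<Rightarrow> 'm list \<Rightarrow> bool" where
  "unit_seq t A B E \<longleftrightarrow> xs t A B E \<and> (\<forall>d \<in> set (butlast E). np (cod d))"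

lemma unit_seq_n: "unit_conflation \<A> \<C> n A B E \<longleftrightarrow> unit_seq n A B E"
  by (simp add: unit_conflation_def unit_seq_def)

lemma unit_seq_EC: "unit_seq t A B E \<Longrightarrow> cls E \<in> EC t A B"
  by (simp add: unit_seq_def)

lemma unit_seq_cases:
  assumes "unit_seq t A B E"
  obtains (single) i p where "t = 1" "E = [i, p]" "cf i p" "A = cod p" "B = dom i" "np (dom p)"
  | (splice) i p t' F where "t = Suc t'" "cf i p" "B = dom i" "np (dom p)" "unit_seq t' A (cod p) F"
     "cls E = ym (cls [i, p]) (cls F)"
proof -
  have E: "xs t A B E" and n: "\<forall>d \<in> set (butlast E). np (cod d)" using assms by (auto simp: unit_seq_def)
  from E show ?thesis
  proof (cases rule: xs_cases)
    case s: (single i p)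
    show ?thesis by (rule single[OF s]) (use n s cfD[OF s(3)] in auto)
  next
    case s: (splice i p d ds t')
    have d: "d \<in> Arr \<A>" "dom d = cod p" using xs_path[OF s(4)] by auto
    have "unit_seq t' A (cod p) (d # ds)" unfolding unit_seq_def using s(4-6) n d cfD[OF s(2)] by auto
    moreover have "cls E = ym (cls [i, p]) (cls (d # ds))"
      using ymul_cls[OF xs_1[OF s(2) refl refl] s(4)] s(6) by (simp add: yo_single)
    moreover have "np (dom p)" using n s(6) cfD[OF s(2)] by simp
    ultimately show ?thesis using splice s by blast
  qed
qed

lemma unit_seq_1: "cf i p \<Longrightarrow> np (dom p) \<Longrightarrow> unit_seq 1 (cod p) (dom i) [i, p]"
  unfolding unit_seq_def using xs_1[of i p] cfD(7)[of i p] by auto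

lemma unit_seq_splice:
  assumes ip: "cf i p" "np (dom p)" and F: "unit_seq t A (cod p) F"
  shows "unit_seq (Suc t) A (dom i) (yo \<A> [i, p] F)" "cls (yo \<A> [i, p] F) = ym (cls [i, p]) (cls F)"
proof -
  have x: "xs t A (cod p) F" using F by (simp add: unit_seq_def)
  then obtain d ds where d: "F = d # ds" using xs_length[OF x] by (cases F) auto
  have l: "ds \<noteq> []" using xs_length[OF x] d by auto
  have dt: "d \<in> Arr \<A>" "dom d = cod p" using xs_path[OF x] d by auto
  show "cls (yo \<A> [i, p] F) = ym (cls [i, p]) (cls F)" using ymul_cls[OF xs_1[OF ip(1) refl refl] x] by simp
  have "xs (Suc t) A (dom i) (yo \<A> [i, p] F)" using xs_yo[OF xs_1[OF ip(1) refl refl] x] by simp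
  thus "unit_seq (Suc t) A (dom i) (yo \<A> [i, p] F)"
    using F l dt cfD[OF ip(1)] ip(2) unfolding unit_seq_def d yo_single by auto
qed

lemma ex_unit_seq:
  assumes "X \<in> \<C>" "t \<ge> 1"
  shows "\<exists>B E. unit_seq t X B E"
  using assms(2)
proof (induction t rule: nat_induct_at_least)
  case base
  obtain i p where "cf i p" "cod p = X" "np (dom p)" by (rule ex_np_deflation[OF assms(1)])
  thus ?case using unit_seq_1 by blast
next
  case (Suc t)
  then obtain B E where E: "unit_seq t X B E" by blast
  hence "B \<in> \<C>" unfolding unit_seq_def using xs_length by blast
  then obtain i p where "cf i p" "cod p = B" "np (dom p)" by (rule ex_np_deflation)
  thus ?case using unit_seq_splice(1) E by blast
qed

section \<open>Multiplication by units: injectivity, surjectivity, kernel\<close>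

lemma unit_seq_inj:
  assumes "unit_seq s A B E" "t > n" "\<xi> \<in> EC t X A" "ym (cls E) \<xi> = ez (s + t) X B"
  shows "\<xi> = ez t X A"
  using assms
proof (induction s arbitrary: B E)
  case 0
  thus ?case unfolding unit_seq_def using xs_length by fastforce
next
  case (Suc s)
  from Suc.prems(1) show ?case
  proof (cases rule: unit_seq_cases)
    case (single i p)
    thus ?thesis using np_connecting_inj[OF single(3,6) Suc.prems(2)] Suc.prems by simp
  next
    case (splice i p t' F)
    have F: "cls F \<in> EC s A (cod p)" "unit_seq s A (cod p) F" using unit_seq_EC splice by auto
    have c: "cls [i, p] \<in> EC 1 (cod p) (dom i)" by (rule EC_cls[OF xs_1[OF splice(2) refl refl]])
    have "ym (cls F) \<xi> = ez (s + t) X (cod p)"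
      by (rule np_connecting_inj[OF splice(2,4) _ ymul_EC[OF F(1) Suc.prems(3)]])
        (use Suc.prems splice ymul_assoc[OF c F(1) Suc.prems(3)] in auto)
    thus ?thesis using Suc.IH[OF F(2) Suc.prems(2,3)] by simp
  qed
qed

lemma unit_seq_surj:
  assumes "unit_seq s A B E" "t \<ge> n" "\<gamma> \<in> EC (s + t) X B"
  shows "\<exists>\<xi> \<in> EC t X A. \<gamma> = ym (cls E) \<xi>"
  using assms
proof (induction s arbitrary: B E \<gamma>)
  case 0
  thus ?case unfolding unit_seq_def using xs_length by fastforce
next
  case (Suc s)
  from Suc.prems(1) show ?case
  proof (cases rule: unit_seq_cases)
    case (single i p)
    have "\<gamma> \<in> EC (Suc t) X (dom i)" using Suc.prems single by simp
    from np_connecting_surj[OF single(3,6) Suc.prems(2) this] show ?thesis using single by blast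
  next
    case (splice i p t' F)
    have F: "cls F \<in> EC s A (cod p)" "unit_seq s A (cod p) F" using unit_seq_EC splice by auto
    have c: "cls [i, p] \<in> EC 1 (cod p) (dom i)" by (rule EC_cls[OF xs_1[OF splice(2) refl refl]])
    have "\<gamma> \<in> EC (Suc (s + t)) X (dom i)" using Suc.prems splice by simp
    then obtain \<gamma>' where g: "\<gamma>' \<in> EC (s + t) X (cod p)" "\<gamma> = ym (cls [i, p]) \<gamma>'"
      by (rule np_connecting_surj[OF splice(2,4), rotated]) (use Suc.prems in auto)
    obtain \<xi> where "\<xi> \<in> EC t X A" "\<gamma>' = ym (cls F) \<xi>" using Suc.IH[OF F(2) Suc.prems(2) g(1)] by blast
    thus ?thesis using g splice ymul_assoc[OF c F(1)] by auto
  qed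
qed

text \<open>The first conflation of the unit multiplies \<xi> first and raises its degree, so the
  induction runs with varying t, unlike that of \<open>unit_seq_inj\<close>.\<close>

lemma unit_seq_inj':
  assumes "unit_seq s A B E" "t > n" "\<xi> \<in> EC t B Y" "ym \<xi> (cls E) = ez (t + s) A Y"
  shows "\<xi> = ez t B Y"
  using assms
proof (induction s arbitrary: B E t \<xi>)
  case 0
  thus ?case unfolding unit_seq_def using xs_length by fastforce
next
  case (Suc s)
  from Suc.prems(1) show ?case
  proof (cases rule: unit_seq_cases)
    case (single i p)
    thus ?thesis using np_connecting_inj'[OF single(3,6) Suc.prems(2)] Suc.prems by simp
  next
    case (splice i p t' F)
    have F: "cls F \<in> EC s A (cod p)" "unit_seq s A (cod p) F" using unit_seq_EC splice by auto
    have c: "cls [i, p] \<in> EC 1 (cod p) (dom i)" by (rule EC_cls[OF xs_1[OF splice(2) refl refl]])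
    have x: "\<xi> \<in> EC t (dom i) Y" using Suc.prems splice by simp
    have y: "ym \<xi> (cls [i, p]) \<in> EC (Suc t) (cod p) Y" using ymul_EC[OF x c] by simp
    have "ym \<xi> (cls [i, p]) = ez (Suc t) (cod p) Y"
      by (rule Suc.IH[OF F(2) _ y]) (use Suc.prems splice ymul_assoc[OF x c F(1)] in auto)
    thus ?thesis using np_connecting_inj'[OF splice(2,4) Suc.prems(2) x] splice by simp
  qed
qed

lemma unit_seq_surj':
  assumes "unit_seq s A B E" "t \<ge> n" "\<gamma> \<in> EC (t + s) A Y"
  shows "\<exists>\<xi> \<in> EC t B Y. \<gamma> = ym \<xi> (cls E)"
  using assms
proof (induction s arbitrary: B E t \<gamma>)
  case 0
  thus ?case unfolding unit_seq_def using xs_length by fastforce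
next
  case (Suc s)
  from Suc.prems(1) show ?case
  proof (cases rule: unit_seq_cases)
    case (single i p)
    have "\<gamma> \<in> EC (Suc t) (cod p) Y" using Suc.prems single by simp
    from np_connecting_surj'[OF single(3,6) Suc.prems(2) this] show ?thesis using single by blast
  next
    case (splice i p t' F)
    have F: "cls F \<in> EC s A (cod p)" "unit_seq s A (cod p) F" using unit_seq_EC splice by auto
    have c: "cls [i, p] \<in> EC 1 (cod p) (dom i)" by (rule EC_cls[OF xs_1[OF splice(2) refl refl]])
    have "\<gamma> \<in> EC (Suc t + s) A Y" "Suc t \<ge> n" using Suc.prems by auto
    then obtain \<xi>' where x: "\<xi>' \<in> EC (Suc t) (cod p) Y" "\<gamma> = ym \<xi>' (cls F)" using Suc.IH[OF F(2)] by blast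
    obtain \<xi> where "\<xi> \<in> EC t (dom i) Y" "\<xi>' = ym \<xi> (cls [i, p])"
      by (rule np_connecting_surj'[OF splice(2,4) Suc.prems(2) x(1)])
    thus ?thesis using x splice ymul_assoc[OF _ c F(1)] by auto
  qed
qed

text \<open>In length one, \<gamma> comes from some \<zeta> in Ext^n(X, P) with P n-projective.
  Embed X into an n-projective by j: the obstruction to extending \<zeta> along j lies in
  Ext^(n+1)(-, P) = 0, so \<zeta>, and with it \<gamma>, is pulled back from that n-projective. In
  greater length the conflations left of the last one cancel, since they act in degree above
  n.\<close>

lemma unit_seq_kernel:
  assumes "unit_seq s A B E" "\<gamma> \<in> EC n X A" "ym (cls E) \<gamma> = ez (s + n) X B"
  shows "\<gamma> \<in> proj_ext \<A> \<C> n X A"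
  using assms
proof (induction s arbitrary: B E)
  case 0
  thus ?case unfolding unit_seq_def using xs_length by fastforce
next
  case (Suc s)
  from Suc.prems(1) show ?case
  proof (cases rule: unit_seq_cases)
    case (single i p)
    have g: "\<gamma> \<in> EC n X (cod p)" "ym (cls [i, p]) \<gamma> = ez (Suc n) X (dom i)" using Suc.prems single by auto
    note I = cfD[OF single(3)]
    obtain \<zeta> where ze: "\<zeta> \<in> EC n X (dom p)" "\<gamma> = pu p \<zeta>" by (rule connecting_kernel[OF single(3) n_pos g])
    have X: "X \<in> \<C>" using EC_obj[OF Suc.prems(2)] by simp
    obtain j q where j: "cf j q" "dom j = X" "np (dom q)" by (rule ex_np_inflation[OF X])
    note J = cfD[OF j(1)]
    have z: "\<zeta> \<in> EC n (dom j) (dom p)" using ze j by simp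
    have "ym \<zeta> (cls [j, q]) = ez (Suc n) (cod q) (dom p)"
      using np_ez'[OF single(6) ymul_EC[OF z EC_cls[OF xs_1[OF j(1) refl refl]]]] by simp
    then obtain \<theta> where th: "\<theta> \<in> EC n (dom q) (dom p)" "\<zeta> = pl \<theta> j" by (rule connecting_kernel'[OF j(1) n_pos z])
    have h: "p \<in> Hom \<A> (dom p) (cod p)" "j \<in> Hom \<A> X (dom q)" using I J j by (auto simp: Hom_iff)
    have "\<gamma> = pl (pu p \<theta>) j" using push_pull[OF th(1) h I(3) X] ze th by simp
    moreover have "pu p \<theta> \<in> carrier (EG n (dom q) A)" using push_EC[OF th(1) h(1) I(3)] single by simp
    ultimately show ?thesis unfolding proj_ext_def using j(3) h(2) by blast
  next
    case (splice i p t' F)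
    have F: "cls F \<in> EC s A (cod p)" "unit_seq s A (cod p) F" using unit_seq_EC splice by auto
    have c: "cls [i, p] \<in> EC 1 (cod p) (dom i)" by (rule EC_cls[OF xs_1[OF splice(2) refl refl]])
    \<comment> \<open>The product of the tail with \<gamma> has degree s + n, which must exceed n
      strictly for \<open>np_connecting_inj\<close>.\<close>
    have "s \<ge> 1" using F(1) EC_obj by blast
    have "ym (cls F) \<gamma> = ez (s + n) X (cod p)"
      by (rule np_connecting_inj[OF splice(2,4) _ ymul_EC[OF F(1) Suc.prems(2)]])
        (use Suc.prems splice ymul_assoc[OF c F(1) Suc.prems(2)] \<open>s \<ge> 1\<close> in auto)
    thus ?thesis using Suc.IH[OF F(2) Suc.prems(2)] by simp
  qed
qed

lemma proj_ext_E:
  assumes "\<gamma> \<in> proj_ext \<A> \<C> n X Y"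
  obtains P \<eta> h where "np P" "h \<in> Hom \<A> X P" "\<eta> \<in> EC n P Y" "\<gamma> = pl \<eta> h"
  using assms unfolding proj_ext_def by auto

text \<open>Multiplying \<eta> by \<kappa> raises its degree above n while its first argument stays
  n-projective.\<close>

lemma proj_ext_ymul:
  assumes "\<gamma> \<in> proj_ext \<A> \<C> n X Y" "\<kappa> \<in> EC s Y Y'" "X \<in> \<C>"
  shows "ym \<kappa> \<gamma> = ez (s + n) X Y'"
proof -
  obtain P \<eta> h where p: "np P" "h \<in> Hom \<A> X P" "\<eta> \<in> EC n P Y" "\<gamma> = pl \<eta> h" by (rule proj_ext_E[OF assms(1)])
  have o: "P \<in> \<C>" "Y' \<in> \<C>" "s \<ge> 1" using p np_sub EC_obj[OF assms(2)] by auto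
  have "ym \<kappa> \<eta> = ez (s + n) P Y'" by (rule np_ez[OF p(1) ymul_EC[OF assms(2) p(3)]]) (use o in simp)
  thus ?thesis using pull_ymul[OF assms(2) p(3,2) assms(3)] pull_ez[OF p(2) assms(3) o(1,2), of "s + n"] o p by simp
qed

text \<open>Embedding the middle term of the first conflation into an n-projective makes this
  conflation the pull-back, along some k, of one with n-projective middle term. Moving k across the
  product onto the tail leaves a shorter class to factorize.\<close>

lemma right_unit_factorization:
  assumes "t \<ge> 1" "\<gamma> \<in> EC t M B"
  shows "\<exists>Z E f. unit_seq t Z B E \<and> f \<in> Hom \<A> M Z \<and> \<gamma> = pl (cls E) f"
  using assms
proof (induction t arbitrary: B \<gamma> rule: nat_induct_at_least)
  case base
  obtain i p where 1: "cf i p" "dom i = B" "cod p = M" "\<gamma> = cls [i, p]" by (rule EC_1_E[OF base])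
  note I = cfD[OF 1(1)]
  obtain j q where j: "cf j q" "dom j = dom p" "np (dom q)" by (rule ex_np_inflation[OF I(4)])
  obtain c k where c: "cf (j \<cdot> i) c" "ses_map \<A> (ide (dom i)) j k i p (j \<cdot> i) c"
    by (rule cf_inflation_cmp[OF 1(1) j(1)]) (use j I in auto)
  have t: "dom (j \<cdot> i) = B" "dom c = dom q" using 1 cfD[OF j(1)] cfD[OF c(1)] I j by auto
  have "unit_seq 1 (cod c) B [j \<cdot> i, c]" using unit_seq_1[OF c(1)] t j by simp
  moreover have "k \<in> Hom \<A> M (cod c)" using ses_mapD[OF c(2)] 1 by (simp add: Hom_iff)
  moreover have "\<gamma> = pl (cls [j \<cdot> i, c]) k" using cls_pull_1[OF c(2) 1(1) c(1) refl] 1 by simp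
  ultimately show ?case by blast
next
  case (Suc t)
  obtain Z1 \<epsilon> \<rho> where 1: "Z1 \<in> \<C>" "\<epsilon> \<in> EC 1 Z1 B" "\<rho> \<in> EC t M Z1" "\<gamma> = ym \<epsilon> \<rho>" by (rule EC_Suc_E[OF Suc.prems Suc.hyps])
  obtain i p where ip: "cf i p" "dom i = B" "cod p = Z1" "\<epsilon> = cls [i, p]" by (rule EC_1_E[OF 1(2)])
  note I = cfD[OF ip(1)]
  obtain j q where j: "cf j q" "dom j = dom p" "np (dom q)" by (rule ex_np_inflation[OF I(4)])
  obtain c k where c: "cf (j \<cdot> i) c" "ses_map \<A> (ide (dom i)) j k i p (j \<cdot> i) c"
    by (rule cf_inflation_cmp[OF ip(1) j(1)]) (use j I in auto)
  have t: "dom (j \<cdot> i) = B" "dom c = dom q" using ip cfD[OF j(1)] cfD[OF c(1)] I j by auto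
  have k: "k \<in> Hom \<A> Z1 (cod c)" using ses_mapD[OF c(2)] ip by (simp add: Hom_iff)
  have e: "\<epsilon> = pl (cls [j \<cdot> i, c]) k" using cls_pull_1[OF c(2) ip(1) c(1) refl] ip by simp
  obtain Z F f where F: "unit_seq t Z (cod c) F" "f \<in> Hom \<A> M Z" "pu k \<rho> = pl (cls F) f"
    using Suc.IH[OF push_EC[OF 1(3) k cfD(3)[OF c(1)]]] by blast
  have np: "np (dom c)" using t j by simp
  have cc: "cls [j \<cdot> i, c] \<in> EC 1 (cod c) B" by (rule EC_cls[OF xs_1[OF c(1) t(1) refl]])
  have M: "M \<in> \<C>" using EC_obj[OF 1(3)] by simp
  have "\<gamma> = pl (cls (yo \<A> [j \<cdot> i, c] F)) f"
    unfolding unit_seq_splice(2)[OF c(1) np F(1)]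
    using ymul_mid[OF cc 1(3) k] pull_ymul[OF cc unit_seq_EC[OF F(1)] F(2) M] e F 1 by simp
  thus ?case using unit_seq_splice(1)[OF c(1) np F(1)] F(2) t by auto
qed

end

section \<open>Composition modulo \<open>\<P>\<close>\<close>

lemma group_hom_diff_one:
  assumes "group_hom G H h" "x \<in> carrier G" "y \<in> carrier G"
  shows "h (x \<otimes>\<^bsub>G\<^esub> inv\<^bsub>G\<^esub> y) = \<one>\<^bsub>H\<^esub> \<longleftrightarrow> h x = h y"
proof -
  interpret group_hom G H h by fact
  have "h (x \<otimes>\<^bsub>G\<^esub> inv\<^bsub>G\<^esub> y) = h x \<otimes>\<^bsub>H\<^esub> inv\<^bsub>H\<^esub> h y" using assms(2,3) by simp
  moreover have "h x \<otimes>\<^bsub>H\<^esub> inv\<^bsub>H\<^esub> h y = \<one>\<^bsub>H\<^esub> \<longleftrightarrow> h x = h y"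
    using assms(2,3) by (metis H.inv_equality H.inv_inv H.r_inv hom_closed H.inv_closed)
  ultimately show ?thesis by simp
qed

context extension_closed_subcategory
begin

lemma ymul_group_hom:
  assumes "\<kappa> \<in> EC s Z B" "A \<in> \<C>" "t \<ge> 1"
  shows "group_hom (EG t A Z) (EG (s + t) A B) (ym \<kappa>)"
proof -
  have o: "Z \<in> \<C>" "B \<in> \<C>" using EC_obj[OF assms(1)] by auto
  have g: "group (EG t A Z)" "group (EG (s + t) A B)"
    using Ext_comm_group[OF assms(3,2) o(1)] Ext_comm_group[OF _ assms(2) o(2), of "s + t"] assms(3)
    by (auto simp: comm_group_def)
  have "ym \<kappa> \<in> hom (EG t A Z) (EG (s + t) A B)"
    by (rule homI) (use assms(1) ymul_bsum_r[OF assms(1)] in auto)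
  thus ?thesis using g by (simp add: group_hom_def group_hom_axioms_def)
qed

lemma ymul_group_hom':
  assumes "\<kappa> \<in> EC s A Z" "B \<in> \<C>" "t \<ge> 1"
  shows "group_hom (EG t Z B) (EG (t + s) A B) (\<lambda>\<xi>. ym \<xi> \<kappa>)"
proof -
  have o: "A \<in> \<C>" "Z \<in> \<C>" using EC_obj[OF assms(1)] by auto
  have g: "group (EG t Z B)" "group (EG (t + s) A B)"
    using Ext_comm_group[OF assms(3) o(2) assms(2)] Ext_comm_group[OF _ o(1) assms(2), of "t + s"] assms(3)
    by (auto simp: comm_group_def)
  have "(\<lambda>\<xi>. ym \<xi> \<kappa>) \<in> hom (EG t Z B) (EG (t + s) A B)"
    by (rule homI) (use assms(1) ymul_bsum_l[OF _ _ assms(1)] in auto)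
  thus ?thesis using g by (simp add: group_hom_def group_hom_axioms_def)
qed

text \<open>A source of deflations: an arrow into the right end of a conflation becomes one when the
  middle term is added to its source.\<close>

lemma copair_deflation:
  assumes jd: "cf j d" and f: "f \<in> Hom \<A> N (cod d)" "N \<in> \<C>"
  obtains k where "cf k (copair f d)"
proof -
  note J = cfD[OF jd]
  have ft: "f \<in> Arr \<A>" "dom f = N" "cod f = cod d" using f by (auto simp: Hom_iff)
  obtain t1 t2 where pb: "is_pullback \<A> d f t1 t2" using ex_pullback[of d f] J ft by metis
  note P = is_pullbackD[OF pb]
  obtain j' where "cf j' t1" by (rule pullback_cf[OF jd pb]) (use f ft in auto)
  hence "dom t1 \<in> \<C>" by (rule cfD)
  moreover have "short_exact \<A> (pair t1 (neg t2)) (copair f d)"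
    by (rule copair_kernel[OF short_exactD(4)[OF J(1)] ft(1,3) pb])
  ultimately have "cf (pair t1 (neg t2)) (copair f d)" by (rule_tac cfI) (use P J ft in auto)
  thus ?thesis by (rule that)
qed

text \<open>Both pull-backs describe the same triples x, y, z with f x + d y = g z, which can be
  read as f x = g z + d (-y). In \<open>ex_co_angled_pair\<close> this shows that both projections
  are deflations.\<close>

lemma pullback_swap:
  assumes ft: "f \<in> Arr \<A>" "d \<in> Arr \<A>" "g \<in> Arr \<A>" "cod f = V" "cod d = V" "cod g = V"
    and pb: "is_pullback \<A> (copair f d) g q2 q1"
  shows "is_pullback \<A> (copair g d) f (pr1 (dom f) (dom d) \<cdot> q1) (pair q2 (neg (pr2 (dom f) (dom d) \<cdot> q1)))"
proof -
  let ?N = "dom f" and ?D = "dom d" and ?Z = "dom g"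
  have o: "?N \<in> Obj \<A>" "?D \<in> Obj \<A>" "?Z \<in> Obj \<A>" using ft by auto
  note P0 = is_pullbackD[OF pb]
  have P: "q2 \<in> Arr \<A>" "q1 \<in> Arr \<A>" "cod q2 = ?Z" "cod q1 = bs ?N ?D" "dom q2 = dom q1" using P0 ft by auto
  define a where "a = pr1 ?N ?D \<cdot> q1"
  define v where "v = pr2 ?N ?D \<cdot> q1"
  have av: "a \<in> Arr \<A>" "dom a = dom q1" "cod a = ?N" "v \<in> Arr \<A>" "dom v = dom q1" "cod v = ?D"
    using P o by (auto simp: a_def v_def)
  have eq: "g \<cdot> q2 = (f \<cdot> a) \<boxplus> (d \<cdot> v)"
    using P0(9) copair_cmp[of f d q1] ft P by (simp add: a_def v_def)
  define m where "m = pair q2 (neg v)"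
  have mt: "m \<in> Arr \<A>" "dom m = dom q1" "cod m = bs ?Z ?D" "pr1 ?Z ?D \<cdot> m = q2" "pr2 ?Z ?D \<cdot> m = neg v"
    using P av by (auto simp: m_def)
  have gd: "copair g d \<in> Arr \<A>" "dom (copair g d) = bs ?Z ?D" "cod (copair g d) = V" using ft by auto
  have "is_pullback \<A> (copair g d) f a m"
  proof (rule is_pullbackI)
    have "copair g d \<cdot> m = ((f \<cdot> a) \<boxplus> (d \<cdot> v)) \<boxplus> neg (d \<cdot> v)"
      unfolding m_def using copair_pair[of g d q2 "neg v"] ft P av eq by simp
    also have "\<dots> = (f \<cdot> a) \<boxplus> ((d \<cdot> v) \<boxplus> neg (d \<cdot> v))" by (rule plus_assoc) (use ft av in auto)
    also have "\<dots> = f \<cdot> a" using ft av by simp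
    finally show "f \<cdot> a = copair g d \<cdot> m" by simp
  next
    fix u y assume u: "u \<in> Arr \<A>" "y \<in> Arr \<A>" "cod u = dom f" "cod y = dom (copair g d)" "dom u = dom y" "f \<cdot> u = copair g d \<cdot> y"
    define y1 where "y1 = pr1 ?Z ?D \<cdot> y"
    define y2 where "y2 = pr2 ?Z ?D \<cdot> y"
    have yt: "y1 \<in> Arr \<A>" "dom y1 = dom y" "cod y1 = ?Z" "y2 \<in> Arr \<A>" "dom y2 = dom y" "cod y2 = ?D"
      using u(2,4) gd o by (auto simp: y1_def y2_def)
    have fu: "f \<cdot> u = (g \<cdot> y1) \<boxplus> (d \<cdot> y2)" unfolding u(6) y1_def y2_def using copair_cmp[of g d y] ft u(2,4) gd by simp
    have "copair f d \<cdot> pair u (neg y2) = ((g \<cdot> y1) \<boxplus> (d \<cdot> y2)) \<boxplus> neg (d \<cdot> y2)"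
      using copair_pair[of f d u "neg y2"] ft u(1,3,5) yt by (simp add: fu)
    also have "\<dots> = (g \<cdot> y1) \<boxplus> ((d \<cdot> y2) \<boxplus> neg (d \<cdot> y2))" by (rule plus_assoc) (use ft yt in auto)
    also have "\<dots> = g \<cdot> y1" using ft yt by simp
    finally have e: "g \<cdot> y1 = copair f d \<cdot> pair u (neg y2)" by simp
    obtain w where w: "w \<in> Arr \<A>" "cod w = dom q2" "dom w = dom y1" "q2 \<cdot> w = y1" "q1 \<cdot> w = pair u (neg y2)"
      by (rule is_pullback_lift[OF pb, of y1 "pair u (neg y2)"]) (use e yt u ft in auto)
    have wt: "cod w = dom q1" using w(2) P by simp
    have aw: "a \<cdot> w = u"
      using reassoc[OF a_def[symmetric], of w] w(1,5) wt P o u(1,3,5) yt by simp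
    have vw: "v \<cdot> w = neg y2"
      using reassoc[OF v_def[symmetric], of w] w(1,5) wt P o u(1,3,5) yt by simp
    have "m \<cdot> w = y"
    proof (rule biprod_ext[where X = ?Z and Y = ?D])
      show "pr1 ?Z ?D \<cdot> (m \<cdot> w) = pr1 ?Z ?D \<cdot> y"
        using reassoc[OF mt(4), of w] mt(1-3) w(1,4) wt o by (simp add: y1_def)
      show "pr2 ?Z ?D \<cdot> (m \<cdot> w) = pr2 ?Z ?D \<cdot> y"
        using reassoc[OF mt(5), of w] mt(1-3) w(1) wt o av vw yt by (simp add: y2_def)
    qed (use mt(1-3) w(1) wt o u(2,4) gd in auto)
    thus "\<exists>w. w \<in> Arr \<A> \<and> cod w = dom a \<and> dom w = dom u \<and> a \<cdot> w = u \<and> m \<cdot> w = y"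
      using w(1,3) wt av(2) aw yt u(5) by (intro exI[of _ w]) simp
  next
    fix w w' assume w: "w \<in> Arr \<A>" "w' \<in> Arr \<A>" "cod w = dom a" "cod w' = dom a" "dom w = dom w'"
      "a \<cdot> w = a \<cdot> w'" "m \<cdot> w = m \<cdot> w'"
    have wt: "cod w = dom q1" "cod w' = dom q1" using w av by auto
    have q2: "q2 \<cdot> w = q2 \<cdot> w'"
      using reassoc[OF mt(4), of w] reassoc[OF mt(4), of w'] mt(1-3) w(1,2,7) wt o by simp
    have "neg v \<cdot> w = neg v \<cdot> w'"
      using reassoc[OF mt(5), of w] reassoc[OF mt(5), of w'] mt(1-3) w(1,2,7) wt o by simp
    hence "neg (neg (v \<cdot> w)) = neg (neg (v \<cdot> w'))" using av w(1,2) wt by simp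
    hence v: "v \<cdot> w = v \<cdot> w'" using av(4-6) w(1,2) wt by simp
    have q1: "q1 \<cdot> w = q1 \<cdot> w'"
    proof (rule biprod_ext[where X = ?N and Y = ?D])
      show "pr1 ?N ?D \<cdot> (q1 \<cdot> w) = pr1 ?N ?D \<cdot> (q1 \<cdot> w')"
        using reassoc[OF a_def[symmetric], of w] reassoc[OF a_def[symmetric], of w'] w(1,2,6) wt P o by simp
      show "pr2 ?N ?D \<cdot> (q1 \<cdot> w) = pr2 ?N ?D \<cdot> (q1 \<cdot> w')"
        using reassoc[OF v_def[symmetric], of w] reassoc[OF v_def[symmetric], of w'] w(1,2) v wt P o by simp
    qed (use w(1,2) wt P o in auto)
    show "w = w'" by (rule is_pullback_ext[OF pb q2 q1]) (use w(1,2,5) wt P in auto)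
  qed (use gd ft av mt in auto)
  thus ?thesis by (simp add: a_def m_def v_def)
qed

end

context n_frobenius_category
begin

lemma unit_seq_inj_eq:
  assumes E: "unit_seq s A B E" and t: "t > n" and x: "\<xi> \<in> EC t X A" "\<xi>' \<in> EC t X A" "ym (cls E) \<xi> = ym (cls E) \<xi>'"
  shows "\<xi> = \<xi>'"
proof -
  interpret group_hom "EG t X A" "EG (s + t) X B" "ym (cls E)"
    by (rule ymul_group_hom[OF unit_seq_EC[OF E]]) (use EC_obj[OF x(1)] in auto)
  have "kernel (EG t X A) (EG (s + t) X B) (ym (cls E)) = {\<one>\<^bsub>EG t X A\<^esub>}"
  proof (intro equalityI subsetI)
    fix x assume "x \<in> kernel (EG t X A) (EG (s + t) X B) (ym (cls E))"
    hence "x \<in> EC t X A" "ym (cls E) x = ez (s + t) X B" by (simp_all add: kernel_def ez_def)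
    from unit_seq_inj[OF E t this] show "x \<in> {\<one>\<^bsub>EG t X A\<^esub>}" by (simp add: ez_def)
  qed (use G.one_closed hom_one in \<open>simp add: kernel_def\<close>)
  from trivial_ker_imp_inj[OF this] show ?thesis using x unfolding inj_on_def by simp
qed

lemma unit_seq_inj_eq':
  assumes E: "unit_seq s A B E" and t: "t > n" and x: "\<xi> \<in> EC t B Y" "\<xi>' \<in> EC t B Y" "ym \<xi> (cls E) = ym \<xi>' (cls E)"
  shows "\<xi> = \<xi>'"
proof -
  interpret group_hom "EG t B Y" "EG (t + s) A Y" "\<lambda>\<xi>. ym \<xi> (cls E)"
    by (rule ymul_group_hom'[OF unit_seq_EC[OF E]]) (use EC_obj[OF x(1)] in auto)
  have "kernel (EG t B Y) (EG (t + s) A Y) (\<lambda>\<xi>. ym \<xi> (cls E)) = {\<one>\<^bsub>EG t B Y\<^esub>}"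
  proof (intro equalityI subsetI)
    fix x assume "x \<in> kernel (EG t B Y) (EG (t + s) A Y) (\<lambda>\<xi>. ym \<xi> (cls E))"
    hence "x \<in> EC t B Y" "ym x (cls E) = ez (t + s) A Y" by (simp_all add: kernel_def ez_def)
    from unit_seq_inj'[OF E t this] show "x \<in> {\<one>\<^bsub>EG t B Y\<^esub>}" by (simp add: ez_def)
  qed (use G.one_closed hom_one in \<open>simp add: kernel_def\<close>)
  from trivial_ker_imp_inj[OF this] show ?thesis using x unfolding inj_on_def by simp
qed

lemma unit_ext_E:
  assumes "\<delta> \<in> unit_ext \<A> \<C> n A B"
  obtains E where "unit_seq n A B E" "\<delta> = cls E"
proof -
  obtain E where E: "\<delta> \<in> EC n A B" "E \<in> \<delta>" "unit_seq n A B E"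
    using assms unfolding unit_ext_def unit_seq_n by auto
  obtain E0 where E0: "\<delta> = cls E0" using E(1) EC_E by blast
  have "cls E0 = cls E" using E(2) unfolding E0 mem_cls cls_eq_iff .
  thus ?thesis using that E E0 by simp
qed

lemma unit_seq_unit_ext: "unit_seq n A B E \<Longrightarrow> cls E \<in> unit_ext \<A> \<C> n A B"
  unfolding unit_ext_def unit_seq_n using unit_seq_EC[of n A B E] by (auto simp: mem_cls)

section \<open>Pull-backs of units and co-angled pairs\<close>

lemma np_extension:
  assumes ip: "cf i p" and n: "np (dom i)" "np (cod p)"
  shows "np (dom p)"
proof (rule npI)
  note I = cfD[OF ip]
  show "dom p \<in> \<C>" by (rule I)
  fix t Y \<gamma> assume g: "\<gamma> \<in> EC t Y (dom p)" and t: "t > n"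
  have Y: "Y \<in> \<C>" "t \<ge> 1" using EC_obj[OF g] by auto
  have pH: "p \<in> Hom \<A> (dom p) (cod p)" "i \<in> Hom \<A> (dom i) (dom p)" using I by (auto simp: Hom_iff)
  have "pu p \<gamma> = ez t Y (cod p)" by (rule np_ez'[OF n(2) push_EC[OF g pH(1) I(3)] t])
  then obtain \<xi> where x: "\<xi> \<in> EC t Y (dom i)" "\<gamma> = pu i \<xi>" by (rule push_middle[OF ip Y(2) g])
  thus "\<gamma> = ez t Y (dom p)" using np_ez'[OF n(1) x(1) t] push_ez[OF pH(2) Y(1) I(2,4) Y(2)] by simp
qed

text \<open>Pulling back a splice affects only its last conflation, and that one is split by its own
  deflation d; so the whole class vanishes along d.\<close>

lemma unit_seq_last:
  assumes "unit_seq t A B E"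
  shows "\<exists>j d. cf j d \<and> cod d = A \<and> np (dom d) \<and> pl (cls E) d = ez t (dom d) B"
  using assms
proof (induction t arbitrary: B E)
  case 0
  thus ?case unfolding unit_seq_def using xs_length by fastforce
next
  case (Suc t)
  from Suc.prems show ?case
  proof (cases rule: unit_seq_cases)
    case (single i p)
    thus ?thesis using pull_own_deflation[OF single(3)] by auto
  next
    case (splice i p t' F)
    hence F: "unit_seq t A (cod p) F" by simp
    obtain j d where d: "cf j d" "cod d = A" "np (dom d)" "pl (cls F) d = ez t (dom d) (cod p)"
      using Suc.IH[OF F] by blast
    note D = cfD[OF d(1)]
    have dH: "d \<in> Hom \<A> (dom d) A" using D d by (simp add: Hom_iff)
    have t: "t \<ge> 1" using unit_seq_EC[OF F] EC_obj by blast
    have c: "cls [i, p] \<in> EC 1 (cod p) (dom i)" by (rule EC_cls[OF xs_1[OF splice(2) refl refl]])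
    have "pl (cls E) d = ez (Suc t) (dom d) B"
      using pull_ymul[OF c unit_seq_EC[OF F] dH D(4)] d(4) ymul_ez_r[OF c D(4) t] splice by simp
    thus ?thesis using d by blast
  qed
qed

text \<open>Only the last conflation changes. Its new middle term is a pull-back, hence an extension
  of the old n-projective middle term by the left end of the conflation of b, and
  \<open>np_extension\<close> applies.\<close>

lemma unit_seq_pull:
  assumes "unit_seq t A B E" "cf k b" "np (dom k)" "cod b = A"
  shows "\<exists>E'. unit_seq t (dom b) B E' \<and> pl (cls E) b = cls E'"
  using assms(1)
proof (induction t arbitrary: B E)
  case 0
  thus ?case unfolding unit_seq_def using xs_length by fastforce
next
  case (Suc t)
  note K = cfD[OF assms(2)]
  have bH: "b \<in> Hom \<A> (dom b) A" using K assms by (simp add: Hom_iff)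
  from Suc.prems show ?case
  proof (cases rule: unit_seq_cases)
    case (single i p)
    note I = cfD[OF single(3)]
    obtain i' p' y where 1: "short_exact \<A> i' p'" "ses_map \<A> (ide (dom i)) y b i' p' i p"
      "dom i' = dom i" "cod p' = dom b" "is_pullback \<A> p b p' y"
      by (rule ses_map_pullback[OF I(1) K(6)]) (use assms single in simp)
    have c: "cf i' p'" by (rule cfI[OF 1(1)]) (use 1 I K in auto)
    have "is_pullback \<A> b p y p'" by (rule is_pullback_sym[OF 1(5)])
    then obtain j' where j': "cf j' y" "dom j' = dom k" by (rule pullback_cf[OF assms(2) _ I(4)])
    have "np (dom y)" by (rule np_extension[OF j'(1)]) (use j' assms(3) is_pullbackD[OF 1(5)] single in auto)
    hence "np (dom p')" using is_pullbackD[OF 1(5)] by simp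
    hence "unit_seq (Suc t) (dom b) B [i', p']" using unit_seq_1[OF c] 1 single by simp
    moreover have "pl (cls E) b = cls [i', p']" using cls_pull_1[OF 1(2) c single(3) 1(3)] single by simp
    ultimately show ?thesis by blast
  next
    case (splice i p t' F)
    hence F: "unit_seq t A (cod p) F" by simp
    obtain F' where F': "unit_seq t (dom b) (cod p) F'" "pl (cls F) b = cls F'" using Suc.IH[OF F] by blast
    have c: "cls [i, p] \<in> EC 1 (cod p) (dom i)" by (rule EC_cls[OF xs_1[OF splice(2) refl refl]])
    have "pl (cls E) b = cls (yo \<A> [i, p] F')"
      using pull_ymul[OF c unit_seq_EC[OF F] bH K(4)] F' splice unit_seq_splice(2)[OF splice(2,4) F'(1)] by simp
    moreover have "unit_seq (Suc t) (dom b) B (yo \<A> [i, p] F')"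
      using unit_seq_splice(1)[OF splice(2,4) F'(1)] splice by simp
    ultimately show ?thesis by blast
  qed
qed

text \<open>With \<delta> and \<delta>' the classes of E and E', the relation \<delta>' \<xi> =
  \<delta> (a \<xi>) factors the shift along \<delta>' through pushing along a. Both shifts are
  bijective in degree n + 1, hence so is the push-out.\<close>

lemma unit_quasi_invertible:
  assumes E: "unit_seq n A B E" and E': "unit_seq n W B E'" and a: "a \<in> Hom \<A> W A" "pl (cls E) a = cls E'"
  shows "quasi_invertible \<A> \<C> n a"
proof -
  have o: "A \<in> \<C>" "W \<in> \<C>" using EC_obj[OF unit_seq_EC[OF E]] EC_obj[OF unit_seq_EC[OF E']] by auto
  have at: "a \<in> Arr \<A>" "dom a = W" "cod a = A" using a by (auto simp: Hom_iff)
  have n: "n + 1 > n" by simp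
  have "pu a \<in> iso (EG (n + 1) X W) (EG (n + 1) X A)" if X: "X \<in> \<C>" for X
  proof -
    have y: "ym (cls E') \<xi> = ym (cls E) (pu a \<xi>)" if "\<xi> \<in> EC (n + 1) X W" for \<xi>
      using ymul_mid[OF unit_seq_EC[OF E] that a(1)] a(2) by simp
    have "pu a \<in> hom (EG (n + 1) X W) (EG (n + 1) X A)"
      by (rule homI) (use push_EC[OF _ a(1) o(1)] push_bsum[OF _ _ a(1) o(1)] in auto)
    moreover have "inj_on (pu a) (EC (n + 1) X W)"
    proof (rule inj_onI)
      fix \<xi> \<xi>' assume x: "\<xi> \<in> EC (n + 1) X W" "\<xi>' \<in> EC (n + 1) X W" "pu a \<xi> = pu a \<xi>'"
      show "\<xi> = \<xi>'" by (rule unit_seq_inj_eq[OF E' n x(1,2)]) (use y x in simp)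
    qed
    moreover have "pu a ` EC (n + 1) X W = EC (n + 1) X A"
    proof (intro equalityI subsetI)
      fix z assume "z \<in> pu a ` EC (n + 1) X W"
      thus "z \<in> EC (n + 1) X A" using push_EC[OF _ a(1) o(1)] by blast
    next
      fix z assume z: "z \<in> EC (n + 1) X A"
      obtain \<xi> where x: "\<xi> \<in> EC (n + 1) X W" "ym (cls E) z = ym (cls E') \<xi>"
        using unit_seq_surj[OF E' _ ymul_EC[OF unit_seq_EC[OF E] z]] by auto
      have "z = pu a \<xi>" by (rule unit_seq_inj_eq[OF E n z push_EC[OF x(1) a(1) o(1)]]) (use x y in simp)
      thus "z \<in> pu a ` EC (n + 1) X W" using x by blast
    qed
    ultimately show ?thesis unfolding iso_def bij_betw_def by simp
  qed
  thus ?thesis unfolding quasi_invertible_def using at o by simp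
qed

text \<open>Both units are restrictions \<open>\<delta> = \<Delta>f\<close>, \<open>\<delta>' = \<Delta>g\<close> of a single unit with right end term \<open>V\<close>. Its last arrow
  \<open>d : V\<^sub>0 \<rightarrow> V\<close> satisfies \<open>\<Delta>d = 0\<close>, so \<open>\<Delta>[f, d] = \<delta>p\<^sub>1\<close> on \<open>N \<oplus> V\<^sub>0\<close>; comparing shifts along \<open>\<Delta>\<close> and \<open>\<delta>\<close>, the kernel
  of the deflation \<open>[f, d]\<close> is \<open>n\<close>-projective. The common source is the pull-back of \<open>[f, d]\<close> along \<open>g\<close>.\<close>

lemma ex_co_angled_pair:
  assumes d1: "\<delta> \<in> unit_ext \<A> \<C> n N B" and d2: "\<delta>' \<in> unit_ext \<A> \<C> n Z B"
  shows "\<exists>a b. co_angled_pair \<A> \<C> n N Z B \<delta> a \<delta>' b"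
proof -
  obtain E where E: "unit_seq n N B E" "\<delta> = cls E" by (rule unit_ext_E[OF d1])
  obtain E' where E': "unit_seq n Z B E'" "\<delta>' = cls E'" by (rule unit_ext_E[OF d2])
  have dE: "\<delta> \<in> EC n N B" "\<delta>' \<in> EC n Z B" using unit_seq_EC[OF E(1)] unit_seq_EC[OF E'(1)] E E' by auto
  have o: "N \<in> \<C>" "B \<in> \<C>" "Z \<in> \<C>" using EC_obj[OF dE(1)] EC_obj[OF dE(2)] by auto
  \<comment> \<open>One class on the biproduct restricts to both units, so a single factorization
    yields f and g together.\<close>
  obtain w where w: "w \<in> EC n (bs N Z) B" "pl w (in1 N Z) = \<delta>" "pl w (in2 N Z) = \<delta>'" by (rule ex_copairing[OF dE])
  obtain V D u where D: "unit_seq n V B D" and u: "u \<in> Hom \<A> (bs N Z) V" "w = pl (cls D) u"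
    using right_unit_factorization[OF n_pos w(1)] by blast
  define \<Delta> where "\<Delta> = cls D"
  have DE: "\<Delta> \<in> EC n V B" "V \<in> \<C>" using unit_seq_EC[OF D] EC_obj unfolding \<Delta>_def by blast+
  note H = biprod_Hom(3,4)[OF o(1,3)]
  define f where "f = u \<cdot> in1 N Z"
  define g where "g = u \<cdot> in2 N Z"
  have fg: "f \<in> Hom \<A> N V" "g \<in> Hom \<A> Z V" unfolding f_def g_def using cmp_in_Hom[OF H(1) u(1)] cmp_in_Hom[OF H(2) u(1)] by auto
  hence fgt: "f \<in> Arr \<A>" "dom f = N" "cod f = V" "g \<in> Arr \<A>" "dom g = Z" "cod g = V" by (auto simp: Hom_iff)
  have df: "pl \<Delta> f = \<delta>" "pl \<Delta> g = \<delta>'"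
    unfolding f_def g_def using pull_pull[OF DE(1) u(1) H(1)] pull_pull[OF DE(1) u(1) H(2)] u(2) w o by (auto simp: \<Delta>_def)
  obtain j d where d: "cf j d" "cod d = V" "np (dom d)" "pl \<Delta> d = ez n (dom d) B"
    using unit_seq_last[OF D] unfolding \<Delta>_def by blast
  note J = cfD[OF d(1)]
  let ?D = "dom d"
  have dH: "d \<in> Hom \<A> ?D V" using J d by (simp add: Hom_iff)
  note HB = biprod_Hom[OF o(1) J(4)]
  define h where "h = copair f d"
  have ht: "h \<in> Arr \<A>" "dom h = bs N ?D" "cod h = V" "h \<cdot> in1 N ?D = f" "h = (f \<cdot> pr1 N ?D) \<boxplus> (d \<cdot> pr2 N ?D)"
    using fgt J d by (auto simp: h_def copair_def)
  have hH: "h \<in> Hom \<A> (bs N ?D) V" using ht by (simp add: Hom_iff)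
  obtain k0 where k0: "cf k0 h" using copair_deflation[OF d(1), of f N] fg d o unfolding h_def by metis
  note K0 = cfD[OF k0]
  have bsC: "bs N ?D \<in> \<C>" using o J by simp
  have dh: "pl \<Delta> h = pl \<delta> (pr1 N ?D)"
  proof -
    have "pl \<Delta> h = bsum (bs N ?D) B (pl \<Delta> (f \<cdot> pr1 N ?D)) (pl \<Delta> (d \<cdot> pr2 N ?D))"
      unfolding ht(5) by (rule pull_plus[OF DE(1) cmp_in_Hom[OF HB(1) fg(1)] cmp_in_Hom[OF HB(2) dH] bsC])
    also have "pl \<Delta> (f \<cdot> pr1 N ?D) = pl \<delta> (pr1 N ?D)" using pull_pull[OF DE(1) fg(1) HB(1) o(1) bsC] df by simp
    also have "pl \<Delta> (d \<cdot> pr2 N ?D) = ez n (bs N ?D) B"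
      using pull_pull[OF DE(1) dH HB(2) J(4) bsC] pull_ez[OF HB(2) bsC J(4) o(2) n_pos] d(4) by simp
    finally have 1: "pl \<Delta> h = bsum (bs N ?D) B (pl \<delta> (pr1 N ?D)) (ez n (bs N ?D) B)" .
    interpret G: comm_group "EG n (bs N ?D) B" by (rule Ext_comm_group[OF n_pos bsC o(2)])
    show ?thesis using 1 G.r_one[of "pl \<delta> (pr1 N ?D)"] pull_EC[OF dE(1) HB(1) bsC] by (simp add: ez_def)
  qed
  \<comment> \<open>A class killed by h has zero component over N, because \<delta> can be
    cancelled, and zero component over the n-projective source of d.\<close>
  have h_inj: "x = ez t Y (bs N ?D)" if x: "x \<in> EC t Y (bs N ?D)" "pu h x = ez t Y V" and t: "t > n" for t Y x
  proof -
    have Y: "Y \<in> \<C>" "t \<ge> 1" using EC_obj[OF x(1)] by auto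
    have x1: "pu (pr1 N ?D) x \<in> EC t Y N" "pu (pr2 N ?D) x \<in> EC t Y ?D"
      using push_EC[OF x(1) HB(1) o(1)] push_EC[OF x(1) HB(2) J(4)] by auto
    have "ym \<delta> (pu (pr1 N ?D) x) = ym \<Delta> (pu h x)"
      using ymul_mid[OF dE(1) x(1) HB(1)] ymul_mid[OF DE(1) x(1) hH] dh by simp
    hence "ym (cls E) (pu (pr1 N ?D) x) = ez (n + t) Y B" using x(2) ymul_ez_r[OF DE(1) Y] E by simp
    hence p1: "pu (pr1 N ?D) x = ez t Y N" using unit_seq_inj[OF E(1) t x1(1)] by simp
    have p2: "pu (pr2 N ?D) x = ez t Y ?D" by (rule np_ez'[OF d(3) x1(2) t])
    have "pu ((in1 N ?D \<cdot> pr1 N ?D) \<boxplus> (in2 N ?D \<cdot> pr2 N ?D)) x =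
       bsum Y (bs N ?D) (pu (in1 N ?D \<cdot> pr1 N ?D) x) (pu (in2 N ?D \<cdot> pr2 N ?D) x)"
      by (rule push_plus[OF x(1) cmp_in_Hom[OF HB(1,3)] cmp_in_Hom[OF HB(2,4)] bsC])
    hence "x = bsum Y (bs N ?D) (pu (in1 N ?D) (ez t Y N)) (pu (in2 N ?D) (ez t Y ?D))"
      using push_push[OF x(1) HB(1,3) o(1) bsC] push_push[OF x(1) HB(2,4) J(4) bsC] p1 p2 x o J by simp
    hence xe: "x = bsum Y (bs N ?D) (ez t Y (bs N ?D)) (ez t Y (bs N ?D))"
      using push_ez[OF HB(3) Y(1) o(1) bsC Y(2)] push_ez[OF HB(4) Y(1) J(4) bsC Y(2)] by simp
    interpret G: comm_group "EG t Y (bs N ?D)" by (rule Ext_comm_group[OF Y(2,1) bsC])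
    show ?thesis using xe G.r_one[OF G.one_closed] by (simp add: ez_def)
  qed
  \<comment> \<open>A preimage is found on the summand N alone: dividing \<Delta> y by \<delta> on
    the left gives \<xi>, and then y = f \<xi>.\<close>
  have h_surj: "\<exists>x \<in> EC t Y (bs N ?D). y = pu h x" if y: "y \<in> EC t Y V" and t: "t > n" for t Y y
  proof -
    obtain \<xi> where x: "\<xi> \<in> EC t Y N" "ym \<Delta> y = ym (cls E) \<xi>"
      using unit_seq_surj[OF E(1) _ ymul_EC[OF DE(1) y]] t by auto
    have "ym (cls D) y = ym (cls D) (pu f \<xi>)"
      using x ymul_mid[OF DE(1) x(1) fg(1)] df E by (simp add: \<Delta>_def)
    hence "y = pu f \<xi>" by (rule unit_seq_inj_eq[OF D t y push_EC[OF x(1) fg(1) DE(2)]])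
    hence "y = pu h (pu (in1 N ?D) \<xi>)" using push_push[OF x(1) HB(3) hH bsC DE(2)] ht by simp
    thus ?thesis using push_EC[OF x(1) HB(3) bsC] by blast
  qed
  have k0H: "k0 \<in> Hom \<A> (dom k0) (bs N ?D)" using K0 ht by (simp add: Hom_iff)
  have kc: "cls [k0, h] \<in> EC 1 V (dom k0)" by (rule EC_cls[OF xs_1[OF k0 refl ht(3)]])
  \<comment> \<open>The degree is at least n + 2 here: the quotient \<xi> has degree t and must be
    lifted along h, which \<open>h_surj\<close> allows only above n.\<close>
  have J_high: "\<gamma> = ez (Suc t) Y (dom k0)" if gg: "\<gamma> \<in> EC (Suc t) Y (dom k0)" and t: "t > n" for t Y \<gamma>
  proof -
    have Y: "Y \<in> \<C>" "t \<ge> 1" using EC_obj[OF gg] t by auto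
    have "pu h (pu k0 \<gamma>) = ez (Suc t) Y V"
      using push_push[OF gg k0H hH bsC DE(2)] push_zero'[OF gg DE(2)] K0 ht by simp
    hence "pu k0 \<gamma> = ez (Suc t) Y (bs N ?D)" using h_inj[OF push_EC[OF gg k0H bsC]] t by simp
    then obtain \<xi> where x: "\<xi> \<in> EC t Y V" "\<gamma> = ym (cls [k0, h]) \<xi>"
      using push_kernel[OF k0 Y(2) gg] ht by metis
    obtain \<zeta> where ze: "\<zeta> \<in> EC t Y (bs N ?D)" "\<xi> = pu h \<zeta>" using h_surj[OF x(1) t] by blast
    have "\<gamma> = ym (pl (cls [k0, h]) h) \<zeta>" using ymul_mid[OF kc ze(1) hH] x ze by simp
    also have "\<dots> = ym (ez 1 (bs N ?D) (dom k0)) \<zeta>" using pull_own_deflation[OF k0] ht by simp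
    finally show ?thesis using ymul_ez_l[OF ze(1) K0(2), of 1] by simp
  qed
  \<comment> \<open>The missing degree n + 1 is recovered by embedding Y into an n-projective, which
    shifts the class up by one degree injectively.\<close>
  have npJ: "np (dom k0)"
  proof (rule npI[OF K0(2)])
    fix t Y \<gamma> assume gg: "\<gamma> \<in> EC t Y (dom k0)" and t: "t > n"
    have Y: "Y \<in> \<C>" "t \<ge> 1" using EC_obj[OF gg] by auto
    obtain i p where ip: "cf i p" "dom i = Y" "np (dom p)" by (rule ex_np_inflation[OF Y(1)])
    note I = cfD[OF ip(1)]
    have gi: "\<gamma> \<in> EC t (dom i) (dom k0)" using gg ip by simp
    have "ym \<gamma> (cls [i, p]) \<in> EC (Suc t) (cod p) (dom k0)" using ymul_EC[OF gi EC_cls[OF xs_1[OF ip(1) refl refl]]] by simp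
    hence "ym \<gamma> (cls [i, p]) = ez (Suc t) (cod p) (dom k0)" by (rule J_high[OF _ t])
    thus "\<gamma> = ez t Y (dom k0)" using np_connecting_inj'[OF ip(1,3) t gi] ip by simp
  qed
  obtain q2 q1 where pb: "is_pullback \<A> h g q2 q1" using ex_pullback[of h g] ht fgt by metis
  note P = is_pullbackD[OF pb]
  define W where "W = dom q1"
  have gZ: "dom g \<in> \<C>" using fgt o by simp
  obtain kb where kb: "cf kb q2" "dom kb = dom k0" by (rule pullback_cf[OF k0 pb gZ])
  define a where "a = pr1 N ?D \<cdot> q1"
  have q: "q1 \<in> Hom \<A> W (bs N ?D)" "q2 \<in> Hom \<A> W Z" "W \<in> \<C>" using P ht fgt cfD[OF kb(1)] by (auto simp: Hom_iff W_def)
  have aH: "a \<in> Hom \<A> W N" unfolding a_def by (rule cmp_in_Hom[OF q(1) HB(1)])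
  \<comment> \<open>By symmetry in f and g the arrow to N is a pull-back of the deflation [g, d], so
    it is a deflation as well.\<close>
  have "is_pullback \<A> (copair g d) f a (pair q2 (neg (pr2 N ?D \<cdot> q1)))"
    using pullback_swap[of f d g V q2 q1] fgt J d pb by (simp add: a_def h_def)
  moreover obtain k1 where "cf k1 (copair g d)" using copair_deflation[OF d(1), of g Z] fg d o by metis
  moreover have "dom f \<in> \<C>" using fgt o by simp
  ultimately obtain ka where ka: "cf ka a" using pullback_cf by blast
  have eq: "pl \<delta> a = pl \<delta>' q2"
  proof -
    have "pl \<delta>' q2 = pl \<Delta> (g \<cdot> q2)" using pull_pull[OF DE(1) fg(2) q(2) o(3) q(3)] df by simp
    also have "\<dots> = pl (pl \<Delta> h) q1" unfolding P(9) by (rule pull_pull[OF DE(1) hH q(1) bsC q(3), symmetric])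
    also have "\<dots> = pl \<delta> a" unfolding dh a_def by (rule pull_pull[OF dE(1) HB(1) q(1) bsC q(3)])
    finally show ?thesis by simp
  qed
  have "np (dom kb)" "cod q2 = Z" "dom q2 = W" using npJ kb q by (auto simp: Hom_iff)
  then obtain EW where EW: "unit_seq n W B EW" "pl \<delta>' q2 = cls EW"
    using unit_seq_pull[OF E'(1) kb(1)] E' by metis
  have qa: "quasi_invertible \<A> \<C> n a" by (rule unit_quasi_invertible[OF E(1) EW(1) aH]) (use eq EW E in simp)
  have qb: "quasi_invertible \<A> \<C> n q2" by (rule unit_quasi_invertible[OF E'(1) EW(1) q(2)]) (use EW E' in simp)
  have "co_angled_pair \<A> \<C> n N Z B \<delta> a \<delta>' q2"
    unfolding co_angled_pair_def deflation_def
    using d1 d2 aH q(2) ka kb(1) qa qb eq unit_seq_unit_ext[OF EW(1)] EW(2) by (auto simp: Hom_iff)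
  thus ?thesis by blast
qed

section \<open>The subgroup P as the kernel of a unit\<close>

lemma proj_ext_kernel:
  assumes K: "unit_seq s Y Y' E" and X: "X \<in> \<C>"
  shows "proj_ext \<A> \<C> n X Y = kernel (EG n X Y) (EG (s + n) X Y') (ym (cls E))"
proof (intro equalityI subsetI)
  fix \<gamma> assume g: "\<gamma> \<in> proj_ext \<A> \<C> n X Y"
  obtain P \<eta> h where "np P" "h \<in> Hom \<A> X P" "\<eta> \<in> EC n P Y" "\<gamma> = pl \<eta> h" by (rule proj_ext_E[OF g])
  hence "\<gamma> \<in> EC n X Y" using pull_EC X by blast
  thus "\<gamma> \<in> kernel (EG n X Y) (EG (s + n) X Y') (ym (cls E))"
    using proj_ext_ymul[OF g unit_seq_EC[OF K] X] unfolding kernel_def ez_def by simp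
next
  fix \<gamma> assume "\<gamma> \<in> kernel (EG n X Y) (EG (s + n) X Y') (ym (cls E))"
  thus "\<gamma> \<in> proj_ext \<A> \<C> n X Y" using unit_seq_kernel[OF K] unfolding kernel_def ez_def by simp
qed

text \<open>Closure under addition is not visible from the form \<eta> h, because h and its
  n-projective target vary. It follows from the description as the kernel of multiplication by any
  unit with right end term Y, here of length one.\<close>

lemma proj_ext_normal:
  assumes "X \<in> \<C>" "Y \<in> \<C>"
  shows "proj_ext \<A> \<C> n X Y \<lhd> EG n X Y"
proof -
  obtain Y' E where E: "unit_seq 1 Y Y' E" using ex_unit_seq[OF assms(2), of 1] by auto
  interpret group_hom "EG n X Y" "EG (1 + n) X Y'" "ym (cls E)"
    by (rule ymul_group_hom[OF unit_seq_EC[OF E] assms(1) n_pos])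
  show ?thesis unfolding proj_ext_kernel[OF E assms(1)] by (rule normal_kernel)
qed

lemma proj_ext_diff:
  assumes K: "unit_seq s Y Y' E" and x: "x \<in> EC n X Y" "y \<in> EC n X Y"
  shows "x \<otimes>\<^bsub>EG n X Y\<^esub> inv\<^bsub>EG n X Y\<^esub> y \<in> proj_ext \<A> \<C> n X Y \<longleftrightarrow> ym (cls E) x = ym (cls E) y"
proof -
  have X: "X \<in> \<C>" "Y \<in> \<C>" using EC_obj[OF x(1)] by auto
  note gh = ymul_group_hom[OF unit_seq_EC[OF K] X(1) n_pos]
  interpret group_hom "EG n X Y" "EG (s + n) X Y'" "ym (cls E)" by (rule gh)
  have "x \<otimes>\<^bsub>EG n X Y\<^esub> inv\<^bsub>EG n X Y\<^esub> y \<in> carrier (EG n X Y)"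
    by (rule G.m_closed[OF _ G.inv_closed]) (use x in simp_all)
  thus ?thesis unfolding proj_ext_kernel[OF K X(1)] kernel_def
    using group_hom_diff_one[OF gh, of x y] x by simp
qed

text \<open>A single unit detects cosets, so comparison modulo P becomes an equation in a higher
  Ext-group.\<close>

lemma coset_eqI:
  assumes K: "unit_seq s Y Y' E" and x: "x \<in> EC n X Y" "y \<in> EC n X Y" "ym (cls E) x = ym (cls E) y"
  shows "proj_ext \<A> \<C> n X Y #>\<^bsub>EG n X Y\<^esub> x = proj_ext \<A> \<C> n X Y #>\<^bsub>EG n X Y\<^esub> y"
proof -
  have X: "X \<in> \<C>" "Y \<in> \<C>" using EC_obj[OF x(1)] by auto
  interpret normal "proj_ext \<A> \<C> n X Y" "EG n X Y" by (rule proj_ext_normal[OF X])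
  have "x \<in> proj_ext \<A> \<C> n X Y #>\<^bsub>EG n X Y\<^esub> y"
    using rcos_module[OF is_group, of y x] proj_ext_diff[OF K x(1,2)] x by simp
  thus ?thesis using repr_independence[OF _ _ subgroup_axioms, of x y] x by simp
qed

lemma coset_memD:
  assumes y: "y \<in> EC n X Y" and x: "x \<in> proj_ext \<A> \<C> n X Y #>\<^bsub>EG n X Y\<^esub> y"
  shows "x \<in> EC n X Y" "\<kappa> \<in> EC s Y Y' \<Longrightarrow> ym \<kappa> x = ym \<kappa> y"
proof -
  have X: "X \<in> \<C>" "Y \<in> \<C>" using EC_obj[OF y] by auto
  interpret normal "proj_ext \<A> \<C> n X Y" "EG n X Y" by (rule proj_ext_normal[OF X])
  show xE: "x \<in> EC n X Y" using elemrcos_carrier[OF is_group _ x] y by simp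
  assume k: "\<kappa> \<in> EC s Y Y'"
  have "x \<otimes>\<^bsub>EG n X Y\<^esub> inv\<^bsub>EG n X Y\<^esub> y \<in> proj_ext \<A> \<C> n X Y"
    by (rule rcos_module_imp[OF is_group _ x]) (use y in simp)
  hence "ym \<kappa> (x \<otimes>\<^bsub>EG n X Y\<^esub> inv\<^bsub>EG n X Y\<^esub> y) = \<one>\<^bsub>EG (s + n) X Y'\<^esub>"
    using proj_ext_ymul[OF _ k X(1)] by (simp add: ez_def)
  thus "ym \<kappa> x = ym \<kappa> y" using group_hom_diff_one[OF ymul_group_hom[OF k X(1) n_pos], of x y] xE y by simp
qed

text \<open>Below, \<open>Ek\<close> represents \<open>\<kappa>\<close> and \<open>\<beta>s\<close> is the class \<open>\<beta>\<^sup>*\<close> with \<open>\<beta>\<^sup>*\<delta>\<^sub>N = \<kappa>\<beta>\<close>.\<close>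

lemma comp_choice_char:
  assumes K: "unit_seq (n + 1) K' Kt Ek" and dN: "\<delta>N \<in> unit_ext \<A> \<C> n N N'"
    and b: "\<beta> \<in> EC n N K'" and bs: "\<beta>s \<in> EC (n + 1) N' Kt" "ym \<beta>s \<delta>N = ym (cls Ek) \<beta>"
    and d: "\<delta> \<in> unit_ext \<A> \<C> n Z N'" and f: "f \<in> Hom \<A> M Z" "M \<in> \<C>"
    and ca: "co_angled_pair \<A> \<C> n N Z N' \<delta>N a \<delta> b" and pi: "pull_inv \<A> \<C> n K' (pl \<beta> a) b \<epsilon>"
  shows "pl \<epsilon> f \<in> EC n M K' \<and> ym (cls Ek) (pl \<epsilon> f) = ym \<beta>s (pl \<delta> f)"
proof -
  obtain E where E: "unit_seq n Z N' E" "\<delta> = cls E" by (rule unit_ext_E[OF d])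
  obtain EN where EN: "unit_seq n N N' EN" "\<delta>N = cls EN" by (rule unit_ext_E[OF dN])
  have dE: "\<delta> \<in> EC n Z N'" "\<delta>N \<in> EC n N N'" using unit_seq_EC[OF E(1)] unit_seq_EC[OF EN(1)] E EN by auto
  note kE = unit_seq_EC[OF K]
  have ab: "dom a = dom b" "cod a = N" "cod b = Z" "pl \<delta>N a = pl \<delta> b" "pl \<delta>N a \<in> unit_ext \<A> \<C> n (dom a) N'"
    "a \<in> Arr \<A>" "b \<in> Arr \<A>" "dom a \<in> \<C>"
    using ca unfolding co_angled_pair_def quasi_invertible_def by auto
  obtain EW where EW: "unit_seq n (dom a) N' EW" "pl \<delta>N a = cls EW" by (rule unit_ext_E[OF ab(5)])
  have H: "a \<in> Hom \<A> (dom a) N" "b \<in> Hom \<A> (dom a) Z" using ab by (auto simp: Hom_iff)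
  have e: "\<epsilon> \<in> EC n Z K'" and di: "pl \<beta> a \<otimes>\<^bsub>EG n (dom a) K'\<^esub> inv\<^bsub>EG n (dom a) K'\<^esub> pl \<epsilon> b \<in> proj_ext \<A> \<C> n (dom a) K'"
    using pi ab unfolding pull_inv_def Let_def by auto
  note ba = pull_EC[OF b H(1) ab(8)] and eb = pull_EC[OF e H(2) ab(8)]
  have kb: "ym (cls Ek) (pl \<beta> a) = ym (cls Ek) (pl \<epsilon> b)" using proj_ext_diff[OF K ba eb] di by simp
  \<comment> \<open>Division by \<delta> on the right lands in degree n + 1. It remains to identify
    the quotient with \<open>\<beta>s\<close>, for which both are multiplied by the unit
    \<open>EW\<close> representing \<delta> b.\<close>
  obtain \<xi> where x: "\<xi> \<in> EC (n + 1) N' Kt" "ym (cls Ek) \<epsilon> = ym \<xi> \<delta>"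
    using unit_seq_surj'[OF E(1) _ ymul_EC[OF kE e]] E by auto
  have "ym \<xi> (cls EW) = pl (ym \<xi> \<delta>) b" using pull_ymul[OF x(1) dE(1) H(2) ab(8)] EW ab by simp
  also have "\<dots> = ym (cls Ek) (pl \<epsilon> b)" unfolding x(2)[symmetric] by (rule pull_ymul[OF kE e H(2) ab(8)])
  also have "\<dots> = pl (ym (cls Ek) \<beta>) a" unfolding kb[symmetric] by (rule pull_ymul[OF kE b H(1) ab(8), symmetric])
  also have "\<dots> = ym \<beta>s (cls EW)" unfolding bs(2)[symmetric] EW(2)[symmetric] by (rule pull_ymul[OF bs(1) dE(2) H(1) ab(8)])
  \<comment> \<open>The unit \<open>EW\<close> can be cancelled on the right because n + 1 exceeds
    n.\<close>
  finally have "\<xi> = \<beta>s" by (rule unit_seq_inj_eq'[OF EW(1) _ x(1) bs(1), rotated]) simp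
  thus ?thesis
    using pull_ymul[OF kE e f] pull_ymul[OF bs(1) dE(1) f] x(2) pull_EC[OF e f] by simp
qed

text \<open>This keeps the union defining \<open>stable_comp\<close> from being empty. The value
  \<epsilon> is found by two divisions: the product of \<kappa> and \<beta> a, divided by the unit
  \<delta> b on the right, gives \<xi>; the product of \<xi> and \<delta>, divided by \<kappa> on
  the left, gives \<epsilon>.\<close>

lemma ex_comp_choice:
  assumes dN: "\<delta>N \<in> unit_ext \<A> \<C> n N N'" and b: "\<beta> \<in> EC n N K'" and g: "\<gamma> \<in> EC n M N'"
  shows "\<exists>Z \<delta> f a b \<epsilon>. \<delta> \<in> unit_ext \<A> \<C> n Z N' \<and> f \<in> Hom \<A> M Z \<and> \<gamma> = pl \<delta> f \<and>
    co_angled_pair \<A> \<C> n N Z N' \<delta>N a \<delta> b \<and> pull_inv \<A> \<C> n K' (pl \<beta> a) b \<epsilon>"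
proof -
  obtain Z E f where E: "unit_seq n Z N' E" and f: "f \<in> Hom \<A> M Z" "\<gamma> = pl (cls E) f"
    using right_unit_factorization[OF n_pos g] by blast
  define \<delta> where "\<delta> = cls E"
  have d: "\<delta> \<in> unit_ext \<A> \<C> n Z N'" unfolding \<delta>_def by (rule unit_seq_unit_ext[OF E])
  obtain a b where ca: "co_angled_pair \<A> \<C> n N Z N' \<delta>N a \<delta> b" using ex_co_angled_pair[OF dN d] by blast
  have K': "K' \<in> \<C>" using EC_obj[OF b] by simp
  obtain Kt Ek where K: "unit_seq (n + 1) K' Kt Ek" using ex_unit_seq[OF K', of "n + 1"] by auto
  note kE = unit_seq_EC[OF K]
  have dE: "\<delta> \<in> EC n Z N'" unfolding \<delta>_def by (rule unit_seq_EC[OF E])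
  have ab: "dom a = dom b" "cod a = N" "cod b = Z" "pl \<delta>N a = pl \<delta> b" "pl \<delta>N a \<in> unit_ext \<A> \<C> n (dom a) N'"
    "a \<in> Arr \<A>" "b \<in> Arr \<A>" "dom a \<in> \<C>"
    using ca unfolding co_angled_pair_def quasi_invertible_def by auto
  obtain EW where EW: "unit_seq n (dom a) N' EW" "pl \<delta>N a = cls EW" by (rule unit_ext_E[OF ab(5)])
  have H: "a \<in> Hom \<A> (dom a) N" "b \<in> Hom \<A> (dom a) Z" using ab by (auto simp: Hom_iff)
  note ba = pull_EC[OF \<open>\<beta> \<in> EC n N K'\<close> H(1) ab(8)]
  obtain \<xi> where x: "\<xi> \<in> EC (n + 1) N' Kt" "ym (cls Ek) (pl \<beta> a) = ym \<xi> (cls EW)"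
    using unit_seq_surj'[OF EW(1) _ ymul_EC[OF kE ba]] by auto
  obtain \<epsilon> where e: "\<epsilon> \<in> EC n Z K'" "ym \<xi> \<delta> = ym (cls Ek) \<epsilon>"
    using unit_seq_surj[OF K _ ymul_EC[OF x(1) dE]] by auto
  have "ym (cls Ek) (pl \<epsilon> b) = pl (ym \<xi> \<delta>) b" using pull_ymul[OF kE e(1) H(2) ab(8)] e by simp
  also have "\<dots> = ym (cls Ek) (pl \<beta> a)" using pull_ymul[OF x(1) dE H(2) ab(8)] x(2) EW ab by simp
  finally have "pull_inv \<A> \<C> n K' (pl \<beta> a) b \<epsilon>"
    unfolding pull_inv_def Let_def using proj_ext_diff[OF K ba pull_EC[OF e(1) H(2) ab(8)]] e(1) ab by simp
  thus ?thesis using d f ca unfolding \<delta>_def by blast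
qed

lemma ex_star:
  assumes K: "unit_seq (n + 1) K' Kt Ek" and dN: "\<delta>N \<in> unit_ext \<A> \<C> n N N'" and b: "\<beta> \<in> EC n N K'"
  obtains \<beta>s where "\<beta>s \<in> EC (n + 1) N' Kt" "ym \<beta>s \<delta>N = ym (cls Ek) \<beta>"
proof -
  obtain EN where EN: "unit_seq n N N' EN" "\<delta>N = cls EN" by (rule unit_ext_E[OF dN])
  from unit_seq_surj'[OF EN(1) _ ymul_EC[OF unit_seq_EC[OF K] b]] show ?thesis using that EN by auto
qed

text \<open>The equation for z pins down its coset and mentions none of the auxiliary choices. By
  \<open>comp_choice_char\<close> every choice gives that coset, by \<open>ex_comp_choice\<close>
  there is a choice, so the union is exactly this coset.\<close>

lemma stable_comp_eq:
  assumes K: "unit_seq (n + 1) K' Kt Ek" and dN: "\<delta>N \<in> unit_ext \<A> \<C> n N N'"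
    and b: "\<beta> \<in> EC n N K'" and bs: "\<beta>s \<in> EC (n + 1) N' Kt" "ym \<beta>s \<delta>N = ym (cls Ek) \<beta>"
    and g: "\<gamma> \<in> EC n M N'" and z: "z \<in> EC n M K'" "ym (cls Ek) z = ym \<beta>s \<gamma>"
  shows "stable_comp \<A> \<C> n M N N' K' \<delta>N (proj_ext \<A> \<C> n N K' #>\<^bsub>EG n N K'\<^esub> \<beta>) (proj_ext \<A> \<C> n M N' #>\<^bsub>EG n M N'\<^esub> \<gamma>)
    = proj_ext \<A> \<C> n M K' #>\<^bsub>EG n M K'\<^esub> z" (is "stable_comp _ _ _ _ _ _ _ _ ?y ?x = ?S")
proof -
  have M: "M \<in> \<C>" "N' \<in> \<C>" "N \<in> \<C>" "K' \<in> \<C>" using EC_obj[OF g] EC_obj[OF b] by auto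
  have *: "proj_ext \<A> \<C> n M K' #>\<^bsub>EG n M K'\<^esub> pl \<epsilon> f = ?S"
    if c: "\<beta>1 \<in> ?y" "\<gamma>1 \<in> ?x" "\<delta> \<in> unit_ext \<A> \<C> n Z N'" "f \<in> Hom \<A> M Z" "\<gamma>1 = pl \<delta> f"
      "co_angled_pair \<A> \<C> n N Z N' \<delta>N a \<delta> b" "pull_inv \<A> \<C> n K' (pl \<beta>1 a) b \<epsilon>" for \<beta>1 \<gamma>1 Z \<delta> f a b \<epsilon>
  proof -
    have b1: "\<beta>1 \<in> EC n N K'" "ym (cls Ek) \<beta>1 = ym (cls Ek) \<beta>"
      using coset_memD[OF b c(1)] unit_seq_EC[OF K] by auto
    have "ym \<beta>s \<delta>N = ym (cls Ek) \<beta>1" using b1 bs by simp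
    from comp_choice_char[OF K dN b1(1) bs(1) this c(3,4) M(1) c(6,7)]
    have e: "pl \<epsilon> f \<in> EC n M K'" "ym (cls Ek) (pl \<epsilon> f) = ym \<beta>s \<gamma>1" using c(5) by auto
    show ?thesis
      by (rule coset_eqI[OF K e(1) z(1)]) (use e z coset_memD(2)[OF g c(2) bs(1)] in simp)
  qed
  have self: "\<beta> \<in> ?y" "\<gamma> \<in> ?x"
  proof -
    interpret N1: normal "proj_ext \<A> \<C> n N K'" "EG n N K'" by (rule proj_ext_normal[OF M(3,4)])
    interpret N2: normal "proj_ext \<A> \<C> n M N'" "EG n M N'" by (rule proj_ext_normal[OF M(1,2)])
    show "\<beta> \<in> ?y" by (rule N1.rcos_self[OF _ N1.subgroup_axioms]) (use b in simp)
    show "\<gamma> \<in> ?x" by (rule N2.rcos_self[OF _ N2.subgroup_axioms]) (use g in simp)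
  qed
  show ?thesis
  proof (intro equalityI subsetI)
    fix x assume "x \<in> stable_comp \<A> \<C> n M N N' K' \<delta>N ?y ?x"
    then obtain \<beta>1 \<gamma>1 Z \<delta> f a b \<epsilon> where "x \<in> proj_ext \<A> \<C> n M K' #>\<^bsub>EG n M K'\<^esub> pl \<epsilon> f" 
      "\<beta>1 \<in> ?y" "\<gamma>1 \<in> ?x" "\<delta> \<in> unit_ext \<A> \<C> n Z N'" "f \<in> Hom \<A> M Z" "\<gamma>1 = pl \<delta> f"
      "co_angled_pair \<A> \<C> n N Z N' \<delta>N a \<delta> b" "pull_inv \<A> \<C> n K' (pl \<beta>1 a) b \<epsilon>"
      unfolding stable_comp_def by blast
    thus "x \<in> ?S" using * by blast
  next
    fix x assume x: "x \<in> ?S"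
    obtain Z \<delta> f a b \<epsilon> where c: "\<delta> \<in> unit_ext \<A> \<C> n Z N'" "f \<in> Hom \<A> M Z" "\<gamma> = pl \<delta> f"
      "co_angled_pair \<A> \<C> n N Z N' \<delta>N a \<delta> b" "pull_inv \<A> \<C> n K' (pl \<beta> a) b \<epsilon>"
      using ex_comp_choice[OF dN b g] by blast
    have "x \<in> proj_ext \<A> \<C> n M K' #>\<^bsub>EG n M K'\<^esub> pl \<epsilon> f" using *[OF self c] x by simp
    thus "x \<in> stable_comp \<A> \<C> n M N N' K' \<delta>N ?y ?x" unfolding stable_comp_def using self c by blast
  qed
qed

section \<open>Addition of cosets and distributivity\<close>

lemma stable_Ext_E:
  assumes "x \<in> carrier (stable_Ext \<A> \<C> n X Y)"
  obtains \<gamma> where "\<gamma> \<in> EC n X Y" "x = proj_ext \<A> \<C> n X Y #>\<^bsub>EG n X Y\<^esub> \<gamma>"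
  using assms unfolding stable_Ext_def FactGroup_def RCOSETS_def by auto

lemma stable_Ext_mult:
  assumes "\<gamma> \<in> EC n X Y" "\<gamma>' \<in> EC n X Y"
  shows "(proj_ext \<A> \<C> n X Y #>\<^bsub>EG n X Y\<^esub> \<gamma>) \<otimes>\<^bsub>stable_Ext \<A> \<C> n X Y\<^esub> (proj_ext \<A> \<C> n X Y #>\<^bsub>EG n X Y\<^esub> \<gamma>') =
    proj_ext \<A> \<C> n X Y #>\<^bsub>EG n X Y\<^esub> bsum X Y \<gamma> \<gamma>'"
proof -
  have X: "X \<in> \<C>" "Y \<in> \<C>" using EC_obj[OF assms(1)] by auto
  interpret normal "proj_ext \<A> \<C> n X Y" "EG n X Y" by (rule proj_ext_normal[OF X])
  show ?thesis using rcos_sum[of \<gamma> \<gamma>'] assms by (simp add: stable_Ext_def FactGroup_def)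
qed

lemma ex_composite:
  assumes K: "unit_seq (n + 1) K' Kt Ek" and x: "\<xi> \<in> EC (n + 1) N' Kt" "\<gamma> \<in> EC n M N'"
  obtains z where "z \<in> EC n M K'" "ym (cls Ek) z = ym \<xi> \<gamma>"
  using unit_seq_surj[OF K _ ymul_EC[OF x]] by auto

text \<open>Baer sums of the data for the two summands are data for the sum, by additivity of the
  Yoneda product in each factor; \<open>stable_comp_eq\<close> then reads off all three
  composites.\<close>

lemma stable_comp_distrib_left:
  assumes dN: "\<delta>N \<in> unit_ext \<A> \<C> n N N'" and a: "\<alpha> \<in> carrier (stable_Ext \<A> \<C> n M N')"
    and b: "\<beta> \<in> carrier (stable_Ext \<A> \<C> n N K')" "\<beta>' \<in> carrier (stable_Ext \<A> \<C> n N K')"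
  shows "stable_comp \<A> \<C> n M N N' K' \<delta>N (\<beta> \<otimes>\<^bsub>stable_Ext \<A> \<C> n N K'\<^esub> \<beta>') \<alpha> =
           stable_comp \<A> \<C> n M N N' K' \<delta>N \<beta> \<alpha> \<otimes>\<^bsub>stable_Ext \<A> \<C> n M K'\<^esub>
           stable_comp \<A> \<C> n M N N' K' \<delta>N \<beta>' \<alpha>"
proof -
  obtain \<alpha>0 where a0: "\<alpha>0 \<in> EC n M N'" "\<alpha> = proj_ext \<A> \<C> n M N' #>\<^bsub>EG n M N'\<^esub> \<alpha>0" by (rule stable_Ext_E[OF a])
  obtain \<beta>0 where b0: "\<beta>0 \<in> EC n N K'" "\<beta> = proj_ext \<A> \<C> n N K' #>\<^bsub>EG n N K'\<^esub> \<beta>0" by (rule stable_Ext_E[OF b(1)])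
  obtain \<beta>1 where b1: "\<beta>1 \<in> EC n N K'" "\<beta>' = proj_ext \<A> \<C> n N K' #>\<^bsub>EG n N K'\<^esub> \<beta>1" by (rule stable_Ext_E[OF b(2)])
  have "K' \<in> \<C>" using EC_obj[OF b0(1)] by simp
  then obtain Kt Ek where K: "unit_seq (n + 1) K' Kt Ek" using ex_unit_seq[of K' "n + 1"] by auto
  note kE = unit_seq_EC[OF K]
  obtain s0 where s0: "s0 \<in> EC (n + 1) N' Kt" "ym s0 \<delta>N = ym (cls Ek) \<beta>0" by (rule ex_star[OF K dN b0(1)])
  obtain s1 where s1: "s1 \<in> EC (n + 1) N' Kt" "ym s1 \<delta>N = ym (cls Ek) \<beta>1" by (rule ex_star[OF K dN b1(1)])
  obtain z0 where z0: "z0 \<in> EC n M K'" "ym (cls Ek) z0 = ym s0 \<alpha>0" by (rule ex_composite[OF K s0(1) a0(1)])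
  obtain z1 where z1: "z1 \<in> EC n M K'" "ym (cls Ek) z1 = ym s1 \<alpha>0" by (rule ex_composite[OF K s1(1) a0(1)])
  have dE: "\<delta>N \<in> EC n N N'" using dN unfolding unit_ext_def by simp
  have s: "ym (bsum N' Kt s0 s1) \<delta>N = ym (cls Ek) (bsum N K' \<beta>0 \<beta>1)"
    using ymul_bsum_l[OF s0(1) s1(1) dE] ymul_bsum_r[OF kE b0(1) b1(1)] s0 s1 by simp
  have z: "ym (cls Ek) (bsum M K' z0 z1) = ym (bsum N' Kt s0 s1) \<alpha>0"
    using ymul_bsum_l[OF s0(1) s1(1) a0(1)] ymul_bsum_r[OF kE z0(1) z1(1)] z0 z1 by simp
  show ?thesis
    using stable_comp_eq[OF K dN b0(1) s0 a0(1) z0] stable_comp_eq[OF K dN b1(1) s1 a0(1) z1]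
      stable_comp_eq[OF K dN bsum_EC[OF b0(1) b1(1)] bsum_EC[OF s0(1) s1(1)] s a0(1) bsum_EC[OF z0(1) z1(1)] z]
      stable_Ext_mult[OF b0(1) b1(1)] stable_Ext_mult[OF z0(1) z1(1)] a0(2) b0(2) b1(2) by simp
qed

text \<open>One class s0 serves all three composites, since it depends only on the left factor;
  additivity of the Yoneda product in its right factor suffices.\<close>

lemma stable_comp_distrib_right:
  assumes dN: "\<delta>N \<in> unit_ext \<A> \<C> n N N'" and b: "\<beta> \<in> carrier (stable_Ext \<A> \<C> n N K')"
    and a: "\<alpha> \<in> carrier (stable_Ext \<A> \<C> n M N')" "\<alpha>' \<in> carrier (stable_Ext \<A> \<C> n M N')"
  shows "stable_comp \<A> \<C> n M N N' K' \<delta>N \<beta> (\<alpha> \<otimes>\<^bsub>stable_Ext \<A> \<C> n M N'\<^esub> \<alpha>') =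
           stable_comp \<A> \<C> n M N N' K' \<delta>N \<beta> \<alpha> \<otimes>\<^bsub>stable_Ext \<A> \<C> n M K'\<^esub>
           stable_comp \<A> \<C> n M N N' K' \<delta>N \<beta> \<alpha>'"
proof -
  obtain \<alpha>0 where a0: "\<alpha>0 \<in> EC n M N'" "\<alpha> = proj_ext \<A> \<C> n M N' #>\<^bsub>EG n M N'\<^esub> \<alpha>0" by (rule stable_Ext_E[OF a(1)])
  obtain \<alpha>1 where a1: "\<alpha>1 \<in> EC n M N'" "\<alpha>' = proj_ext \<A> \<C> n M N' #>\<^bsub>EG n M N'\<^esub> \<alpha>1" by (rule stable_Ext_E[OF a(2)])
  obtain \<beta>0 where b0: "\<beta>0 \<in> EC n N K'" "\<beta> = proj_ext \<A> \<C> n N K' #>\<^bsub>EG n N K'\<^esub> \<beta>0" by (rule stable_Ext_E[OF b])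
  have "K' \<in> \<C>" using EC_obj[OF b0(1)] by simp
  then obtain Kt Ek where K: "unit_seq (n + 1) K' Kt Ek" using ex_unit_seq[of K' "n + 1"] by auto
  note kE = unit_seq_EC[OF K]
  obtain s0 where s0: "s0 \<in> EC (n + 1) N' Kt" "ym s0 \<delta>N = ym (cls Ek) \<beta>0" by (rule ex_star[OF K dN b0(1)])
  obtain z0 where z0: "z0 \<in> EC n M K'" "ym (cls Ek) z0 = ym s0 \<alpha>0" by (rule ex_composite[OF K s0(1) a0(1)])
  obtain z1 where z1: "z1 \<in> EC n M K'" "ym (cls Ek) z1 = ym s0 \<alpha>1" by (rule ex_composite[OF K s0(1) a1(1)])
  have z: "ym (cls Ek) (bsum M K' z0 z1) = ym s0 (bsum M N' \<alpha>0 \<alpha>1)"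
    using ymul_bsum_r[OF s0(1) a0(1) a1(1)] ymul_bsum_r[OF kE z0(1) z1(1)] z0 z1 by simp
  show ?thesis
    using stable_comp_eq[OF K dN b0(1) s0 a0(1) z0] stable_comp_eq[OF K dN b0(1) s0 a1(1) z1]
      stable_comp_eq[OF K dN b0(1) s0 bsum_EC[OF a0(1) a1(1)] bsum_EC[OF z0(1) z1(1)] z]
      stable_Ext_mult[OF a0(1) a1(1)] stable_Ext_mult[OF z0(1) z1(1)] a0(2) a1(2) b0(2) by simp
qed

end

theorem proposition7p5:
  fixes \<A> :: "('o, 'm) addcat" and \<C> :: "'o set" and n :: nat
    and K L M N K' L' N' :: 'o
    and \<delta>\<^sub>K \<delta>\<^sub>N :: "'m list set"
    and \<alpha> \<beta> \<beta>' \<gamma> :: "'m list set set"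
  assumes "extension_closed_subcategory \<A> \<C>"
    and "n \<ge> 1"
    and "n_Frobenius \<A> \<C> n"
    and "K \<in> \<C>" and "L \<in> \<C>" and "M \<in> \<C>" and "N \<in> \<C>"
    and "syzygy \<A> \<C> n L L'"
    and "\<delta>\<^sub>N \<in> unit_ext \<A> \<C> n N N'"
    and "\<delta>\<^sub>K \<in> unit_ext \<A> \<C> n K K'"
    and "\<alpha> \<in> carrier (stable_Ext \<A> \<C> n M N')"
    and "\<beta> \<in> carrier (stable_Ext \<A> \<C> n N K')"
    and "\<beta>' \<in> carrier (stable_Ext \<A> \<C> n N K')"
    and "\<gamma> \<in> carrier (stable_Ext \<A> \<C> n K L')"
  shows "stable_comp \<A> \<C> n M N N' K' \<delta>\<^sub>N (\<beta> \<otimes>\<^bsub>stable_Ext \<A> \<C> n N K'\<^esub> \<beta>') \<alpha> =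
           stable_comp \<A> \<C> n M N N' K' \<delta>\<^sub>N \<beta> \<alpha> \<otimes>\<^bsub>stable_Ext \<A> \<C> n M K'\<^esub>
           stable_comp \<A> \<C> n M N N' K' \<delta>\<^sub>N \<beta>' \<alpha>
         \<and> stable_comp \<A> \<C> n N K K' L' \<delta>\<^sub>K \<gamma> (\<beta> \<otimes>\<^bsub>stable_Ext \<A> \<C> n N K'\<^esub> \<beta>') =
           stable_comp \<A> \<C> n N K K' L' \<delta>\<^sub>K \<gamma> \<beta> \<otimes>\<^bsub>stable_Ext \<A> \<C> n N L'\<^esub>
           stable_comp \<A> \<C> n N K K' L' \<delta>\<^sub>K \<gamma> \<beta>'"
proof -
  interpret extension_closed_subcategory \<A> \<C> by (rule assms(1))
  interpret n_frobenius_category \<A> \<C> n by unfold_locales (use assms(2,3) in auto)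
  \<comment> \<open>For the second equation, K, N and L take the places that N, M and K have in
    \<open>stable_comp_distrib_right\<close>.\<close>
  show ?thesis using stable_comp_distrib_left[OF assms(9,11,12,13)] stable_comp_distrib_right[OF assms(10,14,12,13)] by blast
qed

end
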